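(* Let $\mathrm{char}\,K\neq2$ and $\delta\neq0$. For $(l,\lambda),(m,\mu)\in\Lambda$, $$\mathrm{Hom}_B\big(\mathrm{ind}_lS'(\lambda),\mathrm{ind}_mS'(\mu)\big)=0\quad\text{if }(m,\mu)>(l,\lambda).$$
   Context: Throughout, $K$ is an algebraically closed field, $\delta\in K$, $r\ge 1$, and all modules are finite-dimensional right modules. Hyperoctahedral groups. For $n\ge 0$, $W_n$ is the group of permutations $\sigma$ of $\{\pm1,\dots,\pm n\}$ with $\sigma(-i)=-\sigma(i)$ (acting on the right on symbols), and $KW_n$ is its group algebra. Each $\sigma\in W_n$ is uniquely a product of sign changes $\xi_i$ (swapping $i$ and $-i$, fixing the other symbols) times some $\pi\in\mathfrak S_n$; put $\mathrm{sgn}\,\sigma=(-1)^{x}\mathrm{sgn}\,\pi$ with $x$ the number of sign changes. A bi-partition $\lambda=(\lambda^1,\lambda^2)$ of $n$ is a pair of (possibly empty) partitions with $|\lambda^1|+|\lambda^2|=n$. Dominance: $\lambda\trianglerighteq\mu$ iff $\sum_{i\le j}\lambda^1_i\ge\sum_{i\le j}\mu^1_i$ for all $j$ and $|\lambda^1|+\sum_{i\le j}\lambda^2_i\ge|\mu^1|+\sum_{i\le j}\mu^2_i$ for all $j$. A $\lambda$-bi-tableau $t=(t^1,t^2)$ is a filling of the boxes of the Young diagrams of $\lambda^1,\lambda^2$ by elements of $\{\pm1,\dots,\pm n\}$ in which every absolute value $1,\dots,n$ occurs exactly once; $W_n$ acts on bi-tableaux on the right through the entries. $R_t\le W_n$ is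 the group of elements permuting the entries within each row of $t$, possibly changing signs of entries of $t^2$ (but not of $t^1$); $C_t\le W_n$ is the group of elements permuting the entries within each column of $t$, possibly changing signs of entries of $t^1$ (but not of $t^2$). Put $t_1\sim t_2$ if $t_2=t_1\sigma$ for some $\sigma\in R_{t_1}$; the class of $t$ is the bi-tabloid $\{t\}$. The permutation module $M(\lambda)$ is the $K$-space with basis the $\lambda$-bi-tabloids, with action $\{t\}\sigma=\{t\sigma\}$. Put $k_t=\sum_{\sigma\in C_t}(\mathrm{sgn}\,\sigma)\sigma$ and $e_t=\{t\}k_t$; the Specht module $S(\lambda)\subseteq M(\lambda)$ is the span of all $e_t$, and the dual Specht module is $S'(\lambda)=S(\lambda)^*$ (contragredient dual). Brauer algebra of type $C$. A Brauer diagram of type $C$ is a perfect matching on $4r$ vertices arranged in a top and a bottom row, each labelled $-r,\dots,-1,1,\dots,r$, invariant under the reflection $i\mapsto -i$ applied to both rows. An edge is horizontal if it joins two vertices of the same row; the number of horizontal edges of a diagram is counted in one row (the counts agree). $B=\mathcal{B}(C_r,\delta)$ has these diagrams as $K$-basis; $d_1d_2$ is obtained by placing $d_1$ above $d_2$, concatenating, and replacing each closed loop by a factor $\delta$. $J_l$ is the two-sided ideal generated by diagrams with at least $l$ horizontal edges ($J_{r+1}=0$). For $\delta\neq0$ and $0\le l\le r$, $e_l$ is $\delta^{-l}$ times the diagram with horizontal edges $\{-i,i\}$, $1\le i\le l$, in both rows and vertical edges from top $j$ to bottom $j$ for $|j|>l$; $e_0=1$. $W_{r-l}$, viewed as the signed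 permutations of $\{\pm(l+1),\dots,\pm r\}$, embeds in $e_lBe_l$ by sending $\sigma$ to $\delta^{-l}$ times the diagram with the same horizontal edges as $e_l$ and vertical edges from top $j$ to bottom $j\sigma$. So $e_l(B/J_{l+1}):=e_lB/e_lJ_{l+1}$ is a $KW_{r-l}$-$B$-bimodule. For a $KW_{r-l}$-module $X$ put $\mathrm{ind}_lX=X\otimes_{KW_{r-l}}e_l(B/J_{l+1})$. $\Lambda=\{(l,\lambda):0\le l\le r,\ \lambda\text{ a bi-partition of }r-l\}$, partially ordered by $(m,\mu)\ge(l,\lambda)$ iff $m<l$, or $m=l$ and $\lambda\trianglerighteq\mu$; $>$ means $\ge$ and $\ne$. *)

theory Defs
  imports
    "HOL-Algebra.Module"
    "HOL-Algebra.Ideal"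
    "HOL-Algebra.Free_Abelian_Groups"
    "HOL-Computational_Algebra.Polynomial"
    "HOL-Combinatorics.Permutations"
    "HOL-Library.Disjoint_Sets"
    "HOL-Library.Function_Algebras"
begin

section \<open>Algebras with a finite basis and right modules\<close>

text \<open>
  The ground field is a type \<open>'k\<close>. A vector space with a finite basis \<open>X\<close> is realised as the
  set of functions to \<open>'k\<close> that vanish outside \<open>X\<close>. A \<open>'k\<close>-algebra is a record of type
  \<open>('k, 'a) module\<close>, which has both the ring operations and the scalar multiplication.
\<close>

definition basis_vec :: "'x \<Rightarrow> 'x \<Rightarrow> 'k::field" where
  "basis_vec x = (\<lambda>y. if y = x then 1 else 0)"

text \<open>The algebra with basis \<open>carrier G\<close> and product \<open>g \<cdot> h = c g h (g \<otimes> h)\<close>, for a finite monoid \<open>G\<close>.\<close>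

definition twisted_algebra ::
    "('g, 'm) monoid_scheme \<Rightarrow> ('g \<Rightarrow> 'g \<Rightarrow> 'k::field) \<Rightarrow> ('k, 'g \<Rightarrow> 'k) module" where
  "twisted_algebra G c =
    \<lparr>carrier = {a. \<forall>g. g \<notin> carrier G \<longrightarrow> a g = 0},
     monoid.mult = (\<lambda>a b z. \<Sum>(g, h) \<in> {(g, h) \<in> carrier G \<times> carrier G. g \<otimes>\<^bsub>G\<^esub> h = z}.
               c g h * a g * b h),
     one = basis_vec \<one>\<^bsub>G\<^esub>,
     ring.zero = (\<lambda>_. 0),
     ring.add = (\<lambda>a b z. a z + b z),
     module.smult = (\<lambda>k a z. k * a z)\<rparr>"

abbreviation group_algebra :: "('g, 'm) monoid_scheme \<Rightarrow> ('k::field, 'g \<Rightarrow> 'k) module" where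
  "group_algebra G \<equiv> twisted_algebra G (\<lambda>_ _. 1)"

text \<open>
  The additive group of a module is given by the additive part of a \<open>ring\<close> record, as in
  \<^theory>\<open>HOL-Algebra.Module\<close>; the fields \<open>mult\<close> and \<open>one\<close> of that record are not used.
  \<open>ract M x b\<close> is \<open>x \<cdot> b\<close> and \<open>lact M a x\<close> is \<open>a \<cdot> x\<close>.
\<close>

record ('v, 'b) right_module = "'v ring" +
  ract :: "'v \<Rightarrow> 'b \<Rightarrow> 'v"

record ('v, 'b, 'a) bimodule = "('v, 'b) right_module" +
  lact :: "'a \<Rightarrow> 'v \<Rightarrow> 'v"

text \<open>
  Homomorphisms of right modules. Scalars of the ground field act through the algebra, so these
  maps are automatically linear over the ground field.
\<close>

definition right_module_hom ::
    "('b, 'm) ring_scheme \<Rightarrow> ('v, 'b, 'n) right_module_scheme \<Rightarrow> ('w, 'b, 'p) right_module_scheme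
      \<Rightarrow> ('v \<Rightarrow> 'w) set" where
  "right_module_hom B M N =
    {f \<in> extensional (carrier M) \<inter> hom (add_monoid M) (add_monoid N).
      \<forall>x \<in> carrier M. \<forall>b \<in> carrier B. f (ract M x b) = ract N (f x) b}"

text \<open>
  The tensor product \<open>X \<otimes>\<^sub>A Y\<close> of a right \<open>A\<close>-module \<open>X\<close> and a bimodule \<open>Y\<close>: the free abelian
  group on \<open>X \<times> Y\<close> modulo the usual relations, with the right action coming from \<open>Y\<close>.
\<close>

definition tensor_relations ::
    "('a, 'm) ring_scheme \<Rightarrow> ('v, 'a, 'n) right_module_scheme \<Rightarrow> ('w, 'b, 'a, 'p) bimodule_scheme
      \<Rightarrow> ('v \<times> 'w \<Rightarrow>\<^sub>0 int) set" where
  "tensor_relations A X Y =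
    generate (free_Abelian_group (carrier X \<times> carrier Y))
      ({frag_of (x \<oplus>\<^bsub>X\<^esub> x', y) - frag_of (x, y) - frag_of (x', y) | x x' y.
          x \<in> carrier X \<and> x' \<in> carrier X \<and> y \<in> carrier Y} \<union>
       {frag_of (x, y \<oplus>\<^bsub>Y\<^esub> y') - frag_of (x, y) - frag_of (x, y') | x y y'.
          x \<in> carrier X \<and> y \<in> carrier Y \<and> y' \<in> carrier Y} \<union>
       {frag_of (ract X x a, y) - frag_of (x, lact Y a y) | x a y.
          x \<in> carrier X \<and> a \<in> carrier A \<and> y \<in> carrier Y})"

definition tensor ::
    "('a, 'm) ring_scheme \<Rightarrow> ('v, 'a, 'n) right_module_scheme \<Rightarrow> ('w, 'b, 'a, 'p) bimodule_scheme
      \<Rightarrow> (('v \<times> 'w \<Rightarrow>\<^sub>0 int) set, 'b) right_module" where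
  "tensor A X Y =
    (let F = free_Abelian_group (carrier X \<times> carrier Y); N = tensor_relations A X Y
     in \<lparr>carrier = carrier (F Mod N),
         monoid.mult = undefined, one = undefined,
         ring.zero = \<one>\<^bsub>F Mod N\<^esub>,
         ring.add = (\<lambda>S T. S \<otimes>\<^bsub>F Mod N\<^esub> T),
         ract = (\<lambda>T b. N <#>\<^bsub>F\<^esub> frag_extend (\<lambda>(x, y). frag_of (x, ract Y y b)) ` T)\<rparr>)"

text \<open>
  The contragredient dual of a right module over the group algebra of \<open>G\<close>:
  \<open>(f \<cdot> g) x = f (x \<cdot> g\<^sup>-\<^sup>1)\<close>, extended linearly. The scalar \<open>c\<close> acts on the module as the
  element \<open>c \<cdot> 1\<close> of the group algebra.
\<close>

definition antipode :: "('g, 'm) monoid_scheme \<Rightarrow> ('g \<Rightarrow> 'k::field) \<Rightarrow> 'g \<Rightarrow> 'k" where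
  "antipode G a = (\<lambda>g. if g \<in> carrier G then a (inv\<^bsub>G\<^esub> g) else 0)"

definition dual_module ::
    "('g, 'm) monoid_scheme \<Rightarrow> ('v, 'g \<Rightarrow> 'k::field, 'n) right_module_scheme
      \<Rightarrow> ('v \<Rightarrow> 'k, 'g \<Rightarrow> 'k) right_module" where
  "dual_module G M =
    (let A = group_algebra G :: ('k, 'g \<Rightarrow> 'k) module
     in \<lparr>carrier = {f \<in> extensional (carrier M).
           (\<forall>x \<in> carrier M. \<forall>y \<in> carrier M. f (x \<oplus>\<^bsub>M\<^esub> y) = f x + f y) \<and>
           (\<forall>c. \<forall>x \<in> carrier M. f (ract M x (c \<odot>\<^bsub>A\<^esub> \<one>\<^bsub>A\<^esub>)) = c * f x)},
         monoid.mult = undefined, one = undefined,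
         ring.zero = (\<lambda>x \<in> carrier M. 0),
         ring.add = (\<lambda>f g. \<lambda>x \<in> carrier M. f x + g x),
         ract = (\<lambda>f a. \<lambda>x \<in> carrier M. f (ract M x (antipode G a)))\<rparr>)"


section \<open>Hyperoctahedral groups\<close>

definition symbols :: "nat \<Rightarrow> int set" where
  "symbols n = {i. i \<noteq> 0 \<and> \<bar>i\<bar> \<le> int n}"

text \<open>Permutations act on the right, so \<open>\<sigma> \<otimes> \<tau>\<close> applies \<open>\<sigma>\<close> first.\<close>

definition hyperoct :: "nat \<Rightarrow> (int \<Rightarrow> int) monoid" where
  "hyperoct n =
    \<lparr>carrier = {\<sigma>. \<sigma> permutes symbols n \<and> (\<forall>i. \<sigma> (- i) = - \<sigma> i)},
     monoid.mult = (\<lambda>\<sigma> \<tau>. \<tau> \<circ> \<sigma>),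
     one = id\<rparr>"

text \<open>
  If \<open>\<sigma>\<close> is the product of the sign changes \<open>\<xi>\<^sub>i\<close>, \<open>i \<in> X\<close>, followed by \<open>\<pi>\<close>, then \<open>X\<close> consists of
  the positive symbols with negative image and \<open>\<pi> i = \<bar>\<sigma> i\<bar>\<close> for positive symbols \<open>i\<close>; see
  \<open>hyperoct_sgn_eq\<close> and \<open>hyperoct_decomposition\<close> below.
\<close>

definition hyperoct_sgn :: "nat \<Rightarrow> (int \<Rightarrow> int) \<Rightarrow> int" where
  "hyperoct_sgn n \<sigma> =
    (-1) ^ card {i \<in> {1..int n}. \<sigma> i < 0} * sign (\<lambda>i. if i \<in> {1..int n} then \<bar>\<sigma> i\<bar> else i)"

definition sign_changes :: "int set \<Rightarrow> int \<Rightarrow> int" where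
  "sign_changes X = (\<lambda>i. if \<bar>i\<bar> \<in> X then - i else i)"

definition sym_embed :: "(int \<Rightarrow> int) \<Rightarrow> int \<Rightarrow> int" where
  "sym_embed \<pi> = (\<lambda>i. sgn i * \<pi> \<bar>i\<bar>)"

lemma hyperoct_sgn_eq:
  assumes "X \<subseteq> {1..int n}" "\<pi> permutes {1..int n}"
  shows "hyperoct_sgn n (sym_embed \<pi> \<circ> sign_changes X) = (-1) ^ card X * sign \<pi>"
proof -
  have pos: "\<pi> i \<in> {1..int n}" if "i \<in> {1..int n}" for i
    using permutes_in_image[OF assms(2)] that by blast
  have eq: "(sym_embed \<pi> \<circ> sign_changes X) i = (if i \<in> X then - \<pi> i else \<pi> i)" if "i \<in> {1..int n}" for i
    using that by (simp add: sym_embed_def sign_changes_def)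
  have "{i \<in> {1..int n}. (sym_embed \<pi> \<circ> sign_changes X) i < 0} = X"
  proof (intro equalityI subsetI)
    fix i assume "i \<in> {i \<in> {1..int n}. (sym_embed \<pi> \<circ> sign_changes X) i < 0}"
    then show "i \<in> X"
      using eq[of i] pos[of i] by (auto split: if_splits)
  next
    fix i assume "i \<in> X"
    then have "i \<in> {1..int n}"
      using assms(1) by blast
    then show "i \<in> {i \<in> {1..int n}. (sym_embed \<pi> \<circ> sign_changes X) i < 0}"
      using eq[of i] pos[of i] \<open>i \<in> X\<close> by auto
  qed
  moreover have "(\<lambda>i. if i \<in> {1..int n} then \<bar>(sym_embed \<pi> \<circ> sign_changes X) i\<bar> else i) = \<pi>"
  proof
    fix i
    show "(if i \<in> {1..int n} then \<bar>(sym_embed \<pi> \<circ> sign_changes X) i\<bar> else i) = \<pi> i"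
      using eq[of i] pos[of i] permutes_not_in[OF assms(2), of i] by auto
  qed
  ultimately show ?thesis
    by (simp add: hyperoct_sgn_def)
qed

lemma hyperoct_decomposition:
  assumes "\<sigma> \<in> carrier (hyperoct n)"
  obtains X \<pi> where "X \<subseteq> {1..int n}" "\<pi> permutes {1..int n}" "\<sigma> = sym_embed \<pi> \<circ> sign_changes X"
proof
  let ?X = "{i \<in> {1..int n}. \<sigma> i < 0}"
  let ?\<pi> = "\<lambda>i. if i \<in> {1..int n} then \<bar>\<sigma> i\<bar> else i"
  have perm: "\<sigma> permutes symbols n" and odd: "\<sigma> (- i) = - \<sigma> i" for i
    using assms by (auto simp: hyperoct_def)
  have inj: "inj \<sigma>"
    using perm by (rule permutes_inj)
  have sym: "\<sigma> i \<in> symbols n \<longleftrightarrow> i \<in> symbols n" for i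
    using perm by (rule permutes_in_image)
  have abs_inj: "i = j" if "\<bar>\<sigma> i\<bar> = \<bar>\<sigma> j\<bar>" "i > 0" "j > 0" for i j
  proof -
    have "\<sigma> i = \<sigma> j \<or> \<sigma> i = \<sigma> (- j)"
      using that(1) odd[of j] by linarith
    then have "i = j \<or> i = - j"
      using inj by (auto dest: injD)
    then show ?thesis
      using that by linarith
  qed
  show "?X \<subseteq> {1..int n}"
    by blast
  have maps: "?\<pi> ` {1..int n} \<subseteq> {1..int n}"
  proof clarify
    fix i assume "i \<in> {1..int n}"
    then have "\<sigma> i \<in> symbols n"
      using sym[of i] by (simp add: symbols_def)
    then show "?\<pi> i \<in> {1..int n}"
      using \<open>i \<in> {1..int n}\<close> by (auto simp: symbols_def)
  qed
  moreover have "inj_on ?\<pi> {1..int n}"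
    by (rule inj_onI, rule abs_inj) simp_all
  ultimately have "bij_betw ?\<pi> {1..int n} {1..int n}"
    unfolding bij_betw_def using endo_inj_surj[of "{1..int n}" ?\<pi>] by blast
  then show "?\<pi> permutes {1..int n}"
    by (rule bij_imp_permutes) auto
  show "\<sigma> = sym_embed ?\<pi> \<circ> sign_changes ?X"
  proof
    fix i
    have out: "\<sigma> i = i" if "i \<notin> symbols n"
      using perm that by (rule permutes_not_in)
    consider "i \<notin> symbols n" | "i \<in> {1..int n}" | "- i \<in> {1..int n}"
      by (force simp: symbols_def)
    then show "\<sigma> i = (sym_embed ?\<pi> \<circ> sign_changes ?X) i"
    proof cases
      case 1
      then have "\<bar>i\<bar> \<notin> {1..int n}"
        by (auto simp: symbols_def)
      then show ?thesis
        using out[OF 1] by (auto simp: sym_embed_def sign_changes_def sgn_mult_abs)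
    next
      case 2
      then show ?thesis
        by (simp add: sym_embed_def sign_changes_def)
    next
      case 3
      then show ?thesis
        using odd[of i] by (simp add: sym_embed_def sign_changes_def)
    qed
  qed
qed


section \<open>Bi-partitions, bi-tableaux and Specht modules\<close>

type_synonym bipart = "nat list \<times> nat list"

definition is_partition :: "nat list \<Rightarrow> bool" where
  "is_partition p \<longleftrightarrow> sorted_wrt (\<ge>) p \<and> 0 \<notin> set p"

fun bisize :: "bipart \<Rightarrow> nat" where
  "bisize (p, q) = sum_list p + sum_list q"

definition bipartitions :: "nat \<Rightarrow> bipart set" where
  "bipartitions n = {(p, q). is_partition p \<and> is_partition q \<and> bisize (p, q) = n}"

fun dominates :: "bipart \<Rightarrow> bipart \<Rightarrow> bool" where
  "dominates (p1, p2) (q1, q2) \<longleftrightarrow>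
    (\<forall>j. sum_list (take j p1) \<ge> sum_list (take j q1)) \<and>
    (\<forall>j. sum_list p1 + sum_list (take j p2) \<ge> sum_list q1 + sum_list (take j q2))"

definition young :: "nat list \<Rightarrow> (nat \<times> nat) set" where
  "young p = {(i, j). i < length p \<and> j < p ! i}"

text \<open>Boxes of the first component are tagged \<open>Inl\<close>, those of the second component \<open>Inr\<close>.\<close>

type_synonym box = "nat \<times> nat + nat \<times> nat"

fun boxes :: "bipart \<Rightarrow> box set" where
  "boxes (p, q) = Inl ` young p \<union> Inr ` young q"

text \<open>A bi-tableau is extended by the value 0, which is not a symbol, outside its boxes.\<close>

definition bitableaux :: "bipart \<Rightarrow> (box \<Rightarrow> int) set" where
  "bitableaux la =
    {t. bij_betw (\<lambda>b. \<bar>t b\<bar>) (boxes la) {1..int (bisize la)} \<and> (\<forall>b. b \<notin> boxes la \<longrightarrow> t b = 0)}"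

definition row1 :: "bipart \<Rightarrow> (box \<Rightarrow> int) \<Rightarrow> nat \<Rightarrow> int set" where
  "row1 la t i = {t (Inl (i, j)) | j. Inl (i, j) \<in> boxes la}"

definition row2 :: "bipart \<Rightarrow> (box \<Rightarrow> int) \<Rightarrow> nat \<Rightarrow> int set" where
  "row2 la t i = {t (Inr (i, j)) | j. Inr (i, j) \<in> boxes la}"

definition col1 :: "bipart \<Rightarrow> (box \<Rightarrow> int) \<Rightarrow> nat \<Rightarrow> int set" where
  "col1 la t j = {t (Inl (i, j)) | i. Inl (i, j) \<in> boxes la}"

definition col2 :: "bipart \<Rightarrow> (box \<Rightarrow> int) \<Rightarrow> nat \<Rightarrow> int set" where
  "col2 la t j = {t (Inr (i, j)) | i. Inr (i, j) \<in> boxes la}"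

definition signed :: "int set \<Rightarrow> int set" where
  "signed S = S \<union> uminus ` S"

definition row_stab :: "bipart \<Rightarrow> (box \<Rightarrow> int) \<Rightarrow> (int \<Rightarrow> int) set" where
  "row_stab la t = {\<sigma> \<in> carrier (hyperoct (bisize la)).
    \<forall>i. \<sigma> ` row1 la t i = row1 la t i \<and> \<sigma> ` signed (row2 la t i) = signed (row2 la t i)}"

definition col_stab :: "bipart \<Rightarrow> (box \<Rightarrow> int) \<Rightarrow> (int \<Rightarrow> int) set" where
  "col_stab la t = {\<sigma> \<in> carrier (hyperoct (bisize la)).
    \<forall>j. \<sigma> ` signed (col1 la t j) = signed (col1 la t j) \<and> \<sigma> ` col2 la t j = col2 la t j}"

text \<open>The bi-tableau \<open>t\<sigma>\<close> is \<open>\<sigma> \<circ> t\<close>.\<close>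

definition bitabloid :: "bipart \<Rightarrow> (box \<Rightarrow> int) \<Rightarrow> (box \<Rightarrow> int) set" where
  "bitabloid la t = {\<sigma> \<circ> t | \<sigma>. \<sigma> \<in> row_stab la t}"

definition bitabloids :: "bipart \<Rightarrow> (box \<Rightarrow> int) set set" where
  "bitabloids la = bitabloid la ` bitableaux la"

definition perm_module ::
    "bipart \<Rightarrow> ((box \<Rightarrow> int) set \<Rightarrow> 'k::field, (int \<Rightarrow> int) \<Rightarrow> 'k) right_module" where
  "perm_module la =
    \<lparr>carrier = {v. \<forall>S. S \<notin> bitabloids la \<longrightarrow> v S = 0},
     monoid.mult = undefined, one = undefined,
     ring.zero = (\<lambda>_. 0),
     ring.add = (\<lambda>v w S. v S + w S),
     ract = (\<lambda>v a S'. \<Sum>(S, \<sigma>) \<in> {(S, \<sigma>) \<in> bitabloids la \<times> carrier (hyperoct (bisize la)).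
                                  (\<lambda>t. \<sigma> \<circ> t) ` S = S'}. v S * a \<sigma>)\<rparr>"

definition col_antisymmetrizer :: "bipart \<Rightarrow> (box \<Rightarrow> int) \<Rightarrow> (int \<Rightarrow> int) \<Rightarrow> 'k::field" where
  "col_antisymmetrizer la t =
    (\<lambda>\<sigma>. if \<sigma> \<in> col_stab la t then of_int (hyperoct_sgn (bisize la) \<sigma>) else 0)"

definition polytabloid :: "bipart \<Rightarrow> (box \<Rightarrow> int) \<Rightarrow> (box \<Rightarrow> int) set \<Rightarrow> 'k::field" where
  "polytabloid la t = ract (perm_module la) (basis_vec (bitabloid la t)) (col_antisymmetrizer la t)"

definition specht ::
    "bipart \<Rightarrow> ((box \<Rightarrow> int) set \<Rightarrow> 'k::field, (int \<Rightarrow> int) \<Rightarrow> 'k) right_module" where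
  "specht la =
    (perm_module la)\<lparr>carrier := module.span (\<lambda>c v S. c * v S) (polytabloid la ` bitableaux la)\<rparr>"

definition dual_specht ::
    "bipart \<Rightarrow> (((box \<Rightarrow> int) set \<Rightarrow> 'k::field) \<Rightarrow> 'k, (int \<Rightarrow> int) \<Rightarrow> 'k) right_module" where
  "dual_specht la = dual_module (hyperoct (bisize la)) (specht la)"


section \<open>The Brauer algebra of type C\<close>

text \<open>The vertex \<open>(0, i)\<close> is the one labelled \<open>i\<close> in the top row, \<open>(1, i)\<close> the one in the bottom row.\<close>

type_synonym vertex = "nat \<times> int"
type_synonym diagram = "vertex set set"

definition diagrams :: "nat \<Rightarrow> diagram set" where
  "diagrams r = {d. partition_on ({0, 1} \<times> symbols r) d \<and> (\<forall>e \<in> d. card e = 2) \<and>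
    (\<lambda>e. (\<lambda>(a, i). (a, - i)) ` e) ` d = d}"

definition horizontal :: "diagram \<Rightarrow> nat" where
  "horizontal d = card {e \<in> d. e \<subseteq> {0} \<times> UNIV}"

text \<open>
  To multiply, place \<open>d1\<close> on the rows 0, 1 and \<open>d2\<close> on the rows 1, 2. Vertices of the outer rows
  are joined in the product if they are connected; connected components within the middle row are
  the closed loops.
\<close>

definition stacked :: "diagram \<Rightarrow> diagram \<Rightarrow> (vertex \<times> vertex) set" where
  "stacked d1 d2 = {(u, v). {u, v} \<in> d1 \<union> (\<lambda>e. (\<lambda>(a, i). (a + 1, i)) ` e) ` d2}"

definition concat_diagrams :: "diagram \<Rightarrow> diagram \<Rightarrow> diagram" where
  "concat_diagrams d1 d2 = {(\<lambda>(a, i). (a div 2, i)) ` {u, v} | u v.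
    u \<noteq> v \<and> fst u \<in> {0, 2} \<and> fst v \<in> {0, 2} \<and> (u, v) \<in> (stacked d1 d2)\<^sup>*}"

definition loops :: "nat \<Rightarrow> diagram \<Rightarrow> diagram \<Rightarrow> nat" where
  "loops r d1 d2 = card {C. C \<subseteq> {1} \<times> UNIV \<and> (\<exists>v \<in> {1} \<times> symbols r. C = (stacked d1 d2)\<^sup>* `` {v})}"

text \<open>
  The diagram with horizontal edges \<open>{-i, i}\<close>, \<open>1 \<le> i \<le> l\<close>, in both rows and vertical edges given
  by \<open>\<sigma>\<close>, a signed permutation of \<open>\<plusminus>1, \<dots>, \<plusminus>(r-l)\<close>, transported to the labels
  \<open>\<plusminus>(l+1), \<dots>, \<plusminus>r\<close> via \<open>shift\<close>.
\<close>

definition shift :: "nat \<Rightarrow> int \<Rightarrow> int" where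
  "shift l i = i + sgn i * int l"

definition layer_diagram :: "nat \<Rightarrow> nat \<Rightarrow> (int \<Rightarrow> int) \<Rightarrow> diagram" where
  "layer_diagram r l \<sigma> =
    {{(a, - i), (a, i)} | a i. a \<in> {0, 1} \<and> i \<in> {1..int l}} \<union>
    {{(0, shift l j), (1, shift l (\<sigma> j))} | j. j \<in> symbols (r - l)}"

definition brauer_monoid :: "nat \<Rightarrow> diagram monoid" where
  "brauer_monoid r =
    \<lparr>carrier = diagrams r, monoid.mult = concat_diagrams, one = layer_diagram r 0 id\<rparr>"

definition brauer :: "nat \<Rightarrow> 'k::field \<Rightarrow> ('k, diagram \<Rightarrow> 'k) module" where
  "brauer r \<delta> = twisted_algebra (brauer_monoid r) (\<lambda>d1 d2. \<delta> ^ loops r d1 d2)"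

definition brauer_ideal :: "nat \<Rightarrow> 'k::field \<Rightarrow> nat \<Rightarrow> (diagram \<Rightarrow> 'k) set" where
  "brauer_ideal r \<delta> l = Idl\<^bsub>brauer r \<delta>\<^esub> {basis_vec d | d. d \<in> diagrams r \<and> horizontal d \<ge> l}"

text \<open>The embedding of the group algebra of \<open>W\<^bsub>r-l\<^esub>\<close>, and the idempotent \<open>e\<^sub>l\<close> as the image of 1.\<close>

definition layer_embed ::
    "nat \<Rightarrow> 'k::field \<Rightarrow> nat \<Rightarrow> ((int \<Rightarrow> int) \<Rightarrow> 'k) \<Rightarrow> diagram \<Rightarrow> 'k" where
  "layer_embed r \<delta> l a =
    (\<lambda>d. \<Sum>\<sigma> \<in> carrier (hyperoct (r - l)). a \<sigma> * (inverse \<delta> ^ l * basis_vec (layer_diagram r l \<sigma>) d))"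

definition layer_idem :: "nat \<Rightarrow> 'k::field \<Rightarrow> nat \<Rightarrow> diagram \<Rightarrow> 'k" where
  "layer_idem r \<delta> l = (\<lambda>d. inverse \<delta> ^ l * basis_vec (layer_diagram r l id) d)"

text \<open>The bimodule \<open>e\<^sub>l (B/J\<^bsub>l+1\<^esub>) = e\<^sub>l B / e\<^sub>l J\<^bsub>l+1\<^esub>\<close>, whose elements are cosets.\<close>

definition layer ::
    "nat \<Rightarrow> 'k::field \<Rightarrow> nat \<Rightarrow>
      ((diagram \<Rightarrow> 'k) set, diagram \<Rightarrow> 'k, (int \<Rightarrow> int) \<Rightarrow> 'k) bimodule" where
  "layer r \<delta> l =
    (let B = brauer r \<delta>; e = layer_idem r \<delta> l;
         E = B\<lparr>carrier := e <#\<^bsub>B\<^esub> carrier B\<rparr>;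
         I = e <#\<^bsub>B\<^esub> brauer_ideal r \<delta> (l + 1)
     in \<lparr>carrier = a_rcosets\<^bsub>E\<^esub> I,
         monoid.mult = undefined, one = undefined,
         ring.zero = I,
         ring.add = (\<lambda>X Y. X <+>\<^bsub>E\<^esub> Y),
         ract = (\<lambda>X b. I <+>\<^bsub>E\<^esub> (X #>\<^bsub>B\<^esub> b)),
         lact = (\<lambda>a X. I <+>\<^bsub>E\<^esub> (layer_embed r \<delta> l a <#\<^bsub>B\<^esub> X))\<rparr>)"

definition ind ::
    "nat \<Rightarrow> 'k::field \<Rightarrow> nat \<Rightarrow> ('v, (int \<Rightarrow> int) \<Rightarrow> 'k, 'n) right_module_scheme
      \<Rightarrow> (('v \<times> (diagram \<Rightarrow> 'k) set \<Rightarrow>\<^sub>0 int) set, diagram \<Rightarrow> 'k) right_module" where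
  "ind r \<delta> l X = tensor (group_algebra (hyperoct (r - l))) X (layer r \<delta> l)"


section \<open>The index set\<close>

definition Lambda :: "nat \<Rightarrow> (nat \<times> bipart) set" where
  "Lambda r = {(l, la). l \<le> r \<and> la \<in> bipartitions (r - l)}"

text \<open>\<open>Lambda_ge x y\<close> is \<open>x \<ge> y\<close>. Note the reversal in both components.\<close>

fun Lambda_ge :: "nat \<times> bipart \<Rightarrow> nat \<times> bipart \<Rightarrow> bool" where
  "Lambda_ge (m, mu) (l, la) \<longleftrightarrow> m < l \<or> m = l \<and> dominates la mu"

definition Lambda_gt :: "nat \<times> bipart \<Rightarrow> nat \<times> bipart \<Rightarrow> bool" where
  "Lambda_gt x y \<longleftrightarrow> Lambda_ge x y \<and> x \<noteq> y"

end

theory Submission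
  imports Defs
begin

text \<open>
  Write \<open>\<epsilon>\<close> for the class of \<open>e\<^sub>l\<close> in \<open>e\<^sub>l(B/J\<^bsub>l+1\<^esub>)\<close>. The module \<open>ind\<^sub>l X\<close> is generated over \<open>B\<close> by the
  elements \<open>x \<otimes> \<epsilon>\<close>, and these are fixed by \<open>e\<^sub>l\<close>. A homomorphism \<open>f\<close> out of \<open>ind\<^sub>l X\<close> is therefore
  determined by the values \<open>f (x \<otimes> \<epsilon>)\<close>, which lie in the part of the target fixed by \<open>e\<^sub>l\<close>.

  If \<open>m < l\<close>, then \<open>e\<^sub>l\<close> is a multiple of a diagram with \<open>l \<ge> m + 1\<close> horizontal edges and so lies in
  \<open>J\<^bsub>m+1\<^esub>\<close>, which annihilates \<open>ind\<^sub>m Y\<close>; hence \<open>f = 0\<close> (\<open>induced_hom_zero_of_ideal\<close>).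

  If \<open>m = l\<close>, then modulo \<open>J\<^bsub>l+1\<^esub>\<close> the corner \<open>e\<^sub>l B e\<^sub>l\<close> is the group algebra of \<open>W\<^bsub>r-l\<^esub>\<close>
  (\<open>full_corner\<close>), because a diagram with the arcs \<open>{-i, i}\<close>, \<open>i \<le> l\<close>, in both rows and no other
  horizontal edge is a signed permutation of the remaining labels. Consequently
  \<open>(ind\<^sub>l Y) e\<^sub>l\<close> is a copy of \<open>Y\<close>, and \<open>f\<close> comes from a homomorphism \<open>g\<close> from \<open>S'(\<lambda>)\<close> to \<open>S'(\<mu>)\<close> over
  the group algebra (\<open>induced_hom_restrict\<close>).

  It remains to prove that \<open>g = 0\<close> if \<open>\<lambda> \<noteq> \<mu>\<close> and \<open>\<lambda>\<close> dominates \<open>\<mu>\<close>. For a \<open>\<mu>\<close>-bi-tableau \<open>t\<close>, evaluating at the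
  polytabloid \<open>e\<^sub>t\<close> gives a linear form \<open>F f = g f e\<^sub>t\<close> on \<open>S'(\<lambda>)\<close>, and \<open>C\<^sub>t\<close> acts on it through the sign
  because it acts so on \<open>e\<^sub>t\<close>. The space \<open>S'(\<lambda>)\<close> is spanned by the coordinate functions of the
  \<open>\<lambda>\<close>-bi-tabloids \<open>{s}\<close>, and \<open>R\<^sub>s\<close> fixes the coordinate function of \<open>{s}\<close>. An odd element of
  \<open>R\<^sub>s \<inter> C\<^sub>t\<close> thus forces \<open>2 F = 0\<close> on this function, and \<open>2\<close> is invertible. If \<open>F\<close> does not vanish on
  it, there is no such element, so entries of one row of \<open>s\<close> lie in different columns of \<open>t\<close>, and
  no entry of \<open>s\<^sup>2\<close> lies in \<open>t\<^sup>1\<close>. Together with \<open>|\<lambda>\<^sup>1| = |\<mu>\<^sup>1|\<close>, which follows by comparing the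
  eigenvalues of the sign changes on polytabloids, the usual counting argument in each component
  shows that \<open>\<mu>\<close> dominates \<open>\<lambda>\<close>; hence \<open>\<lambda> = \<mu>\<close> (\<open>dual_specht_hom_zero\<close>).

  All this presupposes that \<open>B\<close> is an associative algebra. Diagram composition is associative
  because connectivity in a stack of three diagrams can be computed by first contracting either of
  the two inner rows, and counting the components that disappear in the contraction shows that the
  exponents of \<open>\<delta>\<close> satisfy the cocycle identity (\<open>concat_assoc\<close>, \<open>loops_cocycle\<close>).
\<close>

section \<open>Twisted algebras of finite monoids\<close>

text \<open>
  The condition on \<open>c\<close> is what associativity of \<open>g \<cdot> h = c(g, h) gh\<close> amounts to on basis vectors. Group
  algebras (\<open>c = 1\<close>) and the Brauer algebra (\<open>c = \<delta>\<^sup>k\<close> for \<open>k\<close> closed loops) are instances.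
\<close>

locale twisted_monoid = monoid G for G (structure) +
  fixes c :: "'g \<Rightarrow> 'g \<Rightarrow> 'k::field"
  assumes finite_carrier: "finite (carrier G)"
    and cocycle: "\<lbrakk>x \<in> carrier G; y \<in> carrier G; z \<in> carrier G\<rbrakk>
      \<Longrightarrow> c x y * c (x \<otimes> y) z = c y z * c x (y \<otimes> z)"
    and c_one: "x \<in> carrier G \<Longrightarrow> c \<one> x = 1" "x \<in> carrier G \<Longrightarrow> c x \<one> = 1"
begin

abbreviation (input) T where "T \<equiv> twisted_algebra G c"

lemma twisted_simps:
  "carrier T = {a. \<forall>g. g \<notin> carrier G \<longrightarrow> a g = 0}"
  "\<one>\<^bsub>T\<^esub> = basis_vec \<one>" "\<zero>\<^bsub>T\<^esub> = 0" "a \<oplus>\<^bsub>T\<^esub> b = a + b" "k \<odot>\<^bsub>T\<^esub> a = (\<lambda>z. k * a z)"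
  by (auto simp: twisted_algebra_def zero_fun_def plus_fun_def)

lemma twisted_mult:
  "(a \<otimes>\<^bsub>T\<^esub> b) z =
    (\<Sum>g\<in>carrier G. \<Sum>h\<in>carrier G. if g \<otimes> h = z then c g h * a g * b h else 0)"
proof -
  have "(a \<otimes>\<^bsub>T\<^esub> b) z =
      (\<Sum>(g, h) \<in> {x \<in> carrier G \<times> carrier G. (case x of (g, h) \<Rightarrow> g \<otimes> h = z)}. c g h * a g * b h)"
    by (simp add: twisted_algebra_def case_prod_unfold) (intro sum.cong, auto)
  also have "\<dots> = (\<Sum>x \<in> carrier G \<times> carrier G.
      if (case x of (g, h) \<Rightarrow> g \<otimes> h = z) then (case x of (g, h) \<Rightarrow> c g h * a g * b h) else 0)"
    by (rule sum.inter_filter) (simp add: finite_carrier)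
  also have "\<dots> = (\<Sum>(g, h) \<in> carrier G \<times> carrier G.
      if g \<otimes> h = z then c g h * a g * b h else 0)"
    by (intro sum.cong) auto
  also have "\<dots> = (\<Sum>g\<in>carrier G. \<Sum>h\<in>carrier G. if g \<otimes> h = z then c g h * a g * b h else 0)"
    by (rule sum.cartesian_product[symmetric])
  finally show ?thesis .
qed

text \<open>
  Pairing a product with an arbitrary function \<open>\<phi>\<close> removes the condition \<open>g h = z\<close> from the
  convolution; all computations with triple products and with modules reduce to this formula.
\<close>

lemma sum_twisted_mult:
  "(\<Sum>z\<in>carrier G. \<phi> z * (a \<otimes>\<^bsub>T\<^esub> b) z) =
    (\<Sum>g\<in>carrier G. \<Sum>h\<in>carrier G. \<phi> (g \<otimes> h) * (c g h * a g * b h))"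
proof -
  have "(\<Sum>z\<in>carrier G. \<phi> z * (a \<otimes>\<^bsub>T\<^esub> b) z) = (\<Sum>z\<in>carrier G. \<Sum>g\<in>carrier G. \<Sum>h\<in>carrier G.
      if g \<otimes> h = z then \<phi> z * (c g h * a g * b h) else 0)"
    by (simp add: twisted_mult sum_distrib_left if_distrib cong: if_cong)
  also have "\<dots> = (\<Sum>g\<in>carrier G. \<Sum>h\<in>carrier G. \<Sum>z\<in>carrier G.
      if g \<otimes> h = z then \<phi> z * (c g h * a g * b h) else 0)"
    by (subst sum.swap, rule sum.cong[OF refl], rule sum.swap)
  also have "\<dots> = (\<Sum>g\<in>carrier G. \<Sum>h\<in>carrier G. \<phi> (g \<otimes> h) * (c g h * a g * b h))"
    by (intro sum.cong refl) (simp add: finite_carrier)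
  finally show ?thesis .
qed

lemma twisted_mult_closed: "a \<otimes>\<^bsub>T\<^esub> b \<in> carrier T"
  by (auto simp: twisted_simps twisted_mult intro!: sum.neutral)

lemma twisted_mult_assoc: "(a \<otimes>\<^bsub>T\<^esub> b) \<otimes>\<^bsub>T\<^esub> d = a \<otimes>\<^bsub>T\<^esub> (b \<otimes>\<^bsub>T\<^esub> d)"
proof
  fix z
  have "((a \<otimes>\<^bsub>T\<^esub> b) \<otimes>\<^bsub>T\<^esub> d) z = (\<Sum>k\<in>carrier G. \<Sum>p\<in>carrier G.
      (if p \<otimes> k = z then c p k * d k else 0) * (a \<otimes>\<^bsub>T\<^esub> b) p)"
    unfolding twisted_mult[of "a \<otimes>\<^bsub>T\<^esub> b" d]
    by (subst sum.swap) (intro sum.cong refl, simp)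
  also have "\<dots> = (\<Sum>k\<in>carrier G. \<Sum>g\<in>carrier G. \<Sum>h\<in>carrier G.
      (if g \<otimes> h \<otimes> k = z then c (g \<otimes> h) k * d k else 0) * (c g h * a g * b h))"
    by (intro sum.cong refl sum_twisted_mult)
  also have "\<dots> = (\<Sum>g\<in>carrier G. \<Sum>h\<in>carrier G. \<Sum>k\<in>carrier G.
      (if g \<otimes> h \<otimes> k = z then c (g \<otimes> h) k * d k else 0) * (c g h * a g * b h))"
    by (subst sum.swap, rule sum.cong[OF refl], rule sum.swap)
  also have "\<dots> = (\<Sum>g\<in>carrier G. \<Sum>h\<in>carrier G. \<Sum>k\<in>carrier G.
      (if g \<otimes> (h \<otimes> k) = z then c g (h \<otimes> k) * a g else 0) * (c h k * b h * d k))"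
  proof (intro sum.cong refl)
    fix g h k assume ghk: "g \<in> carrier G" "h \<in> carrier G" "k \<in> carrier G"
    have "c (g \<otimes> h) k * d k * (c g h * a g * b h) = (c g h * c (g \<otimes> h) k) * (a g * b h * d k)"
      by (simp add: mult_ac)
    also have "\<dots> = c g (h \<otimes> k) * a g * (c h k * b h * d k)"
      by (simp add: cocycle ghk mult_ac)
    finally show "(if g \<otimes> h \<otimes> k = z then c (g \<otimes> h) k * d k else 0) * (c g h * a g * b h) =
      (if g \<otimes> (h \<otimes> k) = z then c g (h \<otimes> k) * a g else 0) * (c h k * b h * d k)"
      using ghk by (auto simp: m_assoc)
  qed
  also have "\<dots> = (\<Sum>g\<in>carrier G. \<Sum>p\<in>carrier G.
      (if g \<otimes> p = z then c g p * a g else 0) * (b \<otimes>\<^bsub>T\<^esub> d) p)"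
    by (intro sum.cong refl sum_twisted_mult[symmetric])
  also have "\<dots> = (a \<otimes>\<^bsub>T\<^esub> (b \<otimes>\<^bsub>T\<^esub> d)) z"
    unfolding twisted_mult[of a "b \<otimes>\<^bsub>T\<^esub> d"] by (intro sum.cong refl) simp
  finally show "((a \<otimes>\<^bsub>T\<^esub> b) \<otimes>\<^bsub>T\<^esub> d) z = (a \<otimes>\<^bsub>T\<^esub> (b \<otimes>\<^bsub>T\<^esub> d)) z" .
qed

lemma twisted_mult_basis_left:
  assumes "g \<in> carrier G"
  shows "(basis_vec g \<otimes>\<^bsub>T\<^esub> b) z = (\<Sum>h\<in>carrier G. if g \<otimes> h = z then c g h * b h else 0)"
proof -
  have "(basis_vec g \<otimes>\<^bsub>T\<^esub> b) z = (\<Sum>x\<in>carrier G. if x = g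
      then (\<Sum>h\<in>carrier G. if g \<otimes> h = z then c g h * b h else 0) else 0)"
    unfolding twisted_mult by (intro sum.cong refl) (auto simp: basis_vec_def intro!: sum.neutral sum.cong)
  then show ?thesis
    using assms by (simp add: finite_carrier)
qed

lemma twisted_mult_basis:
  assumes "g \<in> carrier G" "h \<in> carrier G"
  shows "basis_vec g \<otimes>\<^bsub>T\<^esub> basis_vec h = (\<lambda>z. c g h * basis_vec (g \<otimes> h) z)"
proof
  fix z
  have "(basis_vec g \<otimes>\<^bsub>T\<^esub> basis_vec h) z =
      (\<Sum>x\<in>carrier G. if x = h then if g \<otimes> h = z then c g h else 0 else 0)"
    unfolding twisted_mult_basis_left[OF assms(1)]
    by (intro sum.cong refl) (auto simp: basis_vec_def)
  then show "(basis_vec g \<otimes>\<^bsub>T\<^esub> basis_vec h) z = c g h * basis_vec (g \<otimes> h) z"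
    using assms by (auto simp: finite_carrier basis_vec_def)
qed

lemma twisted_basis_one_left:
  assumes "b \<in> carrier T" shows "basis_vec \<one> \<otimes>\<^bsub>T\<^esub> b = b"
proof
  fix z
  have "(basis_vec \<one> \<otimes>\<^bsub>T\<^esub> b) z = (\<Sum>h\<in>carrier G. if h = z then b h else 0)"
    unfolding twisted_mult_basis_left[OF one_closed] by (intro sum.cong refl) (auto simp: c_one)
  then show "(basis_vec \<one> \<otimes>\<^bsub>T\<^esub> b) z = b z"
    using assms by (auto simp: finite_carrier twisted_simps)
qed

lemma twisted_basis_one_right:
  assumes "a \<in> carrier T" shows "a \<otimes>\<^bsub>T\<^esub> basis_vec \<one> = a"
proof
  fix z
  have "(a \<otimes>\<^bsub>T\<^esub> basis_vec \<one>) z = (\<Sum>g\<in>carrier G. \<Sum>h\<in>carrier G. if h = \<one> then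
      (if g = z then a g else 0) else 0)"
    unfolding twisted_mult by (intro sum.cong refl) (auto simp: basis_vec_def c_one)
  also have "\<dots> = (\<Sum>g\<in>carrier G. if g = z then a g else 0)"
    by (intro sum.cong refl) (simp add: finite_carrier)
  finally show "(a \<otimes>\<^bsub>T\<^esub> basis_vec \<one>) z = a z"
    using assms by (auto simp: finite_carrier twisted_simps)
qed

lemma ring_twisted_algebra: "ring T"
proof (rule ringI)
  show "abelian_group T"
  proof (rule abelian_groupI)
    fix x assume "x \<in> carrier T"
    then show "\<exists>y\<in>carrier T. y \<oplus>\<^bsub>T\<^esub> x = \<zero>\<^bsub>T\<^esub>"
      by (intro bexI[of _ "- x"]) (auto simp: twisted_simps)
  qed (auto simp: twisted_simps)
  show "monoid T"
    by (rule monoidI)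
      (auto simp: twisted_mult_closed twisted_mult_assoc twisted_basis_one_left
        twisted_basis_one_right twisted_simps(2) simp del: twisted_simps(1), auto simp: twisted_simps basis_vec_def)
next
  fix x y z
  show "(x \<oplus>\<^bsub>T\<^esub> y) \<otimes>\<^bsub>T\<^esub> z = x \<otimes>\<^bsub>T\<^esub> z \<oplus>\<^bsub>T\<^esub> y \<otimes>\<^bsub>T\<^esub> z"
    by (rule ext) (simp add: twisted_simps twisted_mult sum.distrib[symmetric] algebra_simps
        flip: sum.distrib cong: if_cong, intro sum.cong refl, auto simp: algebra_simps)
  show "z \<otimes>\<^bsub>T\<^esub> (x \<oplus>\<^bsub>T\<^esub> y) = z \<otimes>\<^bsub>T\<^esub> x \<oplus>\<^bsub>T\<^esub> z \<otimes>\<^bsub>T\<^esub> y"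
    by (rule ext) (simp add: twisted_simps twisted_mult flip: sum.distrib,
       intro sum.cong refl, auto simp: algebra_simps)
qed

lemma twisted_mult_scale:
  "(\<lambda>z. k * a z) \<otimes>\<^bsub>T\<^esub> b = (\<lambda>z. k * (a \<otimes>\<^bsub>T\<^esub> b) z)" "a \<otimes>\<^bsub>T\<^esub> (\<lambda>z. k * b z) = (\<lambda>z. k * (a \<otimes>\<^bsub>T\<^esub> b) z)"
  by (rule ext, simp add: twisted_mult sum_distrib_left if_distrib mult_ac cong: if_cong)+

end

section \<open>Tensor products of a module with a bimodule\<close>

lemma (in abelian_group) eq_minusI:
  assumes "a \<oplus> b = c" "a \<in> carrier G" "b \<in> carrier G" shows "a = c \<ominus> b"
proof -
  have "c \<ominus> b = a \<oplus> b \<ominus> b"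
    using assms(1) by simp
  then show ?thesis
    using assms(2,3) by (simp add: minus_eq a_assoc r_neg)
qed

lemma hom_minus:
  assumes "abelian_group M" "abelian_group H" "h \<in> hom (add_monoid M) (add_monoid H)"
    and "u \<in> carrier M" "v \<in> carrier M"
  shows "h (u \<ominus>\<^bsub>M\<^esub> v) = h u \<ominus>\<^bsub>H\<^esub> h v"
proof -
  interpret M: abelian_group M by fact
  interpret H: abelian_group H by fact
  have "u \<ominus>\<^bsub>M\<^esub> v \<oplus>\<^bsub>M\<^esub> v = u"
    using assms(4,5) by (simp add: M.minus_eq M.a_assoc M.l_neg)
  moreover have "h (u \<ominus>\<^bsub>M\<^esub> v \<oplus>\<^bsub>M\<^esub> v) = h (u \<ominus>\<^bsub>M\<^esub> v) \<oplus>\<^bsub>H\<^esub> h v"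
    using assms(3-5) by (simp add: hom_def)
  ultimately have "h (u \<ominus>\<^bsub>M\<^esub> v) \<oplus>\<^bsub>H\<^esub> h v = h u"
    by simp
  then show ?thesis
    using assms(3-5) by (intro H.eq_minusI) (auto simp: hom_def)
qed

locale right_mod =
  fixes A :: "('a, 'm) ring_scheme" and X :: "('v, 'a, 'n) right_module_scheme"
  assumes abelian_group: "abelian_group X"
    and ract_closed: "\<lbrakk>x \<in> carrier X; a \<in> carrier A\<rbrakk> \<Longrightarrow> ract X x a \<in> carrier X"
    and ract_add_left: "\<lbrakk>x \<in> carrier X; x' \<in> carrier X; a \<in> carrier A\<rbrakk>
      \<Longrightarrow> ract X (x \<oplus>\<^bsub>X\<^esub> x') a = ract X x a \<oplus>\<^bsub>X\<^esub> ract X x' a"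
    and ract_add_right: "\<lbrakk>x \<in> carrier X; a \<in> carrier A; a' \<in> carrier A\<rbrakk>
      \<Longrightarrow> ract X x (a \<oplus>\<^bsub>A\<^esub> a') = ract X x a \<oplus>\<^bsub>X\<^esub> ract X x a'"
    and ract_mult: "\<lbrakk>x \<in> carrier X; a \<in> carrier A; a' \<in> carrier A\<rbrakk>
      \<Longrightarrow> ract X x (a \<otimes>\<^bsub>A\<^esub> a') = ract X (ract X x a) a'"
    and ract_one: "x \<in> carrier X \<Longrightarrow> ract X x \<one>\<^bsub>A\<^esub> = x"

text \<open>
  The axioms under which right multiplication on \<open>Y\<close> induces an action of \<open>B\<close> on tensor products with
  \<open>Y\<close> over \<open>A\<close>.
\<close>

locale bimod =
  fixes A :: "('a, 'm) ring_scheme" and B :: "('b, 'q) ring_scheme"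
    and Y :: "('w, 'b, 'a, 'p) bimodule_scheme"
  assumes abelian_group: "abelian_group Y"
    and ract_closed: "\<lbrakk>y \<in> carrier Y; b \<in> carrier B\<rbrakk> \<Longrightarrow> ract Y y b \<in> carrier Y"
    and lact_closed: "\<lbrakk>y \<in> carrier Y; a \<in> carrier A\<rbrakk> \<Longrightarrow> lact Y a y \<in> carrier Y"
    and ract_add: "\<lbrakk>y \<in> carrier Y; y' \<in> carrier Y; b \<in> carrier B\<rbrakk>
      \<Longrightarrow> ract Y (y \<oplus>\<^bsub>Y\<^esub> y') b = ract Y y b \<oplus>\<^bsub>Y\<^esub> ract Y y' b"
    and lact_ract: "\<lbrakk>y \<in> carrier Y; a \<in> carrier A; b \<in> carrier B\<rbrakk>
      \<Longrightarrow> ract Y (lact Y a y) b = lact Y a (ract Y y b)"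

locale tensor_product = X: right_mod A X + Y: bimod A B Y
  for A :: "('a, 'm) ring_scheme" and X :: "('v, 'a, 'n) right_module_scheme"
    and B :: "('b, 'q) ring_scheme" and Y :: "('w, 'b, 'a, 'p) bimodule_scheme"
begin

abbreviation (input) F where "F \<equiv> free_Abelian_group (carrier X \<times> carrier Y)"
abbreviation (input) N where "N \<equiv> tensor_relations A X Y"
abbreviation (input) T where "T \<equiv> tensor A X Y"

definition tens :: "'v \<Rightarrow> 'w \<Rightarrow> ('v \<times> 'w \<Rightarrow>\<^sub>0 int) set" where
  "tens x y = N #>\<^bsub>F\<^esub> frag_of (x, y)"

definition relators :: "('v \<times> 'w \<Rightarrow>\<^sub>0 int) set" where
  "relators =
    {frag_of (x \<oplus>\<^bsub>X\<^esub> x', y) - frag_of (x, y) - frag_of (x', y) | x x' y.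
        x \<in> carrier X \<and> x' \<in> carrier X \<and> y \<in> carrier Y} \<union>
    {frag_of (x, y \<oplus>\<^bsub>Y\<^esub> y') - frag_of (x, y) - frag_of (x, y') | x y y'.
        x \<in> carrier X \<and> y \<in> carrier Y \<and> y' \<in> carrier Y} \<union>
    {frag_of (ract X x a, y) - frag_of (x, lact Y a y) | x a y.
        x \<in> carrier X \<and> a \<in> carrier A \<and> y \<in> carrier Y}"

sublocale X: abelian_group X by (rule X.abelian_group)
sublocale Y: abelian_group Y by (rule Y.abelian_group)
sublocale F: comm_group F
  rewrites "monoid.mult F = (+)" and "one F = 0"
  using abelian_free_Abelian_group by (auto simp: free_Abelian_group_def)

declare carrier_free_Abelian_group_iff [simp del]

lemma carrier_F: "c \<in> carrier F \<longleftrightarrow> Poly_Mapping.keys c \<subseteq> carrier X \<times> carrier Y"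
  by (simp add: free_Abelian_group_def)

lemma inv_F: "c \<in> carrier F \<Longrightarrow> inv\<^bsub>F\<^esub> c = - c"
  by (simp add: carrier_F)

lemma F_closed:
  "0 \<in> carrier F" "c \<in> carrier F \<Longrightarrow> d \<in> carrier F \<Longrightarrow> c + d \<in> carrier F"
  "c \<in> carrier F \<Longrightarrow> d \<in> carrier F \<Longrightarrow> c - d \<in> carrier F"
  "x \<in> carrier X \<Longrightarrow> y \<in> carrier Y \<Longrightarrow> frag_of (x, y) \<in> carrier F"
  using keys_add[of c d] keys_diff[of c d] by (auto simp: carrier_F)

lemma relators_in_F: "relators \<subseteq> carrier F"
  unfolding relators_def by (auto intro!: F_closed X.ract_closed Y.lact_closed)

lemma relations_eq: "N = generate F relators"
  by (simp add: tensor_relations_def relators_def)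

lemma subgroup_relations: "subgroup N F"
  unfolding relations_eq by (rule F.generate_is_subgroup[OF relators_in_F])

lemma relators_in_N: "relators \<subseteq> N"
  unfolding relations_eq by (auto intro: generate.incl)

sublocale N: normal N F
  by (rule F.subgroup_imp_normal[OF subgroup_relations])

lemma tensor_simps:
  "carrier T = rcosets\<^bsub>F\<^esub> N" "\<zero>\<^bsub>T\<^esub> = N" "S \<oplus>\<^bsub>T\<^esub> S' = S <#>\<^bsub>F\<^esub> S'"
  by (simp_all add: tensor_def Let_def FactGroup_def)

sublocale T: abelian_group T
proof -
  interpret Q: comm_group "F Mod N"
    by (rule F.abelian_FactGroup[OF subgroup_relations])
  have eqs: "carrier (F Mod N) = carrier T" "monoid.mult (F Mod N) = ring.add T" "one (F Mod N) = ring.zero T"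
    by (simp_all add: tensor_def Let_def)
  show "abelian_group T"
  proof (rule abelian_groupI)
    fix x assume "x \<in> carrier T"
    then show "\<exists>y\<in>carrier T. y \<oplus>\<^bsub>T\<^esub> x = \<zero>\<^bsub>T\<^esub>"
      by (rule Q.l_inv_ex[unfolded eqs])
  qed (fact Q.m_closed[unfolded eqs] Q.one_closed[unfolded eqs] Q.m_assoc[unfolded eqs]
      Q.m_comm[unfolded eqs] Q.l_one[unfolded eqs])+
qed

lemma coset_in_tensor: "c \<in> carrier F \<Longrightarrow> N #>\<^bsub>F\<^esub> c \<in> carrier T"
  by (auto simp: tensor_simps RCOSETS_def)

lemma tensor_coset:
  assumes "z \<in> carrier T" obtains c where "c \<in> carrier F" "z = N #>\<^bsub>F\<^esub> c"
  using assms by (auto simp: tensor_simps RCOSETS_def)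

lemma coset_eqI:
  assumes "c \<in> carrier F" "d \<in> carrier F" "c - d \<in> N"
  shows "N #>\<^bsub>F\<^esub> c = N #>\<^bsub>F\<^esub> d"
proof -
  have "c \<in> N #>\<^bsub>F\<^esub> d"
    using assms by (auto simp: r_coset_def intro!: bexI[of _ "c - d"])
  then show ?thesis
    using F.repr_independence[OF _ _ subgroup_relations] assms(2) by blast
qed

lemma coset_add:
  "c \<in> carrier F \<Longrightarrow> d \<in> carrier F \<Longrightarrow> N #>\<^bsub>F\<^esub> (c + d) = (N #>\<^bsub>F\<^esub> c) \<oplus>\<^bsub>T\<^esub> (N #>\<^bsub>F\<^esub> d)"
  by (simp add: tensor_simps N.rcos_sum)

lemma coset_minus:
  assumes "c \<in> carrier F" "d \<in> carrier F"
  shows "N #>\<^bsub>F\<^esub> (c - d) = (N #>\<^bsub>F\<^esub> c) \<ominus>\<^bsub>T\<^esub> (N #>\<^bsub>F\<^esub> d)"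
proof -
  have "(N #>\<^bsub>F\<^esub> (c - d)) \<oplus>\<^bsub>T\<^esub> (N #>\<^bsub>F\<^esub> d) = N #>\<^bsub>F\<^esub> c"
    using coset_add[of "c - d" d] assms by (simp add: F_closed)
  then show ?thesis
    using assms by (intro T.eq_minusI) (simp_all add: F_closed coset_in_tensor)
qed

lemma tens_closed: "\<lbrakk>x \<in> carrier X; y \<in> carrier Y\<rbrakk> \<Longrightarrow> tens x y \<in> carrier T"
  by (simp add: tens_def coset_in_tensor F_closed)

lemma tens_add_left:
  assumes "x \<in> carrier X" "x' \<in> carrier X" "y \<in> carrier Y"
  shows "tens (x \<oplus>\<^bsub>X\<^esub> x') y = tens x y \<oplus>\<^bsub>T\<^esub> tens x' y"
proof -
  have "frag_of (x \<oplus>\<^bsub>X\<^esub> x', y) - frag_of (x, y) - frag_of (x', y) \<in> relators"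
    unfolding relators_def using assms by blast
  then have "frag_of (x \<oplus>\<^bsub>X\<^esub> x', y) - (frag_of (x, y) + frag_of (x', y)) \<in> N"
    using relators_in_N by (auto simp: algebra_simps)
  then show ?thesis
    using assms by (simp add: tens_def F_closed coset_eqI flip: coset_add)
qed

lemma tens_add_right:
  assumes "x \<in> carrier X" "y \<in> carrier Y" "y' \<in> carrier Y"
  shows "tens x (y \<oplus>\<^bsub>Y\<^esub> y') = tens x y \<oplus>\<^bsub>T\<^esub> tens x y'"
proof -
  have "frag_of (x, y \<oplus>\<^bsub>Y\<^esub> y') - frag_of (x, y) - frag_of (x, y') \<in> relators"
    unfolding relators_def using assms by blast
  then have "frag_of (x, y \<oplus>\<^bsub>Y\<^esub> y') - (frag_of (x, y) + frag_of (x, y')) \<in> N"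
    using relators_in_N by (auto simp: algebra_simps)
  then show ?thesis
    using assms by (simp add: tens_def F_closed coset_eqI flip: coset_add)
qed

lemma tens_balanced:
  assumes "x \<in> carrier X" "a \<in> carrier A" "y \<in> carrier Y"
  shows "tens (ract X x a) y = tens x (lact Y a y)"
proof -
  have "frag_of (ract X x a, y) - frag_of (x, lact Y a y) \<in> relators"
    unfolding relators_def using assms by blast
  then show ?thesis
    using assms relators_in_N unfolding tens_def
    by (intro coset_eqI) (auto intro!: F_closed X.ract_closed Y.lact_closed)
qed

lemma tens_zero_right:
  assumes "x \<in> carrier X" shows "tens x \<zero>\<^bsub>Y\<^esub> = \<zero>\<^bsub>T\<^esub>"
  using tens_add_right[of x "\<zero>\<^bsub>Y\<^esub>" "\<zero>\<^bsub>Y\<^esub>"] tens_closed[of x "\<zero>\<^bsub>Y\<^esub>"] assms by simp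

lemma tens_minus_left:
  assumes "x \<in> carrier X" "x' \<in> carrier X" "y \<in> carrier Y"
  shows "tens (x \<ominus>\<^bsub>X\<^esub> x') y = tens x y \<ominus>\<^bsub>T\<^esub> tens x' y"
proof -
  have "x \<ominus>\<^bsub>X\<^esub> x' \<oplus>\<^bsub>X\<^esub> x' = x"
    using assms by (simp add: X.minus_eq X.a_assoc X.l_neg)
  then have "tens (x \<ominus>\<^bsub>X\<^esub> x') y \<oplus>\<^bsub>T\<^esub> tens x' y = tens x y"
    using tens_add_left[of "x \<ominus>\<^bsub>X\<^esub> x'" x' y] assms by simp
  then show ?thesis
    using assms by (intro T.eq_minusI) (simp_all add: tens_closed)
qed

lemma tensor_induct [consumes 1, case_names zero tens minus]:
  assumes "z \<in> carrier T" "P \<zero>\<^bsub>T\<^esub>"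
    and "\<And>x y. \<lbrakk>x \<in> carrier X; y \<in> carrier Y\<rbrakk> \<Longrightarrow> P (tens x y)"
    and "\<And>u v. \<lbrakk>u \<in> carrier T; v \<in> carrier T; P u; P v\<rbrakk> \<Longrightarrow> P (u \<ominus>\<^bsub>T\<^esub> v)"
  shows "P z"
proof -
  obtain c where c: "c \<in> carrier F" "z = N #>\<^bsub>F\<^esub> c"
    using tensor_coset assms(1) by blast
  have "c \<in> carrier F \<and> P (N #>\<^bsub>F\<^esub> c)"
    using c(1)[unfolded carrier_F]
  proof (induction c rule: frag_induction)
    case zero
    have "N #>\<^bsub>F\<^esub> 0 = \<zero>\<^bsub>T\<^esub>"
      by (simp add: tensor_simps) (metis F.coset_mult_one N.subset)
    then show ?case using assms(2) F_closed by simp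
  next
    case (one p)
    then show ?case using assms(3) by (cases p) (auto simp: tens_def F_closed)
  next
    case (diff a b)
    then show ?case using assms(4) by (simp add: F_closed coset_minus coset_in_tensor)
  qed
  then show ?thesis using c(2) by simp
qed

lemma tensor_hom_trivial:
  assumes "abelian_group H" "h \<in> hom (add_monoid T) (add_monoid H)"
    and "\<And>x y. \<lbrakk>x \<in> carrier X; y \<in> carrier Y\<rbrakk> \<Longrightarrow> h (tens x y) = \<zero>\<^bsub>H\<^esub>" and "z \<in> carrier T"
  shows "h z = \<zero>\<^bsub>H\<^esub>"
proof -
  interpret H: abelian_group H by fact
  have h_add: "h (u \<oplus>\<^bsub>T\<^esub> v) = h u \<oplus>\<^bsub>H\<^esub> h v" if "u \<in> carrier T" "v \<in> carrier T" for u v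
    using assms(2) that by (auto simp: hom_def)
  have h_in: "h u \<in> carrier H" if "u \<in> carrier T" for u
    using assms(2) that by (auto simp: hom_def)
  show ?thesis
    using assms(4)
  proof (induction z rule: tensor_induct)
    case zero
    show ?case
      using h_add[of "\<zero>\<^bsub>T\<^esub>" "\<zero>\<^bsub>T\<^esub>"] h_in[of "\<zero>\<^bsub>T\<^esub>"] by simp
  next
    case (minus u v)
    then show ?case
      using hom_minus[OF T.abelian_group_axioms assms(1,2)] by (simp add: H.minus_eq)
  qed (simp add: assms(3))
qed

text \<open>
  The universal property comes from that of the free abelian group: the relators lie in the kernel
  of the extension of \<open>\<psi>\<close> to formal sums, hence so does the subgroup that they generate.
\<close>

lemma tensor_universal:
  assumes "abelian_group H"
    and closed: "\<And>x y. \<lbrakk>x \<in> carrier X; y \<in> carrier Y\<rbrakk> \<Longrightarrow> \<psi> x y \<in> carrier H"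
    and add_left: "\<And>x x' y. \<lbrakk>x \<in> carrier X; x' \<in> carrier X; y \<in> carrier Y\<rbrakk>
      \<Longrightarrow> \<psi> (x \<oplus>\<^bsub>X\<^esub> x') y = \<psi> x y \<oplus>\<^bsub>H\<^esub> \<psi> x' y"
    and add_right: "\<And>x y y'. \<lbrakk>x \<in> carrier X; y \<in> carrier Y; y' \<in> carrier Y\<rbrakk>
      \<Longrightarrow> \<psi> x (y \<oplus>\<^bsub>Y\<^esub> y') = \<psi> x y \<oplus>\<^bsub>H\<^esub> \<psi> x y'"
    and balanced: "\<And>x a y. \<lbrakk>x \<in> carrier X; a \<in> carrier A; y \<in> carrier Y\<rbrakk>
      \<Longrightarrow> \<psi> (ract X x a) y = \<psi> x (lact Y a y)"
  obtains h where "h \<in> hom (add_monoid T) (add_monoid H)"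
    "\<And>x y. \<lbrakk>x \<in> carrier X; y \<in> carrier Y\<rbrakk> \<Longrightarrow> h (tens x y) = \<psi> x y"
proof -
  interpret H: abelian_group H by fact
  have "(\<lambda>(x, y). \<psi> x y) ` (carrier X \<times> carrier Y) \<subseteq> carrier (add_monoid H)"
    using closed by auto
  then obtain k where k: "k \<in> hom F (add_monoid H)"
    and kv: "\<And>p. p \<in> carrier X \<times> carrier Y \<Longrightarrow> k (frag_of p) = (\<lambda>(x, y). \<psi> x y) p"
    using comm_group.free_Abelian_group_universal[OF H.a_comm_group] by blast
  interpret k: group_hom F "add_monoid H" k
    using k by (simp add: group_hom_def group_hom_axioms_def F.group_axioms H.a_group)
  have k_frag: "k (frag_of (x, y)) = \<psi> x y" if "x \<in> carrier X" "y \<in> carrier Y" for x y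
    using kv[of "(x, y)"] that by simp
  have k_add: "k (c + d) = k c \<oplus>\<^bsub>H\<^esub> k d" if "c \<in> carrier F" "d \<in> carrier F" for c d
    using k.hom_mult[OF that] by simp
  have k_in: "k c \<in> carrier H" if "c \<in> carrier F" for c
    using k.hom_closed[OF that] by simp
  have k_diff: "k (c - d) = \<zero>\<^bsub>H\<^esub>" if "c \<in> carrier F" "d \<in> carrier F" "k c = k d" for c d
  proof -
    have "k (c - d) \<oplus>\<^bsub>H\<^esub> k d = k d"
      using k_add[of "c - d" d] that by (simp add: F_closed)
    then show ?thesis
      using that k_in F_closed by (metis H.add.r_cancel_one)
  qed
  have "relators \<subseteq> kernel F (add_monoid H) k"
  proof
    fix u assume u: "u \<in> relators"
    then consider (l) x x' y where "u = frag_of (x \<oplus>\<^bsub>X\<^esub> x', y) - (frag_of (x, y) + frag_of (x', y))"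
        "x \<in> carrier X" "x' \<in> carrier X" "y \<in> carrier Y"
      | (r) x y y' where "u = frag_of (x, y \<oplus>\<^bsub>Y\<^esub> y') - (frag_of (x, y) + frag_of (x, y'))"
        "x \<in> carrier X" "y \<in> carrier Y" "y' \<in> carrier Y"
      | (b) x a y where "u = frag_of (ract X x a, y) - frag_of (x, lact Y a y)"
        "x \<in> carrier X" "a \<in> carrier A" "y \<in> carrier Y"
      unfolding relators_def by (auto simp: algebra_simps)
    then have "k u = \<zero>\<^bsub>H\<^esub>"
    proof cases
      case l
      then show ?thesis
        by (auto intro!: k_diff F_closed simp: k_add F_closed k_frag add_left)
    next
      case r
      then show ?thesis
        by (auto intro!: k_diff F_closed simp: k_add F_closed k_frag add_right)
    next
      case b
      then show ?thesis
        by (auto intro!: k_diff F_closed X.ract_closed Y.lact_closed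
            simp: k_frag X.ract_closed Y.lact_closed balanced)
    qed
    then show "u \<in> kernel F (add_monoid H) k"
      using u relators_in_F by (auto simp: kernel_def)
  qed
  then have "N \<subseteq> kernel F (add_monoid H) k"
    unfolding relations_eq by (rule F.generate_subgroup_incl[OF _ k.subgroup_kernel])
  then obtain h where h: "h \<in> hom (F Mod N) (add_monoid H)"
    and hv: "\<And>c. c \<in> carrier F \<Longrightarrow> h (N #>\<^bsub>F\<^esub> c) = k c"
    using k.FactGroup_universal_kernel[OF N.normal_axioms] by blast
  show thesis
  proof
    show "h \<in> hom (add_monoid T) (add_monoid H)"
      using h by (simp add: hom_def tensor_simps FactGroup_def)
    show "h (tens x y) = \<psi> x y" if "x \<in> carrier X" "y \<in> carrier Y" for x y
      using hv[of "frag_of (x, y)"] that by (simp add: tens_def F_closed k_frag)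
  qed
qed

text \<open>
  The action of \<open>b\<close> on formal sums. It maps relators to relators, since the two actions on \<open>Y\<close>
  commute, and so descends to the tensor product.
\<close>

definition ext :: "'b \<Rightarrow> ('v \<times> 'w \<Rightarrow>\<^sub>0 int) \<Rightarrow> ('v \<times> 'w \<Rightarrow>\<^sub>0 int)" where
  "ext b = frag_extend (\<lambda>(x, y). frag_of (x, ract Y y b))"

lemma ext_simps: "ext b (frag_of (x, y)) = frag_of (x, ract Y y b)" "ext b 0 = 0"
  "ext b (c + d) = ext b c + ext b d" "ext b (c - d) = ext b c - ext b d" "ext b (- c) = - ext b c"
  by (simp_all add: ext_def frag_extend_add frag_extend_diff frag_extend_minus)

lemma ext_closed:
  assumes b: "b \<in> carrier B" and c: "c \<in> carrier F" shows "ext b c \<in> carrier F"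
  using c[unfolded carrier_F]
  by (induction c rule: frag_induction) (auto simp: ext_simps intro!: F_closed Y.ract_closed b)

lemma ext_relations:
  assumes b: "b \<in> carrier B" and c: "c \<in> N" shows "ext b c \<in> N"
  using c[unfolded relations_eq]
proof (induction c rule: generate.induct)
  case one
  then show ?case using N.one_closed by (simp add: ext_simps)
next
  have *: "ext b u \<in> relators" if "u \<in> relators" for u
    using that[unfolded relators_def]
  proof (elim UnE CollectE exE conjE)
    fix x x' y assume "u = frag_of (x \<oplus>\<^bsub>X\<^esub> x', y) - frag_of (x, y) - frag_of (x', y)"
      "x \<in> carrier X" "x' \<in> carrier X" "y \<in> carrier Y"
    then have "ext b u = frag_of (x \<oplus>\<^bsub>X\<^esub> x', ract Y y b) - frag_of (x, ract Y y b)
        - frag_of (x', ract Y y b)" "ract Y y b \<in> carrier Y"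
      by (auto simp: ext_simps intro!: Y.ract_closed b)
    then show ?thesis
      unfolding relators_def using \<open>x \<in> carrier X\<close> \<open>x' \<in> carrier X\<close> by blast
  next
    fix x y y' assume "u = frag_of (x, y \<oplus>\<^bsub>Y\<^esub> y') - frag_of (x, y) - frag_of (x, y')"
      "x \<in> carrier X" "y \<in> carrier Y" "y' \<in> carrier Y"
    then have "ext b u = frag_of (x, ract Y y b \<oplus>\<^bsub>Y\<^esub> ract Y y' b) - frag_of (x, ract Y y b)
        - frag_of (x, ract Y y' b)" "ract Y y b \<in> carrier Y" "ract Y y' b \<in> carrier Y"
      by (auto simp: ext_simps Y.ract_add b intro!: Y.ract_closed)
    then show ?thesis
      unfolding relators_def using \<open>x \<in> carrier X\<close> by blast
  next
    fix x a y assume "u = frag_of (ract X x a, y) - frag_of (x, lact Y a y)"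
      "x \<in> carrier X" "a \<in> carrier A" "y \<in> carrier Y"
    then have "ext b u = frag_of (ract X x a, ract Y y b) - frag_of (x, lact Y a (ract Y y b))"
      "ract Y y b \<in> carrier Y"
      by (auto simp: ext_simps Y.lact_ract b intro!: Y.ract_closed)
    then show ?thesis
      unfolding relators_def using \<open>x \<in> carrier X\<close> \<open>a \<in> carrier A\<close> by blast
  qed
  case (incl h)
  then show ?case using * relators_in_N by blast
  case (inv h)
  have "- ext b h \<in> N"
    using *[OF inv] relators_in_N relators_in_F N.m_inv_closed[of "ext b h"] inv_F[of "ext b h"] by auto
  then show ?case
    using inv relators_in_F by (simp add: inv_F subset_iff ext_simps)
next
  case (eng h1 h2)
  then show ?case using N.m_closed by (auto simp: ext_simps free_Abelian_group_def)
qed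

lemma ract_coset:
  assumes b: "b \<in> carrier B" and c: "c \<in> carrier F"
  shows "ract T (N #>\<^bsub>F\<^esub> c) b = N #>\<^bsub>F\<^esub> ext b c"
proof -
  have "ract T (N #>\<^bsub>F\<^esub> c) b = N <#>\<^bsub>F\<^esub> ext b ` (N #>\<^bsub>F\<^esub> c)"
    by (simp add: tensor_def Let_def ext_def)
  also have "\<dots> = N #>\<^bsub>F\<^esub> ext b c"
  proof (intro equalityI subsetI)
    fix u assume "u \<in> N <#>\<^bsub>F\<^esub> ext b ` (N #>\<^bsub>F\<^esub> c)"
    then obtain n n' where "n \<in> N" "n' \<in> N" "u = n + ext b (n' + c)"
      by (auto simp: set_mult_def r_coset_def)
    then show "u \<in> N #>\<^bsub>F\<^esub> ext b c"
      using N.m_closed[of n "ext b n'"] ext_relations[OF b]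
      by (auto simp: r_coset_def ext_simps add.assoc intro!: bexI[of _ "n + ext b n'"])
  next
    fix u assume "u \<in> N #>\<^bsub>F\<^esub> ext b c"
    then obtain n where "n \<in> N" "u = n + ext b (0 + c)"
      by (auto simp: r_coset_def)
    then show "u \<in> N <#>\<^bsub>F\<^esub> ext b ` (N #>\<^bsub>F\<^esub> c)"
      using N.one_closed by (simp add: set_mult_def r_coset_def) (metis add_0)
  qed
  finally show ?thesis .
qed

lemma ract_tens:
  "\<lbrakk>x \<in> carrier X; y \<in> carrier Y; b \<in> carrier B\<rbrakk> \<Longrightarrow> ract T (tens x y) b = tens x (ract Y y b)"
  by (simp add: tens_def ract_coset F_closed ext_simps)

lemma ract_tensor_hom:
  assumes b: "b \<in> carrier B"
  shows "(\<lambda>z. ract T z b) \<in> hom (add_monoid T) (add_monoid T)"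
proof (rule homI)
  fix z assume "z \<in> carrier (add_monoid T)"
  then show "ract T z b \<in> carrier (add_monoid T)"
    by (auto elim!: tensor_coset simp: ract_coset b coset_in_tensor ext_closed)
next
  fix z z' assume "z \<in> carrier (add_monoid T)" "z' \<in> carrier (add_monoid T)"
  then obtain c c' where "c \<in> carrier F" "z = N #>\<^bsub>F\<^esub> c" "c' \<in> carrier F" "z' = N #>\<^bsub>F\<^esub> c'"
    by (auto elim!: tensor_coset)
  then show "ract T (z \<otimes>\<^bsub>add_monoid T\<^esub> z') b = ract T z b \<otimes>\<^bsub>add_monoid T\<^esub> ract T z' b"
    by (simp add: ract_coset b F_closed ext_closed ext_simps flip: coset_add)
qed

lemma ract_zero:
  assumes "b \<in> carrier B" shows "ract T \<zero>\<^bsub>T\<^esub> b = \<zero>\<^bsub>T\<^esub>"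
  using hom_one[OF ract_tensor_hom[OF assms] T.a_group T.a_group] by simp

end

section \<open>The bimodule e(B/J)\<close>

text \<open>
  The quotient \<open>eB/eJ\<close> for an arbitrary ring \<open>B\<close>, with a ring \<open>A\<close> acting on the left through \<open>\<iota>\<close>. It is
  built in the same way as \<^const>\<open>layer\<close>, so that the layers of the Brauer algebra are instances
  on the nose.
\<close>

definition corner_bimodule ::
    "('b, 'm) ring_scheme \<Rightarrow> 'b set \<Rightarrow> 'b \<Rightarrow> ('a \<Rightarrow> 'b) \<Rightarrow> ('b set, 'b, 'a) bimodule" where
  "corner_bimodule B J e \<iota> =
    (let E = B\<lparr>carrier := e <#\<^bsub>B\<^esub> carrier B\<rparr>; I = e <#\<^bsub>B\<^esub> J
     in \<lparr>carrier = a_rcosets\<^bsub>E\<^esub> I,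
         monoid.mult = undefined, one = undefined,
         ring.zero = I,
         ring.add = (\<lambda>X Y. X <+>\<^bsub>E\<^esub> Y),
         ract = (\<lambda>X b. I <+>\<^bsub>E\<^esub> (X #>\<^bsub>B\<^esub> b)),
         lact = (\<lambda>a X. I <+>\<^bsub>E\<^esub> (\<iota> a <#\<^bsub>B\<^esub> X))\<rparr>)"

locale corner = A: ring A + B: ring B + J: ideal J B
  for A :: "('a, 'm) ring_scheme" and B :: "('b, 'q) ring_scheme" and J +
  fixes \<iota> :: "'a \<Rightarrow> 'b" and e :: 'b
  assumes \<iota>_closed: "a \<in> carrier A \<Longrightarrow> \<iota> a \<in> carrier B"
    and \<iota>_add: "\<lbrakk>a \<in> carrier A; a' \<in> carrier A\<rbrakk> \<Longrightarrow> \<iota> (a \<oplus>\<^bsub>A\<^esub> a') = \<iota> a \<oplus>\<^bsub>B\<^esub> \<iota> a'"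
    and \<iota>_mult: "\<lbrakk>a \<in> carrier A; a' \<in> carrier A\<rbrakk> \<Longrightarrow> \<iota> (a \<otimes>\<^bsub>A\<^esub> a') = \<iota> a \<otimes>\<^bsub>B\<^esub> \<iota> a'"
    and \<iota>_one: "\<iota> \<one>\<^bsub>A\<^esub> = e"
begin

definition I where "I = e <#\<^bsub>B\<^esub> J"
definition L where "L = corner_bimodule B J e \<iota>"
definition cls where "cls w = I +>\<^bsub>B\<^esub> w"
definition eB where "eB = {w \<in> carrier B. e \<otimes>\<^bsub>B\<^esub> w = w}"

lemma e_closed: "e \<in> carrier B"
  using \<iota>_closed[OF A.one_closed] by (simp add: \<iota>_one)

lemma \<iota>_e:
  assumes "a \<in> carrier A" shows "e \<otimes>\<^bsub>B\<^esub> \<iota> a = \<iota> a" "\<iota> a \<otimes>\<^bsub>B\<^esub> e = \<iota> a"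
  using \<iota>_mult[OF A.one_closed assms] \<iota>_mult[OF assms A.one_closed] assms by (simp_all add: \<iota>_one)

lemma e_idem: "e \<otimes>\<^bsub>B\<^esub> e = e"
  using \<iota>_e[OF A.one_closed] by (simp add: \<iota>_one)

lemma eB_eq: "e <#\<^bsub>B\<^esub> carrier B = eB"
proof
  show "e <#\<^bsub>B\<^esub> carrier B \<subseteq> eB"
    by (auto simp: l_coset_def eB_def e_closed e_idem simp flip: B.m_assoc)
  show "eB \<subseteq> e <#\<^bsub>B\<^esub> carrier B"
    by (force simp: l_coset_def eB_def)
qed

lemma I_eq: "I = J \<inter> eB"
proof
  show "I \<subseteq> J \<inter> eB"
    unfolding I_def
    by (auto simp: l_coset_def eB_def e_closed e_idem J.Icarr J.I_l_closed simp flip: B.m_assoc)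
  show "J \<inter> eB \<subseteq> I"
    by (force simp: l_coset_def eB_def I_def)
qed

lemma eB_closed:
  "w \<in> eB \<Longrightarrow> w \<in> carrier B" "e \<in> eB" "a \<in> carrier A \<Longrightarrow> \<iota> a \<in> eB"
  "w \<in> eB \<Longrightarrow> w' \<in> eB \<Longrightarrow> w \<oplus>\<^bsub>B\<^esub> w' \<in> eB" "w \<in> eB \<Longrightarrow> w' \<in> eB \<Longrightarrow> w \<ominus>\<^bsub>B\<^esub> w' \<in> eB"
  "w \<in> eB \<Longrightarrow> \<ominus>\<^bsub>B\<^esub> w \<in> eB"
  "w \<in> eB \<Longrightarrow> b \<in> carrier B \<Longrightarrow> w \<otimes>\<^bsub>B\<^esub> b \<in> eB" "\<zero>\<^bsub>B\<^esub> \<in> eB"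
  "a \<in> carrier A \<Longrightarrow> w \<in> eB \<Longrightarrow> \<iota> a \<otimes>\<^bsub>B\<^esub> w \<in> eB"
  by (auto simp: eB_def e_closed e_idem \<iota>_closed \<iota>_e B.r_distr B.minus_eq B.r_minus simp flip: B.m_assoc)

sublocale I: additive_subgroup I B
proof (rule additive_subgroup.intro, rule subgroup.intro)
  fix x y assume "x \<in> I" "y \<in> I"
  then show "x \<otimes>\<^bsub>add_monoid B\<^esub> y \<in> I"
    by (simp add: I_eq eB_closed)
next
  fix x assume "x \<in> I"
  then have "\<ominus>\<^bsub>B\<^esub> x \<in> I"
    using J.a_inv_closed by (auto simp: I_eq eB_closed)
  then show "inv\<^bsub>add_monoid B\<^esub> x \<in> I"
    by (simp add: a_inv_def)
qed (auto simp: I_eq eB_closed J.zero_closed)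

sublocale I: abelian_subgroup I B
  by (rule abelian_subgroupI3) unfold_locales

lemma cls_eq_iff:
  assumes "w \<in> eB" "w' \<in> eB" shows "cls w = cls w' \<longleftrightarrow> w \<ominus>\<^bsub>B\<^esub> w' \<in> J"
proof -
  have "w \<ominus>\<^bsub>B\<^esub> w' \<in> J \<longleftrightarrow> w \<ominus>\<^bsub>B\<^esub> w' \<in> I"
    using assms by (auto simp: I_eq eB_closed)
  also have "\<dots> \<longleftrightarrow> w \<in> cls w'"
    unfolding cls_def B.minus_eq using I.a_rcos_module[of w' w] assms by (simp add: eB_closed)
  also have "\<dots> \<longleftrightarrow> cls w = cls w'"
    unfolding cls_def using assms
    by (metis I.a_repr_independence' I.a_rcos_self eB_closed(1))
  finally show ?thesis by simp
qed

lemma carrier_L: "carrier L = cls ` eB"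
  by (auto simp: L_def corner_bimodule_def Let_def A_RCOSETS_def RCOSETS_def eB_eq
      cls_def I_def a_r_coset_def r_coset_def)

lemma zero_L: "\<zero>\<^bsub>L\<^esub> = cls \<zero>\<^bsub>B\<^esub>"
  by (simp add: L_def corner_bimodule_def Let_def cls_def B.a_coset_add_zero[OF I.a_subset] flip: I_def)

lemma set_add_B: "X <+>\<^bsub>B\<lparr>carrier := C\<rparr>\<^esub> Y = X <+>\<^bsub>B\<^esub> Y"
  by (simp add: set_add_def set_mult_def)

lemma add_L: "w \<in> eB \<Longrightarrow> w' \<in> eB \<Longrightarrow> cls w \<oplus>\<^bsub>L\<^esub> cls w' = cls (w \<oplus>\<^bsub>B\<^esub> w')"
  by (simp add: L_def corner_bimodule_def Let_def cls_def I.a_rcos_sum eB_closed set_add_B)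

lemma ract_L:
  assumes w: "w \<in> eB" and b: "b \<in> carrier B"
  shows "ract L (cls w) b = cls (w \<otimes>\<^bsub>B\<^esub> b)"
proof -
  have "ract L (cls w) b = I <+>\<^bsub>B\<^esub> (cls w #>\<^bsub>B\<^esub> b)"
    by (simp add: L_def corner_bimodule_def Let_def set_add_B flip: I_def)
  also have "\<dots> = cls (w \<otimes>\<^bsub>B\<^esub> b)"
  proof (intro equalityI subsetI)
    fix u assume "u \<in> I <+>\<^bsub>B\<^esub> (cls w #>\<^bsub>B\<^esub> b)"
    then obtain i i' where i: "i \<in> I" "i' \<in> I" "u = i \<oplus>\<^bsub>B\<^esub> (i' \<oplus>\<^bsub>B\<^esub> w) \<otimes>\<^bsub>B\<^esub> b"
      by (auto simp: set_add_def' r_coset_def cls_def a_r_coset_def')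
    then have "u = (i \<oplus>\<^bsub>B\<^esub> i' \<otimes>\<^bsub>B\<^esub> b) \<oplus>\<^bsub>B\<^esub> w \<otimes>\<^bsub>B\<^esub> b" "i' \<otimes>\<^bsub>B\<^esub> b \<in> I"
      using w b by (auto simp: B.l_distr I.a_Hcarr eB_closed B.a_assoc I_eq J.I_r_closed)
    then show "u \<in> cls (w \<otimes>\<^bsub>B\<^esub> b)"
      using i by (auto simp: cls_def a_r_coset_def')
  next
    fix u assume "u \<in> cls (w \<otimes>\<^bsub>B\<^esub> b)"
    then obtain i where "i \<in> I" "u = i \<oplus>\<^bsub>B\<^esub> (\<zero>\<^bsub>B\<^esub> \<oplus>\<^bsub>B\<^esub> w) \<otimes>\<^bsub>B\<^esub> b"
      using w by (auto simp: cls_def a_r_coset_def' eB_closed)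
    then show "u \<in> I <+>\<^bsub>B\<^esub> (cls w #>\<^bsub>B\<^esub> b)"
      unfolding set_add_def' r_coset_def cls_def a_r_coset_def' using I.zero_closed by blast
  qed
  finally show ?thesis .
qed

lemma lact_L:
  assumes w: "w \<in> eB" and a: "a \<in> carrier A"
  shows "lact L a (cls w) = cls (\<iota> a \<otimes>\<^bsub>B\<^esub> w)"
proof -
  have "lact L a (cls w) = I <+>\<^bsub>B\<^esub> (\<iota> a <#\<^bsub>B\<^esub> cls w)"
    by (simp add: L_def corner_bimodule_def Let_def set_add_B flip: I_def)
  also have "\<dots> = cls (\<iota> a \<otimes>\<^bsub>B\<^esub> w)"
  proof (intro equalityI subsetI)
    fix u assume "u \<in> I <+>\<^bsub>B\<^esub> (\<iota> a <#\<^bsub>B\<^esub> cls w)"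
    then obtain i i' where i: "i \<in> I" "i' \<in> I" "u = i \<oplus>\<^bsub>B\<^esub> \<iota> a \<otimes>\<^bsub>B\<^esub> (i' \<oplus>\<^bsub>B\<^esub> w)"
      by (auto simp: set_add_def' l_coset_def cls_def a_r_coset_def')
    then have "u = (i \<oplus>\<^bsub>B\<^esub> \<iota> a \<otimes>\<^bsub>B\<^esub> i') \<oplus>\<^bsub>B\<^esub> \<iota> a \<otimes>\<^bsub>B\<^esub> w" "\<iota> a \<otimes>\<^bsub>B\<^esub> i' \<in> I"
      using w a by (auto simp: B.r_distr I.a_Hcarr eB_closed B.a_assoc I_eq J.I_l_closed \<iota>_closed)
    then show "u \<in> cls (\<iota> a \<otimes>\<^bsub>B\<^esub> w)"
      using i by (auto simp: cls_def a_r_coset_def')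
  next
    fix u assume "u \<in> cls (\<iota> a \<otimes>\<^bsub>B\<^esub> w)"
    then obtain i where "i \<in> I" "u = i \<oplus>\<^bsub>B\<^esub> \<iota> a \<otimes>\<^bsub>B\<^esub> (\<zero>\<^bsub>B\<^esub> \<oplus>\<^bsub>B\<^esub> w)"
      using w by (auto simp: cls_def a_r_coset_def' eB_closed)
    then show "u \<in> I <+>\<^bsub>B\<^esub> (\<iota> a <#\<^bsub>B\<^esub> cls w)"
      unfolding set_add_def' l_coset_def cls_def a_r_coset_def' using I.zero_closed by blast
  qed
  finally show ?thesis .
qed

lemma bimod_L: "bimod A B L"
proof (rule bimod.intro)
  show "abelian_group L"
  proof (rule abelian_groupI)
    fix x assume "x \<in> carrier L"
    then obtain w where "x = cls w" "w \<in> eB"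
      by (auto simp: carrier_L)
    then show "\<exists>y\<in>carrier L. y \<oplus>\<^bsub>L\<^esub> x = \<zero>\<^bsub>L\<^esub>"
      by (intro bexI[of _ "cls (\<ominus>\<^bsub>B\<^esub> w)"]) (auto simp: add_L zero_L carrier_L eB_closed B.l_neg)
  qed (auto simp: carrier_L add_L zero_L eB_closed B.a_ac)
qed (auto simp: carrier_L add_L ract_L lact_L eB_closed B.l_distr B.m_assoc \<iota>_closed)

lemma \<epsilon>_in_L: "cls e \<in> carrier L"
  by (simp add: carrier_L eB_closed)

lemma ract_\<epsilon>: "w \<in> eB \<Longrightarrow> ract L (cls e) w = cls w"
  by (simp add: ract_L eB_closed) (simp add: eB_def)

end

lemma zero_right_module_hom:
  assumes "abelian_group M'" and "\<And>b. b \<in> carrier B \<Longrightarrow> ract M' \<zero>\<^bsub>M'\<^esub> b = \<zero>\<^bsub>M'\<^esub>"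
    and "\<And>x b. x \<in> carrier M \<Longrightarrow> b \<in> carrier B \<Longrightarrow> ract M x b \<in> carrier M" and "abelian_group M"
  shows "(\<lambda>x\<in>carrier M. \<zero>\<^bsub>M'\<^esub>) \<in> right_module_hom B M M'"
proof -
  interpret M: abelian_group M by fact
  interpret M': abelian_group M' by fact
  show ?thesis
    using assms by (auto simp: right_module_hom_def hom_def)
qed

text \<open>
  Induction of right modules along \<open>e(B/J)\<close>. The element \<open>\<epsilon>\<close> below is the class of the idempotent
  \<open>e\<close>; an induced module is generated by the elements \<open>x \<otimes> \<epsilon>\<close>.
\<close>

locale induced = corner A B J \<iota> e + X: right_mod A X
  for A :: "('a, 'm) ring_scheme" and B :: "('b, 'q) ring_scheme" and J and \<iota> :: "'a \<Rightarrow> 'b" and e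
    and X :: "('v, 'a, 'n) right_module_scheme"
begin

sublocale tensor_product A X B L
  by (intro tensor_product.intro X.right_mod_axioms bimod_L)

lemma ract_induced: "x \<in> carrier X \<Longrightarrow> w \<in> eB \<Longrightarrow> ract T (tens x (cls e)) w = tens x (cls w)"
  by (simp add: ract_tens \<epsilon>_in_L eB_closed ract_\<epsilon>)

text \<open>
  Since \<open>x \<otimes> w = (x \<otimes> \<epsilon>) w\<close>, the values of a homomorphism at the elements \<open>x \<otimes> \<epsilon>\<close> determine it.
\<close>

lemma induced_hom_determined:
  assumes f: "f \<in> right_module_hom B T M" and "abelian_group M"
    and zero: "\<And>b. b \<in> carrier B \<Longrightarrow> ract M \<zero>\<^bsub>M\<^esub> b = \<zero>\<^bsub>M\<^esub>"
    and "\<And>x. x \<in> carrier X \<Longrightarrow> f (tens x (cls e)) = \<zero>\<^bsub>M\<^esub>"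
  shows "f = (\<lambda>z\<in>carrier T. \<zero>\<^bsub>M\<^esub>)"
proof (rule extensionalityI)
  show "f \<in> extensional (carrier T)" using f by (simp add: right_module_hom_def)
  fix z assume z: "z \<in> carrier T"
  have "f z = \<zero>\<^bsub>M\<^esub>"
  proof (rule tensor_hom_trivial[OF assms(2) _ _ z])
    show "f \<in> hom (add_monoid T) (add_monoid M)" using f by (simp add: right_module_hom_def)
    fix x y assume x: "x \<in> carrier X" and "y \<in> carrier L"
    then obtain w where w: "w \<in> eB" "y = cls w" by (auto simp: carrier_L)
    have "f (tens x y) = f (ract T (tens x (cls e)) w)"
      using x w by (simp add: ract_induced)
    also have "\<dots> = ract M (f (tens x (cls e))) w"
      using f x w \<epsilon>_in_L by (auto simp: right_module_hom_def tens_closed eB_closed)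
    finally show "f (tens x y) = \<zero>\<^bsub>M\<^esub>"
      using assms(4) x w by (simp add: zero eB_closed)
  qed
  then show "f z = (\<lambda>z\<in>carrier T. \<zero>\<^bsub>M\<^esub>) z" using z by simp
qed simp

text \<open>For \<open>w \<in> eB\<close> and \<open>j \<in> J\<close> the product \<open>wj\<close> lies in \<open>J \<inter> eB = eJ\<close>.\<close>

lemma ract_ideal_zero:
  assumes j: "j \<in> J" and z: "z \<in> carrier T" shows "ract T z j = \<zero>\<^bsub>T\<^esub>"
proof -
  have jB: "j \<in> carrier B" using j J.Icarr by blast
  show ?thesis
  proof (rule tensor_hom_trivial[OF T.abelian_group_axioms ract_tensor_hom[OF jB] _ z])
    fix x y assume x: "x \<in> carrier X" and "y \<in> carrier L"
    then obtain w where w: "w \<in> eB" "y = cls w" by (auto simp: carrier_L)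
    have "w \<otimes>\<^bsub>B\<^esub> j \<ominus>\<^bsub>B\<^esub> \<zero>\<^bsub>B\<^esub> \<in> J"
      using w j jB J.I_l_closed by (simp add: eB_closed B.minus_eq)
    then have "ract L y j = \<zero>\<^bsub>L\<^esub>"
      using w jB by (simp add: ract_L zero_L cls_eq_iff eB_closed)
    then show "ract T (tens x y) j = \<zero>\<^bsub>T\<^esub>"
      using x \<open>y \<in> carrier L\<close> jB by (simp add: ract_tens tens_zero_right)
  qed
qed

end

text \<open>
  The generators satisfy \<open>x \<otimes> \<epsilon> = (x \<otimes> \<epsilon>) e\<close>, and \<open>e \<in> J'\<close> annihilates the target.
\<close>

lemma induced_hom_zero_of_ideal:
  assumes "induced A B J \<iota> e X" "induced A' B J' \<iota>' e' X'" and "e \<in> J'"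
  shows "right_module_hom B (tensor A X (corner_bimodule B J e \<iota>))
      (tensor A' X' (corner_bimodule B J' e' \<iota>'))
    \<subseteq> {\<lambda>z\<in>carrier (tensor A X (corner_bimodule B J e \<iota>)).
        \<zero>\<^bsub>tensor A' X' (corner_bimodule B J' e' \<iota>')\<^esub>}"
proof -
  interpret P: induced A B J \<iota> e X by fact
  interpret Q: induced A' B J' \<iota>' e' X' by fact
  let ?T = "tensor A X P.L" and ?T' = "tensor A' X' Q.L"
  have "f = (\<lambda>z\<in>carrier ?T. \<zero>\<^bsub>?T'\<^esub>)" if f: "f \<in> right_module_hom B ?T ?T'" for f
  proof (rule P.induced_hom_determined[OF f Q.T.abelian_group_axioms Q.ract_zero])
    fix x assume x: "x \<in> carrier X"
    have t: "P.tens x (P.cls e) \<in> carrier ?T"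
      using x by (simp add: P.tens_closed P.\<epsilon>_in_L)
    have "f (P.tens x (P.cls e)) = f (ract ?T (P.tens x (P.cls e)) e)"
      using x by (simp add: P.ract_induced P.eB_closed)
    also have "\<dots> = ract ?T' (f (P.tens x (P.cls e))) e"
      using f t P.e_closed by (auto simp: right_module_hom_def)
    also have "\<dots> = \<zero>\<^bsub>?T'\<^esub>"
      using f t by (intro Q.ract_ideal_zero assms(3)) (auto simp: right_module_hom_def hom_def)
    finally show "f (P.tens x (P.cls e)) = \<zero>\<^bsub>?T'\<^esub>" .
  qed
  then show ?thesis
    unfolding P.L_def Q.L_def by blast
qed

text \<open>
  If \<open>e B e\<close> is \<open>\<iota>(A)\<close> modulo \<open>J\<close> and \<open>\<iota>\<close> is injective modulo \<open>J\<close>, then \<open>A\<close>-module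
  homomorphisms are recovered from homomorphisms of induced modules by looking at the
  subgroup \<open>(X \<otimes> e(B/J)) e\<close>, which is a copy of \<open>X\<close>.
\<close>

locale full_corner = corner +
  assumes corner_generated: "b \<in> carrier B \<Longrightarrow> \<exists>a\<in>carrier A. e \<otimes>\<^bsub>B\<^esub> b \<otimes>\<^bsub>B\<^esub> e \<ominus>\<^bsub>B\<^esub> \<iota> a \<in> J"
    and \<iota>_inj: "\<lbrakk>a \<in> carrier A; \<iota> a \<in> J\<rbrakk> \<Longrightarrow> a = \<zero>\<^bsub>A\<^esub>"
begin

lemma \<iota>_minus:
  assumes "a \<in> carrier A" "a' \<in> carrier A" shows "\<iota> (a \<ominus>\<^bsub>A\<^esub> a') = \<iota> a \<ominus>\<^bsub>B\<^esub> \<iota> a'"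
proof -
  have "\<iota> (a \<ominus>\<^bsub>A\<^esub> a') \<oplus>\<^bsub>B\<^esub> \<iota> a' = \<iota> (a \<ominus>\<^bsub>A\<^esub> a' \<oplus>\<^bsub>A\<^esub> a')"
    using assms by (simp add: \<iota>_add)
  also have "a \<ominus>\<^bsub>A\<^esub> a' \<oplus>\<^bsub>A\<^esub> a' = a"
    using assms by (simp add: A.minus_eq A.a_assoc A.l_neg)
  finally show ?thesis
    using assms by (intro B.eq_minusI) (simp_all add: \<iota>_closed)
qed

lemma \<iota>_cls_inj:
  assumes "a \<in> carrier A" "a' \<in> carrier A" "cls (\<iota> a) = cls (\<iota> a')" shows "a = a'"
proof -
  have "a \<ominus>\<^bsub>A\<^esub> a' = \<zero>\<^bsub>A\<^esub>"
    using assms by (intro \<iota>_inj) (auto simp: \<iota>_minus cls_eq_iff eB_closed)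
  moreover have "a = a \<ominus>\<^bsub>A\<^esub> a' \<oplus>\<^bsub>A\<^esub> a'"
    using assms by (simp add: A.minus_eq A.a_assoc A.l_neg)
  ultimately show ?thesis using assms by simp
qed

text \<open>
  Right multiplication by \<open>e\<close> maps \<open>e(B/J)\<close> onto the classes of \<open>\<iota>(A)\<close>, a free \<open>A\<close>-module on \<open>\<epsilon>\<close>;
  \<open>coord\<close> is the coordinate with respect to \<open>\<epsilon>\<close>.
\<close>

definition coord where
  "coord y = (THE a. a \<in> carrier A \<and> ract L y e = cls (\<iota> a))"

lemma coord:
  assumes "y \<in> carrier L" shows "coord y \<in> carrier A" "ract L y e = cls (\<iota> (coord y))"
proof -
  obtain w where w: "w \<in> eB" "y = cls w" using assms by (auto simp: carrier_L)
  obtain a where a: "a \<in> carrier A" "e \<otimes>\<^bsub>B\<^esub> w \<otimes>\<^bsub>B\<^esub> e \<ominus>\<^bsub>B\<^esub> \<iota> a \<in> J"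
    using corner_generated[OF eB_closed(1)[OF w(1)]] by blast
  have "ract L y e = cls (\<iota> a)"
    using w a by (simp add: ract_L e_closed cls_eq_iff eB_closed) (simp add: eB_def)
  then have "\<exists>!a. a \<in> carrier A \<and> ract L y e = cls (\<iota> a)"
    using a \<iota>_cls_inj by metis
  from theI'[OF this] show "coord y \<in> carrier A" "ract L y e = cls (\<iota> (coord y))"
    unfolding coord_def by auto
qed

lemma coord_eqI:
  "\<lbrakk>y \<in> carrier L; a \<in> carrier A; ract L y e = cls (\<iota> a)\<rbrakk> \<Longrightarrow> coord y = a"
  using coord \<iota>_cls_inj by metis

lemma coord_add:
  assumes "y \<in> carrier L" "y' \<in> carrier L" shows "coord (y \<oplus>\<^bsub>L\<^esub> y') = coord y \<oplus>\<^bsub>A\<^esub> coord y'"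
proof -
  interpret L: bimod A B L by (rule bimod_L)
  interpret L: abelian_group L by (rule L.abelian_group)
  show ?thesis
    using assms coord[of y] coord[of y'] e_closed
    by (intro coord_eqI) (auto simp: L.ract_add \<iota>_add add_L eB_closed)
qed

lemma coord_lact:
  assumes "y \<in> carrier L" "a \<in> carrier A" shows "coord (lact L a y) = a \<otimes>\<^bsub>A\<^esub> coord y"
proof -
  interpret L: bimod A B L by (rule bimod_L)
  show ?thesis
    using assms coord[of y] e_closed
    by (intro coord_eqI) (auto simp: L.lact_ract L.lact_closed lact_L \<iota>_mult eB_closed)
qed

lemma coord_\<epsilon>: "coord (cls e) = \<one>\<^bsub>A\<^esub>"
  by (rule coord_eqI) (auto simp: \<epsilon>_in_L ract_\<epsilon> eB_closed \<iota>_one)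

end

locale induced_full = full_corner A B J \<iota> e + induced A B J \<iota> e X
  for A :: "('a, 'm) ring_scheme" and B :: "('b, 'q) ring_scheme" and J and \<iota> :: "'a \<Rightarrow> 'b" and e
    and X :: "('v, 'a, 'n) right_module_scheme"
begin

text \<open>
  The balanced map \<open>(x, y) \<mapsto> x \<cdot> coord y\<close> induces a left inverse of \<open>x \<mapsto> x \<otimes> \<epsilon>\<close>.
\<close>

lemma tens_\<epsilon>_inj:
  assumes "x \<in> carrier X" "x' \<in> carrier X" "tens x (cls e) = tens x' (cls e)" shows "x = x'"
proof -
  obtain h where h: "\<And>x y. x \<in> carrier X \<Longrightarrow> y \<in> carrier L \<Longrightarrow> h (tens x y) = ract X x (coord y)"
    by (rule tensor_universal[OF X.abelian_group_axioms, where \<psi> = "\<lambda>x y. ract X x (coord y)"])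
      (auto simp: coord X.ract_closed X.ract_add_left X.ract_add_right coord_add coord_lact X.ract_mult)
  have h_\<epsilon>: "h (tens u (cls e)) = u" if "u \<in> carrier X" for u
    using h[OF that \<epsilon>_in_L] that by (simp add: coord_\<epsilon> X.ract_one)
  show ?thesis
    using arg_cong[OF assms(3), of h] unfolding h_\<epsilon>[OF assms(1)] h_\<epsilon>[OF assms(2)] .
qed

text \<open>
  \<open>(x \<otimes> y) e = x \<otimes> (coord y) \<epsilon> = x \<cdot> coord y \<otimes> \<epsilon>\<close>.
\<close>

lemma ract_e:
  assumes "z \<in> carrier T" shows "\<exists>x\<in>carrier X. ract T z e = tens x (cls e)"
  using assms
proof (induction z rule: tensor_induct)
  case zero
  show ?case
    using tens_minus_left[of "\<zero>\<^bsub>X\<^esub>" "\<zero>\<^bsub>X\<^esub>" "cls e"]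
    by (intro bexI[of _ "\<zero>\<^bsub>X\<^esub>"])
      (auto simp: ract_zero e_closed \<epsilon>_in_L X.minus_eq T.minus_eq X.r_neg T.r_neg tens_closed)
next
  case (tens x y)
  have "ract T (tens x y) e = tens x (lact L (coord y) (cls e))"
    using tens by (simp add: ract_tens e_closed coord lact_L eB_closed \<iota>_e)
  then show ?case
    using tens by (intro bexI[of _ "ract X x (coord y)"])
      (auto simp: tens_balanced coord \<epsilon>_in_L X.ract_closed)
next
  case (minus u v)
  then obtain x x' where x: "x \<in> carrier X" "x' \<in> carrier X"
    "ract T u e = tens x (cls e)" "ract T v e = tens x' (cls e)" by blast
  have "ract T (u \<ominus>\<^bsub>T\<^esub> v) e = ract T u e \<ominus>\<^bsub>T\<^esub> ract T v e"
    using minus by (intro hom_minus[OF T.abelian_group_axioms T.abelian_group_axioms]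
        ract_tensor_hom e_closed)
  then show ?case
    using x by (intro bexI[of _ "x \<ominus>\<^bsub>X\<^esub> x'"]) (auto simp: tens_minus_left \<epsilon>_in_L)
qed

end

text \<open>
  The element \<open>f (x \<otimes> \<epsilon>) = f (x \<otimes> \<epsilon>) e\<close> has the form \<open>x' \<otimes> \<epsilon>\<close> for a unique \<open>x'\<close>, and \<open>g x = x'\<close>. The last
  conclusion expresses that \<open>f\<close> is determined by \<open>g\<close>.
\<close>

lemma induced_hom_restrict:
  assumes "induced_full A B J \<iota> e X" "induced_full A B J \<iota> e X'"
    and f: "f \<in> right_module_hom B (tensor A X (corner_bimodule B J e \<iota>))
      (tensor A X' (corner_bimodule B J e \<iota>))"
  obtains g where "\<And>x. x \<in> carrier X \<Longrightarrow> g x \<in> carrier X'"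
    "\<And>x x'. x \<in> carrier X \<Longrightarrow> x' \<in> carrier X \<Longrightarrow> g (x \<oplus>\<^bsub>X\<^esub> x') = g x \<oplus>\<^bsub>X'\<^esub> g x'"
    "\<And>x a. x \<in> carrier X \<Longrightarrow> a \<in> carrier A \<Longrightarrow> g (ract X x a) = ract X' (g x) a"
    "(\<And>x. x \<in> carrier X \<Longrightarrow> g x = \<zero>\<^bsub>X'\<^esub>) \<Longrightarrow>
      f = (\<lambda>z\<in>carrier (tensor A X (corner_bimodule B J e \<iota>)).
        \<zero>\<^bsub>tensor A X' (corner_bimodule B J e \<iota>)\<^esub>)"
proof -
  interpret P: induced_full A B J \<iota> e X by fact
  interpret Q: induced_full A B J \<iota> e X' by fact
  let ?T = "tensor A X P.L" and ?T' = "tensor A X' P.L" and ?\<epsilon> = "P.cls e"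
  note f = f[folded P.L_def]
  have f_add: "f (u \<oplus>\<^bsub>?T\<^esub> v) = f u \<oplus>\<^bsub>?T'\<^esub> f v" if "u \<in> carrier ?T" "v \<in> carrier ?T" for u v
    using f that by (auto simp: right_module_hom_def hom_def)
  have f_in: "f u \<in> carrier ?T'" if "u \<in> carrier ?T" for u
    using f that by (auto simp: right_module_hom_def hom_def)
  have f_ract: "f (ract ?T u b) = ract ?T' (f u) b" if "u \<in> carrier ?T" "b \<in> carrier B" for u b
    using f that by (auto simp: right_module_hom_def)
  have t: "P.tens x ?\<epsilon> \<in> carrier ?T" if "x \<in> carrier X" for x
    using that by (simp add: P.tens_closed P.\<epsilon>_in_L)
  have "\<exists>x'\<in>carrier X'. f (P.tens x ?\<epsilon>) = Q.tens x' ?\<epsilon>" if x: "x \<in> carrier X" for x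
  proof -
    have "f (P.tens x ?\<epsilon>) = f (ract ?T (P.tens x ?\<epsilon>) e)"
      using x by (simp add: P.ract_induced P.eB_closed)
    also have "\<dots> = ract ?T' (f (P.tens x ?\<epsilon>)) e"
      by (rule f_ract[OF t[OF x] P.e_closed])
    finally show ?thesis
      using Q.ract_e[OF f_in[OF t[OF x]]] by simp
  qed
  then obtain g where g: "\<And>x. x \<in> carrier X \<Longrightarrow> g x \<in> carrier X'"
    and fg: "\<And>x. x \<in> carrier X \<Longrightarrow> f (P.tens x ?\<epsilon>) = Q.tens (g x) ?\<epsilon>"
    by metis
  show thesis
  proof
    show "g x \<in> carrier X'" if "x \<in> carrier X" for x using g that .
    show "g (x \<oplus>\<^bsub>X\<^esub> x') = g x \<oplus>\<^bsub>X'\<^esub> g x'" if "x \<in> carrier X" "x' \<in> carrier X" for x x'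
    proof (rule Q.tens_\<epsilon>_inj)
      have "Q.tens (g (x \<oplus>\<^bsub>X\<^esub> x')) ?\<epsilon> = f (P.tens (x \<oplus>\<^bsub>X\<^esub> x') ?\<epsilon>)"
        using that by (intro fg[symmetric] P.X.a_closed)
      also have "\<dots> = f (P.tens x ?\<epsilon>) \<oplus>\<^bsub>?T'\<^esub> f (P.tens x' ?\<epsilon>)"
        using that P.\<epsilon>_in_L f_add[OF t t] by (simp add: P.tens_add_left)
      also have "\<dots> = Q.tens (g x \<oplus>\<^bsub>X'\<^esub> g x') ?\<epsilon>"
        using that g P.\<epsilon>_in_L by (simp add: fg Q.tens_add_left)
      finally show "Q.tens (g (x \<oplus>\<^bsub>X\<^esub> x')) ?\<epsilon> = Q.tens (g x \<oplus>\<^bsub>X'\<^esub> g x') ?\<epsilon>" .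
    qed (simp_all add: that g)
    show "g (ract X x a) = ract X' (g x) a" if x: "x \<in> carrier X" and a: "a \<in> carrier A" for x a
    proof (rule Q.tens_\<epsilon>_inj)
      have lact: "lact P.L a ?\<epsilon> = P.cls (\<iota> a)"
        using a by (simp add: P.lact_L P.eB_closed P.\<iota>_e)
      have "Q.tens (g (ract X x a)) ?\<epsilon> = f (P.tens x (lact P.L a ?\<epsilon>))"
        using x a fg[OF P.X.ract_closed[OF x a]] by (simp add: P.tens_balanced P.\<epsilon>_in_L)
      also have "\<dots> = f (ract ?T (P.tens x ?\<epsilon>) (\<iota> a))"
        using x a by (simp add: lact P.ract_induced P.eB_closed)
      also have "\<dots> = ract ?T' (Q.tens (g x) ?\<epsilon>) (\<iota> a)"
        using x a by (simp add: f_ract t P.\<iota>_closed fg)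
      also have "\<dots> = Q.tens (g x) (lact P.L a ?\<epsilon>)"
        using x a g by (simp add: lact Q.ract_induced P.eB_closed)
      also have "\<dots> = Q.tens (ract X' (g x) a) ?\<epsilon>"
        using x a g by (simp add: Q.tens_balanced P.\<epsilon>_in_L)
      finally show "Q.tens (g (ract X x a)) ?\<epsilon> = Q.tens (ract X' (g x) a) ?\<epsilon>" .
    qed (simp_all add: x a g P.X.ract_closed Q.X.ract_closed)
    assume g0: "\<And>x. x \<in> carrier X \<Longrightarrow> g x = \<zero>\<^bsub>X'\<^esub>"
    have "Q.tens \<zero>\<^bsub>X'\<^esub> ?\<epsilon> = \<zero>\<^bsub>?T'\<^esub>"
      using Q.tens_minus_left[of "\<zero>\<^bsub>X'\<^esub>" "\<zero>\<^bsub>X'\<^esub>" ?\<epsilon>] Q.tens_closed[of "\<zero>\<^bsub>X'\<^esub>" ?\<epsilon>] P.\<epsilon>_in_L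
      by (simp add: Q.X.minus_eq Q.T.minus_eq Q.X.r_neg Q.T.r_neg)
    then have "f = (\<lambda>z\<in>carrier ?T. \<zero>\<^bsub>?T'\<^esub>)"
      using g0 fg by (intro P.induced_hom_determined[OF f Q.T.abelian_group_axioms Q.ract_zero]) auto
    then show "f = (\<lambda>z\<in>carrier (tensor A X (corner_bimodule B J e \<iota>)).
        \<zero>\<^bsub>tensor A X' (corner_bimodule B J e \<iota>)\<^esub>)"
      by (simp add: P.L_def)
  qed
qed

section \<open>Paths in the union of two matchings\<close>

text \<open>
  A matching is encoded as the involution that exchanges the ends of each edge and fixes the vertices
  that it does not cover; a vertex fixed by one of the two involutions is an end of a path.
\<close>

locale involution_pair =
  fixes \<alpha> \<beta> :: "'v \<Rightarrow> 'v" and V :: "'v set"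
  assumes finite_V: "finite V"
    and \<alpha>_in: "v \<in> V \<Longrightarrow> \<alpha> v \<in> V" and \<beta>_in: "v \<in> V \<Longrightarrow> \<beta> v \<in> V"
    and \<alpha>_invol: "v \<in> V \<Longrightarrow> \<alpha> (\<alpha> v) = v" and \<beta>_invol: "v \<in> V \<Longrightarrow> \<beta> (\<beta> v) = v"
    and no_common_fixpoint: "v \<in> V \<Longrightarrow> \<alpha> v = v \<Longrightarrow> \<beta> v = v \<Longrightarrow> False"
begin

definition step :: "('v \<times> 'v) set" where
  "step = {(v, \<alpha> v) | v. v \<in> V} \<union> {(v, \<beta> v) | v. v \<in> V}"

abbreviation \<rho> where "\<rho> v \<equiv> \<alpha> (\<beta> v)"

lemma \<rho>_pow_in: "v \<in> V \<Longrightarrow> (\<rho> ^^ k) v \<in> V"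
  by (induction k) (auto intro: \<alpha>_in \<beta>_in)

lemma \<rho>_pow_inj:
  assumes "u \<in> V" "v \<in> V" "(\<rho> ^^ k) u = (\<rho> ^^ k) v" shows "u = v"
  using assms(3)
proof (induction k)
  case (Suc k)
  then have "\<beta> (\<alpha> (\<rho> ((\<rho> ^^ k) u))) = \<beta> (\<alpha> (\<rho> ((\<rho> ^^ k) v)))" by simp
  then show ?case
    using Suc.IH \<rho>_pow_in assms by (simp add: \<alpha>_invol \<beta>_invol \<beta>_in)
qed simp

text \<open>
  The component of a fixed point \<open>x\<close> of \<open>\<beta>\<close> is the \<open>\<rho>\<close>-orbit of \<open>x\<close>, on which the dihedral
  group generated by \<open>\<alpha>\<close> and \<open>\<beta>\<close> acts by \<open>\<beta> \<rho>\<^sup>k x = \<rho>\<^sup>-\<^sup>k x\<close> and \<open>\<alpha> \<rho>\<^sup>k x = \<rho>\<^sup>1\<^sup>-\<^sup>k x\<close>. If \<open>n\<close> is the length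
  of the orbit, then \<open>\<rho>\<^sup>k x\<close> with \<open>0 < k < n\<close> is fixed by one of the two involutions iff
  \<open>2k = n\<close> or \<open>2k = n + 1\<close>, and exactly one \<open>k\<close> satisfies this.
\<close>

lemma unique_other_fixpoint_\<beta>:
  assumes x: "x \<in> V" "\<beta> x = x"
  shows "\<exists>!y. y \<noteq> x \<and> (x, y) \<in> step\<^sup>* \<and> (\<alpha> y = y \<or> \<beta> y = y)"
proof -
  have "\<not> inj_on (\<lambda>k. (\<rho> ^^ k) x) {..card V}"
  proof
    assume "inj_on (\<lambda>k. (\<rho> ^^ k) x) {..card V}"
    then have "card {..card V} \<le> card V"
      using \<rho>_pow_in[OF x(1)] finite_V by (intro card_inj_on_le) auto
    then show False by simp
  qed
  then obtain i j where ij: "i < j" "(\<rho> ^^ i) x = (\<rho> ^^ j) x"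
    unfolding inj_on_def by (metis linorder_neqE_nat)
  then have "(\<rho> ^^ i) ((\<rho> ^^ (j - i)) x) = (\<rho> ^^ i) x"
    by (metis comp_apply funpow_add le_add_diff_inverse less_imp_le)
  then have period: "\<exists>k>0. (\<rho> ^^ k) x = x"
    using \<rho>_pow_inj[OF \<rho>_pow_in[OF x(1)] x(1)] ij(1) by (intro exI[of _ "j - i"]) auto
  define n where "n = (LEAST k. k > 0 \<and> (\<rho> ^^ k) x = x)"
  have n: "n > 0" "(\<rho> ^^ n) x = x"
    using LeastI_ex[OF period] by (auto simp: n_def)
  have n_least: "n \<le> k" if "k > 0" "(\<rho> ^^ k) x = x" for k
    unfolding n_def using that by (intro Least_le) auto
  have eq_imp_le: "j \<le> i" if "(\<rho> ^^ i) x = (\<rho> ^^ j) x" "i < n" "j < n" for i j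
  proof (rule ccontr)
    assume "\<not> j \<le> i"
    then have "(\<rho> ^^ i) ((\<rho> ^^ (j - i)) x) = (\<rho> ^^ i) x"
      using that(1) by (metis comp_apply funpow_add le_add_diff_inverse nat_le_linear)
    then have "(\<rho> ^^ (j - i)) x = x"
      using \<rho>_pow_inj[OF \<rho>_pow_in[OF x(1)] x(1)] by blast
    then show False
      using n_least[of "j - i"] that \<open>\<not> j \<le> i\<close> by auto
  qed
  have eq_iff: "(\<rho> ^^ i) x = (\<rho> ^^ j) x \<longleftrightarrow> i = j" if "i < n" "j < n" for i j
    using eq_imp_le[of i j] eq_imp_le[of j i] that by auto
  have \<rho>\<beta>\<rho>: "\<rho> (\<beta> (\<rho> v)) = \<beta> v" if "v \<in> V" for v
    using that by (simp add: \<alpha>_invol \<beta>_invol \<alpha>_in \<beta>_in)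
  have "(\<rho> ^^ k) (\<beta> ((\<rho> ^^ k) x)) = x" for k
  proof (induction k)
    case (Suc k)
    have "(\<rho> ^^ Suc k) (\<beta> ((\<rho> ^^ Suc k) x)) = (\<rho> ^^ k) (\<rho> (\<beta> (\<rho> ((\<rho> ^^ k) x))))"
      by (subst (1) funpow_Suc_right) simp
    then show ?case
      using Suc \<rho>\<beta>\<rho>[OF \<rho>_pow_in[OF x(1)]] by simp
  qed (simp add: x)
  moreover have "(\<rho> ^^ k) ((\<rho> ^^ (n - k)) x) = x" if "k \<le> n" for k
    using n(2) that by (metis comp_apply funpow_add le_add_diff_inverse)
  ultimately have \<beta>_pow: "\<beta> ((\<rho> ^^ k) x) = (\<rho> ^^ (n - k)) x" if "k \<le> n" for k
    using \<rho>_pow_inj \<rho>_pow_in \<beta>_in x(1) that by metis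
  have \<alpha>_pow: "\<alpha> ((\<rho> ^^ k) x) = (\<rho> ^^ Suc (n - k)) x" if "k \<le> n" for k
    using \<beta>_pow[OF that] \<beta>_invol \<rho>_pow_in[OF x(1)] by (metis funpow.simps(2) o_apply)
  have reach: "(x, (\<rho> ^^ k) x) \<in> step\<^sup>*" for k
  proof (induction k)
    case (Suc k)
    have "((\<rho> ^^ k) x, \<beta> ((\<rho> ^^ k) x)) \<in> step" "(\<beta> ((\<rho> ^^ k) x), \<rho> ((\<rho> ^^ k) x)) \<in> step"
      using \<rho>_pow_in[OF x(1)] \<beta>_in by (auto simp: step_def)
    then show ?case
      using Suc by (auto intro: rtrancl_into_rtrancl)
  qed simp
  have orbit: "\<exists>k<n. y = (\<rho> ^^ k) x" if "(x, y) \<in> step\<^sup>*" for y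
    using that
  proof (induction rule: rtrancl_induct)
    case base
    then show ?case using n(1) by (intro exI[of _ 0]) simp
  next
    case (step y z)
    then obtain k where "k < n" "y = (\<rho> ^^ k) x" by blast
    then have "z = (\<rho> ^^ (n - k)) x \<or> z = (\<rho> ^^ Suc (n - k)) x"
      using step(2) \<alpha>_pow[of k] \<beta>_pow[of k] by (auto simp: step_def)
    then obtain m where "z = (\<rho> ^^ m) x" by blast
    then have "z = (\<rho> ^^ (m mod n)) x"
      by (simp add: funpow_mod_eq[OF n(2)])
    then show ?case using n(1) by (intro exI[of _ "m mod n"]) simp
  qed
  have fixed_iff: "(\<alpha> ((\<rho> ^^ k) x) = (\<rho> ^^ k) x \<or> \<beta> ((\<rho> ^^ k) x) = (\<rho> ^^ k) x) \<longleftrightarrow> 2 * k = n \<or> 2 * k = Suc n"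
    if k: "0 < k" "k < n" for k
  proof -
    have "\<beta> ((\<rho> ^^ k) x) = (\<rho> ^^ k) x \<longleftrightarrow> n - k = k"
      using \<beta>_pow[of k] eq_iff[of "n - k" k] k by auto
    moreover have "\<alpha> ((\<rho> ^^ k) x) = (\<rho> ^^ k) x \<longleftrightarrow> Suc (n - k) = k"
    proof (cases "k = 1")
      case True
      then have "\<alpha> ((\<rho> ^^ k) x) = (\<rho> ^^ 0) x"
        using \<alpha>_pow[of k] n k by simp
      then show ?thesis
        using eq_iff[of 0 k] k True by auto
    next
      case False
      then show ?thesis
        using \<alpha>_pow[of k] eq_iff[of "Suc (n - k)" k] k by auto
    qed
    ultimately show ?thesis using k by auto
  qed
  have "n \<noteq> 1"
    using n(2) x no_common_fixpoint by auto
  \<comment> \<open>Half of the even one of \<open>n\<close> and \<open>n + 1\<close>.\<close>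
  define k0 where "k0 = Suc n div 2"
  have k0: "0 < k0" "k0 < n" "2 * k0 = n \<or> 2 * k0 = Suc n"
    using n(1) \<open>n \<noteq> 1\<close> by (auto simp: k0_def)
  show ?thesis
  proof (rule ex1I)
    show "(\<rho> ^^ k0) x \<noteq> x \<and> (x, (\<rho> ^^ k0) x) \<in> step\<^sup>* \<and>
        (\<alpha> ((\<rho> ^^ k0) x) = (\<rho> ^^ k0) x \<or> \<beta> ((\<rho> ^^ k0) x) = (\<rho> ^^ k0) x)"
      using reach fixed_iff[OF k0(1,2)] k0 eq_iff[of k0 0] by auto
  next
    fix y assume y: "y \<noteq> x \<and> (x, y) \<in> step\<^sup>* \<and> (\<alpha> y = y \<or> \<beta> y = y)"
    then obtain k where k: "k < n" "y = (\<rho> ^^ k) x" using orbit by blast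
    with y have "0 < k" by (cases k) auto
    then have "2 * k = n \<or> 2 * k = Suc n" using fixed_iff k y by auto
    then have "k = k0" using k0(3) by linarith
    then show "y = (\<rho> ^^ k0) x" using k by simp
  qed
qed

lemma swap: "involution_pair \<beta> \<alpha> V"
  by unfold_locales (auto intro: finite_V \<alpha>_in \<beta>_in \<alpha>_invol \<beta>_invol no_common_fixpoint)

lemma unique_other_fixpoint:
  assumes "x \<in> V" "\<alpha> x = x \<or> \<beta> x = x"
  shows "\<exists>!y. y \<noteq> x \<and> (x, y) \<in> step\<^sup>* \<and> (\<alpha> y = y \<or> \<beta> y = y)"
proof (cases "\<beta> x = x")
  case True
  then show ?thesis using unique_other_fixpoint_\<beta> assms by blast
next
  case False
  interpret S: involution_pair \<beta> \<alpha> V by (rule swap)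
  have "S.step = step" by (auto simp: S.step_def step_def)
  then show ?thesis
    using S.unique_other_fixpoint_\<beta>[of x] assms False by (simp add: disj_commute)
qed

end

definition matching :: "'v set set \<Rightarrow> bool" where
  "matching A \<longleftrightarrow> (\<forall>e\<in>A. card e = 2) \<and> (\<forall>e\<in>A. \<forall>f\<in>A. e \<inter> f \<noteq> {} \<longrightarrow> e = f)"

definition adj :: "'v set set \<Rightarrow> ('v \<times> 'v) set" where
  "adj A = {(u, v). {u, v} \<in> A}"

lemma adj_iff: "(u, v) \<in> adj A \<longleftrightarrow> {u, v} \<in> A"
  by (simp add: adj_def)

lemma adj_Un: "adj (A \<union> B) = adj A \<union> adj B"
  by (auto simp: adj_def)

lemma sym_adj: "sym (adj A)"
  by (auto simp: sym_def adj_def insert_commute)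

lemma matching_edge_neq: "matching A \<Longrightarrow> {u, v} \<in> A \<Longrightarrow> u \<noteq> v"
  by (force simp: matching_def)

lemma matching_unique: "matching A \<Longrightarrow> {u, v} \<in> A \<Longrightarrow> {u, w} \<in> A \<Longrightarrow> v = w"
  by (metis IntI doubleton_eq_iff empty_iff insertI1 matching_def)

lemma matching_partner:
  assumes "matching A" "u \<in> \<Union>A" obtains v where "{u, v} \<in> A"
proof -
  obtain e where e: "e \<in> A" "u \<in> e" using assms by blast
  then obtain x y where "e = {x, y}"
    using assms(1) by (metis card_2_iff matching_def)
  then show thesis
    using e that by (metis insertE insert_commute singletonD)
qed

text \<open>
  The components of the union of two matchings are cycles and paths, and the vertices covered by
  only one of the matchings are the two ends of the paths.
\<close>

lemma matching_path_end:
  assumes A: "matching A" and B: "matching B" and fin: "finite (\<Union>A \<union> \<Union>B)"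
    and x: "x \<in> \<Union>A \<union> \<Union>B" "x \<notin> \<Union>A \<inter> \<Union>B"
  shows "\<exists>!y. y \<noteq> x \<and> y \<in> \<Union>A \<union> \<Union>B \<and> y \<notin> \<Union>A \<inter> \<Union>B \<and> (x, y) \<in> (adj (A \<union> B))\<^sup>*"
proof -
  define p where "p M v = (if v \<in> \<Union>M then THE w. {v, w} \<in> M else v)" for M :: "'a set set" and v
  have p_edge: "{v, p M v} \<in> M" if "matching M" "v \<in> \<Union>M" for M v
  proof -
    have "\<exists>!w. {v, w} \<in> M"
      using matching_partner[OF that] matching_unique[OF that(1)] by metis
    then show ?thesis using theI'[of "\<lambda>w. {v, w} \<in> M"] that by (simp add: p_def)
  qed
  have p_eqI: "p M v = w" if "matching M" "{v, w} \<in> M" for M v w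
    using matching_unique[OF that(1) _ that(2)] p_edge[OF that(1)] that(2) by blast
  have p_out: "p M v = v" if "v \<notin> \<Union>M" for M v
    using that by (simp add: p_def)
  have p_invol: "p M (p M v) = v" if "matching M" for M v
  proof (cases "v \<in> \<Union>M")
    case True
    then show ?thesis using p_edge[OF that True] by (intro p_eqI[OF that]) (simp add: insert_commute)
  qed (simp add: p_out)
  have p_fix: "p M v = v \<longleftrightarrow> v \<notin> \<Union>M" if "matching M" for M v
    using p_edge[OF that] matching_edge_neq[OF that] p_out by metis
  have p_in: "p M v \<in> \<Union>M" if "matching M" "v \<in> \<Union>M" for M v
    using p_edge[OF that] by blast
  interpret involution_pair "p A" "p B" "\<Union>A \<union> \<Union>B"
  proof
    show "p A v \<in> \<Union>A \<union> \<Union>B" if "v \<in> \<Union>A \<union> \<Union>B" for v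
      using that p_in[OF A, of v] p_out[of v A] by (cases "v \<in> \<Union>A") auto
    show "p B v \<in> \<Union>A \<union> \<Union>B" if "v \<in> \<Union>A \<union> \<Union>B" for v
      using that p_in[OF B, of v] p_out[of v B] by (cases "v \<in> \<Union>B") auto
  qed (use fin p_invol[OF A] p_invol[OF B] p_fix[OF A] p_fix[OF B] in auto)
  have "step \<subseteq> (adj (A \<union> B))\<^sup>*"
  proof
    fix q assume "q \<in> step"
    then consider v where "q = (v, p A v)" | v where "q = (v, p B v)"
      by (auto simp: step_def)
    then show "q \<in> (adj (A \<union> B))\<^sup>*"
    proof cases
      case 1
      then show ?thesis
        using p_edge[OF A, of v] p_out[of v A] by (cases "v \<in> \<Union>A") (auto simp: adj_iff)
    next
      case 2
      then show ?thesis
        using p_edge[OF B, of v] p_out[of v B] by (cases "v \<in> \<Union>B") (auto simp: adj_iff)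
    qed
  qed
  moreover have "adj (A \<union> B) \<subseteq> step"
  proof clarify
    fix u v assume "(u, v) \<in> adj (A \<union> B)"
    then consider "{u, v} \<in> A" | "{u, v} \<in> B" by (auto simp: adj_iff)
    then show "(u, v) \<in> step"
      by cases (use p_eqI[OF A, of u v] p_eqI[OF B, of u v] in \<open>auto simp: step_def\<close>)
  qed
  ultimately have eq: "step\<^sup>* = (adj (A \<union> B))\<^sup>*"
    by (intro rtrancl_subset)
  have ends: "(p A y = y \<or> p B y = y) \<longleftrightarrow> y \<notin> \<Union>A \<inter> \<Union>B" for y
    using p_fix[OF A, of y] p_fix[OF B, of y] by blast
  have inside: "y \<in> \<Union>A \<union> \<Union>B" if "(x, y) \<in> step\<^sup>*" for y
    using that
  proof (induction rule: rtrancl_induct)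
    case (step y z)
    then show ?case using \<alpha>_in[of y] \<beta>_in[of y] by (auto simp: step_def)
  qed (rule x(1))
  have "(y \<noteq> x \<and> (x, y) \<in> step\<^sup>* \<and> (p A y = y \<or> p B y = y)) \<longleftrightarrow>
      (y \<noteq> x \<and> y \<in> \<Union>A \<union> \<Union>B \<and> y \<notin> \<Union>A \<inter> \<Union>B \<and> (x, y) \<in> (adj (A \<union> B))\<^sup>*)" for y
    unfolding ends eq[symmetric] using inside[of y] by blast
  moreover have "\<exists>!y. y \<noteq> x \<and> (x, y) \<in> step\<^sup>* \<and> (p A y = y \<or> p B y = y)"
    using unique_other_fixpoint[OF x(1)] x(2) ends[of x] by blast
  ultimately show ?thesis by (simp only:)
qed

section \<open>Contracting part of a graph\<close>

text \<open>
  Paths of \<open>R\<close> between vertices of \<open>W\<close> become single edges. Edges from a vertex to itself are left out so that contracting a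
  composite of diagrams gives the edges of the product on the nose.
\<close>

definition contraction :: "'v set \<Rightarrow> ('v \<times> 'v) set \<Rightarrow> ('v \<times> 'v) set" where
  "contraction W R = {(u, v). u \<noteq> v \<and> u \<in> W \<and> v \<in> W \<and> (u, v) \<in> R\<^sup>*}"

text \<open>
  A path of \<open>R \<union> Q\<close> can leave \<open>W\<close> only along \<open>R\<close>, so its stretches outside \<open>W\<close> are parts of paths of \<open>R\<close>
  that begin and end in \<open>W\<close>.
\<close>

lemma rtrancl_contraction:
  assumes Q: "Q \<subseteq> W \<times> W" and uv: "u \<in> W" "v \<in> W"
  shows "(u, v) \<in> (R \<union> Q)\<^sup>* \<longleftrightarrow> (u, v) \<in> (contraction W R \<union> Q)\<^sup>*"
proof
  have "contraction W R \<union> Q \<subseteq> (R \<union> Q)\<^sup>*"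
    using rtrancl_mono[of R "R \<union> Q"] by (auto simp: contraction_def)
  then show "(u, v) \<in> (contraction W R \<union> Q)\<^sup>* \<Longrightarrow> (u, v) \<in> (R \<union> Q)\<^sup>*"
    using rtrancl_subset_rtrancl by blast
next
  let ?C = "contraction W R \<union> Q"
  have close: "(u, w) \<in> ?C\<^sup>*" if "(u, w') \<in> ?C\<^sup>*" "w' \<in> W" "w \<in> W" "(w', w) \<in> R\<^sup>*" for w w'
  proof (cases "w' = w")
    case False
    then have "(w', w) \<in> ?C" using that by (simp add: contraction_def)
    then show ?thesis using that(1) by (rule rtrancl_into_rtrancl[rotated])
  qed (use that in simp)
  assume "(u, v) \<in> (R \<union> Q)\<^sup>*"
  then have "\<exists>w\<in>W. (u, w) \<in> ?C\<^sup>* \<and> (w, v) \<in> R\<^sup>*"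
  proof (induction rule: rtrancl_induct)
    case base
    then show ?case using uv by blast
  next
    case (step y z)
    then obtain w where w: "w \<in> W" "(u, w) \<in> ?C\<^sup>*" "(w, y) \<in> R\<^sup>*" by blast
    show ?case
    proof (cases "(y, z) \<in> R")
      case True
      then show ?thesis using w by (meson rtrancl_into_rtrancl)
    next
      case False
      then have yz: "(y, z) \<in> Q" using step by blast
      then have "(u, y) \<in> ?C\<^sup>*" using close w Q by blast
      then have "(u, z) \<in> ?C\<^sup>*" using yz by (meson UnI2 rtrancl_into_rtrancl)
      then show ?thesis using yz Q by blast
    qed
  qed
  then show "(u, v) \<in> ?C\<^sup>*" using close uv by blast
qed

text \<open>
  The components that meet \<open>S\<close> and lie inside \<open>M\<close>. In the applications \<open>S\<close> is the set of all vertices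
  and \<open>M\<close> consists of inner rows, so that these components are closed loops.
\<close>

definition components :: "('v \<times> 'v) set \<Rightarrow> 'v set \<Rightarrow> 'v set \<Rightarrow> 'v set set" where
  "components R S M = {C. C \<subseteq> M \<and> (\<exists>v\<in>S. C = R\<^sup>* `` {v})}"

lemma finite_components:
  assumes "finite (S \<inter> M)" shows "finite (components R S M)"
proof (rule finite_subset)
  show "components R S M \<subseteq> (\<lambda>v. R\<^sup>* `` {v}) ` (S \<inter> M)"
    by (auto simp: components_def)
qed (use assms in simp)

lemma component_eq:
  assumes "sym R" "(v, w) \<in> R\<^sup>*" shows "R\<^sup>* `` {v} = R\<^sup>* `` {w}"
  using assms sym_rtrancl[OF assms(1)] by (auto dest: symD intro: rtrancl_trans)

text \<open>
  The components of \<open>R \<union> Q\<close> inside \<open>M\<close> either avoid \<open>W\<close>, and are components of \<open>R\<close>, or they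
  are determined by their intersection with \<open>W\<close>, which is a component of the contracted graph.
\<close>

lemma card_components_contraction:
  assumes Q: "Q \<subseteq> W \<times> W" and sym: "sym R" "sym Q" and M: "- W \<subseteq> M"
    and S: "R \<union> Q \<subseteq> S \<times> S" and fin: "finite (S \<inter> M)"
  shows "card (components (R \<union> Q) S M) =
    card (components R S (- W)) + card (components (contraction W R \<union> Q) S (M \<inter> W))"
proof -
  let ?U = "(R \<union> Q)\<^sup>*" and ?C = "contraction W R \<union> Q"
  have sym': "sym (R \<union> Q)" using sym by (auto simp: sym_def)
  have avoid: "?U `` {v} = R\<^sup>* `` {v}" if "R\<^sup>* `` {v} \<subseteq> - W" for v
  proof
    show "?U `` {v} \<subseteq> R\<^sup>* `` {v}"
    proof clarify
      fix u assume "(v, u) \<in> ?U"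
      then show "(v, u) \<in> R\<^sup>*"
      proof (induction rule: rtrancl_induct)
        case (step y z)
        then have "(y, z) \<notin> Q" using that Q by blast
        then show ?case using step by (auto intro: rtrancl_into_rtrancl)
      qed simp
    qed
    show "R\<^sup>* `` {v} \<subseteq> ?U `` {v}" using rtrancl_mono[of R "R \<union> Q"] by blast
  qed
  have 1: "{C \<in> components (R \<union> Q) S M. C \<inter> W = {}} = components R S (- W)"
  proof (intro equalityI subsetI)
    fix C assume "C \<in> {C \<in> components (R \<union> Q) S M. C \<inter> W = {}}"
    then obtain v where v: "v \<in> S" "C = ?U `` {v}" "C \<inter> W = {}" by (auto simp: components_def)
    then have "R\<^sup>* `` {v} \<subseteq> - W" using rtrancl_mono[of R "R \<union> Q"] by blast
    then show "C \<in> components R S (- W)" using avoid v by (auto simp: components_def)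
  next
    fix C assume "C \<in> components R S (- W)"
    then obtain v where v: "v \<in> S" "C = R\<^sup>* `` {v}" "C \<subseteq> - W" by (auto simp: components_def)
    then have "C = ?U `` {v}" using avoid by blast
    then show "C \<in> {C \<in> components (R \<union> Q) S M. C \<inter> W = {}}"
      using v M unfolding components_def by blast
  qed
  have rep: "C = ?U `` {w}" "C \<inter> W = ?C\<^sup>* `` {w}" "w \<in> S"
    if C: "C \<in> components (R \<union> Q) S M" and w: "w \<in> C" "w \<in> W" for C w
  proof -
    obtain v where v: "v \<in> S" "C = ?U `` {v}" using C by (auto simp: components_def)
    show Cw: "C = ?U `` {w}" using component_eq[OF sym'] v w by blast
    have "(v, w) \<in> ?U" using v w by blast
    then show "w \<in> S" using v S by (induction rule: rtrancl_induct) auto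
    have "u \<in> W" if "(w, u) \<in> ?C\<^sup>*" for u
      using that by (induction rule: rtrancl_induct) (use w Q in \<open>auto simp: contraction_def\<close>)
    then show "C \<inter> W = ?C\<^sup>* `` {w}"
      using rtrancl_contraction[OF Q w(2), of _ R] Cw by blast
  qed
  have 2: "bij_betw (\<lambda>C. C \<inter> W) {C \<in> components (R \<union> Q) S M. C \<inter> W \<noteq> {}}
      (components ?C S (M \<inter> W))"
  proof (rule bij_betw_imageI)
    show "inj_on (\<lambda>C. C \<inter> W) {C \<in> components (R \<union> Q) S M. C \<inter> W \<noteq> {}}"
    proof (rule inj_onI)
      fix C D assume *: "C \<in> {C \<in> components (R \<union> Q) S M. C \<inter> W \<noteq> {}}"
        "D \<in> {C \<in> components (R \<union> Q) S M. C \<inter> W \<noteq> {}}" "C \<inter> W = D \<inter> W"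
      then obtain w where "w \<in> C" "w \<in> D" "w \<in> W" by blast
      then show "C = D" using rep(1) * by blast
    qed
    show "(\<lambda>C. C \<inter> W) ` {C \<in> components (R \<union> Q) S M. C \<inter> W \<noteq> {}} = components ?C S (M \<inter> W)"
    proof (intro equalityI subsetI)
      fix D assume "D \<in> (\<lambda>C. C \<inter> W) ` {C \<in> components (R \<union> Q) S M. C \<inter> W \<noteq> {}}"
      then obtain C w where "C \<in> components (R \<union> Q) S M" "w \<in> C" "w \<in> W" "D = C \<inter> W" by blast
      then show "D \<in> components ?C S (M \<inter> W)"
        using rep[of C w] by (auto simp: components_def)
    next
      fix D assume "D \<in> components ?C S (M \<inter> W)"
      then obtain w where w: "w \<in> S" "D = ?C\<^sup>* `` {w}" "D \<subseteq> M \<inter> W" by (auto simp: components_def)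
      then have wW: "w \<in> W" by blast
      have "?U `` {w} \<inter> W \<subseteq> D" using rtrancl_contraction[OF Q wW, of _ R] w by blast
      then have "?U `` {w} \<subseteq> M" using w M by blast
      then have C: "?U `` {w} \<in> components (R \<union> Q) S M" using w by (auto simp: components_def)
      have "D = ?U `` {w} \<inter> W" using rep(2)[OF C _ wW] w by blast
      then show "D \<in> (\<lambda>C. C \<inter> W) ` {C \<in> components (R \<union> Q) S M. C \<inter> W \<noteq> {}}"
        using C wW by (intro image_eqI[of _ _ "?U `` {w}"]) auto
    qed
  qed
  have "card (components (R \<union> Q) S M) =
      card ({C \<in> components (R \<union> Q) S M. C \<inter> W = {}} \<union> {C \<in> components (R \<union> Q) S M. C \<inter> W \<noteq> {}})"
    by (rule arg_cong[of _ _ card]) blast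
  also have "\<dots> = card {C \<in> components (R \<union> Q) S M. C \<inter> W = {}} +
      card {C \<in> components (R \<union> Q) S M. C \<inter> W \<noteq> {}}"
    using finite_components[OF fin] by (intro card_Un_disjoint) auto
  finally show ?thesis
    using 1 bij_betw_same_card[OF 2] by simp
qed

lemma rtrancl_map_prod:
  assumes "inj f"
  shows "(f u, v) \<in> (map_prod f f ` R)\<^sup>* \<longleftrightarrow> (\<exists>w. v = f w \<and> (u, w) \<in> R\<^sup>*)"
proof
  assume "(f u, v) \<in> (map_prod f f ` R)\<^sup>*"
  then show "\<exists>w. v = f w \<and> (u, w) \<in> R\<^sup>*"
  proof (induction rule: rtrancl_induct)
    case (step y z)
    then obtain w a b where "y = f w" "(u, w) \<in> R\<^sup>*" "(a, b) \<in> R" "y = f a" "z = f b" by auto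
    then show ?case using injD[OF assms] by (metis rtrancl_into_rtrancl)
  qed blast
next
  assume "\<exists>w. v = f w \<and> (u, w) \<in> R\<^sup>*"
  then obtain w where "v = f w" "(u, w) \<in> R\<^sup>*" by blast
  from this(2) have "(f u, f w) \<in> (map_prod f f ` R)\<^sup>*"
  proof (induction rule: rtrancl_induct)
    case (step y z)
    then have "(f y, f z) \<in> map_prod f f ` R" by force
    then show ?case using step by (meson rtrancl_into_rtrancl)
  qed simp
  then show "(f u, v) \<in> (map_prod f f ` R)\<^sup>*" using \<open>v = f w\<close> by simp
qed

lemma card_components_map_prod:
  assumes f: "inj f" and S: "\<And>v. f v \<in> S' \<longleftrightarrow> v \<in> S" and M: "\<And>v. f v \<in> M' \<longleftrightarrow> v \<in> M"
    and range: "M' \<subseteq> range f"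
  shows "card (components (map_prod f f ` R) S' M') = card (components R S M)"
proof -
  have comp: "(map_prod f f ` R)\<^sup>* `` {f v} = f ` (R\<^sup>* `` {v})" for v
    using rtrancl_map_prod[OF f] by blast
  have "components (map_prod f f ` R) S' M' = (`) f ` components R S M"
  proof (intro equalityI subsetI)
    fix C assume "C \<in> components (map_prod f f ` R) S' M'"
    then obtain v where v: "v \<in> S'" "C \<subseteq> M'" "C = (map_prod f f ` R)\<^sup>* `` {v}"
      by (auto simp: components_def)
    then obtain u where u: "v = f u" using range by blast
    then have "C = f ` (R\<^sup>* `` {u})" using v comp by simp
    moreover from this have "R\<^sup>* `` {u} \<in> components R S M"
      using v u S M by (auto simp: components_def)
    ultimately show "C \<in> (`) f ` components R S M" by blast
  next
    fix C assume "C \<in> (`) f ` components R S M"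
    then obtain u where "u \<in> S" "R\<^sup>* `` {u} \<subseteq> M" "C = f ` (R\<^sup>* `` {u})"
      by (auto simp: components_def)
    then show "C \<in> components (map_prod f f ` R) S' M'"
      unfolding components_def using comp[of u] S[of u] M by blast
  qed
  moreover have "inj_on ((`) f) (components R S M)"
    using f by (meson inj_image_eq_iff inj_onI)
  ultimately show ?thesis by (simp add: card_image)
qed

section \<open>Composition of diagrams\<close>

text \<open>Vertices are pairs; quantifiers over vertices are kept intact.\<close>

declare split_paired_Ex [simp del] split_paired_All [simp del]

definition vertices :: "nat \<Rightarrow> vertex set" where
  "vertices r = {0, 1} \<times> symbols r"

definition neg :: "vertex \<Rightarrow> vertex" where
  "neg = (\<lambda>(a, i). (a, - i))"

definition down :: "vertex \<Rightarrow> vertex" where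
  "down = (\<lambda>(a, i). (a + 1, i))"

lemma neg_simp: "neg (a, i) = (a, - i)" and down_simp: "down (a, i) = (a + 1, i)"
  by (simp_all add: neg_def down_def)

lemma inj_down: "inj down"
  by (auto simp: down_def inj_def)

lemma neg_neg: "neg (neg v) = v"
  by (cases v) (simp add: neg_simp)

lemma finite_symbols: "finite (symbols r)"
proof (rule finite_subset)
  show "symbols r \<subseteq> {- int r..int r}" by (auto simp: symbols_def)
qed simp

lemma symbols_uminus: "- i \<in> symbols r \<longleftrightarrow> i \<in> symbols r"
  by (auto simp: symbols_def)

lemma diagram_matching:
  assumes "d \<in> diagrams r" shows "matching d" "\<Union>d = vertices r"
proof -
  have p: "partition_on (vertices r) d" and c: "\<forall>e\<in>d. card e = 2"
    using assms by (auto simp: diagrams_def vertices_def)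
  show "\<Union>d = vertices r" using p by (simp add: partition_on_def)
  have "e = f" if "e \<in> d" "f \<in> d" "e \<inter> f \<noteq> {}" for e f
    using p that disjointD[of d e f] unfolding partition_on_def by blast
  then show "matching d"
    using c unfolding matching_def by blast
qed

lemma diagram_neg:
  assumes "d \<in> diagrams r" "{u, v} \<in> d" shows "{neg u, neg v} \<in> d"
proof -
  have "(\<lambda>e. neg ` e) ` d = d" using assms(1) by (simp add: diagrams_def neg_def)
  moreover have "{neg u, neg v} = neg ` {u, v}" by simp
  ultimately show ?thesis using assms(2) by blast
qed

lemma diagram_edge_in:
  assumes "d \<in> diagrams r" "{u, v} \<in> d" shows "u \<in> vertices r" "v \<in> vertices r" "u \<noteq> v"
  using diagram_matching(2)[OF assms(1)] assms(2)
    matching_edge_neq[OF diagram_matching(1)[OF assms(1)] assms(2)] by auto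

lemma diagram_edgeE:
  assumes "d \<in> diagrams r" "e \<in> d" obtains u v where "e = {u, v}" "u \<noteq> v" "{u, v} \<in> d"
proof -
  have "card e = 2"
    using diagram_matching(1)[OF assms(1)] assms(2) unfolding matching_def by blast
  then show thesis
    using that assms(2) by (auto simp: card_2_iff)
qed

lemma diagram_partner:
  assumes "d \<in> diagrams r" "u \<in> vertices r" obtains v where "{u, v} \<in> d"
proof (rule matching_partner[OF diagram_matching(1)[OF assms(1)]])
  show "u \<in> \<Union>d" using diagram_matching(2)[OF assms(1)] assms(2) by simp
qed

lemma diagram_unique:
  "d \<in> diagrams r \<Longrightarrow> {u, v} \<in> d \<Longrightarrow> {u, w} \<in> d \<Longrightarrow> v = w"
  by (rule matching_unique[OF diagram_matching(1)])

lemma diagramsI: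
  assumes pairs: "\<And>e. e \<in> d \<Longrightarrow> \<exists>u v. e = {u, v}"
    and edges: "\<And>u v. {u, v} \<in> d \<Longrightarrow> u \<noteq> v \<and> u \<in> vertices r"
    and partner: "\<And>u. u \<in> vertices r \<Longrightarrow> \<exists>v. {u, v} \<in> d"
    and unique: "\<And>u v w. {u, v} \<in> d \<Longrightarrow> {u, w} \<in> d \<Longrightarrow> v = w"
    and neg: "\<And>u v. {u, v} \<in> d \<Longrightarrow> {neg u, neg v} \<in> d"
  shows "d \<in> diagrams r"
proof -
  have "partition_on (vertices r) d"
  proof (rule partition_onI)
    show "\<Union>d = vertices r"
    proof
      show "\<Union>d \<subseteq> vertices r"
      proof clarify
        fix x e assume "x \<in> e" "e \<in> d"
        then obtain u v where "e = {u, v}" using pairs by blast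
        then show "x \<in> vertices r"
          using edges[of u v] edges[of v u] \<open>x \<in> e\<close> \<open>e \<in> d\<close> insert_commute[of u v "{}"] by auto
      qed
      show "vertices r \<subseteq> \<Union>d" using partner by blast
    qed
    show "disjnt e f" if "e \<in> d" "f \<in> d" "e \<noteq> f" for e f
    proof (rule ccontr)
      assume "\<not> disjnt e f"
      then obtain x where "x \<in> e" "x \<in> f" by (auto simp: disjnt_def)
      have other: "\<exists>y. e' = {x, y}" if e': "e' \<in> d" "x \<in> e'" for e'
      proof -
        obtain u v where uv: "e' = {u, v}" using pairs[OF e'(1)] by blast
        show ?thesis
        proof (cases "x = u")
          case True
          then show ?thesis using uv by blast
        next
          case False
          then have "e' = {x, u}" using uv e'(2) by auto
          then show ?thesis by blast
        qed
      qed
      obtain y where y: "e = {x, y}"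
        using other[of e] \<open>e \<in> d\<close> \<open>x \<in> e\<close> by auto
      obtain z where z: "f = {x, z}"
        using other[of f] \<open>f \<in> d\<close> \<open>x \<in> f\<close> by auto
      then have "y = z" using unique[of x y z] that y z by simp
      then show False using y z that(3) by simp
    qed
    show "{} \<notin> d"
    proof
      assume "{} \<in> d"
      from pairs[OF this] show False by auto
    qed
  qed
  moreover have "card e = 2" if "e \<in> d" for e
  proof -
    obtain u v where uv: "e = {u, v}" using pairs[OF \<open>e \<in> d\<close>] by blast
    then have "u \<noteq> v" using edges[of u v] that by simp
    then show ?thesis using uv by simp
  qed
  moreover have "(\<lambda>e. neg ` e) ` d = d"
  proof
    show "(\<lambda>e. neg ` e) ` d \<subseteq> d"
    proof clarify
      fix e assume "e \<in> d"
      then obtain u v where "e = {u, v}" using pairs by blast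
      then show "neg ` e \<in> d" using neg[of u v] \<open>e \<in> d\<close> by simp
    qed
    show "d \<subseteq> (\<lambda>e. neg ` e) ` d"
    proof
      fix e assume "e \<in> d"
      then obtain u v where e: "e = {u, v}" using pairs by blast
      then have "{neg u, neg v} \<in> d" using neg[of u v] \<open>e \<in> d\<close> by simp
      moreover have "e = neg ` {neg u, neg v}" by (simp add: e neg_neg)
      ultimately show "e \<in> (\<lambda>e. neg ` e) ` d" by (rule rev_image_eqI)
    qed
  qed
  ultimately show ?thesis by (simp add: diagrams_def neg_def vertices_def)
qed

lemma diagrams_eqI:
  assumes "d \<in> diagrams r" "d' \<in> diagrams r" and sub: "\<And>u v. {u, v} \<in> d \<Longrightarrow> {u, v} \<in> d'"
  shows "d = d'"
proof
  show "d \<subseteq> d'"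
  proof
    fix e assume "e \<in> d"
    then obtain u v where "e = {u, v}" "{u, v} \<in> d" by (rule diagram_edgeE[OF assms(1)])
    then show "e \<in> d'" using sub by simp
  qed
  show "d' \<subseteq> d"
  proof
    fix e assume "e \<in> d'"
    then obtain u v where uv: "e = {u, v}" "{u, v} \<in> d'" by (rule diagram_edgeE[OF assms(2)])
    obtain w where w: "{u, w} \<in> d"
      using diagram_edge_in(1)[OF assms(2) uv(2)] by (rule diagram_partner[OF assms(1)])
    have "v = w" using diagram_unique[OF assms(2) uv(2) sub[OF w]] .
    then show "e \<in> d" using uv w by simp
  qed
qed

lemma finite_diagrams: "finite (diagrams r)"
proof (rule finite_subset)
  show "diagrams r \<subseteq> Pow (Pow (vertices r))"
    using diagram_matching(2) by (intro subsetI PowI) blast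
qed (simp add: vertices_def finite_symbols)

abbreviation lower :: "diagram \<Rightarrow> diagram" where
  "lower d \<equiv> (\<lambda>e. down ` e) ` d"

lemma lower_iff: "{u, v} \<in> lower d \<longleftrightarrow> (\<exists>u' v'. u = down u' \<and> v = down v' \<and> {u', v'} \<in> d)"
proof
  assume "{u, v} \<in> lower d"
  then obtain e where e: "e \<in> d" "{u, v} = down ` e" by (rule imageE) simp
  have "u \<in> down ` e" "v \<in> down ` e" unfolding e(2)[symmetric] by simp_all
  then obtain u' v' where uv: "u = down u'" "v = down v'" by blast
  then have "down ` e = down ` {u', v'}" using e(2) by simp
  then have "e = {u', v'}" using inj_image_eq_iff[OF inj_down] by metis
  then show "\<exists>u' v'. u = down u' \<and> v = down v' \<and> {u', v'} \<in> d" using e(1) uv by metis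
next
  assume "\<exists>u' v'. u = down u' \<and> v = down v' \<and> {u', v'} \<in> d"
  then obtain u' v' where uv: "u = down u'" "v = down v'" "{u', v'} \<in> d" by metis
  then have "{u, v} = down ` {u', v'}" by simp
  then show "{u, v} \<in> lower d" using uv(3) by (rule image_eqI)
qed

lemma adj_lower: "adj (lower d) = map_prod down down ` adj d"
proof (intro equalityI subsetI)
  fix p assume "p \<in> adj (lower d)"
  then obtain u v where "p = (u, v)" "{u, v} \<in> lower d" by (metis adj_iff surj_pair)
  then obtain u' v' where "p = map_prod down down (u', v')" "(u', v') \<in> adj d"
    unfolding lower_iff by (metis adj_iff map_prod_simp)
  then show "p \<in> map_prod down down ` adj d" by (rule image_eqI)
next
  fix p assume "p \<in> map_prod down down ` adj d"
  then obtain q where "p = map_prod down down q" "q \<in> adj d" by (rule imageE)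
  then show "p \<in> adj (lower d)"
    unfolding map_prod_def case_prod_unfold by (metis adj_iff lower_iff prod.collapse)
qed

lemma stacked_eq: "stacked d1 d2 = adj (d1 \<union> lower d2)"
  by (simp add: stacked_def adj_def down_def)

lemma sym_stacked: "sym (stacked d1 d2)"
  by (simp add: stacked_eq sym_adj)

text \<open>
  The place of a vertex of a product in the stack of the two factors: rows 0 and 1 become the
  outer rows 0 and 2.
\<close>

definition outer :: "vertex \<Rightarrow> vertex" where
  "outer = (\<lambda>(a, i). (2 * a, i))"

lemma outer_simp: "outer (a, i) = (2 * a, i)"
  by (simp add: outer_def)

lemma concat_iff:
  "{u, v} \<in> concat_diagrams d1 d2 \<longleftrightarrow>
    u \<noteq> v \<and> fst u \<le> 1 \<and> fst v \<le> 1 \<and> (outer u, outer v) \<in> (stacked d1 d2)\<^sup>*"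
proof
  assume "{u, v} \<in> concat_diagrams d1 d2"
  then obtain x y where xy: "{u, v} = (\<lambda>(a, i). (a div 2, i)) ` {x, y}" "x \<noteq> y"
    "fst x \<in> {0, 2}" "fst y \<in> {0, 2}" "(x, y) \<in> (stacked d1 d2)\<^sup>*"
    unfolding concat_diagrams_def by blast
  define c :: "vertex \<Rightarrow> vertex" where "c = (\<lambda>(a, i). (a div 2, i))"
  have oc: "outer (c z) = z" "fst (c z) \<le> 1" if "fst z \<in> {0, 2}" for z
    using that by (cases z, auto simp: c_def outer_def)+
  have "{u, v} = {c x, c y}" using xy by (simp add: c_def)
  moreover have "c x \<noteq> c y" using xy oc by metis
  ultimately consider "u = c x" "v = c y" | "u = c y" "v = c x"
    by (metis doubleton_eq_iff)
  then show "u \<noteq> v \<and> fst u \<le> 1 \<and> fst v \<le> 1 \<and> (outer u, outer v) \<in> (stacked d1 d2)\<^sup>*"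
    using xy oc \<open>c x \<noteq> c y\<close> sym_rtrancl[OF sym_stacked, of d1 d2]
    by cases (auto dest: symD)
next
  assume *: "u \<noteq> v \<and> fst u \<le> 1 \<and> fst v \<le> 1 \<and> (outer u, outer v) \<in> (stacked d1 d2)\<^sup>*"
  have "w = (\<lambda>(a, i). (a div 2, i)) (outer w)" for w :: vertex
    by (cases w) (simp add: outer_def)
  then have "{u, v} = (\<lambda>(a, i). (a div 2, i)) ` {outer u, outer v}" by simp
  moreover have "outer u \<noteq> outer v" "fst (outer u) \<in> {0, 2}" "fst (outer v) \<in> {0, 2}"
    using * by (cases u, cases v, auto simp: outer_def)+
  ultimately show "{u, v} \<in> concat_diagrams d1 d2"
    unfolding concat_diagrams_def using * by blast
qed

lemma lower_matching:
  assumes "d \<in> diagrams r" shows "matching (lower d)" "\<Union>(lower d) = {1, 2} \<times> symbols r"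
proof -
  have "card (down ` e) = 2" if "e \<in> d" for e
    using that diagram_matching(1)[OF assms] inj_down
    by (metis card_image inj_on_subset matching_def subset_UNIV)
  moreover have "e = f" if "e \<in> d" "f \<in> d" "down ` e \<inter> down ` f \<noteq> {}" for e f
    using that diagram_matching(1)[OF assms] inj_down unfolding matching_def
    by (metis image_Int image_is_empty)
  ultimately show "matching (lower d)" unfolding matching_def by blast
  have "\<Union>(lower d) = down ` vertices r"
    using diagram_matching(2)[OF assms] by blast
  also have "\<dots> = {1, 2} \<times> symbols r"
    by (force simp: vertices_def down_def)
  finally show "\<Union>(lower d) = {1, 2} \<times> symbols r" .
qed

lemma stacked_in:
  assumes "d1 \<in> diagrams r" "d2 \<in> diagrams r"
  shows "stacked d1 d2 \<subseteq> ({0, 1, 2} \<times> symbols r) \<times> ({0, 1, 2} \<times> symbols r)"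
proof clarify
  fix a i b j assume "((a, i), (b, j)) \<in> stacked d1 d2"
  then have "{(a, i), (b, j)} \<in> d1 \<or> {(a, i), (b, j)} \<in> lower d2" by (simp add: stacked_eq adj_iff)
  then have "{(a, i), (b, j)} \<subseteq> \<Union>d1 \<union> \<Union>(lower d2)" by blast
  then show "(a, i) \<in> {0, 1, 2} \<times> symbols r \<and> (b, j) \<in> {0, 1, 2} \<times> symbols r"
    unfolding diagram_matching(2)[OF assms(1)] lower_matching(2)[OF assms(2)] vertices_def by auto
qed

lemma stacked_path_in:
  assumes "d1 \<in> diagrams r" "d2 \<in> diagrams r" "(u, v) \<in> (stacked d1 d2)\<^sup>*" "u \<noteq> v"
  shows "u \<in> {0, 1, 2} \<times> symbols r" "v \<in> {0, 1, 2} \<times> symbols r"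
proof -
  obtain w where "(u, w) \<in> stacked d1 d2"
    using converse_rtranclE[OF assms(3)] assms(4) by metis
  from SigmaD1[OF subsetD[OF stacked_in[OF assms(1,2)] this]] show "u \<in> {0, 1, 2} \<times> symbols r" .
  obtain w' where "(w', v) \<in> stacked d1 d2"
    using rtranclE[OF assms(3)] assms(4) by metis
  from SigmaD2[OF subsetD[OF stacked_in[OF assms(1,2)] this]] show "v \<in> {0, 1, 2} \<times> symbols r" .
qed

text \<open>
  The stacked graph is the union of two matchings, and exactly the vertices of the outer rows are
  covered by only one of them.
\<close>

lemma concat_closed:
  assumes d1: "d1 \<in> diagrams r" and d2: "d2 \<in> diagrams r"
  shows "concat_diagrams d1 d2 \<in> diagrams r"
proof -
  have U: "\<Union>d1 \<union> \<Union>(lower d2) = {0, 1, 2} \<times> symbols r" "\<Union>d1 \<inter> \<Union>(lower d2) = {1} \<times> symbols r"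
    unfolding diagram_matching(2)[OF d1] lower_matching(2)[OF d2] vertices_def by auto
  have outer_end: "outer u \<in> {0, 1, 2} \<times> symbols r \<and> outer u \<notin> {1} \<times> symbols r \<longleftrightarrow> u \<in> vertices r"
    if "fst u \<le> 1" for u
    using that by (cases u) (auto simp: outer_def vertices_def)
  have row: "fst u \<le> 1" if "u \<in> vertices r" for u
    using that by (auto simp: vertices_def)
  have outer_surj: "\<exists>u\<in>vertices r. x = outer u" if "x \<in> {0, 1, 2} \<times> symbols r" "x \<notin> {1} \<times> symbols r" for x
    using that by (cases x) (force simp: outer_def vertices_def)
  have outer_inj: "outer u = outer v \<longleftrightarrow> u = v" for u v
    by (cases u, cases v) (auto simp: outer_def)
  have path: "\<exists>!y. y \<noteq> outer u \<and> y \<in> {0, 1, 2} \<times> symbols r \<and> y \<notin> {1} \<times> symbols r \<and>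
      (outer u, y) \<in> (stacked d1 d2)\<^sup>*" if "u \<in> vertices r" for u
  proof -
    have fin: "finite ({0, 1, 2} \<times> symbols r :: vertex set)" by (simp add: finite_symbols)
    have mem: "outer u \<in> {0, 1, 2} \<times> symbols r" "outer u \<notin> {1} \<times> symbols r"
      using outer_end[OF row[OF that]] that by simp_all
    show ?thesis
      using matching_path_end[OF diagram_matching(1)[OF d1] lower_matching(1)[OF d2], unfolded U,
          OF fin mem] unfolding stacked_eq .
  qed
  have in_vertices: "u \<in> vertices r" "v \<in> vertices r" if "{u, v} \<in> concat_diagrams d1 d2" for u v
  proof -
    have "outer u \<noteq> outer v" "(outer u, outer v) \<in> (stacked d1 d2)\<^sup>*" "fst u \<le> 1" "fst v \<le> 1"
      using that by (auto simp: concat_iff outer_inj)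
    moreover from this have "outer u \<in> {0, 1, 2} \<times> symbols r" "outer v \<in> {0, 1, 2} \<times> symbols r"
      using stacked_path_in[OF d1 d2] by blast+
    ultimately show "u \<in> vertices r" "v \<in> vertices r"
      by (cases u, cases v, auto simp: outer_def vertices_def)+
  qed
  show ?thesis
  proof (rule diagramsI)
    fix e assume "e \<in> concat_diagrams d1 d2"
    then show "\<exists>u v. e = {u, v}" unfolding concat_diagrams_def by auto
  next
    fix u v assume "{u, v} \<in> concat_diagrams d1 d2"
    then show "u \<noteq> v \<and> u \<in> vertices r" using in_vertices(1)[of u v] by (simp add: concat_iff)
  next
    fix u assume u: "u \<in> vertices r"
    from path[OF u] obtain y where y: "y \<noteq> outer u" "y \<in> {0, 1, 2} \<times> symbols r"
      "y \<notin> {1} \<times> symbols r" "(outer u, y) \<in> (stacked d1 d2)\<^sup>*" by (elim ex1E conjE)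
    from outer_surj[OF y(2,3)] obtain v where "v \<in> vertices r" "y = outer v" by (rule bexE)
    then have "{u, v} \<in> concat_diagrams d1 d2"
      using y(1,4) row u by (simp add: concat_iff outer_inj)
    then show "\<exists>v. {u, v} \<in> concat_diagrams d1 d2" by (rule exI)
  next
    fix u v w assume *: "{u, v} \<in> concat_diagrams d1 d2" "{u, w} \<in> concat_diagrams d1 d2"
    have ends: "outer w' \<noteq> outer u \<and> outer w' \<in> {0, 1, 2} \<times> symbols r \<and> outer w' \<notin> {1} \<times> symbols r \<and>
        (outer u, outer w') \<in> (stacked d1 d2)\<^sup>*" if "{u, w'} \<in> concat_diagrams d1 d2" for w'
      using that outer_end[OF row[OF in_vertices(2)[OF that]]] in_vertices(2)[OF that]
      by (auto simp: concat_iff outer_inj)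
    have "outer v = outer w"
      by (rule ex1E[OF path[OF in_vertices(1)[OF *(1)]]]) (metis ends[OF *(1)] ends[OF *(2)])
    then show "v = w" by (simp add: outer_inj)
  next
    have neg_outer: "neg (outer u) = outer (neg u)" for u
      by (cases u) (simp add: neg_simp outer_def)
    have neg_row: "fst (neg u) = fst u" for u
      by (simp add: neg_def case_prod_unfold)
    have neg_down: "neg (down u) = down (neg u)" for u
      by (cases u) (simp add: neg_simp down_simp)
    have neg_step: "(neg x, neg y) \<in> stacked d1 d2" if "(x, y) \<in> stacked d1 d2" for x y
    proof -
      have "{x, y} \<in> d1 \<or> {x, y} \<in> lower d2"
        using that by (simp add: stacked_eq adj_iff)
      then consider "{x, y} \<in> d1" | x' y' where "x = down x'" "y = down y'" "{x', y'} \<in> d2"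
        unfolding lower_iff by blast
      then show ?thesis
      proof cases
        case 1
        then show ?thesis using diagram_neg[OF d1] by (simp add: stacked_eq adj_iff)
      next
        case 2
        then have "{neg x, neg y} \<in> lower d2"
          unfolding lower_iff using diagram_neg[OF d2 2(3)] neg_down by metis
        then show ?thesis by (simp add: stacked_eq adj_iff)
      qed
    qed
    have neg_path: "(neg x, neg y) \<in> (stacked d1 d2)\<^sup>*" if "(x, y) \<in> (stacked d1 d2)\<^sup>*" for x y
      using that by (induction rule: rtrancl_induct) (auto intro: rtrancl_into_rtrancl neg_step)
    fix u v assume "{u, v} \<in> concat_diagrams d1 d2"
    then show "{neg u, neg v} \<in> concat_diagrams d1 d2"
      using neg_path[of "outer u" "outer v"] neg_neg[of u] neg_neg[of v] neg_row
      by (simp add: concat_iff neg_outer) metis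
  qed
qed

lemma loops_components:
  "loops r d1 d2 = card (components (stacked d1 d2) (UNIV \<times> symbols r) ({1} \<times> UNIV))"
proof -
  have "{C. C \<subseteq> {1} \<times> UNIV \<and> (\<exists>v\<in>{1} \<times> symbols r. C = (stacked d1 d2)\<^sup>* `` {v})} =
      components (stacked d1 d2) (UNIV \<times> symbols r) ({1} \<times> UNIV)"
    unfolding components_def by blast
  then show ?thesis by (simp add: loops_def)
qed

text \<open>
  Three diagrams stacked above each other. Contracting the part formed by the first two diagrams
  at the row 1, or the part formed by the last two at the row 2, gives the graph of one of the two
  ways of bracketing the product, with the rows renumbered; see \<open>stacked_left\<close> and
  \<open>stacked_right\<close>.
\<close>

definition stacked3 :: "diagram \<Rightarrow> diagram \<Rightarrow> diagram \<Rightarrow> (vertex \<times> vertex) set" where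
  "stacked3 d1 d2 d3 = adj (d1 \<union> lower d2 \<union> lower (lower d3))"

text \<open>
  \<open>skip1\<close> and \<open>skip2\<close> number the rows of a stack of two diagrams such that row 1, respectively row 2,
  of a stack of three is left free.
\<close>

definition skip1 :: "vertex \<Rightarrow> vertex" where
  "skip1 = (\<lambda>(a, i). (if a = 0 then 0 else a + 1, i))"

definition skip2 :: "vertex \<Rightarrow> vertex" where
  "skip2 = (\<lambda>(a, i). (if a \<le> 1 then a else a + 1, i))"

lemma inj_skip: "inj skip1" "inj skip2"
  by (auto simp: skip1_def skip2_def inj_def split: if_splits)

lemma stacked_left:
  assumes "d1 \<in> diagrams r" "d2 \<in> diagrams r"
  shows "map_prod skip1 skip1 ` stacked (concat_diagrams d1 d2) d3 =
    contraction {v. fst v \<noteq> 1} (stacked d1 d2) \<union> adj (lower (lower d3))"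
proof -
  have "map_prod skip1 skip1 ` adj (lower d3) = adj (lower (lower d3))"
    unfolding adj_lower[of "lower d3"]
  proof (rule image_cong[OF refl])
    fix p assume "p \<in> adj (lower d3)"
    then obtain q where "p = map_prod down down q" unfolding adj_lower by (rule imageE)
    then show "map_prod skip1 skip1 p = map_prod down down p"
      by (cases q) (auto simp: skip1_def down_def)
  qed
  moreover have "map_prod skip1 skip1 ` adj (concat_diagrams d1 d2) =
      contraction {v. fst v \<noteq> 1} (stacked d1 d2)"
  proof (intro equalityI subsetI)
    fix p assume "p \<in> map_prod skip1 skip1 ` adj (concat_diagrams d1 d2)"
    then obtain u v where uv: "{u, v} \<in> concat_diagrams d1 d2" "p = (skip1 u, skip1 v)"
      by (auto simp: adj_iff)
    moreover have "skip1 w = outer w" if "fst w \<le> 1" for w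
      using that by (cases w) (auto simp: skip1_def outer_def)
    moreover have "fst (outer w) \<noteq> 1" for w
      by (cases w) (simp add: outer_def)
    moreover have "outer u \<noteq> outer v" if "u \<noteq> v"
      using that by (cases u, cases v) (auto simp: outer_def)
    ultimately show "p \<in> contraction {v. fst v \<noteq> 1} (stacked d1 d2)"
      by (auto simp: concat_iff contraction_def)
  next
    fix p assume "p \<in> contraction {v. fst v \<noteq> 1} (stacked d1 d2)"
    then obtain x y where xy: "p = (x, y)" "x \<noteq> y" "fst x \<noteq> 1" "fst y \<noteq> 1"
      "(x, y) \<in> (stacked d1 d2)\<^sup>*" by (auto simp: contraction_def)
    have "\<exists>u. z = outer u \<and> fst u \<le> 1 \<and> skip1 u = z" if "z \<in> {0, 1, 2} \<times> symbols r" "fst z \<noteq> 1" for z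
      using that by (intro exI[of _ "(fst z div 2, snd z)"]) (auto simp: outer_def skip1_def)
    then obtain u v where "x = outer u" "fst u \<le> 1" "skip1 u = x" "y = outer v" "fst v \<le> 1" "skip1 v = y"
      using stacked_path_in[OF assms xy(5,2)] xy(3,4) by metis
    then show "p \<in> map_prod skip1 skip1 ` adj (concat_diagrams d1 d2)"
      using xy by (intro image_eqI[of _ _ "(u, v)"]) (auto simp: adj_iff concat_iff)
  qed
  ultimately show ?thesis
    by (simp add: stacked_eq adj_Un image_Un)
qed

lemma stacked_right:
  assumes "d1 \<in> diagrams r" "d2 \<in> diagrams r" "d3 \<in> diagrams r"
  shows "map_prod skip2 skip2 ` stacked d1 (concat_diagrams d2 d3) =
    contraction {v. fst v \<noteq> 2} (map_prod down down ` stacked d2 d3) \<union> adj d1"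
proof -
  have "map_prod skip2 skip2 ` adj d1 = adj d1"
  proof -
    have "skip2 u = u \<and> skip2 v = v" if "{u, v} \<in> d1" for u v
      using diagram_edge_in[OF assms(1) that] by (auto simp: vertices_def skip2_def)
    then have "map_prod skip2 skip2 p = p" if "p \<in> adj d1" for p
      using that by (cases p) (auto simp: adj_iff)
    then show ?thesis
      using image_cong[of "adj d1" "adj d1" "map_prod skip2 skip2" id] by simp
  qed
  moreover have "map_prod skip2 skip2 ` adj (lower (concat_diagrams d2 d3)) =
      contraction {v. fst v \<noteq> 2} (map_prod down down ` stacked d2 d3)"
  proof (intro equalityI subsetI)
    have skip: "skip2 (down w) = down (outer w)" if "fst w \<le> 1" for w
      using that by (cases w) (auto simp: skip2_def outer_def down_def)
    have row: "fst (down (outer w)) \<noteq> 2" for w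
      by (cases w) (auto simp: outer_def down_def)
    {
      fix p assume "p \<in> map_prod skip2 skip2 ` adj (lower (concat_diagrams d2 d3))"
      then obtain u v where uv: "{u, v} \<in> concat_diagrams d2 d3" "p = (skip2 (down u), skip2 (down v))"
        by (auto simp: adj_lower adj_iff)
      have "(down (outer u), down (outer v)) \<in> (map_prod down down ` stacked d2 d3)\<^sup>*"
        using uv rtrancl_map_prod[OF inj_down] by (auto simp: concat_iff)
      moreover have "down (outer u) \<noteq> down (outer v)"
        using uv by (cases u, cases v) (auto simp: concat_iff outer_def down_def)
      ultimately show "p \<in> contraction {v. fst v \<noteq> 2} (map_prod down down ` stacked d2 d3)"
        using uv skip row by (auto simp: contraction_def concat_iff)
    next
      fix p assume "p \<in> contraction {v. fst v \<noteq> 2} (map_prod down down ` stacked d2 d3)"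
      then obtain x y where xy: "p = (x, y)" "x \<noteq> y" "fst x \<noteq> 2" "fst y \<noteq> 2"
        "(x, y) \<in> (map_prod down down ` stacked d2 d3)\<^sup>*" by (auto simp: contraction_def)
      obtain w where "(x, w) \<in> map_prod down down ` stacked d2 d3"
        using converse_rtranclE[OF xy(5)] xy(2) by metis
      then obtain x' where "x = down x'" by auto
      then obtain y' where xy': "x = down x'" "y = down y'" "(x', y') \<in> (stacked d2 d3)\<^sup>*"
        using xy(5) rtrancl_map_prod[OF inj_down, of x' y "stacked d2 d3"] by blast
      have "\<exists>u. z = outer u \<and> fst u \<le> 1" if "z \<in> {0, 1, 2} \<times> symbols r" "fst (down z) \<noteq> 2" for z
        using that by (intro exI[of _ "(fst z div 2, snd z)"]) (auto simp: outer_def down_def)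
      moreover have "x' \<noteq> y'" using xy(2) xy'(1,2) by auto
      ultimately obtain u v where "x' = outer u" "fst u \<le> 1" "y' = outer v" "fst v \<le> 1"
        using stacked_path_in[OF assms(2,3) xy'(3)] xy(3,4) xy'(1,2) by metis
      moreover from this have "u \<noteq> v" using \<open>x' \<noteq> y'\<close> by auto
      ultimately show "p \<in> map_prod skip2 skip2 ` adj (lower (concat_diagrams d2 d3))"
        using xy(1) xy' skip unfolding adj_lower image_image
        by (intro image_eqI[of _ _ "(u, v)"]) (simp_all add: adj_iff concat_iff)
    }
  qed
  ultimately show ?thesis
    by (simp add: stacked_eq adj_Un image_Un Un_commute)
qed

lemma adj_lower_in:
  assumes "d \<in> diagrams r"
  shows "adj d \<subseteq> ({0, 1} \<times> symbols r) \<times> ({0, 1} \<times> symbols r)"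
    "adj (lower (lower d)) \<subseteq> ({2, 3} \<times> symbols r) \<times> ({2, 3} \<times> symbols r)"
    "map_prod down down ` stacked d' d = adj (lower d' \<union> lower (lower d))"
proof -
  show *: "adj d \<subseteq> ({0, 1} \<times> symbols r) \<times> ({0, 1} \<times> symbols r)"
  proof clarify
    fix a i b j assume "((a, i), (b, j)) \<in> adj d"
    then have "{(a, i), (b, j)} \<in> d" by (simp add: adj_iff)
    from diagram_edge_in[OF assms this]
    show "(a, i) \<in> {0, 1} \<times> symbols r \<and> (b, j) \<in> {0, 1} \<times> symbols r"
      by (simp add: vertices_def)
  qed
  show "adj (lower (lower d)) \<subseteq> ({2, 3} \<times> symbols r) \<times> ({2, 3} \<times> symbols r)"
  proof
    fix p assume "p \<in> adj (lower (lower d))"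
    then obtain a i b j where "p = (down (down (a, i)), down (down (b, j)))" "((a, i), (b, j)) \<in> adj d"
      by (auto simp: adj_lower)
    then show "p \<in> ({2, 3} \<times> symbols r) \<times> ({2, 3} \<times> symbols r)"
      using subsetD[OF *] by (auto simp: down_def)
  qed
  show "map_prod down down ` stacked d' d = adj (lower d' \<union> lower (lower d))"
    by (simp add: stacked_eq adj_Un adj_lower image_Un)
qed

text \<open>
  Both ways of bracketing connect the vertices of the outer rows, which are rows 0 and 3 of the
  triple stack, as the triple stack itself does.
\<close>

lemma concat_assoc_aux:
  assumes "d1 \<in> diagrams r" "d2 \<in> diagrams r" "d3 \<in> diagrams r" "fst u \<le> 1" "fst v \<le> 1"
  defines "o3 \<equiv> \<lambda>(a, i). (3 * a, i)"
  shows "(outer u, outer v) \<in> (stacked (concat_diagrams d1 d2) d3)\<^sup>* \<longleftrightarrow> (o3 u, o3 v) \<in> (stacked3 d1 d2 d3)\<^sup>*"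
    and "(outer u, outer v) \<in> (stacked d1 (concat_diagrams d2 d3))\<^sup>* \<longleftrightarrow> (o3 u, o3 v) \<in> (stacked3 d1 d2 d3)\<^sup>*"
proof -
  have skip: "skip1 (outer w) = o3 w \<and> skip2 (outer w) = o3 w" if "fst w \<le> 1" for w
  proof -
    have "fst w = 0 \<or> fst w = 1" using that by linarith
    then show ?thesis by (cases w) (auto simp: skip1_def skip2_def outer_def o3_def)
  qed
  have W: "o3 w \<in> {v. fst v \<noteq> 1}" "o3 w \<in> {v. fst v \<noteq> 2}" for w
  proof -
    obtain a i where w: "w = (a, i)" by (cases w)
    have "3 * a \<noteq> 1" "3 * a \<noteq> 2" by presburger+
    then show "o3 w \<in> {v. fst v \<noteq> 1}" "o3 w \<in> {v. fst v \<noteq> 2}" by (simp_all add: o3_def w)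
  qed
  have down_eq: "outer u = outer u' \<and> outer v = outer v' \<longleftrightarrow> u = u' \<and> v = v'" for u' v'
    by (cases u, cases v, cases u', cases v') (auto simp: outer_def)
  have "(outer u, outer v) \<in> (stacked (concat_diagrams d1 d2) d3)\<^sup>* \<longleftrightarrow>
      (skip1 (outer u), skip1 (outer v)) \<in> (map_prod skip1 skip1 ` stacked (concat_diagrams d1 d2) d3)\<^sup>*"
    using rtrancl_map_prod[OF inj_skip(1)] injD[OF inj_skip(1)] by metis
  also have "\<dots> \<longleftrightarrow> (o3 u, o3 v) \<in> (contraction {v. fst v \<noteq> 1} (stacked d1 d2) \<union> adj (lower (lower d3)))\<^sup>*"
    using skip assms(4,5) by (simp add: stacked_left[OF assms(1,2)])
  also have "\<dots> \<longleftrightarrow> (o3 u, o3 v) \<in> (stacked d1 d2 \<union> adj (lower (lower d3)))\<^sup>*"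
    using adj_lower_in(2)[OF assms(3)] W by (intro rtrancl_contraction[symmetric]) auto
  finally show "(outer u, outer v) \<in> (stacked (concat_diagrams d1 d2) d3)\<^sup>* \<longleftrightarrow>
      (o3 u, o3 v) \<in> (stacked3 d1 d2 d3)\<^sup>*"
    by (simp add: stacked3_def stacked_eq adj_Un Un_assoc)
  have "(outer u, outer v) \<in> (stacked d1 (concat_diagrams d2 d3))\<^sup>* \<longleftrightarrow>
      (skip2 (outer u), skip2 (outer v)) \<in> (map_prod skip2 skip2 ` stacked d1 (concat_diagrams d2 d3))\<^sup>*"
    using rtrancl_map_prod[OF inj_skip(2)] injD[OF inj_skip(2)] by metis
  also have "\<dots> \<longleftrightarrow> (o3 u, o3 v) \<in>
      (contraction {v. fst v \<noteq> 2} (map_prod down down ` stacked d2 d3) \<union> adj d1)\<^sup>*"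
    using skip assms(4,5) by (simp add: stacked_right[OF assms(1-3)])
  also have "\<dots> \<longleftrightarrow> (o3 u, o3 v) \<in> (map_prod down down ` stacked d2 d3 \<union> adj d1)\<^sup>*"
    using adj_lower_in(1)[OF assms(1)] W by (intro rtrancl_contraction[symmetric]) auto
  finally show "(outer u, outer v) \<in> (stacked d1 (concat_diagrams d2 d3))\<^sup>* \<longleftrightarrow>
      (o3 u, o3 v) \<in> (stacked3 d1 d2 d3)\<^sup>*"
    by (simp add: stacked3_def adj_lower_in(3)[OF assms(3)] adj_Un Un_ac)
qed

lemma concat_assoc:
  assumes "d1 \<in> diagrams r" "d2 \<in> diagrams r" "d3 \<in> diagrams r"
  shows "concat_diagrams (concat_diagrams d1 d2) d3 = concat_diagrams d1 (concat_diagrams d2 d3)"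
  by (rule diagrams_eqI[of _ r])
    (auto simp: concat_closed assms concat_iff concat_assoc_aux[OF assms])

text \<open>
  Both sides count the components of the triple stack inside its two inner rows. On the left a
  component that avoids row 2 is a loop of the first product and the others become loops of the second
  one; on the right row 1 is avoided instead.
\<close>

lemma loops_cocycle:
  assumes "d1 \<in> diagrams r" "d2 \<in> diagrams r" "d3 \<in> diagrams r"
  shows "loops r d1 d2 + loops r (concat_diagrams d1 d2) d3 =
    loops r d2 d3 + loops r d1 (concat_diagrams d2 d3)"
proof -
  let ?S = "UNIV \<times> symbols r :: vertex set"
  let ?M = "{v. fst v = 1 \<or> fst v = 2} :: vertex set"
  have fin: "finite (?S \<inter> ?M)"
  proof (rule finite_subset)
    show "?S \<inter> ?M \<subseteq> {1, 2} \<times> symbols r" by auto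
  qed (simp add: finite_symbols)
  have row: "- {v :: vertex. fst v \<noteq> a} = {a} \<times> UNIV" for a by auto
  let ?R1 = "stacked d1 d2" and ?Q1 = "adj (lower (lower d3))"
  let ?R2 = "map_prod down down ` stacked d2 d3" and ?Q2 = "adj d1"
  have "card (components (?R1 \<union> ?Q1) ?S ?M) =
      card (components ?R1 ?S (- {v. fst v \<noteq> 1})) +
      card (components (contraction {v. fst v \<noteq> 1} ?R1 \<union> ?Q1) ?S (?M \<inter> {v. fst v \<noteq> 1}))"
  proof (rule card_components_contraction[OF _ _ _ _ _ fin])
    show "?Q1 \<subseteq> {v. fst v \<noteq> 1} \<times> {v. fst v \<noteq> 1}" using adj_lower_in(2)[OF assms(3)] by auto
    show "?R1 \<union> ?Q1 \<subseteq> ?S \<times> ?S"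
      using stacked_in[OF assms(1,2)] adj_lower_in(2)[OF assms(3)] by blast
  qed (auto simp: sym_stacked sym_adj)
  also have "card (components ?R1 ?S (- {v. fst v \<noteq> 1})) = loops r d1 d2"
    by (simp only: row loops_components)
  also have "?M \<inter> {v. fst v \<noteq> 1} = {2} \<times> UNIV" by auto
  also have "card (components (contraction {v. fst v \<noteq> 1} ?R1 \<union> ?Q1) ?S ({2} \<times> UNIV)) =
      loops r (concat_diagrams d1 d2) d3"
    unfolding loops_components stacked_left[OF assms(1,2), symmetric]
  proof (rule card_components_map_prod[OF inj_skip(1)])
    show "{2} \<times> UNIV \<subseteq> range skip1"
    proof clarify
      fix i show "(2, i) \<in> range skip1" by (rule range_eqI[of _ _ "(1, i)"]) (simp add: skip1_def)
    qed
  qed (auto simp: skip1_def split: if_splits)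
  finally have 1: "card (components (?R1 \<union> ?Q1) ?S ?M) =
      loops r d1 d2 + loops r (concat_diagrams d1 d2) d3" .
  have "card (components (?R2 \<union> ?Q2) ?S ?M) =
      card (components ?R2 ?S (- {v. fst v \<noteq> 2})) +
      card (components (contraction {v. fst v \<noteq> 2} ?R2 \<union> ?Q2) ?S (?M \<inter> {v. fst v \<noteq> 2}))"
  proof (rule card_components_contraction[OF _ _ _ _ _ fin])
    show "?Q2 \<subseteq> {v. fst v \<noteq> 2} \<times> {v. fst v \<noteq> 2}" using adj_lower_in(1)[OF assms(1)] by auto
    show "?R2 \<union> ?Q2 \<subseteq> ?S \<times> ?S"
      using stacked_in[OF assms(2,3)] adj_lower_in(1)[OF assms(1)] by (fastforce simp: down_def)
    show "sym ?R2" by (simp add: adj_lower_in(3)[OF assms(3)] sym_adj)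
  qed (auto simp: sym_adj)
  also have "card (components ?R2 ?S (- {v. fst v \<noteq> 2})) = loops r d2 d3"
    unfolding loops_components row
  proof (rule card_components_map_prod[OF inj_down])
    show "{2} \<times> UNIV \<subseteq> range down"
    proof clarify
      fix i show "(2, i) \<in> range down" by (rule range_eqI[of _ _ "(1, i)"]) (simp add: down_def)
    qed
  qed (auto simp: down_def)
  also have "?M \<inter> {v. fst v \<noteq> 2} = {1} \<times> UNIV" by auto
  also have "card (components (contraction {v. fst v \<noteq> 2} ?R2 \<union> ?Q2) ?S ({1} \<times> UNIV)) =
      loops r d1 (concat_diagrams d2 d3)"
    unfolding loops_components stacked_right[OF assms, symmetric]
  proof (rule card_components_map_prod[OF inj_skip(2)])
    show "{1} \<times> UNIV \<subseteq> range skip2"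
    proof clarify
      fix i show "(1, i) \<in> range skip2" by (rule range_eqI[of _ _ "(1, i)"]) (simp add: skip2_def)
    qed
  qed (auto simp: skip2_def split: if_splits)
  finally have 2: "card (components (?R2 \<union> ?Q2) ?S ?M) =
      loops r d2 d3 + loops r d1 (concat_diagrams d2 d3)" .
  have "?R1 = adj (d1 \<union> lower d2)" by (rule stacked_eq)
  moreover have "?R2 = adj (lower d2 \<union> lower (lower d3))" by (rule adj_lower_in(3)[OF assms(3)])
  ultimately have "?R1 \<union> ?Q1 = ?R2 \<union> ?Q2"
    by (simp only: adj_Un Un_ac)
  then show ?thesis using 1 2 by simp
qed

section \<open>The hyperoctahedral group\<close>

lemma hyperoctD:
  assumes "\<sigma> \<in> carrier (hyperoct n)"
  shows "\<sigma> permutes symbols n" "\<sigma> (- i) = - \<sigma> i" "\<sigma> i \<in> symbols n \<longleftrightarrow> i \<in> symbols n"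
    "\<sigma> i = \<sigma> j \<longleftrightarrow> i = j" "bij \<sigma>"
  using assms permutes_in_image[of \<sigma>] permutes_bij[of \<sigma>]
  by (auto simp: hyperoct_def dest: permutes_inj injD)

lemma hyperoctI: "\<sigma> permutes symbols n \<Longrightarrow> (\<And>i. \<sigma> (- i) = - \<sigma> i) \<Longrightarrow> \<sigma> \<in> carrier (hyperoct n)"
  by (simp add: hyperoct_def)

lemma hyperoct_simps: "\<sigma> \<otimes>\<^bsub>hyperoct n\<^esub> \<tau> = \<tau> \<circ> \<sigma>" "\<one>\<^bsub>hyperoct n\<^esub> = id"
  by (simp_all add: hyperoct_def)

lemma hyperoct_comp:
  "\<sigma> \<in> carrier (hyperoct n) \<Longrightarrow> \<tau> \<in> carrier (hyperoct n) \<Longrightarrow> \<tau> \<circ> \<sigma> \<in> carrier (hyperoct n)"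
  by (simp add: hyperoct_def permutes_compose)

lemma hyperoct_id: "id \<in> carrier (hyperoct n)"
  by (simp add: hyperoct_def permutes_id)

lemma hyperoct_inv:
  assumes "\<sigma> \<in> carrier (hyperoct n)" shows "inv_into UNIV \<sigma> \<in> carrier (hyperoct n)"
proof (rule hyperoctI)
  show "inv_into UNIV \<sigma> permutes symbols n" using hyperoctD(1)[OF assms] by (rule permutes_inv)
  fix i
  have "\<sigma> (- inv_into UNIV \<sigma> i) = - i"
    using hyperoctD(2)[OF assms] permutes_inverses(1)[OF hyperoctD(1)[OF assms]] by simp
  then show "inv_into UNIV \<sigma> (- i) = - inv_into UNIV \<sigma> i"
    using permutes_inverses(2)[OF hyperoctD(1)[OF assms]] by metis
qed

lemma group_hyperoct: "group (hyperoct n)"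
proof (rule groupI)
  fix \<sigma> assume "\<sigma> \<in> carrier (hyperoct n)"
  then show "\<exists>\<tau>\<in>carrier (hyperoct n). \<tau> \<otimes>\<^bsub>hyperoct n\<^esub> \<sigma> = \<one>\<^bsub>hyperoct n\<^esub>"
    using permutes_inv_o(1)[OF hyperoctD(1)] hyperoct_inv
    by (intro bexI[of _ "inv_into UNIV \<sigma>"]) (auto simp: hyperoct_simps)
qed (auto simp: hyperoct_simps hyperoct_comp hyperoct_id o_assoc)

lemma m_inv_hyperoct:
  assumes "\<sigma> \<in> carrier (hyperoct n)" shows "inv\<^bsub>hyperoct n\<^esub> \<sigma> = inv_into UNIV \<sigma>"
  by (rule group.inv_equality[OF group_hyperoct _ assms hyperoct_inv[OF assms]])
    (simp add: hyperoct_simps permutes_inv_o(1)[OF hyperoctD(1)[OF assms]])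

lemma finite_hyperoct: "finite (carrier (hyperoct n))"
  by (rule finite_subset[OF _ finite_permutations[OF finite_symbols[of n]]]) (auto simp: hyperoct_def)

lemma twisted_monoid_hyperoct: "twisted_monoid (hyperoct n) (\<lambda>_ _. 1)"
  by (intro twisted_monoid.intro group.is_monoid[OF group_hyperoct] twisted_monoid_axioms.intro)
    (simp_all add: finite_hyperoct)

section \<open>The Brauer algebra as a ring\<close>

lemma symbols_shift:
  assumes "l \<le> r" "j \<in> symbols (r - l)" shows "shift l j \<in> symbols r" "\<bar>shift l j\<bar> > int l"
  using assms by (auto simp: shift_def symbols_def sgn_if)

lemma shift_uminus: "shift l (- j) = - shift l j"
  by (simp add: shift_def sgn_minus)

lemma shift_inj: "shift l i = shift l j \<longleftrightarrow> i = j"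
  by (auto simp: shift_def sgn_if split: if_splits)

lemma shift_surj:
  assumes "i \<in> symbols r" "\<bar>i\<bar> > int l" obtains j where "j \<in> symbols (r - l)" "i = shift l j"
proof
  show "i - sgn i * int l \<in> symbols (r - l)" "i = shift l (i - sgn i * int l)"
    using assms by (auto simp: shift_def symbols_def sgn_if)
qed

lemma layer_diagram_iff:
  "{u, v} \<in> layer_diagram r l \<sigma> \<longleftrightarrow>
    (\<exists>a i. a \<in> {0, 1} \<and> i \<noteq> 0 \<and> \<bar>i\<bar> \<le> int l \<and> u = (a, i) \<and> v = (a, - i)) \<or>
    (\<exists>j\<in>symbols (r - l). u = (0, shift l j) \<and> v = (1, shift l (\<sigma> j)) \<or>
      v = (0, shift l j) \<and> u = (1, shift l (\<sigma> j)))"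
  (is "_ \<longleftrightarrow> ?H \<or> ?V")
proof
  assume "{u, v} \<in> layer_diagram r l \<sigma>"
  then consider (h) a i where "{u, v} = {(a, - i), (a, i)}" "a \<in> {0, 1}" "i \<in> {1..int l}"
    | (v) j where "{u, v} = {(0, shift l j), (1, shift l (\<sigma> j))}" "j \<in> symbols (r - l)"
    unfolding layer_diagram_def by blast
  then show "?H \<or> ?V"
  proof cases
    case h
    then have "(u = (a, - i) \<and> v = (a, - (- i))) \<or> (u = (a, i) \<and> v = (a, - i))"
      by (auto simp: doubleton_eq_iff)
    moreover have "i \<noteq> 0 \<and> \<bar>i\<bar> \<le> int l" "- i \<noteq> 0 \<and> \<bar>- i\<bar> \<le> int l" using h(3) by auto
    ultimately have ?H using h(2) by blast
    then show ?thesis ..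
  next
    case v
    then have ?V by (intro bexI[of _ j]) (auto simp: doubleton_eq_iff)
    then show ?thesis ..
  qed
next
  assume "?H \<or> ?V"
  then show "{u, v} \<in> layer_diagram r l \<sigma>"
  proof
    assume ?H
    then obtain a i where ai: "a \<in> {0, 1}" "i \<noteq> 0" "\<bar>i\<bar> \<le> int l" "u = (a, i)" "v = (a, - i)" by metis
    then have "{u, v} = {(a, - \<bar>i\<bar>), (a, \<bar>i\<bar>)}" "\<bar>i\<bar> \<in> {1..int l}" by (auto simp: abs_if)
    then show ?thesis using ai(1) unfolding layer_diagram_def by blast
  next
    assume ?V
    then obtain j where "j \<in> symbols (r - l)" "{u, v} = {(0, shift l j), (1, shift l (\<sigma> j))}" by auto
    then show ?thesis unfolding layer_diagram_def by blast
  qed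
qed

lemma layer_diagram_pairs: "e \<in> layer_diagram r l \<sigma> \<Longrightarrow> \<exists>u v. e = {u, v}"
  unfolding layer_diagram_def by auto

lemma layer_diagram_closed:
  assumes l: "l \<le> r" and \<sigma>: "\<sigma> \<in> carrier (hyperoct (r - l))"
  shows "layer_diagram r l \<sigma> \<in> diagrams r"
proof (rule diagramsI)
  have \<sigma>_in: "\<sigma> j \<in> symbols (r - l)" if "j \<in> symbols (r - l)" for j
    using hyperoctD(3)[OF \<sigma>] that by simp
  note s = symbols_shift[OF l] symbols_shift[OF l \<sigma>_in]
  show "\<exists>u v. e = {u, v}" if "e \<in> layer_diagram r l \<sigma>" for e
    using that by (rule layer_diagram_pairs)
  show "u \<noteq> v \<and> u \<in> vertices r" if "{u, v} \<in> layer_diagram r l \<sigma>" for u v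
    using that unfolding layer_diagram_iff
  proof (elim disjE exE bexE conjE)
    fix a i assume "a \<in> {0, 1 :: nat}" "i \<noteq> 0" "\<bar>i\<bar> \<le> int l" "u = (a, i)" "v = (a, - i)"
    then show ?thesis using l by (auto simp: vertices_def symbols_def)
  next
    fix j assume "j \<in> symbols (r - l)" "u = (0, shift l j)" "v = (1, shift l (\<sigma> j))"
    then show ?thesis using s(1)[of j] by (simp add: vertices_def)
  next
    fix j assume "j \<in> symbols (r - l)" "v = (0, shift l j)" "u = (1, shift l (\<sigma> j))"
    then show ?thesis using s(3)[of j] by (simp add: vertices_def)
  qed
  show "\<exists>v. {u, v} \<in> layer_diagram r l \<sigma>" if u: "u \<in> vertices r" for u
  proof -
    obtain a i where ai: "u = (a, i)" "a \<in> {0, 1}" "i \<in> symbols r"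
      using u unfolding vertices_def by blast
    show ?thesis
    proof (cases "\<bar>i\<bar> \<le> int l")
      case True
      then have "{u, (a, - i)} \<in> layer_diagram r l \<sigma>"
        using ai unfolding layer_diagram_iff
        by (intro disjI1 exI[of _ a] exI[of _ i]) (simp add: symbols_def)
      then show ?thesis ..
    next
      case False
      then have "\<bar>i\<bar> > int l" by simp
      with ai(3) obtain j where j: "j \<in> symbols (r - l)" "i = shift l j" by (rule shift_surj)
      show ?thesis
      proof (cases "a = 0")
        case True
        have "{u, (1, shift l (\<sigma> j))} \<in> layer_diagram r l \<sigma>"
          unfolding layer_diagram_iff by (rule disjI2, rule bexI[of _ j]) (use ai j True in simp_all)
        then show ?thesis ..
      next
        case False
        have inv: "\<sigma> (inv_into UNIV \<sigma> j) = j" "inv_into UNIV \<sigma> j \<in> symbols (r - l)"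
          using permutes_inverses(1)[OF hyperoctD(1)[OF \<sigma>]] hyperoctD(3)[OF hyperoct_inv[OF \<sigma>]] j
          by auto
        have "{u, (0, shift l (inv_into UNIV \<sigma> j))} \<in> layer_diagram r l \<sigma>"
          unfolding layer_diagram_iff
          by (rule disjI2, rule bexI[of _ "inv_into UNIV \<sigma> j"]) (use ai j False inv in simp_all)
        then show ?thesis ..
      qed
    qed
  qed
  show "v = w" if "{u, v} \<in> layer_diagram r l \<sigma>" "{u, w} \<in> layer_diagram r l \<sigma>" for u v w
  proof -
    have cases: "\<bar>snd u\<bar> \<le> int l \<and> x = (fst u, - snd u) \<or> \<bar>snd u\<bar> > int l \<and>
        (\<exists>j. u = (0, shift l j) \<and> x = (1, shift l (\<sigma> j)) \<or> u = (1, shift l (\<sigma> j)) \<and> x = (0, shift l j))"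
      if "{u, x} \<in> layer_diagram r l \<sigma>" for x
      using that unfolding layer_diagram_iff
    proof (elim disjE exE bexE conjE)
      fix j assume "j \<in> symbols (r - l)" "u = (0, shift l j)" "x = (1, shift l (\<sigma> j))"
      then show ?thesis using s(2)[of j] by auto
    next
      fix j assume "j \<in> symbols (r - l)" "x = (0, shift l j)" "u = (1, shift l (\<sigma> j))"
      then show ?thesis using s(4)[of j] by auto
    qed simp
    from cases[OF that(1)] cases[OF that(2)] show ?thesis
      by (elim disjE exE conjE) (simp_all add: shift_inj hyperoctD(4)[OF \<sigma>])
  qed
  show "{neg u, neg v} \<in> layer_diagram r l \<sigma>" if "{u, v} \<in> layer_diagram r l \<sigma>" for u v
    using that unfolding layer_diagram_iff
  proof (elim disjE)
    assume "\<exists>a i. a \<in> {0, 1} \<and> i \<noteq> 0 \<and> \<bar>i\<bar> \<le> int l \<and> u = (a, i) \<and> v = (a, - i)"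
    then obtain a i where ai: "a \<in> {0, 1 :: nat}" "i \<noteq> 0" "\<bar>i\<bar> \<le> int l" "u = (a, i)" "v = (a, - i)"
      by (elim exE conjE)
    then show "(\<exists>a i. a \<in> {0, 1} \<and> i \<noteq> 0 \<and> \<bar>i\<bar> \<le> int l \<and> neg u = (a, i) \<and> neg v = (a, - i)) \<or>
      (\<exists>j\<in>symbols (r - l). neg u = (0, shift l j) \<and> neg v = (1, shift l (\<sigma> j)) \<or>
      neg v = (0, shift l j) \<and> neg u = (1, shift l (\<sigma> j)))"
      by (intro disjI1 exI[of _ a] exI[of _ "- i"]) (simp add: neg_simp)
  next
    assume "\<exists>j\<in>symbols (r - l). u = (0, shift l j) \<and> v = (1, shift l (\<sigma> j)) \<or>
      v = (0, shift l j) \<and> u = (1, shift l (\<sigma> j))"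
    then obtain j where j: "j \<in> symbols (r - l)" "u = (0, shift l j) \<and> v = (1, shift l (\<sigma> j)) \<or>
      v = (0, shift l j) \<and> u = (1, shift l (\<sigma> j))" by blast
    have eqs: "neg (0, shift l j) = (0, shift l (- j))" "neg (1, shift l (\<sigma> j)) = (1, shift l (\<sigma> (- j)))"
      by (simp_all add: neg_simp shift_uminus hyperoctD(2)[OF \<sigma>])
    have "neg u = (0, shift l (- j)) \<and> neg v = (1, shift l (\<sigma> (- j))) \<or>
        neg v = (0, shift l (- j)) \<and> neg u = (1, shift l (\<sigma> (- j)))"
      using j(2) unfolding eqs[symmetric] by blast
    moreover have "- j \<in> symbols (r - l)"
      using j(1) by (simp add: symbols_uminus)
    ultimately show "(\<exists>a i. a \<in> {0, 1} \<and> i \<noteq> 0 \<and> \<bar>i\<bar> \<le> int l \<and> neg u = (a, i) \<and> neg v = (a, - i)) \<or>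
      (\<exists>j\<in>symbols (r - l). neg u = (0, shift l j) \<and> neg v = (1, shift l (\<sigma> j)) \<or>
      neg v = (0, shift l j) \<and> neg u = (1, shift l (\<sigma> j)))"
      by blast
  qed
qed

lemma top_edge_concat:
  "{(0, i), (0, j)} \<in> d1 \<Longrightarrow> i \<noteq> j \<Longrightarrow> {(0, i), (0, j)} \<in> concat_diagrams d1 d2"
  unfolding concat_iff by (auto simp: outer_simp stacked_eq adj_iff)

lemma bottom_edge_concat:
  assumes "{(1, i), (1, j)} \<in> d2" "i \<noteq> j" shows "{(1, i), (1, j)} \<in> concat_diagrams d1 d2"
proof -
  have "{down (1, i), down (1, j)} \<in> lower d2" unfolding lower_iff using assms by blast
  then have "(outer (1, i), outer (1, j)) \<in> stacked d1 d2"
    by (simp add: outer_simp down_simp stacked_eq adj_iff numeral_2_eq_2)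
  then show ?thesis using assms(2) unfolding concat_iff by (simp add: r_into_rtrancl)
qed

text \<open>
  Each row has \<open>2r\<close> vertices, of which the vertical edges cover equally many in both rows.
\<close>

lemma horizontal_bottom:
  assumes d: "d \<in> diagrams r" shows "horizontal d = card {e \<in> d. e \<subseteq> {1} \<times> UNIV}"
proof -
  let ?row = "\<lambda>a. {a} \<times> UNIV :: vertex set"
  have fin: "finite d"
    using diagram_matching(2)[OF d] finite_UnionD[of d] by (simp add: vertices_def finite_symbols)
  have fin_e: "finite e" if "e \<in> d" for e
    using diagram_matching(1)[OF d] that unfolding matching_def by (metis card.infinite zero_neq_numeral)
  have row: "(\<Sum>e\<in>d. card (e \<inter> ?row a)) = card (symbols r)" if "a \<in> {0, 1}" for a
  proof -
    have "(\<Union>e\<in>d. e \<inter> ?row a) = {a} \<times> symbols r"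
      using diagram_matching(2)[OF d] that unfolding vertices_def by blast
    moreover have "card (\<Union>e\<in>d. e \<inter> ?row a) = (\<Sum>e\<in>d. card (e \<inter> ?row a))"
    proof (rule card_UN_disjoint[OF fin])
      show "\<forall>e\<in>d. finite (e \<inter> ?row a)" using fin_e by blast
      show "\<forall>e\<in>d. \<forall>f\<in>d. e \<noteq> f \<longrightarrow> e \<inter> ?row a \<inter> (f \<inter> ?row a) = {}"
        using diagram_matching(1)[OF d] unfolding matching_def by blast
    qed
    ultimately show ?thesis by (simp add: card_cartesian_product_singleton)
  qed
  have edge: "card (e \<inter> ?row 0) + (if e \<subseteq> ?row 1 then 2 else 0) =
      card (e \<inter> ?row 1) + (if e \<subseteq> ?row 0 then 2 else 0)" if e: "e \<in> d" for e
  proof -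
    obtain u v where uv: "e = {u, v}" "u \<noteq> v" "{u, v} \<in> d" by (rule diagram_edgeE[OF d e])
    have "fst u = 0 \<or> fst u = 1" "fst v = 0 \<or> fst v = 1"
      using diagram_edge_in(1,2)[OF d uv(3)] by (auto simp: vertices_def)
    moreover have "w \<in> ?row a \<longleftrightarrow> fst w = a" for w a by (cases w) auto
    ultimately show ?thesis using uv(1,2) by (auto simp: Int_insert_left)
  qed
  have "(\<Sum>e\<in>d. card (e \<inter> ?row 0)) + (\<Sum>e\<in>d. if e \<subseteq> ?row 1 then 2 else 0) =
      (\<Sum>e\<in>d. card (e \<inter> ?row 1)) + (\<Sum>e\<in>d. if e \<subseteq> ?row 0 then 2 else 0)"
    unfolding sum.distrib[symmetric] using edge by (intro sum.cong refl)
  moreover have "(\<Sum>e\<in>d. if e \<subseteq> ?row a then 2 else 0) = 2 * card {e \<in> d. e \<subseteq> ?row a}" for a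
    using fin by (simp add: sum.If_cases Int_def)
  ultimately show ?thesis
    using row[of 0] row[of 1] by (simp add: horizontal_def)
qed

lemma row_edgeE:
  assumes "d \<in> diagrams r" "e \<in> d" "e \<subseteq> {a} \<times> UNIV"
  obtains i j where "e = {(a, i), (a, j)}" "i \<noteq> j"
proof -
  obtain u v where uv: "e = {u, v}" "u \<noteq> v" by (rule diagram_edgeE[OF assms(1,2)])
  then have "u = (a, snd u)" "v = (a, snd v)" using assms(3) by auto
  then show thesis using that[of "snd u" "snd v"] uv by (metis prod.collapse)
qed

lemma finite_diagram: "d \<in> diagrams r \<Longrightarrow> finite d"
  using diagram_matching(2)[of d r] finite_UnionD[of d] by (simp add: vertices_def finite_symbols)

text \<open>
  The horizontal edges of \<open>d1\<close> in the top row and those of \<open>d2\<close> in the bottom row survive.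
\<close>

lemma horizontal_concat:
  assumes d1: "d1 \<in> diagrams r" and d2: "d2 \<in> diagrams r"
  shows "horizontal d1 \<le> horizontal (concat_diagrams d1 d2)"
    "horizontal d2 \<le> horizontal (concat_diagrams d1 d2)"
proof -
  have d: "concat_diagrams d1 d2 \<in> diagrams r" using d1 d2 by (rule concat_closed)
  show "horizontal d1 \<le> horizontal (concat_diagrams d1 d2)"
    unfolding horizontal_def
  proof (rule card_mono)
    show "{e \<in> d1. e \<subseteq> {0} \<times> UNIV} \<subseteq> {e \<in> concat_diagrams d1 d2. e \<subseteq> {0} \<times> UNIV}"
    proof clarify
      fix e assume "e \<in> d1" "e \<subseteq> {0} \<times> UNIV"
      then show "e \<in> concat_diagrams d1 d2"
        using row_edgeE[OF d1] top_edge_concat by metis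
    qed
  qed (simp add: finite_diagram[OF d])
  show "horizontal d2 \<le> horizontal (concat_diagrams d1 d2)"
    unfolding horizontal_bottom[OF d] horizontal_bottom[OF d2]
  proof (rule card_mono)
    show "{e \<in> d2. e \<subseteq> {1} \<times> UNIV} \<subseteq> {e \<in> concat_diagrams d1 d2. e \<subseteq> {1} \<times> UNIV}"
    proof clarify
      fix e assume "e \<in> d2" "e \<subseteq> {1} \<times> UNIV"
      then show "e \<in> concat_diagrams d1 d2"
        using row_edgeE[OF d2] bottom_edge_concat by metis
    qed
  qed (simp add: finite_diagram[OF d])
qed

lemma identity_diagram_iff:
  "{(0, i), (1, j)} \<in> layer_diagram r 0 id \<longleftrightarrow> i = j \<and> i \<in> symbols r"
  unfolding layer_diagram_iff by (auto simp: shift_def)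

lemma concat_identity:
  assumes d: "d \<in> diagrams r"
  shows "concat_diagrams (layer_diagram r 0 id) d = d" "concat_diagrams d (layer_diagram r 0 id) = d"
    "loops r (layer_diagram r 0 id) d = 0" "loops r d (layer_diagram r 0 id) = 0"
proof -
  let ?I = "layer_diagram r 0 id"
  have I: "?I \<in> diagrams r" using layer_diagram_closed[of 0 r id] hyperoct_id by simp
  have up: "((0, i), (1, i)) \<in> stacked ?I d'" if "i \<in> symbols r" for i d'
    using that identity_diagram_iff[of i i r] by (simp add: stacked_eq adj_iff)
  have dn: "((1, i), (2, i)) \<in> stacked d' ?I" if "i \<in> symbols r" for i d'
  proof -
    have "{(1, i), (2, i)} \<in> lower ?I"
      unfolding lower_iff using that identity_diagram_iff[of i i r]
      by (intro exI[of _ "(0, i)"] exI[of _ "(1, i)"]) (simp add: down_simp)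
    then show ?thesis by (simp add: stacked_eq adj_iff)
  qed
  note sym = sym_rtrancl[OF sym_stacked, THEN symD]
  have v: "fst u \<le> 1" if "u \<in> vertices r" for u using that by (auto simp: vertices_def)
  have "d = concat_diagrams ?I d"
  proof (rule diagrams_eqI[OF d concat_closed[OF I d]])
    fix u v assume uv: "{u, v} \<in> d"
    have p: "(outer w, down w) \<in> (stacked ?I d)\<^sup>*" if "w \<in> vertices r" for w
      using that up[of "snd w" d] by (auto simp: vertices_def outer_simp down_simp numeral_2_eq_2)
    have "{down u, down v} \<in> lower d" unfolding lower_iff using uv by blast
    then have "(down u, down v) \<in> (stacked ?I d)\<^sup>*" by (auto simp: stacked_eq adj_iff)
    then have "(outer u, outer v) \<in> (stacked ?I d)\<^sup>*"
      using p diagram_edge_in(1,2)[OF d uv] sym by (metis rtrancl_trans)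
    then show "{u, v} \<in> concat_diagrams ?I d"
      using diagram_edge_in[OF d uv] v by (simp add: concat_iff)
  qed
  then show "concat_diagrams ?I d = d" by simp
  have "d = concat_diagrams d ?I"
  proof (rule diagrams_eqI[OF d concat_closed[OF d I]])
    fix u v assume uv: "{u, v} \<in> d"
    have p: "(w, outer w) \<in> (stacked d ?I)\<^sup>*" if "w \<in> vertices r" for w
      using that dn[of "snd w" d] by (auto simp: vertices_def outer_simp)
    have "(u, v) \<in> (stacked d ?I)\<^sup>*" using uv by (auto simp: stacked_eq adj_iff)
    then have "(outer u, outer v) \<in> (stacked d ?I)\<^sup>*"
      using p diagram_edge_in(1,2)[OF d uv] sym by (metis rtrancl_trans)
    then show "{u, v} \<in> concat_diagrams d ?I"
      using diagram_edge_in[OF d uv] v by (simp add: concat_iff)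
  qed
  then show "concat_diagrams d ?I = d" by simp
  have "\<not> (\<exists>v\<in>{1} \<times> symbols r. C = (stacked ?I d)\<^sup>* `` {v})" if "C \<subseteq> {1} \<times> UNIV" for C
  proof
    assume "\<exists>v\<in>{1} \<times> symbols r. C = (stacked ?I d)\<^sup>* `` {v}"
    then obtain i where i: "i \<in> symbols r" "C = (stacked ?I d)\<^sup>* `` {(1, i)}" by blast
    then have "(0, i) \<in> C" using sym[OF r_into_rtrancl[OF up[OF i(1), of d]]] by simp
    then show False using that by auto
  qed
  then have "{C. C \<subseteq> {1} \<times> UNIV \<and> (\<exists>v\<in>{1} \<times> symbols r. C = (stacked ?I d)\<^sup>* `` {v})} = {}"
    by blast
  then show "loops r ?I d = 0" unfolding loops_def by (simp only: card.empty)
  have "\<not> (\<exists>v\<in>{1} \<times> symbols r. C = (stacked d ?I)\<^sup>* `` {v})" if "C \<subseteq> {1} \<times> UNIV" for C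
  proof
    assume "\<exists>v\<in>{1} \<times> symbols r. C = (stacked d ?I)\<^sup>* `` {v}"
    then obtain i where i: "i \<in> symbols r" "C = (stacked d ?I)\<^sup>* `` {(1, i)}" by blast
    then have "(2, i) \<in> C" using r_into_rtrancl[OF dn[OF i(1), of d]] by simp
    then show False using that by auto
  qed
  then have "{C. C \<subseteq> {1} \<times> UNIV \<and> (\<exists>v\<in>{1} \<times> symbols r. C = (stacked d ?I)\<^sup>* `` {v})} = {}"
    by blast
  then show "loops r d ?I = 0" unfolding loops_def by (simp only: card.empty)
qed

lemma twisted_monoid_brauer: "twisted_monoid (brauer_monoid r) (\<lambda>d1 d2. \<delta> ^ loops r d1 d2)"
proof (intro twisted_monoid.intro twisted_monoid_axioms.intro)
  have I: "layer_diagram r 0 id \<in> diagrams r"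
    using layer_diagram_closed[of 0 r id] hyperoct_id by simp
  show "Group.monoid (brauer_monoid r)"
    by (rule monoidI) (simp_all add: brauer_monoid_def concat_closed concat_assoc[of _ r] concat_identity I)
  show "finite (carrier (brauer_monoid r))"
    by (simp add: brauer_monoid_def finite_diagrams)
  show "\<delta> ^ loops r x y * \<delta> ^ loops r (x \<otimes>\<^bsub>brauer_monoid r\<^esub> y) z =
      \<delta> ^ loops r y z * \<delta> ^ loops r x (y \<otimes>\<^bsub>brauer_monoid r\<^esub> z)"
    if "x \<in> carrier (brauer_monoid r)" "y \<in> carrier (brauer_monoid r)" "z \<in> carrier (brauer_monoid r)" for x y z
    using that loops_cocycle[of x r y z] by (simp add: brauer_monoid_def flip: power_add)
qed (simp_all add: brauer_monoid_def concat_identity)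

section \<open>Diagrams in a corner of the Brauer algebra\<close>

lemma layer_diagram_arc: "a \<in> {0, 1} \<Longrightarrow> i \<noteq> 0 \<Longrightarrow> \<bar>i\<bar> \<le> int l \<Longrightarrow> {(a, i), (a, - i)} \<in> layer_diagram r l \<sigma>"
  unfolding layer_diagram_iff by (intro disjI1 exI[of _ a] exI[of _ i]) simp

lemma layer_diagram_strand:
  "j \<in> symbols (r - l) \<Longrightarrow> {(0, shift l j), (1, shift l (\<sigma> j))} \<in> layer_diagram r l \<sigma>"
  unfolding layer_diagram_iff by (rule disjI2) (rule bexI[of _ j], simp_all)

lemma concat_layer_diagram:
  assumes l: "l \<le> r" and \<sigma>: "\<sigma> \<in> carrier (hyperoct (r - l))" and \<tau>: "\<tau> \<in> carrier (hyperoct (r - l))"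
  shows "concat_diagrams (layer_diagram r l \<sigma>) (layer_diagram r l \<tau>) = layer_diagram r l (\<tau> \<circ> \<sigma>)"
proof -
  let ?D = "layer_diagram r l \<sigma>" and ?E = "layer_diagram r l \<tau>"
  have D: "?D \<in> diagrams r" and E: "?E \<in> diagrams r" and DE: "layer_diagram r l (\<tau> \<circ> \<sigma>) \<in> diagrams r"
    using layer_diagram_closed[OF l] \<sigma> \<tau> hyperoct_comp by auto
  have path: "{(0, shift l j), (1, shift l (\<tau> (\<sigma> j)))} \<in> concat_diagrams ?D ?E"
    if j: "j \<in> symbols (r - l)" for j
  proof -
    have "((0, shift l j), (1, shift l (\<sigma> j))) \<in> stacked ?D ?E"
      using layer_diagram_strand[OF j, of \<sigma>] by (simp add: stacked_eq adj_iff)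
    moreover have "{down (0, shift l (\<sigma> j)), down (1, shift l (\<tau> (\<sigma> j)))} \<in> lower ?E"
      unfolding lower_iff using layer_diagram_strand[of "\<sigma> j" r l \<tau>] hyperoctD(3)[OF \<sigma>] j by blast
    then have "((1, shift l (\<sigma> j)), (2, shift l (\<tau> (\<sigma> j)))) \<in> stacked ?D ?E"
      by (simp add: stacked_eq adj_iff down_simp numeral_2_eq_2)
    ultimately have "((0, shift l j), (2, shift l (\<tau> (\<sigma> j)))) \<in> (stacked ?D ?E)\<^sup>*"
      by (rule converse_rtrancl_into_rtrancl[OF _ r_into_rtrancl])
    then show ?thesis unfolding concat_iff by (simp add: outer_simp)
  qed
  have "layer_diagram r l (\<tau> \<circ> \<sigma>) = concat_diagrams ?D ?E"
  proof (rule diagrams_eqI[OF DE concat_closed[OF D E]])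
    fix u v assume "{u, v} \<in> layer_diagram r l (\<tau> \<circ> \<sigma>)"
    then show "{u, v} \<in> concat_diagrams ?D ?E"
      unfolding layer_diagram_iff
    proof (elim disjE exE bexE conjE)
      fix a i assume ai: "a \<in> {0, 1 :: nat}" "i \<noteq> 0" "\<bar>i\<bar> \<le> int l" "u = (a, i)" "v = (a, - i)"
      then consider "a = 0" | "a = 1" by blast
      then show ?thesis
      proof cases
        case 1
        then show ?thesis using top_edge_concat[OF layer_diagram_arc[of 0 i l r \<sigma>], of ?E] ai by simp
      next
        case 2
        then show ?thesis using bottom_edge_concat[OF layer_diagram_arc[of 1 i l r \<tau>], of ?D] ai by simp
      qed
    next
      fix j assume "j \<in> symbols (r - l)" "u = (0, shift l j)" "v = (1, shift l ((\<tau> \<circ> \<sigma>) j))"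
      then show ?thesis using path[of j] by simp
    next
      fix j assume "j \<in> symbols (r - l)" "v = (0, shift l j)" "u = (1, shift l ((\<tau> \<circ> \<sigma>) j))"
      then show ?thesis using path[of j] by (simp add: insert_commute)
    qed
  qed
  then show "concat_diagrams ?D ?E = layer_diagram r l (\<tau> \<circ> \<sigma>)" by simp
qed

lemma layer_component:
  assumes l: "l \<le> r" and \<sigma>: "\<sigma> \<in> carrier (hyperoct (r - l))" and \<tau>: "\<tau> \<in> carrier (hyperoct (r - l))"
    and i: "i \<noteq> 0" "\<bar>i\<bar> \<le> int l"
  shows "(stacked (layer_diagram r l \<sigma>) (layer_diagram r l \<tau>))\<^sup>* `` {(1, i)} = {(1, i), (1, - i)}"
    (is "?S\<^sup>* `` _ = _")
proof
  let ?D = "layer_diagram r l \<sigma>" and ?E = "layer_diagram r l \<tau>"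
  have D: "?D \<in> diagrams r" and E: "?E \<in> diagrams r"
    using layer_diagram_closed[OF l] \<sigma> \<tau> by auto
  have step: "v \<in> {(1, i), (1, - i)}" if st: "(u, v) \<in> ?S" "u \<in> {(1, i), (1, - i)}" for u v
  proof -
    obtain k where k: "u = (1, k)" "k \<noteq> 0" "\<bar>k\<bar> \<le> int l" "(1, - k) \<in> {(1, i), (1, - i)}"
      using st(2) i by auto
    have "{u, v} \<in> ?D \<or> {u, v} \<in> lower ?E" using st(1) by (simp add: stacked_eq adj_iff)
    then have "v = (1, - k)"
    proof
      assume "{u, v} \<in> ?D"
      then show ?thesis using diagram_unique[OF D, of u v] layer_diagram_arc[of 1 k l r \<sigma>] k by simp
    next
      assume "{u, v} \<in> lower ?E"
      then obtain u' v' where uv: "u = down u'" "v = down v'" "{u', v'} \<in> ?E"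
        unfolding lower_iff by blast
      then have "u' = (0, k)" using k(1) by (cases u') (simp add: down_simp)
      then have "v' = (0, - k)" using diagram_unique[OF E uv(3)] layer_diagram_arc[of 0 k l r \<tau>] k by simp
      then show ?thesis using uv by (simp add: down_simp)
    qed
    then show ?thesis using k(4) by simp
  qed
  show "?S\<^sup>* `` {(1, i)} \<subseteq> {(1, i), (1, - i)}"
  proof
    fix v assume "v \<in> ?S\<^sup>* `` {(1, i)}"
    then have "((1, i), v) \<in> ?S\<^sup>*" by simp
    then show "v \<in> {(1, i), (1, - i)}"
      by (induction rule: rtrancl_induct) (use step in blast)+
  qed
  have "((1, i), (1, - i)) \<in> ?S" using layer_diagram_arc[of 1 i l r \<sigma>] i by (simp add: stacked_eq adj_iff)
  then show "{(1, i), (1, - i)} \<subseteq> ?S\<^sup>* `` {(1, i)}" by auto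
qed

text \<open>
  The arcs \<open>{-i, i}\<close> facing each other close up to a loop for each \<open>i \<le> l\<close>; every other vertex of
  the middle row is joined to the bottom row.
\<close>

lemma loops_layer_diagram:
  assumes l: "l \<le> r" and \<sigma>: "\<sigma> \<in> carrier (hyperoct (r - l))" and \<tau>: "\<tau> \<in> carrier (hyperoct (r - l))"
  shows "loops r (layer_diagram r l \<sigma>) (layer_diagram r l \<tau>) = l"
proof -
  let ?D = "layer_diagram r l \<sigma>" and ?E = "layer_diagram r l \<tau>"
  let ?S = "stacked ?D ?E"
  have "{C. C \<subseteq> {1} \<times> UNIV \<and> (\<exists>v\<in>{1} \<times> symbols r. C = ?S\<^sup>* `` {v})} =
      (\<lambda>i. {(1, i), (1, - i)}) ` {1..int l}"
  proof (intro equalityI subsetI)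
    fix C assume "C \<in> {C. C \<subseteq> {1} \<times> UNIV \<and> (\<exists>v\<in>{1} \<times> symbols r. C = ?S\<^sup>* `` {v})}"
    then obtain i where C: "C \<subseteq> {1} \<times> UNIV" "i \<in> symbols r" "C = ?S\<^sup>* `` {(1, i)}" by blast
    have "\<bar>i\<bar> \<le> int l"
    proof (rule ccontr)
      assume "\<not> \<bar>i\<bar> \<le> int l"
      then have "\<bar>i\<bar> > int l" by simp
      with C(2) obtain j where j: "j \<in> symbols (r - l)" "i = shift l j" by (rule shift_surj)
      have "{(1, i), (2, shift l (\<tau> j))} \<in> lower ?E"
        unfolding lower_iff using layer_diagram_strand[OF j(1), of \<tau>] j(2)
        by (intro exI[of _ "(0, shift l j)"] exI[of _ "(1, shift l (\<tau> j))"]) (simp add: down_simp)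
      then have "((1, i), (2, shift l (\<tau> j))) \<in> ?S" by (simp add: stacked_eq adj_iff)
      then have "(2, shift l (\<tau> j)) \<in> C" using C(3) by auto
      then show False using C(1) by auto
    qed
    moreover have "i \<noteq> 0" using C(2) by (simp add: symbols_def)
    ultimately have "C = {(1, i), (1, - i)}" using layer_component[OF l \<sigma> \<tau>, of i] \<open>\<bar>i\<bar> \<le> int l\<close> C(3) by simp
    then have "C = {(1, \<bar>i\<bar>), (1, - \<bar>i\<bar>)}" by (auto simp: abs_if)
    then show "C \<in> (\<lambda>i. {(1, i), (1, - i)}) ` {1..int l}"
      using \<open>\<bar>i\<bar> \<le> int l\<close> \<open>i \<noteq> 0\<close> by (intro image_eqI[of _ _ "\<bar>i\<bar>"]) auto
  next
    fix C :: "vertex set" assume "C \<in> (\<lambda>i. {(1, i), (1, - i)}) ` {1..int l}"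
    then obtain i where i: "i \<in> {1..int l}" "C = {(1, i), (1, - i)}" by blast
    have "C = ?S\<^sup>* `` {(1, i)}" "(1, i) \<in> {1} \<times> symbols r"
      using layer_component[OF l \<sigma> \<tau>, of i] l i by (simp_all add: symbols_def)
    moreover have "C \<subseteq> {1} \<times> UNIV" using i(2) by simp
    ultimately show "C \<in> {C. C \<subseteq> {1} \<times> UNIV \<and> (\<exists>v\<in>{1} \<times> symbols r. C = ?S\<^sup>* `` {v})}"
      by (intro CollectI conjI bexI[of _ "(1, i)"])
  qed
  moreover have "inj_on (\<lambda>i. {(1, i), (1, - i)} :: vertex set) {1..int l}"
    by (rule inj_onI) (auto simp: doubleton_eq_iff)
  ultimately show "loops r ?D ?E = l"
    unfolding loops_def by (simp only: card_image) simp
qed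

text \<open>
  The arcs are \<open>l\<close> horizontal edges, so they are all those of the top row if there are at most \<open>l\<close>.
\<close>

lemma top_arcs:
  assumes "l \<le> r" and d: "d \<in> diagrams r"
    and arcs: "\<And>i. i \<noteq> 0 \<Longrightarrow> \<bar>i\<bar> \<le> int l \<Longrightarrow> {(0, i), (0, - i)} \<in> d"
  shows "l \<le> horizontal d"
    and "horizontal d \<le> l \<Longrightarrow> {(0, i), (0, j)} \<in> d \<Longrightarrow> \<bar>i\<bar> \<le> int l"
proof -
  let ?arc = "\<lambda>i. {(0, i), (0, - i)} :: vertex set"
  have inj: "inj_on ?arc {1..int l}"
    by (rule inj_onI) (auto simp: doubleton_eq_iff)
  have sub: "?arc ` {1..int l} \<subseteq> {e \<in> d. e \<subseteq> {0} \<times> UNIV}"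
  proof
    fix e assume "e \<in> ?arc ` {1..int l}"
    then obtain i where "i \<in> {1..int l}" "e = ?arc i" by (rule imageE)
    then show "e \<in> {e \<in> d. e \<subseteq> {0} \<times> UNIV}" using arcs[of i] by simp
  qed
  have fin: "finite {e \<in> d. e \<subseteq> {0} \<times> UNIV}" using finite_diagram[OF d] by simp
  have card: "card (?arc ` {1..int l}) = l" using card_image[OF inj] by simp
  show "l \<le> horizontal d"
    unfolding horizontal_def using card_mono[OF fin sub] card by simp
  assume "horizontal d \<le> l" and ij: "{(0, i), (0, j)} \<in> d"
  then have eq: "?arc ` {1..int l} = {e \<in> d. e \<subseteq> {0} \<times> UNIV}"
    using card_seteq[OF fin sub] card by (simp add: horizontal_def)
  have "{(0, i), (0, j)} \<in> ?arc ` {1..int l}" unfolding eq using ij by simp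
  then obtain k where "{(0, i), (0, j)} = ?arc k" "k \<in> {1..int l}" by (rule imageE)
  then show "\<bar>i\<bar> \<le> int l" by (auto simp: doubleton_eq_iff)
qed

lemma horizontal_layer_diagram:
  assumes l: "l \<le> r" and \<sigma>: "\<sigma> \<in> carrier (hyperoct (r - l))"
  shows "horizontal (layer_diagram r l \<sigma>) = l"
proof -
  have "{e \<in> layer_diagram r l \<sigma>. e \<subseteq> {0} \<times> UNIV} = (\<lambda>i. {(0, - i), (0, i)}) ` {1..int l}"
  proof (intro equalityI subsetI)
    fix e assume "e \<in> {e \<in> layer_diagram r l \<sigma>. e \<subseteq> {0} \<times> UNIV}"
    then have e: "e \<in> layer_diagram r l \<sigma>" "e \<subseteq> {0} \<times> UNIV" by auto
    from e(1) consider (arc) a i where "e = {(a, - i), (a, i)}" "i \<in> {1..int l}"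
      | (strand) j where "e = {(0, shift l j), (1, shift l (\<sigma> j))}"
      unfolding layer_diagram_def by blast
    then show "e \<in> (\<lambda>i. {(0, - i), (0, i)}) ` {1..int l}"
    proof cases
      case arc
      then show ?thesis using e(2) by (intro image_eqI[of _ _ i]) auto
    next
      case strand
      then show ?thesis using e(2) by simp
    qed
  next
    fix e :: "vertex set" assume "e \<in> (\<lambda>i. {(0, - i), (0, i)}) ` {1..int l}"
    then obtain i where i: "e = {(0, - i), (0, i)}" "i \<in> {1..int l}" by (rule imageE)
    then have "e \<in> layer_diagram r l \<sigma>" unfolding layer_diagram_def by blast
    then show "e \<in> {e \<in> layer_diagram r l \<sigma>. e \<subseteq> {0} \<times> UNIV}" using i(1) by simp
  qed
  moreover have "inj_on (\<lambda>i. {(0, - i), (0, i)} :: vertex set) {1..int l}"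
    by (rule inj_onI) (auto simp: doubleton_eq_iff)
  ultimately show ?thesis
    unfolding horizontal_def by (simp only: card_image) simp
qed

lemma layer_diagram_inj:
  assumes l: "l \<le> r" and \<sigma>: "\<sigma> \<in> carrier (hyperoct (r - l))" and \<tau>: "\<tau> \<in> carrier (hyperoct (r - l))"
    and eq: "layer_diagram r l \<sigma> = layer_diagram r l \<tau>"
  shows "\<sigma> = \<tau>"
proof
  fix j show "\<sigma> j = \<tau> j"
  proof (cases "j \<in> symbols (r - l)")
    case True
    then have "{(0, shift l j), (1, shift l (\<sigma> j))} \<in> layer_diagram r l \<sigma>"
      "{(0, shift l j), (1, shift l (\<tau> j))} \<in> layer_diagram r l \<tau>"
      unfolding layer_diagram_def by blast+
    then show ?thesis
      using diagram_unique[OF layer_diagram_closed[OF l \<tau>]] eq by (metis Pair_inject shift_inj)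
  next
    case False
    then show ?thesis
      using permutes_not_in[OF hyperoctD(1)[OF \<sigma>]] permutes_not_in[OF hyperoctD(1)[OF \<tau>]] by simp
  qed
qed

text \<open>
  A diagram with the arcs \<open>{-i, i}\<close>, \<open>i \<le> l\<close>, in both rows and no further horizontal edges
  is determined by how its vertical edges match the remaining labels.
\<close>

lemma layer_diagram_if_arcs:
  assumes l: "l \<le> r" and d: "d \<in> diagrams r"
    and arcs: "\<And>a i. a \<in> {0, 1} \<Longrightarrow> i \<noteq> 0 \<Longrightarrow> \<bar>i\<bar> \<le> int l \<Longrightarrow> {(a, i), (a, - i)} \<in> d"
    and h: "horizontal d \<le> l"
  shows "\<exists>\<sigma>\<in>carrier (hyperoct (r - l)). d = layer_diagram r l \<sigma>"
proof -
  let ?S = "symbols (r - l)"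
  have ex: "\<exists>k\<in>?S. {(0, shift l j), (1, shift l k)} \<in> d" if j: "j \<in> ?S" for j
  proof -
    have s: "shift l j \<in> symbols r" "\<bar>shift l j\<bar> > int l" using symbols_shift[OF l j] .
    then have "(0, shift l j) \<in> vertices r" by (simp add: vertices_def)
    then obtain w where w: "{(0, shift l j), w} \<in> d" by (rule diagram_partner[OF d])
    obtain b i where bi: "w = (b, i)" by (cases w)
    have bi_in: "b \<in> {0, 1}" "i \<in> symbols r"
      using diagram_edge_in(2)[OF d w] bi by (auto simp: vertices_def)
    have "b \<noteq> 0"
    proof
      assume "b = 0"
      then have "{(0, shift l j), (0, i)} \<in> d" using w bi by simp
      moreover have "{(0, i), (0, - i)} \<in> d" if "i \<noteq> 0" "\<bar>i\<bar> \<le> int l" for i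
        using arcs[of 0 i] that by simp
      ultimately have "\<bar>shift l j\<bar> \<le> int l" using top_arcs(2)[OF l d _ h] by blast
      then show False using s(2) by simp
    qed
    then have b: "b = 1" using bi_in by simp
    have "\<bar>i\<bar> > int l"
    proof (rule ccontr)
      assume "\<not> \<bar>i\<bar> > int l"
      then have "{w, (1, - i)} \<in> d" using arcs[of 1 i] bi_in bi b by (simp add: symbols_def)
      moreover have "{w, (0, shift l j)} \<in> d" using w by (simp add: insert_commute)
      ultimately have "(1, - i) = (0 :: nat, shift l j)" using diagram_unique[OF d] by blast
      then show False by simp
    qed
    with bi_in(2) obtain k where "k \<in> ?S" "i = shift l k" by (rule shift_surj)
    then show ?thesis using w bi b by blast
  qed
  define \<sigma> where "\<sigma> j = (if j \<in> ?S then SOME k. k \<in> ?S \<and> {(0, shift l j), (1, shift l k)} \<in> d else j)" for j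
  have \<sigma>: "\<sigma> j \<in> ?S" "{(0, shift l j), (1, shift l (\<sigma> j))} \<in> d" if "j \<in> ?S" for j
  proof -
    have "\<exists>k. k \<in> ?S \<and> {(0, shift l j), (1, shift l k)} \<in> d" using ex[OF that] by blast
    from someI_ex[OF this] show "\<sigma> j \<in> ?S" "{(0, shift l j), (1, shift l (\<sigma> j))} \<in> d"
      using that by (simp_all add: \<sigma>_def)
  qed
  have \<sigma>_eqI: "\<sigma> j = k" if "j \<in> ?S" "{(0, shift l j), (1, shift l k)} \<in> d" for j k
    using diagram_unique[OF d \<sigma>(2)[OF that(1)] that(2)] by (simp add: shift_inj)
  have "inj_on \<sigma> ?S"
  proof (rule inj_onI)
    fix j k assume jk: "j \<in> ?S" "k \<in> ?S" "\<sigma> j = \<sigma> k"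
    have "{(1, shift l (\<sigma> j)), (0, shift l j)} \<in> d" "{(1, shift l (\<sigma> j)), (0, shift l k)} \<in> d"
      using \<sigma>(2)[OF jk(1)] \<sigma>(2)[OF jk(2)] jk(3) by (simp_all add: insert_commute)
    then have "(0 :: nat, shift l j) = (0, shift l k)" by (rule diagram_unique[OF d])
    then show "j = k" by (simp add: shift_inj)
  qed
  moreover have "\<sigma> ` ?S \<subseteq> ?S" using \<sigma>(1) by blast
  ultimately have "bij_betw \<sigma> ?S ?S"
    unfolding bij_betw_def using endo_inj_surj[OF finite_symbols] by blast
  then have "\<sigma> permutes ?S"
    by (rule bij_imp_permutes) (simp add: \<sigma>_def)
  moreover have "\<sigma> (- j) = - \<sigma> j" for j
  proof (cases "j \<in> ?S")
    case True
    have "{neg (0, shift l j), neg (1, shift l (\<sigma> j))} \<in> d" using diagram_neg[OF d \<sigma>(2)[OF True]] .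
    then have "{(0, shift l (- j)), (1, shift l (- \<sigma> j))} \<in> d" by (simp add: neg_simp shift_uminus)
    then show ?thesis using True by (intro \<sigma>_eqI) (simp_all add: symbols_uminus)
  qed (simp add: \<sigma>_def symbols_uminus)
  ultimately have \<sigma>_in: "\<sigma> \<in> carrier (hyperoct (r - l))" by (rule hyperoctI)
  have "layer_diagram r l \<sigma> = d"
  proof (rule diagrams_eqI[OF layer_diagram_closed[OF l \<sigma>_in] d])
    fix u v assume "{u, v} \<in> layer_diagram r l \<sigma>"
    then show "{u, v} \<in> d"
      unfolding layer_diagram_iff
    proof (elim disjE exE bexE conjE)
      fix a i assume "a \<in> {0, 1 :: nat}" "i \<noteq> 0" "\<bar>i\<bar> \<le> int l" "u = (a, i)" "v = (a, - i)"
      then show ?thesis using arcs by simp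
    next
      fix j assume "j \<in> ?S" "u = (0, shift l j)" "v = (1, shift l (\<sigma> j))"
      then show ?thesis using \<sigma>(2)[of j] by simp
    next
      fix j assume "j \<in> ?S" "v = (0, shift l j)" "u = (1, shift l (\<sigma> j))"
      then show ?thesis using \<sigma>(2)[of j] by (simp add: insert_commute)
    qed
  qed
  then show ?thesis using \<sigma>_in by blast
qed

section \<open>The corner given by a layer\<close>

lemma twisted_mult_sum:
  assumes "twisted_monoid G c"
  shows "(\<lambda>z. \<Sum>i\<in>I. f i z) \<otimes>\<^bsub>twisted_algebra G c\<^esub> b = (\<lambda>z. \<Sum>i\<in>I. (f i \<otimes>\<^bsub>twisted_algebra G c\<^esub> b) z)"
    and "b \<otimes>\<^bsub>twisted_algebra G c\<^esub> (\<lambda>z. \<Sum>i\<in>I. f i z) = (\<lambda>z. \<Sum>i\<in>I. (b \<otimes>\<^bsub>twisted_algebra G c\<^esub> f i) z)"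
proof -
  interpret twisted_monoid G c by fact
  have swap: "(\<Sum>g\<in>carrier G. \<Sum>h\<in>carrier G. \<Sum>i\<in>I. t g h i) = (\<Sum>i\<in>I. \<Sum>g\<in>carrier G. \<Sum>h\<in>carrier G. t g h i)"
    for t :: "'a \<Rightarrow> 'a \<Rightarrow> 'd \<Rightarrow> 'c"
  proof -
    have "(\<Sum>g\<in>carrier G. \<Sum>h\<in>carrier G. \<Sum>i\<in>I. t g h i) = (\<Sum>g\<in>carrier G. \<Sum>i\<in>I. \<Sum>h\<in>carrier G. t g h i)"
      by (intro sum.cong refl sum.swap)
    also have "\<dots> = (\<Sum>i\<in>I. \<Sum>g\<in>carrier G. \<Sum>h\<in>carrier G. t g h i)" by (rule sum.swap)
    finally show ?thesis .
  qed
  show "(\<lambda>z. \<Sum>i\<in>I. f i z) \<otimes>\<^bsub>twisted_algebra G c\<^esub> b = (\<lambda>z. \<Sum>i\<in>I. (f i \<otimes>\<^bsub>twisted_algebra G c\<^esub> b) z)"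
    unfolding twisted_mult swap[symmetric] fun_eq_iff
    by (intro allI sum.cong refl) (simp add: sum_distrib_left sum_distrib_right)
  show "b \<otimes>\<^bsub>twisted_algebra G c\<^esub> (\<lambda>z. \<Sum>i\<in>I. f i z) = (\<lambda>z. \<Sum>i\<in>I. (b \<otimes>\<^bsub>twisted_algebra G c\<^esub> f i) z)"
    unfolding twisted_mult swap[symmetric] fun_eq_iff
    by (intro allI sum.cong refl) (simp add: sum_distrib_left)
qed

lemma layer_eq_corner_bimodule:
  "layer r \<delta> l = corner_bimodule (brauer r \<delta>) (brauer_ideal r \<delta> (l + 1)) (layer_idem r \<delta> l) (layer_embed r \<delta> l)"
  by (simp add: layer_def corner_bimodule_def Let_def)

text \<open>
  The factor \<open>\<delta>\<^sup>-\<^sup>l\<close> in \<open>\<epsilon> \<sigma>\<close> cancels the \<open>l\<close> loops of \<open>loops_layer_diagram\<close>; this makes \<open>\<iota>\<close>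
  multiplicative and is where \<open>\<delta> \<noteq> 0\<close> enters.
\<close>

locale brauer_layer =
  fixes r l :: nat and \<delta> :: "'k::field"
  assumes l_le: "l \<le> r" and \<delta>_nz: "\<delta> \<noteq> 0"
begin

abbreviation (input) "W \<equiv> hyperoct (r - l)"
abbreviation (input) "A \<equiv> group_algebra W :: ('k, (int \<Rightarrow> int) \<Rightarrow> 'k) module"
abbreviation (input) "B \<equiv> brauer r \<delta>"
abbreviation (input) "J \<equiv> brauer_ideal r \<delta> (l + 1)"
abbreviation (input) "\<iota> \<equiv> layer_embed r \<delta> l"
abbreviation (input) "e \<equiv> layer_idem r \<delta> l"

definition \<epsilon> :: "(int \<Rightarrow> int) \<Rightarrow> diagram \<Rightarrow> 'k" where
  "\<epsilon> \<sigma> = (\<lambda>d. inverse \<delta> ^ l * basis_vec (layer_diagram r l \<sigma>) d)"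

sublocale A: twisted_monoid W "\<lambda>_ _. 1 :: 'k" by (rule twisted_monoid_hyperoct)
sublocale B: twisted_monoid "brauer_monoid r" "\<lambda>d1 d2. \<delta> ^ loops r d1 d2" by (rule twisted_monoid_brauer)
sublocale A: ring A by (rule A.ring_twisted_algebra)
sublocale B: ring B unfolding brauer_def by (rule B.ring_twisted_algebra)

lemmas B_simps = B.twisted_simps[folded brauer_def]

lemma carrier_monoid: "carrier (brauer_monoid r) = diagrams r" "d \<otimes>\<^bsub>brauer_monoid r\<^esub> d' = concat_diagrams d d'"
  by (simp_all add: brauer_monoid_def)

lemma carrier_B: "carrier B = {b. \<forall>d. d \<notin> diagrams r \<longrightarrow> b d = 0}"
  by (simp add: B_simps carrier_monoid)

lemma basis_in_B: "d \<in> diagrams r \<Longrightarrow> basis_vec d \<in> carrier B"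
  by (auto simp: carrier_B basis_vec_def)

lemma scale_B: "b \<in> carrier B \<Longrightarrow> (\<lambda>d. k * b d) \<in> carrier B"
  by (simp add: carrier_B)

lemma basis_mult:
  "d \<in> diagrams r \<Longrightarrow> d' \<in> diagrams r \<Longrightarrow>
    basis_vec d \<otimes>\<^bsub>B\<^esub> basis_vec d' = (\<lambda>z. \<delta> ^ loops r d d' * basis_vec (concat_diagrams d d') z)"
  using B.twisted_mult_basis[of d d', folded brauer_def] by (simp add: carrier_monoid)

lemma \<epsilon>_in_B: "\<sigma> \<in> carrier W \<Longrightarrow> \<epsilon> \<sigma> \<in> carrier B"
  unfolding \<epsilon>_def by (intro scale_B basis_in_B layer_diagram_closed l_le)

lemma \<epsilon>_mult:
  assumes "\<sigma> \<in> carrier W" "\<tau> \<in> carrier W" shows "\<epsilon> \<sigma> \<otimes>\<^bsub>B\<^esub> \<epsilon> \<tau> = \<epsilon> (\<sigma> \<otimes>\<^bsub>W\<^esub> \<tau>)"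
proof -
  note D = layer_diagram_closed[OF l_le assms(1)] layer_diagram_closed[OF l_le assms(2)]
  have cancel: "inverse \<delta> ^ l * (\<delta> ^ l * x) = x" for x
    using \<delta>_nz by (simp add: mult.assoc[symmetric] flip: power_mult_distrib)
  show ?thesis
    unfolding \<epsilon>_def B.twisted_mult_scale[folded brauer_def] basis_mult[OF D] concat_layer_diagram[OF l_le assms] loops_layer_diagram[OF l_le assms]
    by (simp add: hyperoct_simps cancel)
qed

lemma layer_embed_eq: "\<iota> a = (\<lambda>d. \<Sum>\<sigma>\<in>carrier W. a \<sigma> * \<epsilon> \<sigma> d)"
  by (simp add: layer_embed_def \<epsilon>_def)

lemma \<iota>_closed: "\<iota> a \<in> carrier B"
  using \<epsilon>_in_B by (auto simp: layer_embed_eq carrier_B intro!: sum.neutral)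

lemma \<iota>_mult: "\<iota> (a \<otimes>\<^bsub>A\<^esub> b) = \<iota> a \<otimes>\<^bsub>B\<^esub> \<iota> b"
proof
  fix d
  have "\<iota> (a \<otimes>\<^bsub>A\<^esub> b) d = (\<Sum>\<rho>\<in>carrier W. \<epsilon> \<rho> d * (a \<otimes>\<^bsub>A\<^esub> b) \<rho>)"
    by (simp add: layer_embed_eq mult.commute)
  also have "\<dots> = (\<Sum>\<sigma>\<in>carrier W. \<Sum>\<tau>\<in>carrier W. \<epsilon> (\<sigma> \<otimes>\<^bsub>W\<^esub> \<tau>) d * (1 * a \<sigma> * b \<tau>))"
    by (rule A.sum_twisted_mult)
  also have "\<dots> = (\<Sum>\<sigma>\<in>carrier W. \<Sum>\<tau>\<in>carrier W. b \<tau> * (a \<sigma> * (\<epsilon> \<sigma> \<otimes>\<^bsub>B\<^esub> \<epsilon> \<tau>) d))"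
    by (intro sum.cong refl) (simp add: \<epsilon>_mult)
  also have "\<dots> = (\<iota> a \<otimes>\<^bsub>B\<^esub> \<iota> b) d"
    unfolding layer_embed_eq brauer_def twisted_mult_sum[OF B.twisted_monoid_axioms] B.twisted_mult_scale
    by (simp add: sum_distrib_left mult_ac)
  finally show "\<iota> (a \<otimes>\<^bsub>A\<^esub> b) d = (\<iota> a \<otimes>\<^bsub>B\<^esub> \<iota> b) d" .
qed

lemma \<iota>_basis: "\<sigma> \<in> carrier W \<Longrightarrow> \<iota> (basis_vec \<sigma>) = \<epsilon> \<sigma>"
proof
  fix d assume "\<sigma> \<in> carrier W"
  moreover have "\<iota> (basis_vec \<sigma>) d = (\<Sum>\<tau>\<in>carrier W. if \<tau> = \<sigma> then \<epsilon> \<sigma> d else 0)"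
    unfolding layer_embed_eq by (intro sum.cong refl) (simp add: basis_vec_def)
  ultimately show "\<iota> (basis_vec \<sigma>) d = \<epsilon> \<sigma> d" by (simp add: finite_hyperoct)
qed

lemma \<iota>_add: "\<iota> (a \<oplus>\<^bsub>A\<^esub> b) = \<iota> a \<oplus>\<^bsub>B\<^esub> \<iota> b"
  by (simp add: layer_embed_eq B_simps A.twisted_simps fun_eq_iff sum.distrib ring_distribs)

lemma \<iota>_scale: "\<iota> (\<lambda>\<sigma>. k * a \<sigma>) = (\<lambda>d. k * \<iota> a d)"
  by (simp add: layer_embed_eq sum_distrib_left mult.assoc)

lemma \<iota>_one: "\<iota> \<one>\<^bsub>A\<^esub> = e"
  unfolding A.twisted_simps(2) hyperoct_simps using \<iota>_basis[OF hyperoct_id]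
  by (simp add: \<epsilon>_def layer_idem_def)

sublocale J: ideal J B
  unfolding brauer_ideal_def by (rule B.genideal_ideal) (auto intro: basis_in_B)

lemma basis_in_ideal: "d \<in> diagrams r \<Longrightarrow> horizontal d \<ge> n \<Longrightarrow> basis_vec d \<in> brauer_ideal r \<delta> n"
  unfolding brauer_ideal_def by (rule subsetD[OF B.genideal_self]) (auto intro: basis_in_B)

lemma ideal_scale:
  assumes "ideal I B" "b \<in> I" shows "(\<lambda>d. k * b d) \<in> I"
proof -
  interpret I: ideal I B by fact
  have one: "\<one>\<^bsub>B\<^esub> \<in> carrier B" by simp
  have "(\<lambda>d. k * b d) = (\<lambda>d. k * \<one>\<^bsub>B\<^esub> d) \<otimes>\<^bsub>B\<^esub> b"
    using B.l_one[OF I.Icarr[OF assms(2)]]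
    unfolding brauer_def B.twisted_mult_scale by simp
  then show ?thesis using I.I_l_closed[OF assms(2) scale_B[OF one]] by simp
qed

lemma ideal_sum:
  assumes I: "ideal I B" and "finite D" and "\<And>d. d \<in> D \<Longrightarrow> x d \<in> I"
  shows "(\<lambda>z. \<Sum>d\<in>D. k d * x d z) \<in> I"
  using assms(2,3)
proof (induction D)
  case empty
  have "0 \<in> I"
    using additive_subgroup.zero_closed[OF ideal.axioms(1)[OF I]] by (simp add: B_simps)
  then show ?case by (simp add: zero_fun_def)
next
  case (insert d D)
  have "(\<lambda>z. k d * x d z) \<oplus>\<^bsub>B\<^esub> (\<lambda>z. \<Sum>d\<in>D. k d * x d z) \<in> I"
    using insert ideal_scale[OF I] by (intro additive_subgroup.a_closed[OF ideal.axioms(1)[OF I]]) auto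
  then show ?case using insert(1,2) by (simp add: B_simps plus_fun_def)
qed

text \<open>
  \<open>J\<close> is contained in the span of the diagrams with more than \<open>l\<close> horizontal edges, which is an
  ideal as composition never removes horizontal edges.
\<close>

lemma ideal_support:
  assumes "b \<in> J" "d \<in> diagrams r" "horizontal d \<le> l" shows "b d = 0"
proof -
  let ?K = "{b \<in> carrier B. \<forall>d\<in>diagrams r. horizontal d \<le> l \<longrightarrow> b d = 0}"
  have K_mult: "(a \<otimes>\<^bsub>B\<^esub> b) d = 0"
    if "a \<in> ?K \<or> b \<in> ?K" "d \<in> diagrams r" "horizontal d \<le> l" for a b d
    unfolding brauer_def B.twisted_mult carrier_monoid
  proof (intro sum.neutral ballI)
    fix g h assume gh: "g \<in> diagrams r" "h \<in> diagrams r"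
    show "(if concat_diagrams g h = d then \<delta> ^ loops r g h * a g * b h else 0) = 0"
      using that gh horizontal_concat[OF gh] by auto
  qed
  have "ideal ?K B"
  proof (rule idealI[OF B.ring_axioms])
    show "subgroup ?K (add_monoid B)"
    proof (rule subgroup.intro)
      fix x assume x: "x \<in> ?K"
      then have "- x \<in> ?K" "- x \<oplus>\<^bsub>B\<^esub> x = \<zero>\<^bsub>B\<^esub>" by (auto simp: carrier_B B_simps)
      then have "inv\<^bsub>add_monoid B\<^esub> x = - x"
        using B.add.inv_equality[of "- x" x] x by (simp add: a_inv_def)
      then show "inv\<^bsub>add_monoid B\<^esub> x \<in> ?K" using \<open>- x \<in> ?K\<close> by simp
    qed (auto simp: carrier_B B_simps)
  qed (use K_mult in auto)
  moreover have "{basis_vec d |d. d \<in> diagrams r \<and> l + 1 \<le> horizontal d} \<subseteq> ?K"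
    using basis_in_B by (auto simp: basis_vec_def)
  ultimately have "J \<subseteq> ?K"
    unfolding brauer_ideal_def by (rule B.genideal_minimal)
  then show ?thesis using assms by blast
qed

lemma \<iota>_coeff:
  assumes "\<sigma> \<in> carrier W" shows "\<iota> a (layer_diagram r l \<sigma>) = a \<sigma> * inverse \<delta> ^ l"
proof -
  have "\<iota> a (layer_diagram r l \<sigma>) = (\<Sum>\<tau>\<in>carrier W. if \<tau> = \<sigma> then a \<sigma> * inverse \<delta> ^ l else 0)"
    unfolding layer_embed_eq \<epsilon>_def basis_vec_def
    using layer_diagram_inj[OF l_le] assms by (intro sum.cong refl) auto
  then show ?thesis using assms by (simp add: finite_hyperoct)
qed

text \<open>
  The diagrams occurring in \<open>\<iota> a\<close> are distinct and have only \<open>l\<close> horizontal edges, whereas those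
  occurring in an element of \<open>J\<close> have more.
\<close>

lemma \<iota>_inj:
  assumes "a \<in> carrier A" "\<iota> a \<in> J" shows "a = \<zero>\<^bsub>A\<^esub>"
proof -
  have "a \<sigma> = 0" if \<sigma>: "\<sigma> \<in> carrier W" for \<sigma>
    using ideal_support[OF assms(2) layer_diagram_closed[OF l_le \<sigma>]] \<sigma> \<delta>_nz
    by (simp add: horizontal_layer_diagram[OF l_le \<sigma>] \<iota>_coeff)
  then show ?thesis using assms(1) by (auto simp: A.twisted_simps fun_eq_iff)
qed

lemma minus_B: "x \<in> carrier B \<Longrightarrow> y \<in> carrier B \<Longrightarrow> x \<ominus>\<^bsub>B\<^esub> y = x - y"
  by (rule B.eq_minusI[symmetric]) (auto simp: B_simps)

text \<open>
  Up to a scalar, \<open>e d e\<close> is a diagram that inherits the arcs of \<open>e\<close> in both rows. Either it has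
  further horizontal edges and lies in \<open>J\<close>, or it is a layer diagram.
\<close>

lemma corner_generated_basis:
  assumes d: "d \<in> diagrams r"
  shows "\<exists>a\<in>carrier A. e \<otimes>\<^bsub>B\<^esub> basis_vec d \<otimes>\<^bsub>B\<^esub> e - \<iota> a \<in> J"
proof -
  let ?D = "layer_diagram r l id"
  have D: "?D \<in> diagrams r" using layer_diagram_closed[OF l_le hyperoct_id] .
  let ?d1 = "concat_diagrams ?D d" and ?d2 = "concat_diagrams (concat_diagrams ?D d) ?D"
  have d1: "?d1 \<in> diagrams r" and d2: "?d2 \<in> diagrams r" using D d by (auto intro: concat_closed)
  define k where "k = inverse \<delta> ^ l * (inverse \<delta> ^ l * (\<delta> ^ loops r ?D d * \<delta> ^ loops r ?d1 ?D))"
  have k: "e \<otimes>\<^bsub>B\<^esub> basis_vec d \<otimes>\<^bsub>B\<^esub> e = (\<lambda>z. k * basis_vec ?d2 z)"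
    unfolding layer_idem_def B.twisted_mult_scale[folded brauer_def] basis_mult[OF D d] basis_mult[OF d1 D]
    by (simp add: k_def mult_ac)
  have arcs: "{(a, i), (a, - i)} \<in> ?d2" if "a \<in> {0, 1}" "i \<noteq> 0" "\<bar>i\<bar> \<le> int l" for a i
  proof (cases "a = 0")
    case True
    then show ?thesis
      using top_edge_concat[OF top_edge_concat[OF layer_diagram_arc[of 0 i l r id]]] that by simp
  next
    case False
    then show ?thesis using bottom_edge_concat[OF layer_diagram_arc[of 1 i l r id]] that by simp
  qed
  show ?thesis
  proof (cases "horizontal ?d2 \<le> l")
    case False
    then have "basis_vec ?d2 \<in> J" using basis_in_ideal d2 by simp
    then have "(\<lambda>z. k * basis_vec ?d2 z) \<in> J" using ideal_scale[OF J.ideal_axioms] by blast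
    moreover have "\<iota> \<zero>\<^bsub>A\<^esub> = 0" by (simp add: layer_embed_eq A.twisted_simps fun_eq_iff)
    ultimately show ?thesis using k A.zero_closed by (intro bexI[of _ "\<zero>\<^bsub>A\<^esub>"]) simp_all
  next
    case True
    then obtain \<sigma> where \<sigma>: "\<sigma> \<in> carrier W" "?d2 = layer_diagram r l \<sigma>"
      using layer_diagram_if_arcs[OF l_le d2 arcs] by blast
    let ?a = "\<lambda>\<tau>. k * \<delta> ^ l * basis_vec \<sigma> \<tau>"
    have "?a \<in> carrier A" using \<sigma>(1) by (auto simp: A.twisted_simps basis_vec_def)
    moreover have cancel: "\<delta> ^ l * (inverse \<delta> ^ l * x) = x" for x
      using \<delta>_nz by (simp add: mult.assoc[symmetric] flip: power_mult_distrib)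
    have "\<iota> ?a = (\<lambda>z. k * basis_vec ?d2 z)"
      unfolding \<iota>_scale \<iota>_basis[OF \<sigma>(1)] \<epsilon>_def \<sigma>(2) by (simp add: mult.assoc cancel)
    moreover have "0 \<in> J" using J.zero_closed by (simp add: B_simps)
    ultimately show ?thesis using k by (intro bexI[of _ ?a]) simp_all
  qed
qed

lemma corner_generated:
  assumes b: "b \<in> carrier B"
  shows "\<exists>a\<in>carrier A. e \<otimes>\<^bsub>B\<^esub> b \<otimes>\<^bsub>B\<^esub> e \<ominus>\<^bsub>B\<^esub> \<iota> a \<in> J"
proof -
  obtain a where a: "\<And>d. d \<in> diagrams r \<Longrightarrow> a d \<in> carrier A"
    "\<And>d. d \<in> diagrams r \<Longrightarrow> e \<otimes>\<^bsub>B\<^esub> basis_vec d \<otimes>\<^bsub>B\<^esub> e - \<iota> (a d) \<in> J"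
    using corner_generated_basis by metis
  have e: "e \<in> carrier B" using \<iota>_closed[of "\<one>\<^bsub>A\<^esub>"] by (simp add: \<iota>_one)
  let ?a = "\<lambda>\<sigma>. \<Sum>d\<in>diagrams r. b d * a d \<sigma>"
  have A: "?a \<in> carrier A" using a(1) by (auto simp: A.twisted_simps intro!: sum.neutral)
  have "b = (\<lambda>z. \<Sum>d\<in>diagrams r. b d * basis_vec d z)"
  proof
    fix z
    have "(\<Sum>d\<in>diagrams r. b d * basis_vec d z) = (\<Sum>d\<in>diagrams r. if d = z then b z else 0)"
      by (intro sum.cong refl) (auto simp: basis_vec_def)
    then show "b z = (\<Sum>d\<in>diagrams r. b d * basis_vec d z)"
      using b by (simp add: finite_diagrams carrier_B)
  qed
  then have "e \<otimes>\<^bsub>B\<^esub> b \<otimes>\<^bsub>B\<^esub> e = e \<otimes>\<^bsub>B\<^esub> (\<lambda>z. \<Sum>d\<in>diagrams r. b d * basis_vec d z) \<otimes>\<^bsub>B\<^esub> e"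
    by simp
  also have "\<dots> = (\<lambda>z. \<Sum>d\<in>diagrams r. b d * (e \<otimes>\<^bsub>B\<^esub> basis_vec d \<otimes>\<^bsub>B\<^esub> e) z)"
    unfolding brauer_def twisted_mult_sum[OF B.twisted_monoid_axioms] B.twisted_mult_scale ..
  finally have "e \<otimes>\<^bsub>B\<^esub> b \<otimes>\<^bsub>B\<^esub> e - \<iota> ?a =
      (\<lambda>z. \<Sum>d\<in>diagrams r. b d * (e \<otimes>\<^bsub>B\<^esub> basis_vec d \<otimes>\<^bsub>B\<^esub> e - \<iota> (a d)) z)"
    unfolding layer_embed_eq fun_eq_iff
    by (simp add: right_diff_distrib sum_subtractf sum_distrib_left sum_distrib_right mult.assoc sum.swap[of _ "carrier W"])
  also have "\<dots> \<in> J"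
    by (rule ideal_sum[OF J.ideal_axioms finite_diagrams a(2)])
  finally have "e \<otimes>\<^bsub>B\<^esub> b \<otimes>\<^bsub>B\<^esub> e - \<iota> ?a \<in> J" .
  then show ?thesis
    using A minus_B[of "e \<otimes>\<^bsub>B\<^esub> b \<otimes>\<^bsub>B\<^esub> e" "\<iota> ?a"] e b \<iota>_closed by (intro bexI[of _ ?a]) simp_all
qed

lemma full_corner: "full_corner A B J \<iota> e"
proof (intro full_corner.intro corner.intro corner_axioms.intro full_corner_axioms.intro)
  show "a = \<zero>\<^bsub>A\<^esub>" if "a \<in> carrier A" "\<iota> a \<in> J" for a
    using that by (rule \<iota>_inj)
qed (rule A.ring_axioms B.ring_axioms J.ideal_axioms \<iota>_closed \<iota>_add \<iota>_mult \<iota>_one corner_generated, assumption?)+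

end

section \<open>Signs of signed permutations\<close>

lemma hyperoct_abs: 
  assumes "\<sigma> \<in> carrier (hyperoct n)" shows "\<bar>\<sigma> x\<bar> = \<bar>\<sigma> \<bar>x\<bar>\<bar>" "\<sigma> x = sgn x * \<sigma> \<bar>x\<bar>" "\<sigma> 0 = 0"
proof -
  show z: "\<sigma> 0 = 0" using hyperoctD(2)[OF assms, of 0] by simp
  show "\<sigma> x = sgn x * \<sigma> \<bar>x\<bar>"
    using hyperoctD(2)[OF assms, of x] z by (cases "x = 0") (auto simp: sgn_if abs_if)
  show "\<bar>\<sigma> x\<bar> = \<bar>\<sigma> \<bar>x\<bar>\<bar>" using hyperoctD(2)[OF assms, of x] by (simp add: abs_if)
qed

lemma hyperoct_pos: 
  assumes "\<sigma> \<in> carrier (hyperoct n)" "x \<in> {1..int n}" shows "\<bar>\<sigma> x\<bar> \<in> {1..int n}"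
proof -
  have "\<sigma> x \<in> symbols n" using hyperoctD(3)[OF assms(1)] assms(2) by (auto simp: symbols_def)
  then show ?thesis by (auto simp: symbols_def)
qed

text \<open>
  The image of \<open>\<sigma>\<close> in the symmetric group, the quotient by the sign changes.
\<close>

definition abs_perm :: "nat \<Rightarrow> (int \<Rightarrow> int) \<Rightarrow> int \<Rightarrow> int" where
  "abs_perm n \<sigma> = (\<lambda>i. if i \<in> {1..int n} then \<bar>\<sigma> i\<bar> else i)"

lemma abs_perm_permutes:
  assumes "\<sigma> \<in> carrier (hyperoct n)" shows "abs_perm n \<sigma> permutes {1..int n}"
proof -
  have "inj_on (abs_perm n \<sigma>) {1..int n}"
  proof (rule inj_onI)
    fix i j assume ij: "i \<in> {1..int n}" "j \<in> {1..int n}" "abs_perm n \<sigma> i = abs_perm n \<sigma> j"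
    then have "\<sigma> i = \<sigma> j \<or> \<sigma> i = \<sigma> (- j)" by (simp add: abs_perm_def hyperoctD(2)[OF assms] abs_eq_iff)
    then have "i = j \<or> i = - j" by (simp add: hyperoctD(4)[OF assms])
    then show "i = j" using ij by auto
  qed
  moreover have "abs_perm n \<sigma> ` {1..int n} \<subseteq> {1..int n}"
    using hyperoct_pos[OF assms] by (auto simp: abs_perm_def)
  ultimately have "bij_betw (abs_perm n \<sigma>) {1..int n} {1..int n}"
    unfolding bij_betw_def using endo_inj_surj[of "{1..int n}"] by blast
  then show ?thesis by (rule bij_imp_permutes) (auto simp: abs_perm_def)
qed

lemma abs_perm_comp:
  assumes "\<sigma> \<in> carrier (hyperoct n)" "\<tau> \<in> carrier (hyperoct n)"
  shows "abs_perm n (\<tau> \<circ> \<sigma>) = abs_perm n \<tau> \<circ> abs_perm n \<sigma>"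
proof
  fix i show "abs_perm n (\<tau> \<circ> \<sigma>) i = (abs_perm n \<tau> \<circ> abs_perm n \<sigma>) i"
  proof (cases "i \<in> {1..int n}")
    case True
    then show ?thesis
      using hyperoct_pos[OF assms(1) True] hyperoct_abs(1)[OF assms(2), of "\<sigma> i"] by (simp add: abs_perm_def)
  next
    case False
    then have "abs_perm n f i = i" for f by (simp only: abs_perm_def if_False)
    then show ?thesis by simp
  qed
qed

lemma hyperoct_sgn_altdef:
  assumes "\<sigma> \<in> carrier (hyperoct n)"
  shows "hyperoct_sgn n \<sigma> = (\<Prod>i\<in>{1..int n}. sgn (\<sigma> i)) * sign (abs_perm n \<sigma>)"
proof -
  have "(\<Prod>i\<in>{1..int n}. sgn (\<sigma> i)) = (\<Prod>i\<in>{1..int n}. if \<sigma> i < 0 then - 1 else 1)"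
  proof (rule prod.cong[OF refl])
    fix i assume "i \<in> {1..int n}"
    then have "\<sigma> i \<noteq> 0" using hyperoct_pos[OF assms, of i] by auto
    then show "sgn (\<sigma> i) = (if \<sigma> i < 0 then - 1 else 1)" by (simp add: sgn_if)
  qed
  also have "\<dots> = (- 1) ^ card {i \<in> {1..int n}. \<sigma> i < 0}"
    by (simp add: prod.If_cases Int_def)
  finally show ?thesis by (simp add: hyperoct_sgn_def abs_perm_def)
qed

text \<open>
  The number of sign changes is additive modulo 2, as \<open>\<sigma>\<close> only permutes the absolute values to which
  \<open>\<tau>\<close> applies its sign changes.
\<close>

lemma hyperoct_sgn_comp:
  assumes \<sigma>: "\<sigma> \<in> carrier (hyperoct n)" and \<tau>: "\<tau> \<in> carrier (hyperoct n)"
  shows "hyperoct_sgn n (\<tau> \<circ> \<sigma>) = hyperoct_sgn n \<tau> * hyperoct_sgn n \<sigma>"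
proof -
  have "(\<Prod>i\<in>{1..int n}. sgn ((\<tau> \<circ> \<sigma>) i)) =
      (\<Prod>i\<in>{1..int n}. sgn (\<sigma> i) * sgn (\<tau> (abs_perm n \<sigma> i)))"
  proof (rule prod.cong[OF refl])
    fix i assume i: "i \<in> {1..int n}"
    have "(\<tau> \<circ> \<sigma>) i = sgn (\<sigma> i) * \<tau> \<bar>\<sigma> i\<bar>" using hyperoct_abs(2)[OF \<tau>, of "\<sigma> i"] by simp
    then show "sgn ((\<tau> \<circ> \<sigma>) i) = sgn (\<sigma> i) * sgn (\<tau> (abs_perm n \<sigma> i))"
      using i by (simp add: sgn_mult abs_perm_def)
  qed
  also have "\<dots> = (\<Prod>i\<in>{1..int n}. sgn (\<sigma> i)) * (\<Prod>i\<in>{1..int n}. sgn (\<tau> (abs_perm n \<sigma> i)))"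
    by (rule prod.distrib)
  also have "(\<Prod>i\<in>{1..int n}. sgn (\<tau> (abs_perm n \<sigma> i))) = (\<Prod>i\<in>{1..int n}. sgn (\<tau> i))"
    using prod.permute[OF abs_perm_permutes[OF \<sigma>], of "\<lambda>i. sgn (\<tau> i)"] by (simp add: o_def)
  finally show ?thesis
    using sign_compose[of "abs_perm n \<tau>" "abs_perm n \<sigma>"] abs_perm_permutes[OF \<sigma>] abs_perm_permutes[OF \<tau>]
    by (simp add: hyperoct_sgn_altdef \<sigma> \<tau> hyperoct_comp abs_perm_comp permutes_imp_permutation[of "{1..int n}"] mult_ac)
qed

lemma hyperoct_sgn_id: "hyperoct_sgn n id = 1"
proof -
  have "(\<lambda>i. if i \<in> {1..int n} then \<bar>id i\<bar> else i) = id" by auto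
  moreover have "{i \<in> {1..int n}. id i < 0} = {}" by auto
  ultimately show ?thesis unfolding hyperoct_sgn_def by (simp only: sign_id card.empty) simp
qed

lemma hyperoct_sgn_square: "hyperoct_sgn n \<sigma> * hyperoct_sgn n \<sigma> = 1"
proof -
  have "(a * b) * (a * b) = 1" if "a * a = 1" "b * b = 1" for a b :: int
  proof -
    have "(a * b) * (a * b) = (a * a) * (b * b)" by (simp only: mult_ac)
    then show ?thesis using that by simp
  qed
  moreover have "(- 1) ^ k * (- 1) ^ k = (1 :: int)" for k
    by (simp flip: power_mult_distrib)
  moreover have "sign p * sign p = (1 :: int)" for p :: "int \<Rightarrow> int" by (simp add: sign_def)
  ultimately show ?thesis unfolding hyperoct_sgn_def by blast
qed

lemma hyperoct_sgn_inv:
  assumes "\<sigma> \<in> carrier (hyperoct n)" shows "hyperoct_sgn n (inv_into UNIV \<sigma>) = hyperoct_sgn n \<sigma>"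
proof -
  have "hyperoct_sgn n \<sigma> * hyperoct_sgn n (inv_into UNIV \<sigma>) = 1"
    using hyperoct_sgn_comp[OF hyperoct_inv[OF assms] assms] permutes_inv_o(1)[OF hyperoctD(1)[OF assms]]
    by (simp add: hyperoct_sgn_id)
  then have "hyperoct_sgn n \<sigma> * (hyperoct_sgn n \<sigma> * hyperoct_sgn n (inv_into UNIV \<sigma>)) = hyperoct_sgn n \<sigma>" by simp
  then show ?thesis by (simp add: mult.assoc[symmetric] hyperoct_sgn_square)
qed

lemma involution_permutes:
  assumes inv: "\<And>i. f (f i) = i" and out: "\<And>i. i \<notin> S \<Longrightarrow> f i = i"
  shows "f permutes S"
  unfolding permutes_def
proof (intro conjI allI impI)
  fix y show "\<exists>!x. f x = y"
  proof (rule ex1I[of _ "f y"])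
    fix x assume "f x = y"
    then show "x = f y" using inv[of x] by simp
  qed (rule inv)
qed (rule out)

abbreviation sign_change :: "int \<Rightarrow> int \<Rightarrow> int" where
  "sign_change a \<equiv> sign_changes {a}"

lemma sign_change_involution: "sign_change a (sign_change a i) = i"
  by (simp add: sign_changes_def)

lemma sign_change_in:
  assumes "a \<in> {1..int n}" shows "sign_change a \<in> carrier (hyperoct n)" "hyperoct_sgn n (sign_change a) = - 1"
proof -
  have "hyperoct_sgn n (sym_embed id \<circ> sign_change a) = (- 1) ^ card {a} * sign (id :: int \<Rightarrow> int)"
    by (rule hyperoct_sgn_eq) (use assms in \<open>simp_all add: permutes_id\<close>)
  moreover have "sym_embed id \<circ> sign_change a = sign_change a"
    by (simp add: fun_eq_iff sym_embed_def sgn_mult_abs)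
  ultimately show "hyperoct_sgn n (sign_change a) = - 1" by (simp add: sign_id)
  have "sign_change a permutes symbols n"
  proof (rule involution_permutes[OF sign_change_involution])
    fix i assume "i \<notin> symbols n"
    then have "\<bar>i\<bar> \<noteq> a" using assms by (auto simp: symbols_def)
    then show "sign_change a i = i" by (simp add: sign_changes_def)
  qed
  then show "sign_change a \<in> carrier (hyperoct n)"
    by (rule hyperoctI) (simp add: sign_changes_def)
qed

lemma sign_change_image:
  assumes "a \<in> X \<longleftrightarrow> - a \<in> X" shows "sign_change a ` X = X"
proof -
  have "sign_change a i \<in> X" if "i \<in> X" for i
  proof (cases "\<bar>i\<bar> = a")
    case True
    then have "i = a \<or> i = - a" by linarith
    then show ?thesis using assms that by (auto simp: sign_changes_def)
  qed (simp add: sign_changes_def that)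
  then have sub: "sign_change a ` X \<subseteq> X" by blast
  have "X = sign_change a ` sign_change a ` X" by (simp only: image_image sign_change_involution image_ident)
  then show ?thesis using sub image_mono[OF sub, of "sign_change a"] by simp
qed

text \<open>The signed permutation exchanging \<open>x\<close> with \<open>y\<close> and \<open>-x\<close> with \<open>-y\<close>.\<close>

definition signed_swap :: "int \<Rightarrow> int \<Rightarrow> int \<Rightarrow> int" where
  "signed_swap x y i = (if i = x then y else if i = y then x else if i = - x then - y else
    if i = - y then - x else i)"

lemma signed_swap_simps:
  assumes "x \<noteq> 0" "y \<noteq> 0" "\<bar>x\<bar> \<noteq> \<bar>y\<bar>"
  shows "signed_swap x y x = y" "signed_swap x y y = x" "signed_swap x y (- x) = - y"
    "signed_swap x y (- y) = - x" "\<bar>i\<bar> \<noteq> \<bar>x\<bar> \<Longrightarrow> \<bar>i\<bar> \<noteq> \<bar>y\<bar> \<Longrightarrow> signed_swap x y i = i"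
proof -
  have ne: "x \<noteq> y" "x \<noteq> - x" "x \<noteq> - y" "y \<noteq> - x" "y \<noteq> - y" "- x \<noteq> - y" using assms by auto
  show "signed_swap x y x = y" "signed_swap x y y = x" "signed_swap x y (- x) = - y"
    "signed_swap x y (- y) = - x"
    unfolding signed_swap_def using ne ne[symmetric] by (simp_all only: if_True if_False refl simp_thms)
  assume i: "\<bar>i\<bar> \<noteq> \<bar>x\<bar>" "\<bar>i\<bar> \<noteq> \<bar>y\<bar>"
  then have "i \<noteq> x" "i \<noteq> y" "i \<noteq> - x" "i \<noteq> - y" by auto
  then show "signed_swap x y i = i" by (simp only: signed_swap_def if_False)
qed

lemma signed_swap_cases:
  fixes i x y :: int
  obtains "i = x" | "i = y" | "i = - x" | "i = - y" | "\<bar>i\<bar> \<noteq> \<bar>x\<bar>" "\<bar>i\<bar> \<noteq> \<bar>y\<bar>"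
  using abs_eq_iff[of i x] abs_eq_iff[of i y] by blast

lemma signed_swap_involution:
  assumes "x \<noteq> 0" "y \<noteq> 0" "\<bar>x\<bar> \<noteq> \<bar>y\<bar>" shows "signed_swap x y (signed_swap x y i) = i"
  by (cases rule: signed_swap_cases[where i = i and x = x and y = y]) (simp_all add: signed_swap_simps[OF assms])

lemma signed_swap_in:
  assumes "x \<in> symbols n" "y \<in> symbols n" "\<bar>x\<bar> \<noteq> \<bar>y\<bar>"
  shows "signed_swap x y \<in> carrier (hyperoct n)" "hyperoct_sgn n (signed_swap x y) = - 1"
proof -
  have nz: "x \<noteq> 0" "y \<noteq> 0" using assms by (auto simp: symbols_def)
  note swap = signed_swap_simps[OF nz assms(3)]
  have "signed_swap x y permutes symbols n"
  proof (rule involution_permutes[OF signed_swap_involution[OF nz assms(3)]])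
    fix i assume "i \<notin> symbols n"
    then have "\<bar>i\<bar> \<noteq> \<bar>x\<bar>" "\<bar>i\<bar> \<noteq> \<bar>y\<bar>" using assms by (auto simp: symbols_def)
    then show "signed_swap x y i = i" by (rule swap(5))
  qed
  moreover have "signed_swap x y (- i) = - signed_swap x y i" for i
    by (cases rule: signed_swap_cases[where i = i and x = x and y = y]) (simp_all add: swap)
  ultimately show "signed_swap x y \<in> carrier (hyperoct n)" by (rule hyperoctI)
  let ?X = "if sgn x = sgn y then {} else {\<bar>x\<bar>, \<bar>y\<bar>}" and ?\<pi> = "Transposition.transpose \<bar>x\<bar> \<bar>y\<bar>"
  let ?c = "if sgn x = sgn y then 1 else - 1 :: int"
  have "sgn x = 1 \<or> sgn x = - 1" "sgn y = 1 \<or> sgn y = - 1" using nz unfolding sgn_if by presburger+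
  then have c: "?c * sgn x = sgn y" "?c * sgn y = sgn x" by (elim disjE, simp_all)+
  have val: "(sym_embed ?\<pi> \<circ> sign_changes ?X) i = (if \<bar>i\<bar> \<in> ?X then - 1 else 1) * sgn i * ?\<pi> \<bar>i\<bar>" for i
  proof -
    have "sgn (sign_changes Z i) = (if \<bar>i\<bar> \<in> Z then - 1 else 1) * sgn i" "\<bar>sign_changes Z i\<bar> = \<bar>i\<bar>" for Z
      unfolding sign_changes_def by (simp_all add: sgn_minus)
    then show ?thesis by (simp only: comp_apply sym_embed_def)
  qed
  have "signed_swap x y i = (sym_embed ?\<pi> \<circ> sign_changes ?X) i" for i
  proof (cases rule: signed_swap_cases[where i = i and x = x and y = y])
    case 1
    have h: "(if \<bar>x\<bar> \<in> ?X then - 1 else 1) = ?c" by simp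
    have "(sym_embed ?\<pi> \<circ> sign_changes ?X) x = sgn y * \<bar>y\<bar>" unfolding val h c(1) by simp
    then show ?thesis unfolding 1 swap(1) by (simp only: sgn_mult_abs)
  next
    case 2
    have h: "(if \<bar>y\<bar> \<in> ?X then - 1 else 1) = ?c" by simp
    have "(sym_embed ?\<pi> \<circ> sign_changes ?X) y = sgn x * \<bar>x\<bar>" unfolding val h c(2) by simp
    then show ?thesis unfolding 2 swap(2) by (simp only: sgn_mult_abs)
  next
    case 3
    have h: "(if \<bar>x\<bar> \<in> ?X then - 1 else 1) = ?c" by simp
    have "(sym_embed ?\<pi> \<circ> sign_changes ?X) (- x) = - (sgn y * \<bar>y\<bar>)"
      unfolding val using c(1) by (simp add: sgn_minus split: if_splits)
    then show ?thesis unfolding 3 swap(3) by (simp only: sgn_mult_abs)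
  next
    case 4
    have h: "(if \<bar>y\<bar> \<in> ?X then - 1 else 1) = ?c" by simp
    have "(sym_embed ?\<pi> \<circ> sign_changes ?X) (- y) = - (sgn x * \<bar>x\<bar>)"
      unfolding val using c(2) by (simp add: sgn_minus split: if_splits)
    then show ?thesis unfolding 4 swap(4) by (simp only: sgn_mult_abs)
  next
    case 5
    then have "?\<pi> \<bar>i\<bar> = \<bar>i\<bar>" "\<bar>i\<bar> \<notin> ?X" by simp_all
    then have "(sym_embed ?\<pi> \<circ> sign_changes ?X) i = sgn i * \<bar>i\<bar>" unfolding val by simp
    then show ?thesis unfolding swap(5)[OF 5] by (simp only: sgn_mult_abs)
  qed
  then have "signed_swap x y = sym_embed ?\<pi> \<circ> sign_changes ?X" by (rule ext)
  moreover have "?\<pi> permutes {1..int n}"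
    using assms by (intro permutes_swap_id) (auto simp: symbols_def)
  moreover have "?X \<subseteq> {1..int n}" using assms by (auto simp: symbols_def)
  ultimately have "hyperoct_sgn n (signed_swap x y) = (- 1) ^ card ?X * sign ?\<pi>"
    by (simp only: hyperoct_sgn_eq)
  also have "\<dots> = - 1" using assms(3) by (simp add: sign_swap_id)
  finally show "hyperoct_sgn n (signed_swap x y) = - 1" .
qed

lemma signed_swap_image:
  assumes X: "x \<in> X \<longleftrightarrow> y \<in> X" "- x \<in> X \<longleftrightarrow> - y \<in> X" and nz: "x \<noteq> 0" "y \<noteq> 0" "\<bar>x\<bar> \<noteq> \<bar>y\<bar>"
  shows "signed_swap x y ` X = X"
proof -
  have "signed_swap x y i \<in> X" if "i \<in> X" for i
    using X that by (cases rule: signed_swap_cases[where i = i and x = x and y = y]) (simp_all add: signed_swap_simps[OF nz])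
  then have sub: "signed_swap x y ` X \<subseteq> X" by blast
  have "X = signed_swap x y ` signed_swap x y ` X"
    by (simp only: image_image signed_swap_involution[OF nz] image_ident)
  then show ?thesis using sub image_mono[OF sub, of "signed_swap x y"] by simp
qed

section \<open>Bi-tableaux and bi-tabloids\<close>

lemma finite_young: "finite (young p)"
proof -
  have "young p = (SIGMA i:{..<length p}. {..<p ! i})" by (auto simp: young_def)
  then show ?thesis by simp
qed

lemma finite_boxes: "finite (boxes la)"
  by (cases la) (simp add: finite_young)

lemma signed_image_hyperoct:
  assumes "\<sigma> \<in> carrier (hyperoct n)" shows "signed (\<sigma> ` X) = \<sigma> ` signed X"
  by (simp add: signed_def image_Un image_image hyperoctD(2)[OF assms])

definition line1 :: "bipart \<Rightarrow> nat \<Rightarrow> box set" where "line1 la i = {b \<in> boxes la. \<exists>j. b = Inl (i, j)}"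
definition line2 :: "bipart \<Rightarrow> nat \<Rightarrow> box set" where "line2 la i = {b \<in> boxes la. \<exists>j. b = Inr (i, j)}"
definition pile1 :: "bipart \<Rightarrow> nat \<Rightarrow> box set" where "pile1 la j = {b \<in> boxes la. \<exists>i. b = Inl (i, j)}"
definition pile2 :: "bipart \<Rightarrow> nat \<Rightarrow> box set" where "pile2 la j = {b \<in> boxes la. \<exists>i. b = Inr (i, j)}"

lemma rows_cols_image:
  "row1 la t i = t ` line1 la i" "row2 la t i = t ` line2 la i"
  "col1 la t i = t ` pile1 la i" "col2 la t i = t ` pile2 la i"
  by (auto simp: row1_def row2_def col1_def col2_def line1_def line2_def pile1_def pile2_def)

lemma lines_in_boxes:
  "line1 la i \<subseteq> boxes la" "line2 la i \<subseteq> boxes la" "pile1 la i \<subseteq> boxes la" "pile2 la i \<subseteq> boxes la"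
  by (auto simp: line1_def line2_def pile1_def pile2_def)

text \<open>
  Row and column stabilisers are treated together: both consist of the \<open>\<sigma>\<close> that preserve the
  images of some sets of boxes, strictly for the sets \<open>P i\<close> and up to sign for the sets \<open>Q i\<close>.
\<close>

definition stab :: "nat \<Rightarrow> (nat \<Rightarrow> box set) \<Rightarrow> (nat \<Rightarrow> box set) \<Rightarrow> (box \<Rightarrow> int) \<Rightarrow> (int \<Rightarrow> int) set" where
  "stab n P Q t = {\<sigma> \<in> carrier (hyperoct n). \<forall>i. \<sigma> ` t ` P i = t ` P i \<and> \<sigma> ` signed (t ` Q i) = signed (t ` Q i)}"

lemma row_stab_eq: "row_stab la t = stab (bisize la) (line1 la) (line2 la) t"
  by (auto simp: row_stab_def stab_def rows_cols_image)

lemma col_stab_eq: "col_stab la t = stab (bisize la) (pile2 la) (pile1 la) t"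
  unfolding col_stab_def stab_def rows_cols_image by (rule Collect_cong) meson

lemma stab_hyperoct: "\<sigma> \<in> stab n P Q t \<Longrightarrow> \<sigma> \<in> carrier (hyperoct n)"
  by (simp add: stab_def)

lemma stabD: "\<sigma> \<in> stab n P Q t \<Longrightarrow> \<sigma> ` t ` P i = t ` P i"
    "\<sigma> \<in> stab n P Q t \<Longrightarrow> \<sigma> ` signed (t ` Q i) = signed (t ` Q i)"
  unfolding stab_def by blast+

lemma stabI:
  assumes "\<sigma> \<in> carrier (hyperoct n)" "\<And>i. \<sigma> ` t ` P i = t ` P i"
    "\<And>i. \<sigma> ` signed (t ` Q i) = signed (t ` Q i)"
  shows "\<sigma> \<in> stab n P Q t"
  unfolding stab_def by (intro CollectI conjI allI assms)

lemma stab_comp: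
  assumes \<sigma>: "\<sigma> \<in> stab n P Q t" and \<tau>: "\<tau> \<in> stab n P Q t" shows "\<tau> \<circ> \<sigma> \<in> stab n P Q t"
proof (rule stabI)
  show "\<tau> \<circ> \<sigma> \<in> carrier (hyperoct n)" using \<sigma> \<tau> by (intro hyperoct_comp stab_hyperoct)
qed (simp_all only: image_comp[symmetric] stabD[OF \<sigma>] stabD[OF \<tau>])

lemma stab_inv:
  assumes "\<sigma> \<in> stab n P Q t" shows "inv_into UNIV \<sigma> \<in> stab n P Q t"
proof -
  have \<sigma>: "\<sigma> \<in> carrier (hyperoct n)" using assms by (rule stab_hyperoct)
  have "inv_into UNIV \<sigma> ` X = X" if "\<sigma> ` X = X" for X
  proof -
    have "inv_into UNIV \<sigma> ` \<sigma> ` X = X"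
      using permutes_inv_o(2)[OF hyperoctD(1)[OF \<sigma>]] by (simp add: image_comp)
    then show ?thesis using that by simp
  qed
  then show ?thesis using assms hyperoct_inv[OF \<sigma>] by (simp add: stab_def)
qed

lemma stab_translate:
  assumes \<sigma>: "\<sigma> \<in> stab n P Q t" shows "stab n P Q (\<sigma> \<circ> t) = stab n P Q t"
proof -
  have "(\<sigma> \<circ> t) ` P i = t ` P i" "signed ((\<sigma> \<circ> t) ` Q i) = signed (t ` Q i)" for i
    by (simp_all only: image_comp[symmetric] signed_image_hyperoct[OF stab_hyperoct[OF \<sigma>]] stabD[OF \<sigma>])
  then show ?thesis by (simp only: stab_def)
qed

lemma stab_conj:
  assumes \<sigma>: "\<sigma> \<in> carrier (hyperoct n)" and \<rho>: "\<rho> \<in> stab n P Q t"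
  shows "\<sigma> \<circ> \<rho> \<circ> inv_into UNIV \<sigma> \<in> stab n P Q (\<sigma> \<circ> t)"
proof -
  have "inv_into UNIV \<sigma> ` \<sigma> ` X = X" for X
    using permutes_inv_o(2)[OF hyperoctD(1)[OF \<sigma>]] by (simp add: image_comp)
  then have *: "(\<sigma> \<circ> \<rho> \<circ> inv_into UNIV \<sigma>) ` \<sigma> ` X = \<sigma> ` X" if "\<rho> ` X = X" for X
    using that by (simp only: image_comp[symmetric])
  have "\<sigma> \<circ> \<rho> \<circ> inv_into UNIV \<sigma> \<in> carrier (hyperoct n)"
    using \<sigma> stab_hyperoct[OF \<rho>] by (intro hyperoct_comp hyperoct_inv)
  then show ?thesis
  proof (rule stabI)
    show "(\<sigma> \<circ> \<rho> \<circ> inv_into UNIV \<sigma>) ` (\<sigma> \<circ> t) ` P i = (\<sigma> \<circ> t) ` P i" for i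
      unfolding image_comp[symmetric, of \<sigma> t] by (rule *[OF stabD(1)[OF \<rho>]])
    show "(\<sigma> \<circ> \<rho> \<circ> inv_into UNIV \<sigma>) ` signed ((\<sigma> \<circ> t) ` Q i) = signed ((\<sigma> \<circ> t) ` Q i)" for i
      unfolding image_comp[symmetric, of \<sigma> t] signed_image_hyperoct[OF \<sigma>] by (rule *[OF stabD(2)[OF \<rho>]])
  qed
qed

lemma inv_comp_hyperoct:
  assumes "\<sigma> \<in> carrier (hyperoct n)"
  shows "inv_into UNIV \<sigma> \<circ> \<sigma> = id" "\<sigma> \<circ> inv_into UNIV \<sigma> = id" "inv_into UNIV (inv_into UNIV \<sigma>) = \<sigma>"
    "inv_into UNIV \<sigma> (\<sigma> x) = x" "\<sigma> (inv_into UNIV \<sigma> x) = x"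
  using permutes_inv_o[OF hyperoctD(1)[OF assms]] permutes_inv_inv[OF hyperoctD(1)[OF assms]]
    permutes_inverses[OF hyperoctD(1)[OF assms]] by simp_all

lemma inv_hyperoct_comp:
  assumes "\<sigma> \<in> carrier (hyperoct n)" "\<tau> \<in> carrier (hyperoct n)"
  shows "inv_into UNIV (\<tau> \<circ> \<sigma>) = inv_into UNIV \<sigma> \<circ> inv_into UNIV \<tau>"
  using hyperoctD(5)[OF assms(1)] hyperoctD(5)[OF assms(2)] by (rule o_inv_distrib[rotated])

lemma stab_conj_bij:
  assumes \<sigma>: "\<sigma> \<in> carrier (hyperoct n)"
  shows "bij_betw (\<lambda>\<rho>. \<sigma> \<circ> \<rho> \<circ> inv_into UNIV \<sigma>) (stab n P Q t) (stab n P Q (\<sigma> \<circ> t))"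
proof (rule bij_betwI[where g = "\<lambda>\<rho>. inv_into UNIV \<sigma> \<circ> \<rho> \<circ> \<sigma>"])
  have "inv_into UNIV \<sigma> \<circ> (\<sigma> \<circ> t) = t" using inv_comp_hyperoct(1)[OF \<sigma>] by (simp add: o_assoc)
  then show "(\<lambda>\<rho>. inv_into UNIV \<sigma> \<circ> \<rho> \<circ> \<sigma>) \<in> stab n P Q (\<sigma> \<circ> t) \<rightarrow> stab n P Q t"
    using stab_conj[OF hyperoct_inv[OF \<sigma>], of _ P Q "\<sigma> \<circ> t"] inv_comp_hyperoct(3)[OF \<sigma>] by auto
qed (use stab_conj[OF \<sigma>] inv_comp_hyperoct[OF \<sigma>] in \<open>auto simp: fun_eq_iff\<close>)

definition tabloid_act :: "(int \<Rightarrow> int) \<Rightarrow> (box \<Rightarrow> int) set \<Rightarrow> (box \<Rightarrow> int) set" where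
  "tabloid_act \<sigma> S = (\<lambda>t. \<sigma> \<circ> t) ` S"

lemma tabloid_act_comp: "tabloid_act (\<tau> \<circ> \<sigma>) S = tabloid_act \<tau> (tabloid_act \<sigma> S)"
  by (simp add: tabloid_act_def image_image o_assoc)

lemma tabloid_act_id: "tabloid_act id S = S"
  by (simp add: tabloid_act_def)

lemma tabloid_act_inv:
  assumes "\<sigma> \<in> carrier (hyperoct n)"
  shows "tabloid_act (inv_into UNIV \<sigma>) (tabloid_act \<sigma> S) = S"
    "tabloid_act \<sigma> (tabloid_act (inv_into UNIV \<sigma>) S) = S"
  using inv_comp_hyperoct[OF assms] by (simp_all add: tabloid_act_comp[symmetric] tabloid_act_id)

lemma tabloid_act_bitabloid:
  assumes \<sigma>: "\<sigma> \<in> carrier (hyperoct (bisize la))"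
  shows "tabloid_act \<sigma> (bitabloid la t) = bitabloid la (\<sigma> \<circ> t)"
proof -
  let ?n = "bisize la" and ?P = "line1 la" and ?Q = "line2 la"
  have "bitabloid la (\<sigma> \<circ> t) = (\<lambda>\<rho>. \<rho> \<circ> (\<sigma> \<circ> t)) ` stab ?n ?P ?Q (\<sigma> \<circ> t)"
    by (auto simp: bitabloid_def row_stab_eq)
  also have "stab ?n ?P ?Q (\<sigma> \<circ> t) = (\<lambda>\<rho>. \<sigma> \<circ> \<rho> \<circ> inv_into UNIV \<sigma>) ` stab ?n ?P ?Q t"
    using stab_conj_bij[OF \<sigma>] by (simp add: bij_betw_def)
  also have "(\<lambda>\<rho>. \<rho> \<circ> (\<sigma> \<circ> t)) ` (\<lambda>\<rho>. \<sigma> \<circ> \<rho> \<circ> inv_into UNIV \<sigma>) ` stab ?n ?P ?Q t =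
      (\<lambda>\<rho>. \<sigma> \<circ> (\<rho> \<circ> t)) ` stab ?n ?P ?Q t"
    unfolding image_image using inv_comp_hyperoct(4)[OF \<sigma>] by (intro image_cong refl) (simp add: fun_eq_iff)
  also have "\<dots> = tabloid_act \<sigma> (bitabloid la t)"
    by (auto simp: tabloid_act_def bitabloid_def row_stab_eq)
  finally show ?thesis by (rule sym)
qed

text \<open>
  \<open>R\<^sub>t\<close> does not change if \<open>t\<close> is moved by an element of \<open>R\<^sub>t\<close>.
\<close>

lemma bitabloid_row_stab:
  assumes \<rho>: "\<rho> \<in> row_stab la t" shows "bitabloid la (\<rho> \<circ> t) = bitabloid la t"
proof -
  have \<rho>': "\<rho> \<in> stab (bisize la) (line1 la) (line2 la) t" using \<rho> by (simp add: row_stab_eq)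
  have stab: "row_stab la (\<rho> \<circ> t) = row_stab la t"
    using stab_translate[OF \<rho>'] by (simp add: row_stab_eq)
  show ?thesis
  proof (intro equalityI subsetI)
    fix s assume "s \<in> bitabloid la (\<rho> \<circ> t)"
    then obtain \<tau> where "\<tau> \<in> row_stab la t" "s = (\<tau> \<circ> \<rho>) \<circ> t"
      by (auto simp: bitabloid_def stab o_assoc)
    then show "s \<in> bitabloid la t"
      using stab_comp[OF \<rho>', of \<tau>] by (auto simp: bitabloid_def row_stab_eq)
  next
    fix s assume "s \<in> bitabloid la t"
    then obtain \<tau> where \<tau>: "\<tau> \<in> row_stab la t" "s = \<tau> \<circ> t" by (auto simp: bitabloid_def)
    have "s = (\<tau> \<circ> inv_into UNIV \<rho>) \<circ> (\<rho> \<circ> t)"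
      using \<tau>(2) inv_comp_hyperoct(4)[OF stab_hyperoct[OF \<rho>']] by (simp add: fun_eq_iff)
    moreover have "\<tau> \<circ> inv_into UNIV \<rho> \<in> row_stab la (\<rho> \<circ> t)"
      unfolding stab using stab_comp[OF stab_inv[OF \<rho>'], of \<tau>] \<tau>(1) by (simp add: row_stab_eq)
    ultimately show "s \<in> bitabloid la (\<rho> \<circ> t)" unfolding bitabloid_def by blast
  qed
qed

lemma bitableaux_act:
  assumes \<sigma>: "\<sigma> \<in> carrier (hyperoct (bisize la))" and t: "t \<in> bitableaux la"
  shows "\<sigma> \<circ> t \<in> bitableaux la"
proof -
  let ?N = "{1..int (bisize la)}"
  have t': "bij_betw (\<lambda>b. \<bar>t b\<bar>) (boxes la) ?N" "\<And>b. b \<notin> boxes la \<Longrightarrow> t b = 0"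
    using t by (auto simp: bitableaux_def)
  have "bij_betw (abs_perm (bisize la) \<sigma>) ?N ?N"
    using abs_perm_permutes[OF \<sigma>] by (rule permutes_imp_bij)
  then have "bij_betw (abs_perm (bisize la) \<sigma> \<circ> (\<lambda>b. \<bar>t b\<bar>)) (boxes la) ?N"
    using t'(1) by (rule bij_betw_trans[rotated])
  moreover have "(abs_perm (bisize la) \<sigma> \<circ> (\<lambda>b. \<bar>t b\<bar>)) b = \<bar>(\<sigma> \<circ> t) b\<bar>" if "b \<in> boxes la" for b
    using bij_betwE[OF t'(1)] that hyperoct_abs(1)[OF \<sigma>, of "t b"] by (auto simp: abs_perm_def)
  ultimately have "bij_betw (\<lambda>b. \<bar>(\<sigma> \<circ> t) b\<bar>) (boxes la) ?N"
    by (subst bij_betw_cong[of "boxes la" _ "abs_perm (bisize la) \<sigma> \<circ> (\<lambda>b. \<bar>t b\<bar>)"]) auto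
  then show ?thesis
    using t'(2) hyperoct_abs(3)[OF \<sigma>] by (simp add: bitableaux_def)
qed

lemma finite_bitableaux: "finite (bitableaux la)"
proof (rule finite_subset)
  let ?N = "int (bisize la)"
  show "bitableaux la \<subseteq> {t. \<forall>b. (b \<in> boxes la \<longrightarrow> t b \<in> {- ?N..?N}) \<and> (b \<notin> boxes la \<longrightarrow> t b = 0)}"
  proof
    fix t assume t: "t \<in> bitableaux la"
    have "t b \<in> {- ?N..?N}" if "b \<in> boxes la" for b
    proof -
      have "\<bar>t b\<bar> \<in> {1..?N}" using t that bij_betwE unfolding bitableaux_def by fastforce
      then show ?thesis by auto
    qed
    then show "t \<in> {t. \<forall>b. (b \<in> boxes la \<longrightarrow> t b \<in> {- ?N..?N}) \<and> (b \<notin> boxes la \<longrightarrow> t b = 0)}"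
      using t by (simp add: bitableaux_def)
  qed
qed (intro finite_set_of_finite_funs finite_boxes finite_atLeastAtMost_int)

lemma finite_bitabloids: "finite (bitabloids la)"
  by (simp add: bitabloids_def finite_bitableaux)

section \<open>Permutation modules and Specht modules\<close>

text \<open>
  The right action of a single group element on functions on bi-tabloids; it is an action because
  products in \<^const>\<open>hyperoct\<close> are composed from left to right.
\<close>

definition translate :: "(int \<Rightarrow> int) \<Rightarrow> ((box \<Rightarrow> int) set \<Rightarrow> 'k) \<Rightarrow> (box \<Rightarrow> int) set \<Rightarrow> 'k" where
  "translate \<sigma> v = (\<lambda>S. v (tabloid_act (inv_into UNIV \<sigma>) S))"

lemma translate_comp:
  "\<sigma> \<in> carrier (hyperoct n) \<Longrightarrow> \<tau> \<in> carrier (hyperoct n) \<Longrightarrow>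
    translate (\<tau> \<circ> \<sigma>) v = translate \<tau> (translate \<sigma> v)"
  by (simp only: translate_def inv_hyperoct_comp tabloid_act_comp)

lemma translate_id: "translate id v = v"
  by (simp only: translate_def inv_id tabloid_act_id)

lemma translate_scale: "translate \<sigma> (\<lambda>S. c * v S) = (\<lambda>S. c * translate \<sigma> v S)"
  by (simp add: translate_def)

lemma translate_add: "translate \<sigma> (v + w) = translate \<sigma> v + translate \<sigma> w"
  by (simp add: translate_def plus_fun_def)

lemma translate_zero: "translate \<sigma> 0 = (0 :: _ \<Rightarrow> 'k::zero)"
  by (simp add: translate_def zero_fun_def)

lemma translate_basis:
  assumes "\<sigma> \<in> carrier (hyperoct n)"
  shows "translate \<sigma> (basis_vec S) = (basis_vec (tabloid_act \<sigma> S) :: _ \<Rightarrow> 'k::field)"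
proof
  fix S'
  have "tabloid_act (inv_into UNIV \<sigma>) S' = S \<longleftrightarrow> S' = tabloid_act \<sigma> S"
    using tabloid_act_inv[OF assms] by metis
  then show "translate \<sigma> (basis_vec S) S' = (basis_vec (tabloid_act \<sigma> S) S' :: 'k)"
    by (simp add: translate_def basis_vec_def)
qed

lemma ract_perm_module:
  fixes v :: "(box \<Rightarrow> int) set \<Rightarrow> 'k::field"
  assumes v: "\<And>S. S \<notin> bitabloids la \<Longrightarrow> v S = 0"
  shows "ract (perm_module la) v a = (\<lambda>S. \<Sum>\<sigma>\<in>carrier (hyperoct (bisize la)). a \<sigma> * translate \<sigma> v S)"
proof
  fix S'
  let ?T = "bitabloids la" and ?W = "carrier (hyperoct (bisize la))"
  have "ract (perm_module la) v a S' =
      (\<Sum>(S, \<sigma>) \<in> {p \<in> ?T \<times> ?W. (case p of (S, \<sigma>) \<Rightarrow> tabloid_act \<sigma> S = S')}. v S * a \<sigma>)"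
    by (simp add: perm_module_def tabloid_act_def case_prod_unfold) (intro sum.cong, auto)
  also have "\<dots> = (\<Sum>p \<in> ?T \<times> ?W. if (case p of (S, \<sigma>) \<Rightarrow> tabloid_act \<sigma> S = S')
      then (case p of (S, \<sigma>) \<Rightarrow> v S * a \<sigma>) else 0)"
    by (rule sum.inter_filter) (simp add: finite_bitabloids finite_hyperoct)
  also have "\<dots> = (\<Sum>(S, \<sigma>) \<in> ?T \<times> ?W. if tabloid_act \<sigma> S = S' then v S * a \<sigma> else 0)"
    by (simp only: case_prod_unfold)
  also have "\<dots> = (\<Sum>S\<in>?T. \<Sum>\<sigma>\<in>?W. if tabloid_act \<sigma> S = S' then v S * a \<sigma> else 0)"
    by (rule sum.cartesian_product[symmetric])
  also have "\<dots> = (\<Sum>\<sigma>\<in>?W. \<Sum>S\<in>?T. if tabloid_act \<sigma> S = S' then v S * a \<sigma> else 0)"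
    by (rule sum.swap)
  also have "\<dots> = (\<Sum>\<sigma>\<in>?W. a \<sigma> * translate \<sigma> v S')"
  proof (rule sum.cong[OF refl])
    fix \<sigma> assume \<sigma>: "\<sigma> \<in> ?W"
    have "tabloid_act \<sigma> S = S' \<longleftrightarrow> S = tabloid_act (inv_into UNIV \<sigma>) S'" for S
      using tabloid_act_inv[OF \<sigma>] by metis
    then have "(\<Sum>S\<in>?T. if tabloid_act \<sigma> S = S' then v S * a \<sigma> else 0) =
        (\<Sum>S\<in>?T. if S = tabloid_act (inv_into UNIV \<sigma>) S' then v S * a \<sigma> else 0)"
      by (simp only:)
    also have "\<dots> = a \<sigma> * v (tabloid_act (inv_into UNIV \<sigma>) S')"
      using v by (simp add: finite_bitabloids)
    finally show "(\<Sum>S\<in>?T. if tabloid_act \<sigma> S = S' then v S * a \<sigma> else 0) = a \<sigma> * translate \<sigma> v S'"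
      by (simp only: translate_def)
  qed
  finally show "ract (perm_module la) v a S' = (\<Sum>\<sigma>\<in>?W. a \<sigma> * translate \<sigma> v S')" .
qed

lemma col_stab_hyperoct: "\<sigma> \<in> col_stab la t \<Longrightarrow> \<sigma> \<in> carrier (hyperoct (bisize la))"
  by (simp add: col_stab_def)

lemma polytabloid_eq:
  assumes t: "t \<in> bitableaux la"
  shows "polytabloid la t = (\<lambda>S. \<Sum>\<sigma>\<in>col_stab la t.
    of_int (hyperoct_sgn (bisize la) \<sigma>) * (basis_vec (bitabloid la (\<sigma> \<circ> t)) S :: 'k::field))"
proof
  fix S
  let ?W = "carrier (hyperoct (bisize la))" and ?b = "basis_vec (bitabloid la t) :: _ \<Rightarrow> 'k"
  have "?b S = 0" if "S \<notin> bitabloids la" for S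
    using that t by (auto simp: basis_vec_def bitabloids_def)
  then have "polytabloid la t S = (\<Sum>\<sigma>\<in>?W. col_antisymmetrizer la t \<sigma> * translate \<sigma> ?b S)"
    unfolding polytabloid_def by (subst ract_perm_module) auto
  also have "\<dots> = (\<Sum>\<sigma>\<in>col_stab la t. of_int (hyperoct_sgn (bisize la) \<sigma>) * basis_vec (bitabloid la (\<sigma> \<circ> t)) S)"
  proof (rule sum.mono_neutral_cong_right)
    show "col_stab la t \<subseteq> ?W" using col_stab_hyperoct by blast
    show "\<forall>\<sigma>\<in>?W - col_stab la t. col_antisymmetrizer la t \<sigma> * translate \<sigma> ?b S = 0"
      by (simp add: col_antisymmetrizer_def)
    fix \<sigma> assume \<sigma>: "\<sigma> \<in> col_stab la t"
    have "translate \<sigma> ?b S = basis_vec (bitabloid la (\<sigma> \<circ> t)) S"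
      by (simp only: translate_basis[OF col_stab_hyperoct[OF \<sigma>]] tabloid_act_bitabloid[OF col_stab_hyperoct[OF \<sigma>]])
    then show "col_antisymmetrizer la t \<sigma> * translate \<sigma> ?b S =
        of_int (hyperoct_sgn (bisize la) \<sigma>) * basis_vec (bitabloid la (\<sigma> \<circ> t)) S"
      by (simp only: col_antisymmetrizer_def \<sigma> if_True)
  qed (rule finite_hyperoct)
  finally show "polytabloid la t S = (\<Sum>\<sigma>\<in>col_stab la t.
    of_int (hyperoct_sgn (bisize la) \<sigma>) * (basis_vec (bitabloid la (\<sigma> \<circ> t)) S :: 'k))" .
qed

lemma translate_polytabloid_eq:
  assumes t: "t \<in> bitableaux la" and \<sigma>: "\<sigma> \<in> carrier (hyperoct (bisize la))"
  shows "translate \<sigma> (polytabloid la t) = (\<lambda>S. \<Sum>\<rho>\<in>col_stab la t.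
    of_int (hyperoct_sgn (bisize la) \<rho>) * (basis_vec (bitabloid la (\<sigma> \<circ> (\<rho> \<circ> t))) S :: 'k::field))"
proof
  fix S
  have "basis_vec (bitabloid la (\<rho> \<circ> t)) (tabloid_act (inv_into UNIV \<sigma>) S) =
      (basis_vec (bitabloid la (\<sigma> \<circ> (\<rho> \<circ> t))) S :: 'k)" for \<rho>
    using fun_cong[OF translate_basis[OF \<sigma>, of "bitabloid la (\<rho> \<circ> t)"], of S]
    unfolding tabloid_act_bitabloid[OF \<sigma>] translate_def .
  then show "translate \<sigma> (polytabloid la t) S = (\<Sum>\<rho>\<in>col_stab la t.
    of_int (hyperoct_sgn (bisize la) \<rho>) * (basis_vec (bitabloid la (\<sigma> \<circ> (\<rho> \<circ> t))) S :: 'k))"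
    unfolding polytabloid_eq[OF t] translate_def by (simp only:)
qed

text \<open>
  \<open>e\<^sub>t \<sigma> = e\<^bsub>t\<sigma>\<^esub>\<close>, since the column group of \<open>t\<sigma>\<close> is the conjugate of that of \<open>t\<close> and the sign is
  invariant under conjugation.
\<close>

lemma translate_polytabloid:
  assumes t: "t \<in> bitableaux la" and \<sigma>: "\<sigma> \<in> carrier (hyperoct (bisize la))"
  shows "translate \<sigma> (polytabloid la t) = (polytabloid la (\<sigma> \<circ> t) :: _ \<Rightarrow> 'k::field)"
proof
  fix S
  let ?n = "bisize la"
  have "polytabloid la (\<sigma> \<circ> t) S = (\<Sum>\<rho>\<in>col_stab la (\<sigma> \<circ> t).
      of_int (hyperoct_sgn ?n \<rho>) * (basis_vec (bitabloid la (\<rho> \<circ> (\<sigma> \<circ> t))) S :: 'k))"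
    by (simp only: polytabloid_eq[OF bitableaux_act[OF \<sigma> t]])
  also have "\<dots> = (\<Sum>\<rho>\<in>col_stab la t. of_int (hyperoct_sgn ?n (\<sigma> \<circ> \<rho> \<circ> inv_into UNIV \<sigma>)) *
      (basis_vec (bitabloid la ((\<sigma> \<circ> \<rho> \<circ> inv_into UNIV \<sigma>) \<circ> (\<sigma> \<circ> t))) S :: 'k))"
    unfolding col_stab_eq by (rule sum.reindex_bij_betw[OF stab_conj_bij[OF \<sigma>], symmetric])
  also have "\<dots> = (\<Sum>\<rho>\<in>col_stab la t. of_int (hyperoct_sgn ?n \<rho>) *
      (basis_vec (bitabloid la (\<sigma> \<circ> (\<rho> \<circ> t))) S :: 'k))"
  proof (rule sum.cong[OF refl])
    fix \<rho> assume "\<rho> \<in> col_stab la t"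
    then have \<rho>: "\<rho> \<in> carrier (hyperoct ?n)" by (rule col_stab_hyperoct)
    have "hyperoct_sgn ?n (\<sigma> \<circ> \<rho> \<circ> inv_into UNIV \<sigma>) = (hyperoct_sgn ?n \<sigma> * hyperoct_sgn ?n \<sigma>) * hyperoct_sgn ?n \<rho>"
      by (simp only: hyperoct_sgn_comp hyperoct_inv \<sigma> \<rho> hyperoct_comp hyperoct_sgn_inv mult_ac)
    then have "hyperoct_sgn ?n (\<sigma> \<circ> \<rho> \<circ> inv_into UNIV \<sigma>) = hyperoct_sgn ?n \<rho>"
      by (simp only: hyperoct_sgn_square mult_1)
    moreover have "(\<sigma> \<circ> \<rho> \<circ> inv_into UNIV \<sigma>) \<circ> (\<sigma> \<circ> t) = \<sigma> \<circ> (\<rho> \<circ> t)"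
      using inv_comp_hyperoct(4)[OF \<sigma>] by (simp add: fun_eq_iff)
    ultimately show "of_int (hyperoct_sgn ?n (\<sigma> \<circ> \<rho> \<circ> inv_into UNIV \<sigma>)) *
        (basis_vec (bitabloid la ((\<sigma> \<circ> \<rho> \<circ> inv_into UNIV \<sigma>) \<circ> (\<sigma> \<circ> t))) S :: 'k) =
      of_int (hyperoct_sgn ?n \<rho>) * basis_vec (bitabloid la (\<sigma> \<circ> (\<rho> \<circ> t))) S"
      by (simp only:)
  qed
  also have "\<dots> = translate \<sigma> (polytabloid la t) S" by (simp only: translate_polytabloid_eq[OF t \<sigma>])
  finally show "translate \<sigma> (polytabloid la t) S = (polytabloid la (\<sigma> \<circ> t) S :: 'k)" by (rule sym)
qed

text \<open>
  Multiplication by \<open>\<sigma> \<in> C\<^sub>t\<close> permutes the terms of the signed sum over \<open>C\<^sub>t\<close>.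
\<close>

lemma polytabloid_col_stab:
  assumes t: "t \<in> bitableaux la" and \<sigma>: "\<sigma> \<in> col_stab la t"
  shows "translate \<sigma> (polytabloid la t) =
    (\<lambda>S. of_int (hyperoct_sgn (bisize la) \<sigma>) * (polytabloid la t S :: 'k::field))"
proof
  fix S
  let ?n = "bisize la" and ?C = "col_stab la t"
  have \<sigma>W: "\<sigma> \<in> carrier (hyperoct ?n)" using \<sigma> by (rule col_stab_hyperoct)
  have \<sigma>': "\<sigma> \<in> stab ?n (pile2 la) (pile1 la) t" using \<sigma> by (simp only: col_stab_eq)
  have bij: "bij_betw (\<lambda>\<rho>. \<sigma> \<circ> \<rho>) ?C ?C"
  proof (rule bij_betwI[where g = "\<lambda>\<rho>. inv_into UNIV \<sigma> \<circ> \<rho>"])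
    show "(\<lambda>\<rho>. \<sigma> \<circ> \<rho>) \<in> ?C \<rightarrow> ?C" using stab_comp[OF _ \<sigma>'] by (auto simp: col_stab_eq)
    show "(\<lambda>\<rho>. inv_into UNIV \<sigma> \<circ> \<rho>) \<in> ?C \<rightarrow> ?C"
      using stab_comp[OF _ stab_inv[OF \<sigma>']] by (auto simp: col_stab_eq)
  qed (simp_all add: fun_eq_iff inv_comp_hyperoct[OF \<sigma>W])
  have "polytabloid la t S = (\<Sum>\<rho>\<in>?C. of_int (hyperoct_sgn ?n (\<sigma> \<circ> \<rho>)) *
      (basis_vec (bitabloid la ((\<sigma> \<circ> \<rho>) \<circ> t)) S :: 'k))"
    unfolding polytabloid_eq[OF t] by (rule sum.reindex_bij_betw[OF bij, symmetric])
  then have "of_int (hyperoct_sgn ?n \<sigma>) * polytabloid la t S = (\<Sum>\<rho>\<in>?C. of_int (hyperoct_sgn ?n \<sigma>) *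
      (of_int (hyperoct_sgn ?n (\<sigma> \<circ> \<rho>)) * (basis_vec (bitabloid la ((\<sigma> \<circ> \<rho>) \<circ> t)) S :: 'k)))"
    by (simp only: sum_distrib_left)
  also have "\<dots> = (\<Sum>\<rho>\<in>?C. of_int (hyperoct_sgn ?n \<rho>) * (basis_vec (bitabloid la (\<sigma> \<circ> (\<rho> \<circ> t))) S :: 'k))"
  proof (rule sum.cong[OF refl])
    fix \<rho> assume "\<rho> \<in> ?C"
    then have \<rho>: "\<rho> \<in> carrier (hyperoct ?n)" by (rule col_stab_hyperoct)
    have "hyperoct_sgn ?n \<sigma> * hyperoct_sgn ?n (\<sigma> \<circ> \<rho>) = hyperoct_sgn ?n \<rho>"
      by (simp only: hyperoct_sgn_comp \<sigma>W \<rho> mult.assoc[symmetric] hyperoct_sgn_square mult_1)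
    then have "of_int (hyperoct_sgn ?n \<sigma>) * (of_int (hyperoct_sgn ?n (\<sigma> \<circ> \<rho>)) :: 'k) = of_int (hyperoct_sgn ?n \<rho>)"
      by (simp only: of_int_mult[symmetric])
    then show "of_int (hyperoct_sgn ?n \<sigma>) *
        (of_int (hyperoct_sgn ?n (\<sigma> \<circ> \<rho>)) * (basis_vec (bitabloid la ((\<sigma> \<circ> \<rho>) \<circ> t)) S :: 'k)) =
      of_int (hyperoct_sgn ?n \<rho>) * basis_vec (bitabloid la (\<sigma> \<circ> (\<rho> \<circ> t))) S"
      by (simp only: mult.assoc[symmetric] comp_assoc)
  qed
  also have "\<dots> = translate \<sigma> (polytabloid la t) S" by (simp only: translate_polytabloid_eq[OF t \<sigma>W])
  finally show "translate \<sigma> (polytabloid la t) S = of_int (hyperoct_sgn ?n \<sigma>) * (polytabloid la t S :: 'k)"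
    by (rule sym)
qed

lemma bitableau_abs:
  assumes t: "t \<in> bitableaux la"
  shows "b \<in> boxes la \<Longrightarrow> \<bar>t b\<bar> \<in> {1..int (bisize la)}"
    "b \<in> boxes la \<Longrightarrow> c \<in> boxes la \<Longrightarrow> \<bar>t b\<bar> = \<bar>t c\<bar> \<longleftrightarrow> b = c"
    "a \<in> {1..int (bisize la)} \<Longrightarrow> \<exists>b\<in>boxes la. \<bar>t b\<bar> = a"
proof -
  have bij: "bij_betw (\<lambda>b. \<bar>t b\<bar>) (boxes la) {1..int (bisize la)}" using t by (simp add: bitableaux_def)
  show "b \<in> boxes la \<Longrightarrow> \<bar>t b\<bar> \<in> {1..int (bisize la)}" using bij_betwE[OF bij] by simp
  show "b \<in> boxes la \<Longrightarrow> c \<in> boxes la \<Longrightarrow> \<bar>t b\<bar> = \<bar>t c\<bar> \<longleftrightarrow> b = c"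
    using bij_betw_imp_inj_on[OF bij] by (auto dest: inj_onD)
  show "a \<in> {1..int (bisize la)} \<Longrightarrow> \<exists>b\<in>boxes la. \<bar>t b\<bar> = a"
    using bij_betw_imp_surj_on[OF bij] by (metis imageE)
qed

lemma signed_iff: "x \<in> signed X \<longleftrightarrow> x \<in> X \<or> - x \<in> X"
  by (force simp: signed_def)

lemma bitableau_mem:
  assumes t: "t \<in> bitableaux la" and D: "D \<subseteq> boxes la" and b: "b \<in> boxes la" and x: "\<bar>x\<bar> = \<bar>t b\<bar>"
  shows "x \<in> signed (t ` D) \<longleftrightarrow> b \<in> D" "x \<in> t ` D \<longleftrightarrow> b \<in> D \<and> x = t b"
proof -
  have *: "y \<in> t ` D \<longleftrightarrow> b \<in> D \<and> y = t b" if "\<bar>y\<bar> = \<bar>t b\<bar>" for y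
  proof
    assume "y \<in> t ` D"
    then obtain c where c: "c \<in> D" "y = t c" by blast
    then have "c = b" using bitableau_abs(2)[OF t _ b, of c] D that by auto
    then show "b \<in> D \<and> y = t b" using c by simp
  qed blast
  show "x \<in> t ` D \<longleftrightarrow> b \<in> D \<and> x = t b" using *[OF x] .
  have "x = t b \<or> - x = t b" using x by linarith
  then show "x \<in> signed (t ` D) \<longleftrightarrow> b \<in> D" using *[OF x] *[of "- x"] x unfolding signed_iff by auto
qed

text \<open>
  A sign change lies in a stabiliser if its entry is not in a set that must be preserved strictly.
  A signed transposition does if it concerns entries of one set and respects their signs where the
  set must be preserved strictly.
\<close>

lemma sign_change_stab:
  assumes t: "t \<in> bitableaux la" and P: "\<And>i. P i \<subseteq> boxes la" and Q: "\<And>i. Q i \<subseteq> boxes la"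
    and b: "b \<in> boxes la" and out: "\<And>i. b \<notin> P i"
  shows "sign_change \<bar>t b\<bar> \<in> stab (bisize la) P Q t"
proof (rule stabI)
  show "sign_change \<bar>t b\<bar> \<in> carrier (hyperoct (bisize la))"
    using bitableau_abs(1)[OF t b] by (rule sign_change_in(1))
  fix i
  have abs: "\<bar>\<bar>t b\<bar>\<bar> = \<bar>t b\<bar>" "\<bar>- \<bar>t b\<bar>\<bar> = \<bar>t b\<bar>" by simp_all
  show "sign_change \<bar>t b\<bar> ` t ` P i = t ` P i"
    using bitableau_mem(2)[OF t P b abs(1)] bitableau_mem(2)[OF t P b abs(2)] out
    by (intro sign_change_image) simp
  show "sign_change \<bar>t b\<bar> ` signed (t ` Q i) = signed (t ` Q i)"
    using bitableau_mem(1)[OF t Q b abs(1)] bitableau_mem(1)[OF t Q b abs(2)]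
    by (intro sign_change_image) simp
qed

lemma signed_swap_stab:
  assumes t: "t \<in> bitableaux la" and P: "\<And>i. P i \<subseteq> boxes la" and Q: "\<And>i. Q i \<subseteq> boxes la"
    and b: "b \<in> boxes la" "c \<in> boxes la" "b \<noteq> c" and x: "\<bar>x\<bar> = \<bar>t b\<bar>" and y: "\<bar>y\<bar> = \<bar>t c\<bar>"
    and bc: "\<And>i. b \<in> P i \<longleftrightarrow> c \<in> P i" "\<And>i. b \<in> Q i \<longleftrightarrow> c \<in> Q i"
    and xy: "\<And>i. b \<in> P i \<Longrightarrow> x = t b \<and> y = t c"
  shows "signed_swap x y \<in> stab (bisize la) P Q t"
proof (rule stabI)
  have ne: "\<bar>x\<bar> \<noteq> \<bar>y\<bar>" using bitableau_abs(2)[OF t b(1,2)] b(3) x y by simp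
  have in_range: "\<bar>x\<bar> \<in> {1..int (bisize la)}" "\<bar>y\<bar> \<in> {1..int (bisize la)}"
    using bitableau_abs(1)[OF t] b x y by simp_all
  then have nz: "x \<noteq> 0" "y \<noteq> 0" by auto
  have "x \<in> symbols (bisize la)" "y \<in> symbols (bisize la)"
    using in_range nz by (auto simp: symbols_def)
  then show "signed_swap x y \<in> carrier (hyperoct (bisize la))" using ne by (rule signed_swap_in(1))
  have x': "\<bar>- x\<bar> = \<bar>t b\<bar>" and y': "\<bar>- y\<bar> = \<bar>t c\<bar>" using x y by simp_all
  fix i
  have "- x \<noteq> x" "- y \<noteq> y" using nz by auto
  then show "signed_swap x y ` t ` P i = t ` P i"
    using bitableau_mem(2)[OF t P b(1) x, of i] bitableau_mem(2)[OF t P b(2) y, of i]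
      bitableau_mem(2)[OF t P b(1) x', of i] bitableau_mem(2)[OF t P b(2) y', of i] bc(1)[of i] xy[of i]
    by (intro signed_swap_image nz ne) auto
  show "signed_swap x y ` signed (t ` Q i) = signed (t ` Q i)"
    using bitableau_mem(1)[OF t Q b(1) x, of i] bitableau_mem(1)[OF t Q b(2) y, of i]
      bitableau_mem(1)[OF t Q b(1) x', of i] bitableau_mem(1)[OF t Q b(2) y', of i] bc(2)[of i]
    by (intro signed_swap_image nz ne) simp_all
qed

text \<open>
  For an entry of \<open>t\<^sup>1\<close> the sign change lies in \<open>C\<^sub>t\<close>. For an entry of \<open>t\<^sup>2\<close> it is moved past the elements
  of \<open>C\<^sub>t\<close>, which keep the entries of \<open>t\<^sup>2\<close> in \<open>t\<^sup>2\<close>, and then absorbed by \<open>{t}\<close>.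
\<close>

lemma polytabloid_sign_change:
  assumes t: "t \<in> bitableaux la" and b: "b \<in> boxes la"
  shows "translate (sign_change \<bar>t b\<bar>) (polytabloid la t) =
    (\<lambda>S. (case b of Inl _ \<Rightarrow> - 1 | Inr _ \<Rightarrow> 1) * (polytabloid la t S :: 'k::field))"
proof (cases b)
  case (Inl p)
  have "sign_change \<bar>t b\<bar> \<in> col_stab la t"
    unfolding col_stab_eq
    by (rule sign_change_stab[OF t lines_in_boxes(4,3) b]) (simp add: pile2_def Inl)
  then show ?thesis
    using polytabloid_col_stab[OF t, of "sign_change \<bar>t b\<bar>"] sign_change_in(2)[OF bitableau_abs(1)[OF t b]]
    by (simp add: Inl)
next
  case (Inr p)
  let ?\<xi> = "sign_change \<bar>t b\<bar>"
  have \<xi>: "?\<xi> \<in> carrier (hyperoct (bisize la))"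
    using bitableau_abs(1)[OF t b] by (rule sign_change_in(1))
  have absorb: "bitabloid la (?\<xi> \<circ> (\<rho> \<circ> t)) = bitabloid la (\<rho> \<circ> t)" if \<rho>C: "\<rho> \<in> col_stab la t" for \<rho>
  proof -
    have \<rho>: "\<rho> \<in> carrier (hyperoct (bisize la))" using \<rho>C by (rule col_stab_hyperoct)
    have "inv_into UNIV \<rho> \<in> stab (bisize la) (pile2 la) (pile1 la) t"
      using \<rho>C unfolding col_stab_eq by (rule stab_inv)
    from stabD(1)[OF this, of "snd p"] have "inv_into UNIV \<rho> ` t ` pile2 la (snd p) = t ` pile2 la (snd p)" .
    moreover have "b \<in> pile2 la (snd p)" using b Inr by (cases p) (simp add: pile2_def)
    \<comment> \<open>\<open>c\<close> is the box whose entry \<open>\<rho>\<close> moves to the entry of \<open>b\<close>.\<close>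
    ultimately obtain c where c: "c \<in> pile2 la (snd p)" "inv_into UNIV \<rho> (t b) = t c" by blast
    then have cb: "c \<in> boxes la" "\<And>i. c \<notin> line1 la i" using b by (auto simp: pile2_def line1_def)
    have \<rho>c: "\<rho> (t c) = t b" using c(2) inv_comp_hyperoct(5)[OF \<rho>] by metis
    have "?\<xi> \<circ> \<rho> = \<rho> \<circ> sign_change \<bar>t c\<bar>"
    proof
      fix i
      have "\<bar>\<rho> i\<bar> = \<bar>t b\<bar> \<longleftrightarrow> \<bar>i\<bar> = \<bar>t c\<bar>"
        unfolding \<rho>c[symmetric] abs_eq_iff using hyperoctD(2,4)[OF \<rho>] by metis
      then show "(?\<xi> \<circ> \<rho>) i = (\<rho> \<circ> sign_change \<bar>t c\<bar>) i"
        by (simp add: sign_changes_def hyperoctD(2)[OF \<rho>])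
    qed
    then have "?\<xi> \<circ> (\<rho> \<circ> t) = \<rho> \<circ> (sign_change \<bar>t c\<bar> \<circ> t)" by (simp only: comp_assoc[symmetric])
    moreover have "sign_change \<bar>t c\<bar> \<in> row_stab la t"
      unfolding row_stab_eq by (rule sign_change_stab[OF t lines_in_boxes(1,2) cb])
    then have "bitabloid la (sign_change \<bar>t c\<bar> \<circ> t) = bitabloid la t" by (rule bitabloid_row_stab)
    ultimately show ?thesis by (simp only: tabloid_act_bitabloid[OF \<rho>, symmetric])
  qed
  have "translate ?\<xi> (polytabloid la t) = (\<lambda>S. \<Sum>\<rho>\<in>col_stab la t.
      of_int (hyperoct_sgn (bisize la) \<rho>) * (basis_vec (bitabloid la (?\<xi> \<circ> (\<rho> \<circ> t))) S :: 'k))"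
    by (rule translate_polytabloid_eq[OF t \<xi>])
  also have "\<dots> = (\<lambda>S. \<Sum>\<rho>\<in>col_stab la t.
      of_int (hyperoct_sgn (bisize la) \<rho>) * basis_vec (bitabloid la (\<rho> \<circ> t)) S)"
    by (intro ext sum.cong refl) (simp only: absorb)
  also have "\<dots> = polytabloid la t" by (simp only: polytabloid_eq[OF t])
  finally show ?thesis by (simp add: Inr)
qed

section \<open>Dual Specht modules\<close>

interpretation tabloid_fun: vector_space "\<lambda>c (v :: (box \<Rightarrow> int) set \<Rightarrow> 'k::field) S. c * v S"
  by unfold_locales (auto simp: fun_eq_iff algebra_simps)

lemma specht_space_eq: "carrier (specht la) = tabloid_fun.span (polytabloid la ` bitableaux la)"
  by (simp add: specht_def)

lemma specht_simps: "ract (specht la) = ract (perm_module la)" "v \<oplus>\<^bsub>specht la\<^esub> w = v + w"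
  by (simp_all add: specht_def perm_module_def plus_fun_def)

lemma specht_zero: "0 \<in> carrier (specht la)"
  unfolding specht_space_eq by (rule tabloid_fun.span_zero)

lemma specht_add: "v \<in> carrier (specht la) \<Longrightarrow> w \<in> carrier (specht la) \<Longrightarrow> v + w \<in> carrier (specht la)"
  unfolding specht_space_eq by (rule tabloid_fun.span_add)

lemma specht_scale: "v \<in> carrier (specht la) \<Longrightarrow> (\<lambda>S. c * v S) \<in> carrier (specht la)"
  unfolding specht_space_eq by (rule tabloid_fun.span_scale)

lemma specht_polytabloid: "t \<in> bitableaux la \<Longrightarrow> polytabloid la t \<in> carrier (specht la)"
  unfolding specht_space_eq by (intro tabloid_fun.span_base imageI)

lemma specht_induct [consumes 1, case_names zero add]:
  assumes "x \<in> carrier (specht la)" "P 0"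
    and "\<And>c t y. t \<in> bitableaux la \<Longrightarrow> y \<in> carrier (specht la) \<Longrightarrow> P y
      \<Longrightarrow> P ((\<lambda>S. c * polytabloid la t S) + y)"
  shows "P x"
proof -
  have "x \<in> carrier (specht la) \<and> P x"
    using assms(1) unfolding specht_space_eq
  proof (induction rule: tabloid_fun.span_induct_alt)
    case base
    show ?case by (intro conjI tabloid_fun.span_zero assms(2))
  next
    case (step c x y)
    then obtain t where t: "t \<in> bitableaux la" "x = polytabloid la t" by blast
    have y: "y \<in> carrier (specht la)" "P y" using step(2) unfolding specht_space_eq by auto
    have "(\<lambda>S. c * x S) + y \<in> carrier (specht la)"
      unfolding t(2) by (intro specht_add specht_scale specht_polytabloid t(1) y(1))
    moreover have "P ((\<lambda>S. c * x S) + y)" unfolding t(2) by (rule assms(3)[OF t(1) y])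
    ultimately show ?case unfolding specht_space_eq by (rule conjI)
  qed
  then show ?thesis ..
qed

lemma specht_translate:
  assumes \<sigma>: "\<sigma> \<in> carrier (hyperoct (bisize la))" and "x \<in> carrier (specht la)"
  shows "translate \<sigma> x \<in> carrier (specht la)"
  using assms(2)
proof (induction x rule: specht_induct)
  case zero
  show ?case by (simp only: translate_zero specht_zero)
next
  case (add c t y)
  then show ?case
    by (simp only: translate_add translate_scale translate_polytabloid[OF _ \<sigma>])
      (intro specht_add specht_scale specht_polytabloid bitableaux_act \<sigma>)
qed

lemma specht_support:
  fixes x :: "(box \<Rightarrow> int) set \<Rightarrow> 'k::field"
  assumes "x \<in> carrier (specht la)" "S \<notin> bitabloids la" shows "x S = 0"
  using assms(1)
proof (induction x rule: specht_induct)
  case (add c t y)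
  have "bitabloid la (\<sigma> \<circ> t) \<noteq> S" if "\<sigma> \<in> col_stab la t" for \<sigma>
    using assms(2) bitableaux_act[OF col_stab_hyperoct[OF that] add(1)] by (auto simp: bitabloids_def)
  then have "polytabloid la t S = (0 :: 'k)"
    unfolding polytabloid_eq[OF add(1)] by (intro sum.neutral ballI) (auto simp: basis_vec_def)
  then show ?case using add by (simp add: plus_fun_def)
qed (simp add: zero_fun_def)

lemma ract_specht:
  "x \<in> carrier (specht la) \<Longrightarrow>
    ract (specht la) x a = (\<lambda>S. \<Sum>\<sigma>\<in>carrier (hyperoct (bisize la)). a \<sigma> * translate \<sigma> x S)"
  unfolding specht_simps by (rule ract_perm_module) (rule specht_support)

text \<open>
  The carrier of the dual Specht module, with linearity expressed pointwise instead of through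
  the scalars of the group algebra.
\<close>

definition functionals :: "bipart \<Rightarrow> (((box \<Rightarrow> int) set \<Rightarrow> 'k::field) \<Rightarrow> 'k) set" where
  "functionals la = {f \<in> extensional (carrier (specht la)).
    (\<forall>x\<in>carrier (specht la). \<forall>y\<in>carrier (specht la). f (x + y) = f x + f y) \<and>
    (\<forall>c. \<forall>x\<in>carrier (specht la). f (\<lambda>S. c * x S) = c * f x)}"

lemma scalar_group_algebra:
  "c \<odot>\<^bsub>group_algebra (hyperoct n)\<^esub> \<one>\<^bsub>group_algebra (hyperoct n)\<^esub> = (\<lambda>\<sigma>. c * basis_vec id \<sigma>)"
  by (simp add: twisted_algebra_def hyperoct_simps)

lemma sum_basis_hyperoct:
  fixes h :: "(int \<Rightarrow> int) \<Rightarrow> 'k::field"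
  assumes "\<sigma> \<in> carrier (hyperoct n)"
  shows "(\<Sum>\<rho>\<in>carrier (hyperoct n). c * basis_vec \<sigma> \<rho> * h \<rho>) = c * h \<sigma>"
proof -
  have "(\<Sum>\<rho>\<in>carrier (hyperoct n). c * basis_vec \<sigma> \<rho> * h \<rho>) =
      (\<Sum>\<rho>\<in>carrier (hyperoct n). if \<rho> = \<sigma> then c * h \<sigma> else 0)"
    by (intro sum.cong refl) (simp add: basis_vec_def)
  then show ?thesis using assms by (simp add: finite_hyperoct)
qed

lemma ract_specht_scalar:
  "x \<in> carrier (specht la) \<Longrightarrow> ract (specht la) x (\<lambda>\<sigma>. c * basis_vec id \<sigma>) = (\<lambda>S. c * x S)"
  by (simp only: ract_specht sum_basis_hyperoct[OF hyperoct_id] translate_id)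

lemma carrier_dual_specht: "carrier (dual_specht la) = functionals la"
  unfolding dual_specht_def dual_module_def Let_def functionals_def
  by (auto simp: scalar_group_algebra ract_specht_scalar specht_simps(2))

lemma dual_specht_simps:
  "\<zero>\<^bsub>dual_specht la\<^esub> = (\<lambda>x\<in>carrier (specht la). 0)"
  "f \<oplus>\<^bsub>dual_specht la\<^esub> g = (\<lambda>x\<in>carrier (specht la). f x + g x)"
  by (simp_all add: dual_specht_def dual_module_def Let_def)

lemma functionalD:
  fixes f :: "((box \<Rightarrow> int) set \<Rightarrow> 'k::field) \<Rightarrow> 'k"
  assumes "f \<in> functionals la"
  shows "f \<in> extensional (carrier (specht la))"
    "x \<in> carrier (specht la) \<Longrightarrow> y \<in> carrier (specht la) \<Longrightarrow> f (x + y) = f x + f y"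
    "x \<in> carrier (specht la) \<Longrightarrow> f (\<lambda>S. c * x S) = c * f x"
    "f 0 = 0"
proof -
  show "f \<in> extensional (carrier (specht la))"
    "x \<in> carrier (specht la) \<Longrightarrow> y \<in> carrier (specht la) \<Longrightarrow> f (x + y) = f x + f y"
    "x \<in> carrier (specht la) \<Longrightarrow> f (\<lambda>S. c * x S) = c * f x" for c
    using assms unfolding functionals_def by blast+
  have "f (0 + 0) = f 0 + f 0"
    using assms specht_zero unfolding functionals_def by blast
  then have "f 0 + f 0 = f 0 + 0" by (simp only: add_0_right)
  then show "f 0 = 0" by (rule add_left_imp_eq)
qed

lemma restrict_functional:
  assumes add: "\<And>x y. x \<in> carrier (specht la) \<Longrightarrow> y \<in> carrier (specht la) \<Longrightarrow> f (x + y) = f x + f y"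
    and scale: "\<And>x c. x \<in> carrier (specht la) \<Longrightarrow> f (\<lambda>S. c * x S) = c * f x"
  shows "restrict f (carrier (specht la)) \<in> functionals la"
  unfolding functionals_def
proof (intro CollectI conjI ballI allI)
  fix x y :: "(box \<Rightarrow> int) set \<Rightarrow> 'a" and c :: 'a
  assume x: "x \<in> carrier (specht la)"
  show "restrict f (carrier (specht la)) (\<lambda>S. c * x S) = c * restrict f (carrier (specht la)) x"
    unfolding restrict_apply'[OF x] restrict_apply'[OF specht_scale[OF x]] by (rule scale[OF x])
  assume y: "y \<in> carrier (specht la)"
  show "restrict f (carrier (specht la)) (x + y) =
      restrict f (carrier (specht la)) x + restrict f (carrier (specht la)) y"
    unfolding restrict_apply'[OF x] restrict_apply'[OF y] restrict_apply'[OF specht_add[OF x y]]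
    by (rule add[OF x y])
qed (rule restrict_extensional)

lemma functional_sum:
  assumes f: "f \<in> functionals la" and "finite I" and x: "\<And>i. i \<in> I \<Longrightarrow> x i \<in> carrier (specht la)"
  shows "(\<lambda>S. \<Sum>i\<in>I. k i * x i S) \<in> carrier (specht la) \<and>
    f (\<lambda>S. \<Sum>i\<in>I. k i * x i S) = (\<Sum>i\<in>I. k i * f (x i))"
  using assms(2) x
proof (induction I)
  case empty
  then show ?case using functionalD(4)[OF f] specht_zero by (simp add: zero_fun_def)
next
  case (insert i I)
  let ?y = "\<lambda>S. \<Sum>i\<in>I. k i * x i S"
  have eq: "(\<lambda>S. \<Sum>i\<in>insert i I. k i * x i S) = (\<lambda>S. k i * x i S) + ?y"
    using insert(1,2) by (simp add: plus_fun_def)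
  have y: "?y \<in> carrier (specht la)" "f ?y = (\<Sum>i\<in>I. k i * f (x i))"
    using insert by simp_all
  have xi: "x i \<in> carrier (specht la)" "(\<lambda>S. k i * x i S) \<in> carrier (specht la)"
    using insert(4)[of i] by (auto intro: specht_scale)
  show ?case
    unfolding eq using specht_add[OF xi(2) y(1)] functionalD(2)[OF f xi(2) y(1)] functionalD(3)[OF f xi(1)] y(2) insert(1,2)
    by simp
qed

text \<open>The contragredient action: the antipode replaces each group element by its inverse.\<close>

lemma ract_dual_specht:
  fixes a :: "(int \<Rightarrow> int) \<Rightarrow> 'k::field"
  assumes f: "f \<in> functionals la" and x: "x \<in> carrier (specht la)"
  shows "ract (dual_specht la) f a x =
    (\<Sum>\<sigma>\<in>carrier (hyperoct (bisize la)). a \<sigma> * f (translate (inv_into UNIV \<sigma>) x))"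
proof -
  let ?W = "carrier (hyperoct (bisize la))"
  have "ract (dual_specht la) f a x = f (ract (specht la) x (antipode (hyperoct (bisize la)) a))"
    using x by (simp add: dual_specht_def dual_module_def Let_def)
  also have "\<dots> = f (\<lambda>S. \<Sum>\<sigma>\<in>?W. antipode (hyperoct (bisize la)) a \<sigma> * translate \<sigma> x S)"
    by (simp only: ract_specht[OF x])
  also have "\<dots> = (\<Sum>\<sigma>\<in>?W. antipode (hyperoct (bisize la)) a \<sigma> * f (translate \<sigma> x))"
    using functional_sum[OF f finite_hyperoct, of "bisize la" "\<lambda>\<sigma>. translate \<sigma> x"] specht_translate[OF _ x] by blast
  also have "\<dots> = (\<Sum>\<sigma>\<in>?W. a (inv_into UNIV \<sigma>) * f (translate (inv_into UNIV (inv_into UNIV \<sigma>)) x))"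
    by (intro sum.cong refl) (simp add: antipode_def m_inv_hyperoct inv_comp_hyperoct(3))
  also have "\<dots> = (\<Sum>\<sigma>\<in>?W. a \<sigma> * f (translate (inv_into UNIV \<sigma>) x))"
  proof (rule sum.reindex_bij_betw)
    show "bij_betw (\<lambda>\<sigma>. inv_into UNIV \<sigma>) ?W ?W"
      by (rule bij_betwI[where g = "\<lambda>\<sigma>. inv_into UNIV \<sigma>"]) (auto simp: hyperoct_inv inv_comp_hyperoct(3))
  qed
  finally show ?thesis .
qed

lemma ract_dual_extensional: "ract (dual_specht la) f a \<in> extensional (carrier (specht la))"
  by (simp add: dual_specht_def dual_module_def Let_def)

lemma functional_eqI:
  assumes "f \<in> extensional (carrier (specht la))" "g \<in> extensional (carrier (specht la))"
    and "\<And>x. x \<in> carrier (specht la) \<Longrightarrow> f x = g x"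
  shows "f = g"
  using assms by (rule extensionalityI)

lemma translate_inv_in:
  "\<sigma> \<in> carrier (hyperoct (bisize la)) \<Longrightarrow> x \<in> carrier (specht la) \<Longrightarrow>
    translate (inv_into UNIV \<sigma>) x \<in> carrier (specht la)"
  by (intro specht_translate hyperoct_inv)

lemma ract_dual_closed:
  assumes f: "f \<in> functionals la" shows "ract (dual_specht la) f a \<in> functionals la"
proof -
  let ?S = "carrier (specht la) :: ((box \<Rightarrow> int) set \<Rightarrow> 'a) set"
  have "ract (dual_specht la) f a (x + y) = ract (dual_specht la) f a x + ract (dual_specht la) f a y"
    if "x \<in> ?S" "y \<in> ?S" for x y
    unfolding ract_dual_specht[OF f that(1)] ract_dual_specht[OF f that(2)]
      ract_dual_specht[OF f specht_add[OF that]] translate_add sum.distrib[symmetric]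
    using functionalD(2)[OF f translate_inv_in[OF _ that(1)] translate_inv_in[OF _ that(2)]]
    by (intro sum.cong refl) (simp add: distrib_left)
  moreover have "ract (dual_specht la) f a (\<lambda>S. c * x S) = c * ract (dual_specht la) f a x"
    if "x \<in> ?S" for c x
    unfolding ract_dual_specht[OF f that] ract_dual_specht[OF f specht_scale[OF that]] translate_scale
      sum_distrib_left
    using functionalD(3)[OF f translate_inv_in[OF _ that]]
    by (intro sum.cong refl) (simp add: mult.left_commute)
  ultimately show ?thesis
    unfolding functionals_def using ract_dual_extensional[of la f a] by blast
qed

lemma dual_add_closed:
  assumes "f \<in> functionals la" "g \<in> functionals la" shows "f \<oplus>\<^bsub>dual_specht la\<^esub> g \<in> functionals la"
  unfolding dual_specht_simps
  by (rule restrict_functional)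
    (simp_all add: functionalD(2,3)[OF assms(1)] functionalD(2,3)[OF assms(2)] algebra_simps)

lemma dual_add_apply: "x \<in> carrier (specht la) \<Longrightarrow> (f \<oplus>\<^bsub>dual_specht la\<^esub> g) x = f x + g x"
  by (simp add: dual_specht_simps)

lemma dual_add_extensional: "f \<oplus>\<^bsub>dual_specht la\<^esub> g \<in> extensional (carrier (specht la))"
  by (simp add: dual_specht_simps)

lemma right_mod_dual_specht:
  "right_mod (group_algebra (hyperoct (bisize la))) (dual_specht la :: (_, (int \<Rightarrow> int) \<Rightarrow> 'k::field) right_module)"
proof (rule right_mod.intro)
  let ?D = "dual_specht la :: (_, (int \<Rightarrow> int) \<Rightarrow> 'k) right_module" and ?n = "bisize la"
  let ?S = "carrier (specht la) :: ((box \<Rightarrow> int) set \<Rightarrow> 'k) set"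
  let ?A = "group_algebra (hyperoct ?n) :: ('k, (int \<Rightarrow> int) \<Rightarrow> 'k) module"
  interpret A: twisted_monoid "hyperoct ?n" "\<lambda>_ _. 1 :: 'k" by (rule twisted_monoid_hyperoct)
  note ext = functional_eqI[OF ract_dual_extensional] functional_eqI[OF dual_add_extensional]
  show "abelian_group ?D"
  proof (rule abelian_groupI, unfold carrier_dual_specht)
    show "\<zero>\<^bsub>?D\<^esub> \<in> functionals la"
      unfolding dual_specht_simps by (rule restrict_functional) simp_all
    show "f \<oplus>\<^bsub>?D\<^esub> g \<in> functionals la" if "f \<in> functionals la" "g \<in> functionals la" for f g
      using that by (rule dual_add_closed)
    show "f \<oplus>\<^bsub>?D\<^esub> g \<oplus>\<^bsub>?D\<^esub> h = f \<oplus>\<^bsub>?D\<^esub> (g \<oplus>\<^bsub>?D\<^esub> h)" for f g h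
      by (rule functional_eqI[OF dual_add_extensional dual_add_extensional]) (simp add: dual_add_apply)
    show "f \<oplus>\<^bsub>?D\<^esub> g = g \<oplus>\<^bsub>?D\<^esub> f" for f g
      by (rule functional_eqI[OF dual_add_extensional dual_add_extensional]) (simp add: dual_add_apply)
    show "\<zero>\<^bsub>?D\<^esub> \<oplus>\<^bsub>?D\<^esub> f = f" if "f \<in> functionals la" for f
      by (rule functional_eqI[OF dual_add_extensional functionalD(1)[OF that]])
        (simp add: dual_add_apply, simp add: dual_specht_simps)
    show "\<exists>g\<in>functionals la. g \<oplus>\<^bsub>?D\<^esub> f = \<zero>\<^bsub>?D\<^esub>" if f: "f \<in> functionals la" for f
    proof
      show "(\<lambda>x\<in>?S. - f x) \<in> functionals la"
        by (rule restrict_functional) (simp_all add: functionalD(2,3)[OF f])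
      show "(\<lambda>x\<in>?S. - f x) \<oplus>\<^bsub>?D\<^esub> f = \<zero>\<^bsub>?D\<^esub>"
        by (rule functional_eqI[OF dual_add_extensional]) (simp_all add: dual_specht_simps)
    qed
  qed
  fix f g :: "((box \<Rightarrow> int) set \<Rightarrow> 'k) \<Rightarrow> 'k" and a b :: "(int \<Rightarrow> int) \<Rightarrow> 'k"
  assume "f \<in> carrier ?D"
  then have f: "f \<in> functionals la" by (simp only: carrier_dual_specht)
  show "ract ?D f a \<in> carrier ?D" unfolding carrier_dual_specht using f by (rule ract_dual_closed)
  show "ract ?D f (a \<oplus>\<^bsub>?A\<^esub> b) = ract ?D f a \<oplus>\<^bsub>?D\<^esub> ract ?D f b"
    by (rule functional_eqI[OF ract_dual_extensional dual_add_extensional])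
      (simp add: dual_add_apply ract_dual_specht[OF f] A.twisted_simps sum.distrib distrib_right)
  show "ract ?D f (a \<otimes>\<^bsub>?A\<^esub> b) = ract ?D (ract ?D f a) b"
  proof (rule functional_eqI[OF ract_dual_extensional ract_dual_extensional])
    fix x assume x: "x \<in> ?S"
    let ?W = "carrier (hyperoct ?n)"
    let ?F = "\<lambda>\<rho>. f (translate (inv_into UNIV \<rho>) x)"
    have "ract ?D f (a \<otimes>\<^bsub>?A\<^esub> b) x = (\<Sum>\<rho>\<in>?W. ?F \<rho> * (a \<otimes>\<^bsub>?A\<^esub> b) \<rho>)"
      by (simp only: ract_dual_specht[OF f x] mult.commute)
    also have "\<dots> = (\<Sum>\<sigma>\<in>?W. \<Sum>\<tau>\<in>?W. ?F (\<sigma> \<otimes>\<^bsub>hyperoct ?n\<^esub> \<tau>) * (1 * a \<sigma> * b \<tau>))"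
      by (rule A.sum_twisted_mult)
    also have "\<dots> = (\<Sum>\<sigma>\<in>?W. \<Sum>\<tau>\<in>?W. b \<tau> * (a \<sigma> * f (translate (inv_into UNIV \<sigma>) (translate (inv_into UNIV \<tau>) x))))"
    proof (intro sum.cong refl)
      fix \<sigma> \<tau> assume st: "\<sigma> \<in> ?W" "\<tau> \<in> ?W"
      have "translate (inv_into UNIV (\<tau> \<circ> \<sigma>)) x = translate (inv_into UNIV \<sigma>) (translate (inv_into UNIV \<tau>) x)"
        by (simp only: inv_hyperoct_comp[OF st] translate_comp[OF hyperoct_inv[OF st(2)] hyperoct_inv[OF st(1)]])
      then show "?F (\<sigma> \<otimes>\<^bsub>hyperoct ?n\<^esub> \<tau>) * (1 * a \<sigma> * b \<tau>) =
          b \<tau> * (a \<sigma> * f (translate (inv_into UNIV \<sigma>) (translate (inv_into UNIV \<tau>) x)))"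
        by (simp add: hyperoct_simps mult_ac)
    qed
    also have "\<dots> = (\<Sum>\<tau>\<in>?W. \<Sum>\<sigma>\<in>?W. b \<tau> * (a \<sigma> * f (translate (inv_into UNIV \<sigma>) (translate (inv_into UNIV \<tau>) x))))"
      by (rule sum.swap)
    also have "\<dots> = (\<Sum>\<tau>\<in>?W. b \<tau> * ract ?D f a (translate (inv_into UNIV \<tau>) x))"
      by (intro sum.cong refl) (simp only: ract_dual_specht[OF f translate_inv_in[OF _ x]] sum_distrib_left)
    also have "\<dots> = ract ?D (ract ?D f a) b x"
      by (simp only: ract_dual_specht[OF ract_dual_closed[OF f] x])
    finally show "ract ?D f (a \<otimes>\<^bsub>?A\<^esub> b) x = ract ?D (ract ?D f a) b x" .
  qed
  show "ract ?D f \<one>\<^bsub>?A\<^esub> = f"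
  proof (rule functional_eqI[OF ract_dual_extensional functionalD(1)[OF f]])
    fix x assume x: "x \<in> ?S"
    have "ract ?D f \<one>\<^bsub>?A\<^esub> x = (\<Sum>\<sigma>\<in>carrier (hyperoct ?n). 1 * basis_vec id \<sigma> * f (translate (inv_into UNIV \<sigma>) x))"
      by (simp only: ract_dual_specht[OF f x] A.twisted_simps(2) hyperoct_simps mult_1)
    also have "\<dots> = 1 * f (translate (inv_into UNIV id) x)" by (rule sum_basis_hyperoct[OF hyperoct_id])
    finally show "ract ?D f \<one>\<^bsub>?A\<^esub> x = f x" by (simp only: mult_1 inv_id translate_id)
  qed
  assume "g \<in> carrier ?D"
  then have g: "g \<in> functionals la" by (simp only: carrier_dual_specht)
  show "ract ?D (f \<oplus>\<^bsub>?D\<^esub> g) a = ract ?D f a \<oplus>\<^bsub>?D\<^esub> ract ?D g a"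
  proof (rule functional_eqI[OF ract_dual_extensional dual_add_extensional])
    fix x assume x: "x \<in> ?S"
    show "ract ?D (f \<oplus>\<^bsub>?D\<^esub> g) a x = (ract ?D f a \<oplus>\<^bsub>?D\<^esub> ract ?D g a) x"
      unfolding dual_add_apply[OF x] ract_dual_specht[OF dual_add_closed[OF f g] x] ract_dual_specht[OF f x]
        ract_dual_specht[OF g x] sum.distrib[symmetric]
      using dual_add_apply[OF translate_inv_in[OF _ x], of _ f g] by (intro sum.cong refl) (simp add: distrib_left)
  qed
qed

section \<open>Dominance\<close>

lemma card_young_take: "card {x \<in> young p. fst x < j} = sum_list (take j p)"
proof -
  have "{x \<in> young p. fst x < j} = (SIGMA i:{..<min j (length p)}. {..<p ! i})"
    by (auto simp: young_def)
  then have "card {x \<in> young p. fst x < j} = (\<Sum>i<min j (length p). p ! i)" by simp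
  also have "\<dots> = sum_list (take j p)"
    by (simp add: sum_list_sum_nth atLeast0LessThan min.commute)
  finally show ?thesis .
qed

text \<open>
  A column of \<open>q\<close> receives at most \<open>j\<close> boxes from the first \<open>j\<close> rows of \<open>p\<close>, one from each row, and at
  most as many as it has; these bounds together give the number of its boxes in the first \<open>j\<close> rows
  of \<open>q\<close>.
\<close>

lemma sum_take_le_if_rows_split:
  assumes q: "is_partition q" and inj: "inj_on f (young p)" and im: "f ` young p \<subseteq> young q"
    and split: "\<And>x y. x \<in> young p \<Longrightarrow> y \<in> young p \<Longrightarrow> x \<noteq> y \<Longrightarrow> fst x = fst y \<Longrightarrow> snd (f x) \<noteq> snd (f y)"
  shows "sum_list (take j p) \<le> sum_list (take j q)"
proof -
  let ?C = "snd ` young q"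
  let ?E = "\<lambda>c. {x \<in> {x \<in> young p. fst x < j}. snd (f x) = c}"
  let ?G = "\<lambda>c. {y \<in> {y \<in> young q. fst y < j}. snd y = c}"
  have fin: "finite (young p)" "finite (young q)" by (rule finite_young)+
  have "card (?E c) \<le> card (?G c)" for c
  proof -
    \<comment> \<open>The rows of \<open>q\<close> that reach column \<open>c\<close> form an initial segment as the parts decrease.\<close>
    define h where "h = {i. i < length q \<and> c < q ! i}"
    have down: "i' \<in> h" if "i \<in> h" "i' \<le> i" for i i'
      using that q sorted_wrt_nth_less[of "(\<ge>)" q i' i] unfolding h_def is_partition_def
      by (cases "i' = i") auto
    have fin_h: "finite h" by (rule finite_subset[of _ "{..<length q}"]) (auto simp: h_def)
    have h: "h = {..<card h}"
    proof -
      have "i < card h" if "i \<in> h" for i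
      proof -
        have "{..i} \<subseteq> h" by (intro subsetI down[OF that]) simp
        then have "card {..i} \<le> card h" by (rule card_mono[OF fin_h])
        then show ?thesis by simp
      qed
      then have "h \<subseteq> {..<card h}" by (intro subsetI) simp
      then show ?thesis by (rule card_subset_eq[OF finite_lessThan]) simp
    qed
    have "?G c = (\<lambda>i. (i, c)) ` (h \<inter> {..<j})"
      by (auto simp: young_def h_def)
    then have "card (?G c) = card (h \<inter> {..<j})"
      by (simp add: card_image inj_on_def)
    also have "h \<inter> {..<j} = {..<card h} \<inter> {..<j}" using arg_cong[OF h, of "\<lambda>X. X \<inter> {..<j}"] .
    also have "\<dots> = {..<min (card h) j}" by auto
    finally have G: "card (?G c) = min (card h) j" by simp
    have "inj_on fst (?E c)"
    proof (rule inj_onI, rule ccontr)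
      fix x y assume "x \<in> ?E c" "y \<in> ?E c" "fst x = fst y" "x \<noteq> y"
      then show False using split[of x y] by simp
    qed
    moreover have "fst ` ?E c \<subseteq> {..<j}" by auto
    ultimately have "card (?E c) \<le> card {..<j}" using card_inj_on_le[of fst "?E c" "{..<j}"] by blast
    moreover have "inj_on (\<lambda>x. fst (f x)) (?E c)"
    proof (rule inj_onI)
      fix x y assume "x \<in> ?E c" "y \<in> ?E c" "fst (f x) = fst (f y)"
      then have "f x = f y" "x \<in> young p" "y \<in> young p" by (simp_all add: prod_eq_iff)
      then show "x = y" by (rule inj_onD[OF inj])
    qed
    moreover have "(\<lambda>x. fst (f x)) ` ?E c \<subseteq> h"
    proof clarify
      fix x assume "x \<in> young p" "c = snd (f x)"
      then have "(fst (f x), c) \<in> young q" using subsetD[OF im imageI, of x] by simp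
      then show "fst (f x) \<in> h" by (simp add: h_def young_def)
    qed
    ultimately show ?thesis using card_inj_on_le[of "\<lambda>x. fst (f x)" "?E c" h] fin_h G by simp
  qed
  then have "(\<Sum>c\<in>?C. card (?E c)) \<le> (\<Sum>c\<in>?C. card (?G c))" by (intro sum_mono)
  moreover have "(\<Sum>c\<in>?C. card (?E c)) = card {x \<in> young p. fst x < j}"
    unfolding card_eq_sum by (rule sum.group) (use fin im in auto)
  moreover have "(\<Sum>c\<in>?C. card (?G c)) = card {y \<in> young q. fst y < j}"
    unfolding card_eq_sum by (rule sum.group) (use fin in auto)
  ultimately show ?thesis by (simp only: card_young_take)
qed

lemma partition_eqI:
  assumes p: "is_partition p" and q: "is_partition q" and eq: "\<And>j. sum_list (take j p) = sum_list (take j q)"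
  shows "p = q"
proof -
  have part: "(if i < length r then r ! i else 0) = sum_list (take (Suc i) r) - sum_list (take i r)"
    for r :: "nat list" and i
    by (simp add: take_Suc_conv_app_nth)
  have nth: "(if i < length p then p ! i else 0) = (if i < length q then q ! i else 0)" for i
    unfolding part eq ..
  have pos: "r ! i \<noteq> 0" if "is_partition r" "i < length r" for r i
    using that nth_mem[of i r] unfolding is_partition_def by metis
  have "i < length p \<longleftrightarrow> i < length q" for i
    using nth[of i] pos[OF p, of i] pos[OF q, of i] by (auto split: if_splits)
  then have "length p = length q" by (metis linorder_neqE_nat less_irrefl)
  then show ?thesis using nth by (intro nth_equalityI) (auto split: if_splits, metis)
qed

section \<open>Homomorphisms between dual Specht modules\<close>

lemma ract_dual_basis:
  fixes f :: "((box \<Rightarrow> int) set \<Rightarrow> 'k::field) \<Rightarrow> 'k"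
  assumes f: "f \<in> functionals la" and x: "x \<in> carrier (specht la)" and \<sigma>: "\<sigma> \<in> carrier (hyperoct (bisize la))"
  shows "ract (dual_specht la) f (\<lambda>\<rho>. c * basis_vec \<sigma> \<rho>) x = c * f (translate (inv_into UNIV \<sigma>) x)"
  by (simp only: ract_dual_specht[OF f x] sum_basis_hyperoct[OF \<sigma>])

lemma sign_change_inv: "inv_into UNIV (sign_change a) = sign_change a"
  using sign_change_involution by (intro inv_unique_comp) (auto simp: fun_eq_iff)

text \<open>
  A homomorphism \<open>g\<close> between dual Specht modules, evaluated at a polytabloid \<open>e\<^sub>t\<close> of the target
  shape, is a linear form \<open>F\<close> on the dual Specht module of the source shape.
\<close>

locale dual_specht_hom =
  fixes la mu :: bipart and n :: nat
    and g :: "(((box \<Rightarrow> int) set \<Rightarrow> 'k::field) \<Rightarrow> 'k) \<Rightarrow> (((box \<Rightarrow> int) set \<Rightarrow> 'k) \<Rightarrow> 'k)"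
    and t :: "box \<Rightarrow> int"
  assumes size: "bisize la = n" "bisize mu = n"
    and two: "(2 :: 'k) \<noteq> 0"
    and g_in: "\<And>f. f \<in> functionals la \<Longrightarrow> g f \<in> functionals mu"
    and g_add: "\<And>f f'. f \<in> functionals la \<Longrightarrow> f' \<in> functionals la \<Longrightarrow>
      g (f \<oplus>\<^bsub>dual_specht la\<^esub> f') = g f \<oplus>\<^bsub>dual_specht mu\<^esub> g f'"
    and g_ract: "\<And>f a. f \<in> functionals la \<Longrightarrow> a \<in> carrier (group_algebra (hyperoct n)) \<Longrightarrow>
      g (ract (dual_specht la) f a) = ract (dual_specht mu) (g f) a"
    and t: "t \<in> bitableaux mu"
begin

abbreviation (input) "D \<equiv> dual_specht la :: (((box \<Rightarrow> int) set \<Rightarrow> 'k) \<Rightarrow> 'k, (int \<Rightarrow> int) \<Rightarrow> 'k) right_module"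
abbreviation (input) "W \<equiv> carrier (hyperoct n)"

definition F :: "(((box \<Rightarrow> int) set \<Rightarrow> 'k) \<Rightarrow> 'k) \<Rightarrow> 'k" where
  "F f = g f (polytabloid mu t)"

definition act :: "'k \<Rightarrow> (int \<Rightarrow> int) \<Rightarrow> (((box \<Rightarrow> int) set \<Rightarrow> 'k) \<Rightarrow> 'k) \<Rightarrow> (((box \<Rightarrow> int) set \<Rightarrow> 'k) \<Rightarrow> 'k)" where
  "act c \<sigma> f = ract D f (\<lambda>\<rho>. c * basis_vec \<sigma> \<rho>)"

lemma e_t: "polytabloid mu t \<in> carrier (specht mu)"
  using t by (rule specht_polytabloid)

lemma act_in: "f \<in> functionals la \<Longrightarrow> act c \<sigma> f \<in> functionals la"
  unfolding act_def by (rule ract_dual_closed)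

lemma act_apply:
  "f \<in> functionals la \<Longrightarrow> x \<in> carrier (specht la) \<Longrightarrow> \<sigma> \<in> W \<Longrightarrow>
    act c \<sigma> f x = c * f (translate (inv_into UNIV \<sigma>) x)"
  unfolding act_def using ract_dual_basis[of f la x \<sigma> c] by (simp add: size)

lemma F_add: "f \<in> functionals la \<Longrightarrow> f' \<in> functionals la \<Longrightarrow> F (f \<oplus>\<^bsub>D\<^esub> f') = F f + F f'"
  unfolding F_def by (simp only: g_add dual_add_apply[OF e_t])

lemma F_act:
  assumes f: "f \<in> functionals la" and \<sigma>: "\<sigma> \<in> W"
    and eigen: "translate (inv_into UNIV \<sigma>) (polytabloid mu t) = (\<lambda>S. k * polytabloid mu t S)"
  shows "F (act c \<sigma> f) = c * k * F f"
proof -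
  have "(\<lambda>\<rho>. c * basis_vec \<sigma> \<rho>) \<in> carrier (group_algebra (hyperoct n))"
    using \<sigma> by (auto simp: twisted_algebra_def basis_vec_def)
  then have "F (act c \<sigma> f) = ract (dual_specht mu) (g f) (\<lambda>\<rho>. c * basis_vec \<sigma> \<rho>) (polytabloid mu t)"
    unfolding F_def act_def by (simp only: g_ract[OF f])
  also have "\<dots> = c * g f (translate (inv_into UNIV \<sigma>) (polytabloid mu t))"
    using \<sigma> by (intro ract_dual_basis[OF g_in[OF f] e_t]) (simp add: size)
  also have "\<dots> = c * k * F f"
    unfolding eigen functionalD(3)[OF g_in[OF f] e_t] F_def by (simp add: mult.assoc)
  finally show ?thesis .
qed

lemma F_scale:
  assumes "f \<in> functionals la" shows "F (act c id f) = c * F f"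
proof -
  have "translate (inv_into UNIV id) (polytabloid mu t) = (\<lambda>S. 1 * polytabloid mu t S :: 'k)"
    by (simp only: inv_id translate_id mult_1)
  then show ?thesis using F_act[OF assms hyperoct_id, of 1 c] by simp
qed

lemma F_col_stab:
  assumes f: "f \<in> functionals la" and \<sigma>: "\<sigma> \<in> col_stab mu t"
  shows "F (act 1 \<sigma> f) = of_int (hyperoct_sgn n \<sigma>) * F f"
proof -
  have \<sigma>W: "\<sigma> \<in> W" using col_stab_hyperoct[OF \<sigma>] by (simp add: size)
  have "inv_into UNIV \<sigma> \<in> col_stab mu t"
    using \<sigma> unfolding col_stab_eq by (rule stab_inv)
  from polytabloid_col_stab[OF t this]
  have "translate (inv_into UNIV \<sigma>) (polytabloid mu t) =
      (\<lambda>S. of_int (hyperoct_sgn n \<sigma>) * polytabloid mu t S :: 'k)"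
    unfolding size hyperoct_sgn_inv[OF \<sigma>W] .
  then show ?thesis using F_act[OF f \<sigma>W, of _ 1] by simp
qed

lemma zero_in: "\<zero>\<^bsub>D\<^esub> \<in> functionals la"
  unfolding dual_specht_simps by (rule restrict_functional) simp_all

lemma F_zero: "F \<zero>\<^bsub>D\<^esub> = 0"
proof -
  have "act 0 id \<zero>\<^bsub>D\<^esub> = \<zero>\<^bsub>D\<^esub>"
  proof (rule functional_eqI[OF functionalD(1)[OF act_in[OF zero_in]] functionalD(1)[OF zero_in]])
    fix x :: "(box \<Rightarrow> int) set \<Rightarrow> 'k" assume x: "x \<in> carrier (specht la)"
    have "\<zero>\<^bsub>D\<^esub> x = 0" using x by (simp add: dual_specht_simps)
    then show "act 0 id \<zero>\<^bsub>D\<^esub> x = \<zero>\<^bsub>D\<^esub> x"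
      by (simp only: act_apply[OF zero_in x hyperoct_id] mult_zero_left)
  qed
  then show ?thesis using F_scale[OF zero_in, of 0] by simp
qed

definition coordinate :: "(box \<Rightarrow> int) set \<Rightarrow> (((box \<Rightarrow> int) set \<Rightarrow> 'k) \<Rightarrow> 'k)" where
  "coordinate S = (\<lambda>x\<in>carrier (specht la). x S)"

lemma coordinate_in: "coordinate S \<in> functionals la"
  unfolding coordinate_def by (rule restrict_functional) simp_all

lemma coordinate_act:
  assumes \<sigma>: "\<sigma> \<in> W" shows "act 1 \<sigma> (coordinate S) = coordinate (tabloid_act \<sigma> S)"
proof (rule functional_eqI[OF functionalD(1)[OF act_in[OF coordinate_in]] functionalD(1)[OF coordinate_in]])
  fix x :: "(box \<Rightarrow> int) set \<Rightarrow> 'k" assume x: "x \<in> carrier (specht la)"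
  have "translate (inv_into UNIV \<sigma>) x \<in> carrier (specht la)"
    using \<sigma> by (intro translate_inv_in[OF _ x]) (simp add: size)
  then have "act 1 \<sigma> (coordinate S) x = translate (inv_into UNIV \<sigma>) x S"
    unfolding act_apply[OF coordinate_in x \<sigma>] by (simp add: coordinate_def)
  also have "\<dots> = coordinate (tabloid_act \<sigma> S) x"
    using x by (simp add: translate_def inv_comp_hyperoct(3)[OF \<sigma>] coordinate_def)
  finally show "act 1 \<sigma> (coordinate S) x = coordinate (tabloid_act \<sigma> S) x" .
qed

text \<open>
  An odd element of \<open>R\<^sub>s \<inter> C\<^sub>t\<close> fixes the coordinate function of \<open>{s}\<close> and changes the sign of \<open>F\<close>, so
  that \<open>2 F\<close> vanishes there.
\<close>

lemma F_coordinate_zero: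
  assumes \<sigma>: "\<sigma> \<in> row_stab la s" "\<sigma> \<in> col_stab mu t" and odd: "hyperoct_sgn n \<sigma> = - 1"
  shows "F (coordinate (bitabloid la s)) = 0"
proof -
  have \<sigma>W: "\<sigma> \<in> W" using col_stab_hyperoct[OF \<sigma>(2)] by (simp add: size)
  have "tabloid_act \<sigma> (bitabloid la s) = bitabloid la s"
    using tabloid_act_bitabloid[of \<sigma> la s] \<sigma>W bitabloid_row_stab[OF \<sigma>(1)] by (simp add: size)
  then have "F (coordinate (bitabloid la s)) = - F (coordinate (bitabloid la s))"
    using F_col_stab[OF coordinate_in \<sigma>(2), of "bitabloid la s"] coordinate_act[OF \<sigma>W, of "bitabloid la s"] odd
    by simp
  then have "2 * F (coordinate (bitabloid la s)) = 0" by (metis mult_2 add.right_inverse)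
  then show ?thesis using two by simp
qed

lemma F_sum:
  assumes "finite I" "\<And>i. i \<in> I \<Longrightarrow> f i \<in> functionals la" "\<And>i. i \<in> I \<Longrightarrow> F (f i) = 0"
  shows "(\<lambda>x\<in>carrier (specht la). \<Sum>i\<in>I. k i * f i x) \<in> functionals la \<and>
    F (\<lambda>x\<in>carrier (specht la). \<Sum>i\<in>I. k i * f i x) = 0"
  using assms
proof (induction I)
  case empty
  have "(\<lambda>x\<in>carrier (specht la). \<Sum>i\<in>{}. k i * f i x) = \<zero>\<^bsub>D\<^esub>" by (simp add: dual_specht_simps)
  then show ?case using zero_in F_zero by simp
next
  case (insert i I)
  let ?h = "\<lambda>x\<in>carrier (specht la). \<Sum>i\<in>I. k i * f i x"
  have "?h \<in> functionals la \<and> F ?h = 0" by (rule insert.IH) (use insert.prems in blast)+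
  then have h: "?h \<in> functionals la" "F ?h = 0" by blast+
  have fi: "f i \<in> functionals la" "F (f i) = 0" using insert by simp_all
  have eq: "(\<lambda>x\<in>carrier (specht la). \<Sum>i\<in>insert i I. k i * f i x) = act (k i) id (f i) \<oplus>\<^bsub>D\<^esub> ?h"
    by (rule functional_eqI[OF restrict_extensional dual_add_extensional])
      (simp add: dual_add_apply act_apply[OF fi(1) _ hyperoct_id] inv_id translate_id insert(1,2))
  show ?case
    unfolding eq F_add[OF act_in[OF fi(1)] h(1)] F_scale[OF fi(1)] fi(2) h(2)
    using dual_add_closed[OF act_in[OF fi(1)] h(1)] by simp
qed

text \<open>
  A functional on the Specht module extends to a linear form on all functions; on the functions
  supported on the finitely many bi-tabloids, this form is a combination of coordinates.
\<close>

lemma functional_coordinates: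
  assumes f: "f \<in> functionals la"
  obtains k where "f = (\<lambda>x\<in>carrier (specht la). \<Sum>S\<in>bitabloids la. k S * coordinate S x)"
proof -
  let ?X = "polytabloid la ` bitableaux la :: ((box \<Rightarrow> int) set \<Rightarrow> 'k) set"
  obtain E :: "((box \<Rightarrow> int) set \<Rightarrow> 'k) set" where E: "E \<subseteq> ?X" "tabloid_fun.independent E" "?X \<subseteq> tabloid_fun.span E"
    using tabloid_fun.maximal_independent_subset[of ?X] by metis
  interpret pair: vector_space_pair "\<lambda>c (v :: (box \<Rightarrow> int) set \<Rightarrow> 'k) S. c * v S" "(*) :: 'k \<Rightarrow> 'k \<Rightarrow> 'k"
    by (intro vector_space_pair.intro tabloid_fun.vector_space_axioms) (unfold_locales, auto simp: algebra_simps)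
  obtain h where h: "Vector_Spaces.linear (\<lambda>c (v :: (box \<Rightarrow> int) set \<Rightarrow> 'k) S. c * v S) (*) h" "\<And>x. x \<in> E \<Longrightarrow> h x = f x"
    using pair.linear_independent_extend[OF E(2), of f] by blast
  interpret h: Vector_Spaces.linear "\<lambda>c (v :: (box \<Rightarrow> int) set \<Rightarrow> 'k) S. c * v S" "(*)" h by (rule h(1))
  have span: "carrier (specht la) = tabloid_fun.span E"
    unfolding specht_space_eq
    by (intro equalityI tabloid_fun.span_mono[OF E(1)] tabloid_fun.span_minimal[OF E(3) tabloid_fun.subspace_span])
  have fh: "f x = h x" if "x \<in> carrier (specht la)" for x
  proof -
    have "x \<in> carrier (specht la) \<and> f x = h x"
      using that unfolding span
    proof (induction rule: tabloid_fun.span_induct_alt)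
      case base
      show ?case by (simp only: tabloid_fun.span_zero functionalD(4)[OF f] h.zero simp_thms)
    next
      case (step c x y)
      have x: "x \<in> carrier (specht la)" unfolding span using step(1) by (rule tabloid_fun.span_base)
      have y: "y \<in> carrier (specht la)" using step(2) unfolding span by simp
      have "f ((\<lambda>S. c * x S) + y) = h ((\<lambda>S. c * x S) + y)"
        using step functionalD(2)[OF f specht_scale[OF x] y] functionalD(3)[OF f x] h(2)
        by (simp add: h.add h.scale)
      moreover have "(\<lambda>S. c * x S) + y \<in> carrier (specht la)" using specht_add[OF specht_scale[OF x] y] .
      ultimately show ?case unfolding span by (rule conjI[rotated])
    qed
    then show ?thesis ..
  qed
  show thesis
  proof
    show "f = (\<lambda>x\<in>carrier (specht la). \<Sum>S\<in>bitabloids la. h (basis_vec S) * coordinate S x)"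
    proof (rule functional_eqI[OF functionalD(1)[OF f] restrict_extensional])
      fix x :: "(box \<Rightarrow> int) set \<Rightarrow> 'k" assume x: "x \<in> carrier (specht la)"
      have "x = (\<Sum>S\<in>bitabloids la. (\<lambda>S'. x S * basis_vec S S'))"
      proof
        fix S'
        have "(\<Sum>S\<in>bitabloids la. (\<lambda>S'. x S * basis_vec S S')) S' = (\<Sum>S\<in>bitabloids la. x S * basis_vec S S')"
          by (induction rule: infinite_finite_induct) (simp_all add: plus_fun_def)
        also have "\<dots> = (\<Sum>S\<in>bitabloids la. if S = S' then x S' else 0)"
          by (intro sum.cong refl) (simp add: basis_vec_def)
        also have "\<dots> = x S'" using specht_support[OF x] by (simp add: finite_bitabloids)
        finally show "x S' = (\<Sum>S\<in>bitabloids la. (\<lambda>S'. x S * basis_vec S S')) S'" by simp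
      qed
      then have "h x = h (\<Sum>S\<in>bitabloids la. (\<lambda>S'. x S * basis_vec S S'))" by (rule arg_cong)
      also have "\<dots> = (\<Sum>S\<in>bitabloids la. h (\<lambda>S'. x S * basis_vec S S'))" by (rule h.sum)
      also have "\<dots> = (\<Sum>S\<in>bitabloids la. x S * h (basis_vec S))" by (simp only: h.scale)
      finally have "f x = (\<Sum>S\<in>bitabloids la. x S * h (basis_vec S))" unfolding fh[OF x] .
      then show "f x = (\<lambda>x\<in>carrier (specht la). \<Sum>S\<in>bitabloids la. h (basis_vec S) * coordinate S x) x"
        using x by (simp add: coordinate_def mult.commute)
    qed
  qed
qed

lemma F_zero_if_coordinates:
  assumes "\<And>S. S \<in> bitabloids la \<Longrightarrow> F (coordinate S) = 0" and f: "f \<in> functionals la"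
  shows "F f = 0"
proof -
  obtain k where "f = (\<lambda>x\<in>carrier (specht la). \<Sum>S\<in>bitabloids la. k S * coordinate S x)"
    using functional_coordinates[OF f] .
  then show ?thesis
    using F_sum[OF finite_bitabloids, of la coordinate k] coordinate_in assms(1) by simp
qed

end

context dual_specht_hom
begin

text \<open>
  The polytabloids are simultaneous eigenvectors of the sign changes: \<open>\<xi>\<^sub>a\<close> has the eigenvalue \<open>-1\<close> on
  \<open>e\<^sub>u\<close> if \<open>\<plusminus>a\<close> occurs in \<open>u\<^sup>1\<close> and the eigenvalue \<open>1\<close> if it occurs in \<open>u\<^sup>2\<close>. Let \<open>a\<close> run over the absolute
  values of the entries of \<open>t\<^sup>2\<close>. By assumption the product of the \<open>1 + \<xi>\<^sub>a\<close> kills every \<open>e\<^sub>u\<close> and so sends every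
  functional to 0, while each factor multiplies the value of \<open>F\<close> by 2. The product is built one
  factor at a time.
\<close>

lemma F_zero_if_first_larger:
  assumes f: "f \<in> functionals la"
    and meet: "\<And>u. u \<in> bitableaux la \<Longrightarrow>
      \<exists>p q. Inl p \<in> boxes la \<and> Inr q \<in> boxes mu \<and> \<bar>u (Inl p)\<bar> = \<bar>t (Inr q)\<bar>"
  shows "F f = 0"
proof -
  let ?T = "{c \<in> boxes mu. \<exists>q. c = Inr q}"
  have step: "\<exists>f'\<in>functionals la. F f' = 2 ^ card X * F f \<and>
      (\<forall>u\<in>bitableaux la. (\<exists>c\<in>X. \<exists>p. Inl p \<in> boxes la \<and> \<bar>u (Inl p)\<bar> = \<bar>t c\<bar>) \<longrightarrow> f' (polytabloid la u) = 0)"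
    if "finite X" "X \<subseteq> ?T" for X
    using that
  proof (induction X)
    case empty
    show ?case using f by (intro bexI[of _ f]) simp_all
  next
    case (insert c X)
    have "X \<subseteq> ?T" using insert.prems by simp
    from insert.IH[OF this] obtain f' where f': "f' \<in> functionals la" "F f' = 2 ^ card X * F f"
      and vanish: "\<forall>u\<in>bitableaux la. (\<exists>c\<in>X. \<exists>p. Inl p \<in> boxes la \<and> \<bar>u (Inl p)\<bar> = \<bar>t c\<bar>) \<longrightarrow> f' (polytabloid la u) = 0"
      by (elim bexE conjE)
    have "c \<in> ?T" using insert.prems by simp
    then obtain q where c: "c \<in> boxes mu" "c = Inr q" by (elim CollectE conjE exE)
    let ?\<xi> = "sign_change \<bar>t c\<bar>"
    have a: "\<bar>t c\<bar> \<in> {1..int n}" using bitableau_abs(1)[OF t c(1)] by (simp add: size)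
    have \<xi>: "?\<xi> \<in> W" using a by (rule sign_change_in(1))
    let ?f = "f' \<oplus>\<^bsub>D\<^esub> act 1 ?\<xi> f'"
    have in_f: "?f \<in> functionals la" by (intro dual_add_closed act_in f'(1))
    have "translate (inv_into UNIV ?\<xi>) (polytabloid mu t) = (\<lambda>S. 1 * polytabloid mu t S :: 'k)"
      unfolding sign_change_inv using polytabloid_sign_change[OF t c(1)] by (simp add: c(2))
    then have "F (act 1 ?\<xi> f') = F f'" using F_act[OF f'(1) \<xi>, of 1 1] by simp
    then have F: "F ?f = 2 ^ card (insert c X) * F f"
      unfolding F_add[OF f'(1) act_in[OF f'(1)]] using f'(2) insert(1,2) by simp
    have vanish': "?f (polytabloid la u) = 0"
      if u: "u \<in> bitableaux la" and ex: "\<exists>c'\<in>insert c X. \<exists>p. Inl p \<in> boxes la \<and> \<bar>u (Inl p)\<bar> = \<bar>t c'\<bar>" for u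
    proof -
      have eu: "polytabloid la u \<in> carrier (specht la)" using u by (rule specht_polytabloid)
      obtain b where b: "b \<in> boxes la" "\<bar>u b\<bar> = \<bar>t c\<bar>" using bitableau_abs(3)[OF u, of "\<bar>t c\<bar>"] a size by auto
      let ?k = "(case b of Inl _ \<Rightarrow> - 1 | Inr _ \<Rightarrow> 1) :: 'k"
      have "translate (inv_into UNIV ?\<xi>) (polytabloid la u) = (\<lambda>S. ?k * polytabloid la u S)"
        unfolding sign_change_inv b(2)[symmetric] by (rule polytabloid_sign_change[OF u b(1)])
      then have val: "?f (polytabloid la u) = f' (polytabloid la u) + ?k * f' (polytabloid la u)"
        unfolding dual_add_apply[OF eu] act_apply[OF f'(1) eu \<xi>] by (simp only: functionalD(3)[OF f'(1) eu] mult_1)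
      from ex consider p where "Inl p \<in> boxes la" "\<bar>u (Inl p)\<bar> = \<bar>t c\<bar>"
        | "\<exists>c'\<in>X. \<exists>p. Inl p \<in> boxes la \<and> \<bar>u (Inl p)\<bar> = \<bar>t c'\<bar>" by blast
      then show ?thesis
      proof cases
        case (1 p)
        then have "b = Inl p" using bitableau_abs(2)[OF u b(1), of "Inl p"] b(2) by simp
        then show ?thesis using val by simp
      next
        case 2
        then have "f' (polytabloid la u) = 0" by (rule bspec[OF vanish u, THEN mp])
        then show ?thesis using val by simp
      qed
    qed
    show ?case by (intro bexI[OF _ in_f] conjI F ballI impI vanish')
  qed
  have "finite ?T" using finite_boxes by simp
  from step[OF this subset_refl] obtain f' where f': "f' \<in> functionals la" "F f' = 2 ^ card ?T * F f"
    and vanish: "\<forall>u\<in>bitableaux la. (\<exists>c\<in>?T. \<exists>p. Inl p \<in> boxes la \<and> \<bar>u (Inl p)\<bar> = \<bar>t c\<bar>) \<longrightarrow> f' (polytabloid la u) = 0"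
    by (elim bexE conjE)
  have gen: "f' (polytabloid la u) = 0" if u: "u \<in> bitableaux la" for u
  proof (rule bspec[OF vanish u, THEN mp])
    obtain p q where "Inl p \<in> boxes la" "Inr q \<in> boxes mu" "\<bar>u (Inl p)\<bar> = \<bar>t (Inr q)\<bar>"
      using meet[OF u] by metis
    then show "\<exists>c\<in>?T. \<exists>p. Inl p \<in> boxes la \<and> \<bar>u (Inl p)\<bar> = \<bar>t c\<bar>"
      by (intro bexI[of _ "Inr q"] exI[of _ p]) simp_all
  qed
  have zero: "f' x = 0" if "x \<in> carrier (specht la)" for x
    using that
  proof (induction x rule: specht_induct)
    case zero
    show ?case by (rule functionalD(4)[OF f'(1)])
  next
    case (add c u y)
    have pu: "polytabloid la u \<in> carrier (specht la)" using add(1) by (rule specht_polytabloid)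
    show ?case
      by (simp only: functionalD(2)[OF f'(1) specht_scale[OF pu] add(2)] functionalD(3)[OF f'(1) pu]
          gen[OF add(1)] add(3) mult_zero_right add_0_right)
  qed
  have "f' = \<zero>\<^bsub>D\<^esub>"
    by (rule functional_eqI[OF functionalD(1)[OF f'(1)] functionalD(1)[OF zero_in]])
      (simp add: zero, simp add: dual_specht_simps)
  then have "2 ^ card ?T * F f = 0" using F_zero f'(2) by simp
  then show ?thesis using two by simp
qed

lemma matching_box:
  assumes s: "s \<in> bitableaux la" and b: "b \<in> boxes la"
  obtains c where "c \<in> boxes mu" "\<bar>t c\<bar> = \<bar>s b\<bar>"
  using bitableau_abs(3)[OF t, of "\<bar>s b\<bar>"] bitableau_abs(1)[OF s b] size by auto

lemma boxes_simps: "Inl x \<in> boxes (p, q) \<longleftrightarrow> x \<in> young p" "Inr x \<in> boxes (p, q) \<longleftrightarrow> x \<in> young q"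
  by auto

text \<open>
  An entry lying in \<open>s\<^sup>2\<close> and in \<open>t\<^sup>1\<close> would make its sign change an odd element of \<open>R\<^sub>s \<inter> C\<^sub>t\<close>, and two
  entries lying in one row of \<open>s\<close> and in one column of \<open>t\<close> would do so for a signed transposition.
\<close>

lemma
  assumes s: "s \<in> bitableaux la" and F: "F (coordinate (bitabloid la s)) \<noteq> 0"
    and b: "b \<in> boxes la" and c: "c \<in> boxes mu" and bc: "\<bar>t c\<bar> = \<bar>s b\<bar>"
  shows F_nonzero_component: "c = Inl x \<Longrightarrow> \<exists>y. b = Inl y"
    and F_nonzero_line: "b' \<in> boxes la \<Longrightarrow> c' \<in> boxes mu \<Longrightarrow> \<bar>t c'\<bar> = \<bar>s b'\<bar> \<Longrightarrow> b \<noteq> b' \<Longrightarrow>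
      b = Inl (i, j) \<and> b' = Inl (i, j') \<and> c = Inl (h, k) \<and> c' = Inl (h', k') \<or>
      b = Inr (i, j) \<and> b' = Inr (i, j') \<and> c = Inr (h, k) \<and> c' = Inr (h', k') \<Longrightarrow> k \<noteq> k'"
proof -
  show "\<exists>y. b = Inl y" if "c = Inl x"
  proof (cases b)
    case (Inr z)
    have "sign_change \<bar>s b\<bar> \<in> row_stab la s"
      unfolding row_stab_eq by (rule sign_change_stab[OF s lines_in_boxes(1,2) b]) (simp add: line1_def Inr)
    moreover have "sign_change \<bar>t c\<bar> \<in> col_stab mu t"
      unfolding col_stab_eq by (rule sign_change_stab[OF t lines_in_boxes(4,3) c]) (simp add: pile2_def that)
    moreover have "hyperoct_sgn n (sign_change \<bar>s b\<bar>) = - 1"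
      using sign_change_in(2)[OF bitableau_abs(1)[OF s b]] size by simp
    ultimately have False using F F_coordinate_zero bc by metis
    then show ?thesis ..
  qed blast
  show "k \<noteq> k'"
    if b': "b' \<in> boxes la" and c': "c' \<in> boxes mu" and bc': "\<bar>t c'\<bar> = \<bar>s b'\<bar>" and ne: "b \<noteq> b'"
    and shape: "b = Inl (i, j) \<and> b' = Inl (i, j') \<and> c = Inl (h, k) \<and> c' = Inl (h', k') \<or>
      b = Inr (i, j) \<and> b' = Inr (i, j') \<and> c = Inr (h, k) \<and> c' = Inr (h', k')"
  proof
    assume k: "k = k'"
    have ne': "c \<noteq> c'" using bitableau_abs(2)[OF s b b'] ne bc bc' by auto
    \<comment> \<open>\<open>R\<^sub>s\<close> must respect the signs of the entries of \<open>s\<^sup>1\<close> and \<open>C\<^sub>t\<close> those of the entries of \<open>t\<^sup>2\<close>.\<close>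
    define x y where "x = (case b of Inl _ \<Rightarrow> s b | Inr _ \<Rightarrow> t c)" and "y = (case b of Inl _ \<Rightarrow> s b' | Inr _ \<Rightarrow> t c')"
    have xy: "\<bar>x\<bar> = \<bar>s b\<bar>" "\<bar>y\<bar> = \<bar>s b'\<bar>" "\<bar>x\<bar> = \<bar>t c\<bar>" "\<bar>y\<bar> = \<bar>t c'\<bar>"
      using bc bc' by (auto simp: x_def y_def split: sum.splits)
    have "signed_swap x y \<in> stab (bisize la) (line1 la) (line2 la) s"
      by (rule signed_swap_stab[OF s lines_in_boxes(1,2) b b' ne xy(1,2)])
        (use shape b b' in \<open>auto simp: line1_def line2_def x_def y_def\<close>)
    then have row: "signed_swap x y \<in> row_stab la s" by (simp only: row_stab_eq)
    have "signed_swap x y \<in> stab (bisize mu) (pile2 mu) (pile1 mu) t"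
      by (rule signed_swap_stab[OF t lines_in_boxes(4,3) c c' ne' xy(3,4)])
        (use shape c c' k in \<open>auto simp: pile1_def pile2_def x_def y_def\<close>)
    then have col: "signed_swap x y \<in> col_stab mu t" by (simp only: col_stab_eq)
    have "\<bar>x\<bar> \<in> {1..int n}" "\<bar>y\<bar> \<in> {1..int n}" "\<bar>x\<bar> \<noteq> \<bar>y\<bar>"
      using bitableau_abs(1)[OF s b] bitableau_abs(1)[OF s b'] bitableau_abs(2)[OF s b b'] ne xy(1,2) size by auto
    then have "hyperoct_sgn n (signed_swap x y) = - 1"
      by (intro signed_swap_in(2)) (auto simp: symbols_def)
    then show False using F F_coordinate_zero[OF row col] by blast
  qed
qed

end

lemma card_young: "card (young p) = sum_list p"
proof -
  have "{x \<in> young p. fst x < length p} = young p" by (auto simp: young_def)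
  then show ?thesis using card_young_take[of p "length p"] by simp
qed

text \<open>
  Suppose that \<open>F\<close> is not zero. Then \<open>|\<lambda>\<^sup>1| = |\<mu>\<^sup>1|\<close>, for otherwise \<open>|\<lambda>\<^sup>1| > |\<mu>\<^sup>1|\<close> by dominance, every \<open>u\<^sup>1\<close> has
  an entry in common with \<open>t\<^sup>2\<close> up to sign, and \<open>F\<close> vanishes. Moreover \<open>F\<close> does not vanish at the
  coordinate function of some \<open>{s}\<close>. The boxes of \<open>s\<close> and \<open>t\<close> with equal entries up to sign correspond
  to each other; since \<open>t\<^sup>1\<close> receives entries of \<open>s\<^sup>1\<close> only and both have the same size, the correspondence
  respects the components. In each of them it spreads the rows of \<open>s\<close> over different columns of \<open>t\<close>, which
  gives the reverse dominance.
\<close>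

lemma dual_specht_hom_zero:
  assumes hom: "dual_specht_hom la mu n (g :: (((box \<Rightarrow> int) set \<Rightarrow> 'k::field) \<Rightarrow> 'k) \<Rightarrow> _) t"
    and la: "la \<in> bipartitions n" and mu: "mu \<in> bipartitions n"
    and dom: "dominates la mu" "la \<noteq> mu" and f: "f \<in> functionals la"
  shows "g f (polytabloid mu t) = 0"
proof (rule ccontr)
  interpret dual_specht_hom la mu n g t by (rule hom)
  assume "g f (polytabloid mu t) \<noteq> 0"
  then have Ff: "F f \<noteq> 0" by (simp add: F_def)
  obtain p1 p2 where p: "la = (p1, p2)" by (cases la)
  obtain q1 q2 where q: "mu = (q1, q2)" by (cases mu)
  have parts: "is_partition p1" "is_partition p2" "is_partition q1" "is_partition q2"
    and sizes: "sum_list p1 + sum_list p2 = n" "sum_list q1 + sum_list q2 = n"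
    using la mu by (auto simp: bipartitions_def p q)
  have d1: "sum_list (take j q1) \<le> sum_list (take j p1)" for j using dom(1) by (simp add: p q)
  have d2: "sum_list q1 + sum_list (take j q2) \<le> sum_list p1 + sum_list (take j p2)" for j
    using dom(1) by (simp add: p q)
  have le: "sum_list q1 \<le> sum_list p1" using d1[of "max (length p1) (length q1)"] by simp
  have eq1: "sum_list p1 = sum_list q1"
  proof (rule ccontr)
    assume "sum_list p1 \<noteq> sum_list q1"
    then have less: "card (young q1) < card (young p1)" using le by (simp add: card_young)
    have "F f = 0"
    proof (rule F_zero_if_first_larger[OF f])
      fix u assume u: "u \<in> bitableaux la"
      \<comment> \<open>By the pigeonhole principle some entry of \<open>u\<^sup>1\<close> is not an entry of \<open>t\<^sup>1\<close>.\<close>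
      have "\<exists>x\<in>young p1. \<forall>y\<in>young q1. \<bar>u (Inl x)\<bar> \<noteq> \<bar>t (Inl y)\<bar>"
      proof (rule ccontr)
        assume "\<not> ?thesis"
        then have sub: "(\<lambda>x. \<bar>u (Inl x)\<bar>) ` young p1 \<subseteq> (\<lambda>y. \<bar>t (Inl y)\<bar>) ` young q1" by auto
        have "inj_on (\<lambda>x. \<bar>u (Inl x)\<bar>) (young p1)"
          using bitableau_abs(2)[OF u] by (intro inj_onI) (simp add: p boxes_simps)
        then have "card (young p1) = card ((\<lambda>x. \<bar>u (Inl x)\<bar>) ` young p1)" by (rule card_image[symmetric])
        also have "\<dots> \<le> card ((\<lambda>y. \<bar>t (Inl y)\<bar>) ` young q1)" using sub by (intro card_mono) (simp_all add: finite_young)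
        also have "\<dots> \<le> card (young q1)" by (rule card_image_le[OF finite_young])
        finally show False using less by simp
      qed
      then obtain x where x: "x \<in> young p1" "\<And>y. y \<in> young q1 \<Longrightarrow> \<bar>u (Inl x)\<bar> \<noteq> \<bar>t (Inl y)\<bar>" by blast
      have xb: "Inl x \<in> boxes la" using x(1) by (simp add: p)
      obtain c where c: "c \<in> boxes mu" "\<bar>t c\<bar> = \<bar>u (Inl x)\<bar>" by (rule matching_box[OF u xb])
      obtain z where "c = Inr z"
      proof (cases c)
        case (Inl y)
        then have "y \<in> young q1" using c(1) by (simp only: q boxes_simps)
        then show thesis using x(2)[of y] c(2) unfolding Inl by simp
      qed
      then show "\<exists>p q. Inl p \<in> boxes la \<and> Inr q \<in> boxes mu \<and> \<bar>u (Inl p)\<bar> = \<bar>t (Inr q)\<bar>"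
        using c xb by (intro exI[of _ x] exI[of _ z]) simp
    qed
    then show False using Ff by simp
  qed
  have "\<exists>s\<in>bitableaux la. F (coordinate (bitabloid la s)) \<noteq> 0"
  proof (rule ccontr)
    assume "\<not> ?thesis"
    then have "F (coordinate S) = 0" if "S \<in> bitabloids la" for S
      using that unfolding bitabloids_def by fast
    then show False using F_zero_if_coordinates[OF _ f] Ff by simp
  qed
  then obtain s where s: "s \<in> bitableaux la" "F (coordinate (bitabloid la s)) \<noteq> 0" by (rule bexE)
  define m where "m b = (SOME c. c \<in> boxes mu \<and> \<bar>t c\<bar> = \<bar>s b\<bar>)" for b
  have m: "m b \<in> boxes mu" "\<bar>t (m b)\<bar> = \<bar>s b\<bar>" if b: "b \<in> boxes la" for b
  proof -
    obtain c where "c \<in> boxes mu" "\<bar>t c\<bar> = \<bar>s b\<bar>" by (rule matching_box[OF s(1) b])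
    then have "\<exists>c. c \<in> boxes mu \<and> \<bar>t c\<bar> = \<bar>s b\<bar>" by (intro exI conjI)
    then have "m b \<in> boxes mu \<and> \<bar>t (m b)\<bar> = \<bar>s b\<bar>" unfolding m_def by (rule someI_ex)
    then show "m b \<in> boxes mu" "\<bar>t (m b)\<bar> = \<bar>s b\<bar>" by simp_all
  qed
  have m_inj: "m b = m b' \<longleftrightarrow> b = b'" if "b \<in> boxes la" "b' \<in> boxes la" for b b'
    using bitableau_abs(2)[OF s(1) that] m(2)[OF that(1)] m(2)[OF that(2)] by auto
  \<comment> \<open>The boxes that \<open>m\<close> sends to the first component; there are \<open>|\<mu>\<^sup>1|\<close> of them, all in the first component.\<close>
  let ?L = "{b \<in> boxes la. \<exists>c. m b = Inl c}"
  have L: "?L \<subseteq> Inl ` young p1"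
  proof
    fix b assume b: "b \<in> ?L"
    then obtain c where c: "b \<in> boxes la" "m b = Inl c" by blast
    from F_nonzero_component[OF s c(1) m[OF c(1)] c(2)] obtain y where y: "b = Inl y" ..
    show "b \<in> Inl ` young p1" using c(1) unfolding y p boxes_simps by (rule imageI)
  qed
  have "m ` boxes la = boxes mu"
  proof (rule card_subset_eq[OF finite_boxes])
    show "m ` boxes la \<subseteq> boxes mu" using m(1) by blast
    have "card (boxes (p, q)) = sum_list p + sum_list q" for p q
    proof -
      have "card (Inl ` young p \<union> Inr ` young q :: box set) = card (Inl ` young p :: box set) + card (Inr ` young q :: box set)"
        by (rule card_Un_disjoint[OF finite_imageI[OF finite_young] finite_imageI[OF finite_young]]) fast
      then show ?thesis by (simp add: card_image card_young)
    qed
    moreover have "card (m ` boxes la) = card (boxes la)"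
      by (rule card_image) (simp add: inj_on_def m_inj)
    ultimately show "card (m ` boxes la) = card (boxes mu)" using sizes by (simp add: p q)
  qed
  note m_image = this
  have "m ` ?L = Inl ` young q1"
  proof
    show "m ` ?L \<subseteq> Inl ` young q1"
    proof
      fix c assume "c \<in> m ` ?L"
      then obtain b y where b: "b \<in> boxes la" "c = m b" "m b = Inl y" by blast
      have "Inl y \<in> boxes mu" using m(1)[OF b(1)] by (simp only: b(3))
      then have "y \<in> young q1" by (simp only: q boxes_simps)
      then show "c \<in> Inl ` young q1" unfolding b(2,3) by (rule imageI)
    qed
    show "Inl ` young q1 \<subseteq> m ` ?L"
    proof
      fix c assume "c \<in> (Inl ` young q1 :: box set)"
      then obtain y where y: "y \<in> young q1" "c = Inl y" by (rule imageE)
      have "c \<in> m ` boxes la" unfolding m_image y(2) q boxes_simps by (rule y(1))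
      then obtain b where b: "c = m b" "b \<in> boxes la" by (rule imageE)
      have "m b = Inl y" using b(1) y(2) by simp
      then have "b \<in> ?L" using b(2) by fast
      then show "c \<in> m ` ?L" unfolding b(1) by (rule imageI)
    qed
  qed
  moreover have "card (m ` ?L) = card ?L" by (rule card_image) (simp add: inj_on_def m_inj)
  ultimately have "card ?L = card (Inl ` young p1 :: box set)"
    using eq1 by (simp add: card_image card_young)
  then have L_eq: "?L = Inl ` young p1"
    using L by (intro card_subset_eq) (simp_all add: finite_young)
  have m1: "\<exists>y\<in>young q1. m (Inl x) = Inl y" if x: "x \<in> young p1" for x
  proof -
    have "Inl x \<in> ?L" unfolding L_eq using x by simp
    then obtain c where c: "Inl x \<in> boxes la" "m (Inl x) = Inl c" by blast
    have "Inl c \<in> boxes mu" using m(1)[OF c(1)] unfolding c(2) .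
    then have "c \<in> young q1" by (simp only: q boxes_simps)
    then show ?thesis using c(2) by (rule bexI[rotated])
  qed
  have m2: "\<exists>y\<in>young q2. m (Inr x) = Inr y" if x: "x \<in> young p2" for x
  proof -
    have bx: "Inr x \<in> boxes la" using x by (simp add: p)
    have "Inr x \<notin> ?L" unfolding L_eq by fast
    then have no: "m (Inr x) \<noteq> Inl c" for c using bx by fast
    obtain c where c: "m (Inr x) = Inr c" by (cases "m (Inr x)") (use no in fast)+
    have "Inr c \<in> boxes mu" using m(1)[OF bx] unfolding c .
    then have "c \<in> young q2" by (simp only: q boxes_simps)
    then show ?thesis using c by (rule bexI[rotated])
  qed
  have "\<forall>x\<in>young p1. \<exists>y. y \<in> young q1 \<and> m (Inl x) = Inl y" using m1 by fast
  then obtain f1 where "\<forall>x\<in>young p1. f1 x \<in> young q1 \<and> m (Inl x) = Inl (f1 x)"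
    unfolding bchoice_iff by (rule exE)
  then have f1: "f1 x \<in> young q1" "m (Inl x) = Inl (f1 x)" if "x \<in> young p1" for x using that by simp_all
  have "\<forall>x\<in>young p2. \<exists>y. y \<in> young q2 \<and> m (Inr x) = Inr y" using m2 by fast
  then obtain f2 where "\<forall>x\<in>young p2. f2 x \<in> young q2 \<and> m (Inr x) = Inr (f2 x)"
    unfolding bchoice_iff by (rule exE)
  then have f2: "f2 x \<in> young q2" "m (Inr x) = Inr (f2 x)" if "x \<in> young p2" for x using that by simp_all
  have b1: "Inl x \<in> boxes la" if "x \<in> young p1" for x using that by (simp only: p boxes_simps)
  have b2: "Inr x \<in> boxes la" if "x \<in> young p2" for x using that by (simp only: p boxes_simps)
  have "sum_list (take j p1) \<le> sum_list (take j q1)" for j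
  proof (rule sum_take_le_if_rows_split[OF parts(3), of f1])
    show "inj_on f1 (young p1)"
    proof (rule inj_onI)
      fix x y assume xy: "x \<in> young p1" "y \<in> young p1" "f1 x = f1 y"
      then have "m (Inl x) = m (Inl y)" by (simp only: f1(2))
      then show "x = y" by (simp only: m_inj[OF b1[OF xy(1)] b1[OF xy(2)]] sum.inject)
    qed
    show "f1 ` young p1 \<subseteq> young q1" by (rule image_subsetI) (rule f1(1))
    fix x y assume xy: "x \<in> young p1" "y \<in> young p1" "x \<noteq> y" "fst x = fst y"
    show "snd (f1 x) \<noteq> snd (f1 y)"
    proof (rule F_nonzero_line[OF s b1[OF xy(1)] m[OF b1[OF xy(1)]] b1[OF xy(2)] m[OF b1[OF xy(2)]]])
      show "Inl x \<noteq> Inl y" using xy(3) by simp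
      show "Inl x = Inl (fst x, snd x) \<and> Inl y = Inl (fst x, snd y) \<and> m (Inl x) = Inl (fst (f1 x), snd (f1 x)) \<and>
          m (Inl y) = Inl (fst (f1 y), snd (f1 y)) \<or>
        Inl x = Inr (fst x, snd x) \<and> Inl y = Inr (fst x, snd y) \<and> m (Inl x) = Inr (fst (f1 x), snd (f1 x)) \<and>
          m (Inl y) = Inr (fst (f1 y), snd (f1 y))"
        unfolding f1(2)[OF xy(1)] f1(2)[OF xy(2)] using xy(4) by (simp add: prod_eq_iff)
    qed
  qed
  then have e1: "p1 = q1" using d1 by (intro partition_eqI parts) (simp add: antisym)
  have "sum_list (take j p2) \<le> sum_list (take j q2)" for j
  proof (rule sum_take_le_if_rows_split[OF parts(4), of f2])
    show "inj_on f2 (young p2)"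
    proof (rule inj_onI)
      fix x y assume xy: "x \<in> young p2" "y \<in> young p2" "f2 x = f2 y"
      then have "m (Inr x) = m (Inr y)" by (simp only: f2(2))
      then show "x = y" by (simp only: m_inj[OF b2[OF xy(1)] b2[OF xy(2)]] sum.inject)
    qed
    show "f2 ` young p2 \<subseteq> young q2" by (rule image_subsetI) (rule f2(1))
    fix x y assume xy: "x \<in> young p2" "y \<in> young p2" "x \<noteq> y" "fst x = fst y"
    show "snd (f2 x) \<noteq> snd (f2 y)"
    proof (rule F_nonzero_line[OF s b2[OF xy(1)] m[OF b2[OF xy(1)]] b2[OF xy(2)] m[OF b2[OF xy(2)]]])
      show "Inr x \<noteq> Inr y" using xy(3) by simp
      show "Inr x = Inl (fst x, snd x) \<and> Inr y = Inl (fst x, snd y) \<and> m (Inr x) = Inl (fst (f2 x), snd (f2 x)) \<and>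
          m (Inr y) = Inl (fst (f2 y), snd (f2 y)) \<or>
        Inr x = Inr (fst x, snd x) \<and> Inr y = Inr (fst x, snd y) \<and> m (Inr x) = Inr (fst (f2 x), snd (f2 x)) \<and>
          m (Inr y) = Inr (fst (f2 y), snd (f2 y))"
        unfolding f2(2)[OF xy(1)] f2(2)[OF xy(2)] using xy(4) by (simp add: prod_eq_iff)
    qed
  qed
  moreover have "sum_list (take j q2) \<le> sum_list (take j p2)" for j using d2[of j] eq1 by simp
  ultimately have "p2 = q2" by (intro partition_eqI parts antisym)
  then show False using e1 dom(2) by (simp add: p q)
qed

section \<open>Homomorphisms between induced modules\<close>

theorem lemma5p3:
  fixes \<delta> :: "'k::alg_closed_field" and r l m :: nat and la mu :: bipart
  assumes "CHAR('k) \<noteq> 2" and "\<delta> \<noteq> 0" and "r \<ge> 1"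
    and "(l, la) \<in> Lambda r" and "(m, mu) \<in> Lambda r"
    and "Lambda_gt (m, mu) (l, la)"
  shows "right_module_hom (brauer r \<delta>) (ind r \<delta> l (dual_specht la)) (ind r \<delta> m (dual_specht mu)) =
    {\<lambda>x \<in> carrier (ind r \<delta> l (dual_specht la)). \<zero>\<^bsub>ind r \<delta> m (dual_specht mu)\<^esub>}"
proof -
  let ?X = "dual_specht la :: (((box \<Rightarrow> int) set \<Rightarrow> 'k) \<Rightarrow> 'k, (int \<Rightarrow> int) \<Rightarrow> 'k) right_module"
  let ?Y = "dual_specht mu :: (((box \<Rightarrow> int) set \<Rightarrow> 'k) \<Rightarrow> 'k, (int \<Rightarrow> int) \<Rightarrow> 'k) right_module"
  have l: "l \<le> r" "la \<in> bipartitions (r - l)" and m: "m \<le> r" "mu \<in> bipartitions (r - m)"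
    using assms(4,5) by (auto simp: Lambda_def)
  have size: "bisize la = r - l" "bisize mu = r - m"
    using l(2) m(2) by (auto simp: bipartitions_def)
  interpret L: brauer_layer r l \<delta> using l(1) assms(2) by unfold_locales
  interpret M: brauer_layer r m \<delta> using m(1) assms(2) by unfold_locales
  interpret CL: full_corner L.A L.B L.J L.\<iota> L.e by (rule L.full_corner)
  interpret CM: full_corner M.A M.B M.J M.\<iota> M.e by (rule M.full_corner)
  have X: "right_mod L.A ?X" using right_mod_dual_specht[of la] by (simp only: size)
  have Y: "right_mod M.A ?Y" using right_mod_dual_specht[of mu] by (simp only: size)
  interpret IL: induced L.A L.B L.J L.\<iota> L.e ?X by (intro induced.intro CL.corner_axioms X)
  interpret IM: induced M.A M.B M.J M.\<iota> M.e ?Y by (intro induced.intro CM.corner_axioms Y)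
  have ind_l: "ind r \<delta> l ?X = tensor L.A ?X (corner_bimodule L.B L.J L.e L.\<iota>)"
    by (simp only: ind_def layer_eq_corner_bimodule)
  have ind_m: "ind r \<delta> m ?Y = tensor M.A ?Y (corner_bimodule M.B M.J M.e M.\<iota>)"
    by (simp only: ind_def layer_eq_corner_bimodule)
  have two: "(2 :: 'k) \<noteq> 0"
  proof
    assume "(2 :: 'k) = 0"
    then have "of_nat 2 = (0 :: 'k)" by simp
    then have "CHAR('k) dvd 2" by (simp only: of_nat_eq_0_iff_char_dvd)
    moreover have "CHAR('k) \<noteq> 1" by simp
    ultimately show False using assms(1) prime_nat_iff two_is_prime_nat by blast
  qed
  let ?Hom = "right_module_hom (brauer r \<delta>) (ind r \<delta> l ?X) (ind r \<delta> m ?Y)"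
  let ?zero = "\<lambda>x \<in> carrier (ind r \<delta> l ?X). \<zero>\<^bsub>ind r \<delta> m ?Y\<^esub>"
  have "?zero \<in> ?Hom"
    unfolding ind_l ind_m
  proof (rule zero_right_module_hom)
    show "abelian_group (tensor M.A ?Y (corner_bimodule M.B M.J M.e M.\<iota>))"
      using IM.T.abelian_group_axioms by (simp only: CM.L_def)
    show "abelian_group (tensor L.A ?X (corner_bimodule L.B L.J L.e L.\<iota>))"
      using IL.T.abelian_group_axioms by (simp only: CL.L_def)
    fix b assume b: "b \<in> carrier (brauer r \<delta>)"
    show "ract (tensor M.A ?Y (corner_bimodule M.B M.J M.e M.\<iota>)) \<zero>\<^bsub>tensor M.A ?Y (corner_bimodule M.B M.J M.e M.\<iota>)\<^esub> b =
        \<zero>\<^bsub>tensor M.A ?Y (corner_bimodule M.B M.J M.e M.\<iota>)\<^esub>"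
      using IM.ract_zero[OF b] by (simp only: CM.L_def)
    fix x assume x: "x \<in> carrier (tensor L.A ?X (corner_bimodule L.B L.J L.e L.\<iota>))"
    show "ract (tensor L.A ?X (corner_bimodule L.B L.J L.e L.\<iota>)) x b \<in>
        carrier (tensor L.A ?X (corner_bimodule L.B L.J L.e L.\<iota>))"
      using hom_in_carrier[OF IL.ract_tensor_hom[OF b]] x by (simp only: CL.L_def partial_object.simps monoid.simps)
  qed
  moreover have "?Hom \<subseteq> {?zero}"
  proof (cases "m < l")
    case True
    \<comment> \<open>The diagram of \<open>e\<^sub>l\<close> has \<open>l \<ge> m + 1\<close> horizontal edges.\<close>
    have D: "layer_diagram r l id \<in> diagrams r" by (rule layer_diagram_closed[OF l(1) hyperoct_id])
    have "basis_vec (layer_diagram r l id) \<in> M.J"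
      using True by (intro M.basis_in_ideal D) (simp add: horizontal_layer_diagram[OF l(1) hyperoct_id])
    then have "L.e \<in> M.J"
      unfolding layer_idem_def by (rule M.ideal_scale[OF M.J.ideal_axioms])
    then show ?thesis
      unfolding ind_l ind_m by (rule induced_hom_zero_of_ideal[OF IL.induced_axioms IM.induced_axioms])
  next
    case False
    then have eq: "m = l" and dom: "dominates la mu" "la \<noteq> mu"
      using assms(6) by (auto simp: Lambda_gt_def)
    have Y': "right_mod L.A ?Y" using Y eq by simp
    have IF: "induced_full L.A L.B L.J L.\<iota> L.e ?X" "induced_full L.A L.B L.J L.\<iota> L.e ?Y"
      by (intro induced_full.intro[OF L.full_corner] induced.intro[OF CL.corner_axioms] X Y')+
    have "f = ?zero" if "f \<in> ?Hom" for f
    proof -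
      have "f \<in> right_module_hom L.B (tensor L.A ?X (corner_bimodule L.B L.J L.e L.\<iota>))
          (tensor L.A ?Y (corner_bimodule L.B L.J L.e L.\<iota>))"
        using that unfolding eq ind_l ind_m[unfolded eq] .
      then obtain g where
        g: "\<And>x. x \<in> carrier ?X \<Longrightarrow> g x \<in> carrier ?Y"
        "\<And>x x'. x \<in> carrier ?X \<Longrightarrow> x' \<in> carrier ?X \<Longrightarrow> g (x \<oplus>\<^bsub>?X\<^esub> x') = g x \<oplus>\<^bsub>?Y\<^esub> g x'"
        "\<And>x a. x \<in> carrier ?X \<Longrightarrow> a \<in> carrier L.A \<Longrightarrow> g (ract ?X x a) = ract ?Y (g x) a"
        and g0: "(\<And>x. x \<in> carrier ?X \<Longrightarrow> g x = \<zero>\<^bsub>?Y\<^esub>) \<Longrightarrow>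
          f = (\<lambda>z\<in>carrier (tensor L.A ?X (corner_bimodule L.B L.J L.e L.\<iota>)).
            \<zero>\<^bsub>tensor L.A ?Y (corner_bimodule L.B L.J L.e L.\<iota>)\<^esub>)"
      proof (rule induced_hom_restrict[OF IF], goal_cases)
        case (1 g)
        show ?case by (rule that[of g]) (fact 1)+
      qed
      have "g x = \<zero>\<^bsub>?Y\<^esub>" if x: "x \<in> carrier ?X" for x
      proof -
        have gx: "g x \<in> functionals mu" using g(1)[OF x] by (simp only: carrier_dual_specht)
        have e: "g x (polytabloid mu t) = 0" if t: "t \<in> bitableaux mu" for t
        proof (rule dual_specht_hom_zero[where g = g and t = t, OF _ l(2) _ dom])
          show "dual_specht_hom la mu (r - l) g t"
          proof (rule dual_specht_hom.intro)
            show "bisize la = r - l" "bisize mu = r - l" using size eq by simp_all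
          qed (fact two t g[unfolded carrier_dual_specht])+
          show "mu \<in> bipartitions (r - l)" using m(2) eq by simp
          show "x \<in> functionals la" using x by (simp only: carrier_dual_specht)
        qed
        have zero: "g x y = 0" if "y \<in> carrier (specht mu)" for y
          using that
        proof (induction y rule: specht_induct)
          case zero
          show ?case by (rule functionalD(4)[OF gx])
        next
          case (add c t y)
          have pt: "polytabloid mu t \<in> carrier (specht mu)" using add(1) by (rule specht_polytabloid)
          show ?case
            by (simp only: functionalD(2)[OF gx specht_scale[OF pt] add(2)] functionalD(3)[OF gx pt]
                e[OF add(1)] add(3) mult_zero_right add_0_right)
        qed
        show ?thesis
          unfolding dual_specht_simps
          by (rule functional_eqI[OF functionalD(1)[OF gx] restrict_extensional]) (simp add: zero)
      qed
      from g0[OF this] show ?thesis unfolding eq ind_l ind_m[unfolded eq] .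
    qed
    then show ?thesis by blast
  qed
  ultimately show ?thesis by blast
qed

end
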